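(* Let $v\in\wedge^4V_8$ be general and let $v^\vee\in\wedge^4V_8^\vee$ be its image under the isomorphism given by a volume form. Then the hypersurface $D_{Z_1}(v)\subset G(2,V_8)$ is Grassmannian self-dual: its Grassmannian dual $D_{Z_1}(v)^\vee\subset G(6,V_8)$ is equal to $D_{Z_1}(v^\vee)\subset G(2,V_8^\vee)=G(6,V_8)$, and $D_{Z_1}(v)\simeq D_{Z_1}(v^\vee)$.
   Context: We work over $\mathbb{C}$; $V_8$ is a complex vector space of dimension $8$, $G(k,V)$ is the Grassmannian of $k$-dimensional subspaces of $V$; $G(2,V_8^\vee)$ is identified with $G(6,V_8)$ by taking orthogonals. "General" means in a suitable nonempty Zariski open subset. For an $8$-dimensional space $V$ and general $w\in\wedge^4V$, $D_{Z_1}(w)\subset G(2,V)$ is the Pfaffian hypersurface of those $[U_2]$ such that the image of $w$ in $\wedge^4(V/U_2)\simeq\wedge^2(V/U_2)^\vee\otimes\det(V/U_2)$ is a skew form of rank at most $4$. It is applied with $(V,w)=(V_8,v)$ and $(V_8^\vee,v^\vee)$. A volume form on $V_8$ induces an isomorphism $\wedge^4V_8\simeq\wedge^4V_8^\vee$, $v\mapsto v^\vee$ (defined up to scalar); for a basis $e_1,\dots,e_8$ adapted to the volume form it sends $e_I$ to $\epsilon_{I,J}e_J^\vee$, with $J$ the complement of the $4$-element set $I$ in $\{1,\dots,8\}$ and $\epsilon_{I,J}$ the sign of the permutation $(I,J)$. Grassmannian duality (Chaput): let $H\subset G(2,V_8)$ be a hypersurface. At a smooth point $h=[U_2]$ of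 $H$, the tangent space of $H$ is a hyperplane in $T_hG(2,V_8)=\mathrm{Hom}(U_2,V_8/U_2)$, i.e. a line in the dual space $\mathrm{Hom}(V_8/U_2,U_2)$. If this line is generated by a surjective morphism, its kernel is a $4$-dimensional subspace of $V_8/U_2$, i.e. defines $U_6$ with $U_2\subset U_6\subset V_8$, $\dim U_6=6$. When this happens for general $h$, this defines a rational map $H\dashrightarrow G(6,V_8)$, and the Grassmannian dual $H^\vee$ is the (closure of the) image of this map. *)

theory Defs
  imports "HOL-Analysis.Analysis"
begin

text \<open>
  The vector space is \<open>V = complex ^ 'n\<close>, where \<open>'n\<close> is a finite linearly ordered index type
  (\<open>8\<close> in the theorem). Its dual is again \<open>complex ^ 'n\<close>, in the dual basis. The exterior algebra
  of \<open>V\<close> is \<open>complex ^ ('n set)\<close>: the coordinate \<open>I\<close> is the coefficient of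
  \<open>e_I = e_(i1) \<and> ... \<and> e_(ik)\<close> with \<open>i1 < ... < ik\<close> the elements of \<open>I\<close>.
\<close>

type_synonym 'n vsp = "(complex, 'n) vec"
type_synonym 'n ext = "(complex, 'n set) vec"
type_synonym 'n endo = "((complex, 'n) vec, 'n) vec"

section \<open>Exterior algebra\<close>

text \<open>
  For disjoint \<open>I\<close> and \<open>J\<close>, each listed increasingly, the sign of the permutation \<open>(I, J)\<close>:
  its inversions are the pairs in \<open>I \<times> J\<close> that are in the wrong order.
\<close>

definition shuffle_sign :: "'n::{finite,linorder} set \<Rightarrow> 'n set \<Rightarrow> complex" where
  "shuffle_sign I J = (- 1) ^ card {(i, j). i \<in> I \<and> j \<in> J \<and> j < i}"

definition wedge ::
    "'n::{finite,linorder} ext \<Rightarrow> 'n ext \<Rightarrow> 'n ext" where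
  "wedge a b = (\<chi> K. \<Sum>I\<in>Pow K. shuffle_sign I (K - I) * a $ I * b $ (K - I))"

definition ext_one :: "'n::{finite,linorder} ext" where
  "ext_one = axis {} 1"

definition ext_vec :: "'n::{finite,linorder} vsp \<Rightarrow> 'n ext" where
  "ext_vec x = (\<chi> I. \<Sum>i | I = {i}. x $ i)"

definition wedge_list :: "'n::{finite,linorder} vsp list \<Rightarrow> 'n ext" where
  "wedge_list us = foldr (\<lambda>u a. wedge (ext_vec u) a) us ext_one"

definition ext_power :: "nat \<Rightarrow> 'n::{finite,linorder} ext set" where
  "ext_power k = {a. \<forall>I. card I \<noteq> k \<longrightarrow> a $ I = 0}"

text \<open>
  The isomorphism from the exterior powers of \<open>V\<close> to those of its dual given by the volume form
  \<open>c \<cdot> e_1\<^sup>* \<and> ... \<and> e_n\<^sup>*\<close>, \<open>c \<noteq> 0\<close> (every volume form is of this shape); it sends \<open>e_I\<close> to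
  \<open>c \<cdot> \<epsilon>(I, J) \<cdot> e_J\<^sup>*\<close> with \<open>J\<close> the complement of \<open>I\<close>.
\<close>

definition vol_dual ::
    "complex \<Rightarrow> 'n::{finite,linorder} ext \<Rightarrow> 'n ext" where
  "vol_dual c v = (\<chi> J. c * shuffle_sign (- J) J * v $ (- J))"

section \<open>Polynomial functions and Zariski topologies\<close>

inductive polynomial_fun :: "(complex ^ 'm \<Rightarrow> complex) \<Rightarrow> bool" where
  const: "polynomial_fun (\<lambda>x. c)"
| coord: "polynomial_fun (\<lambda>x. x $ i)"
| add: "polynomial_fun f \<Longrightarrow> polynomial_fun g \<Longrightarrow> polynomial_fun (\<lambda>x. f x + g x)"
| mult: "polynomial_fun f \<Longrightarrow> polynomial_fun g \<Longrightarrow> polynomial_fun (\<lambda>x. f x * g x)"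

definition homogeneous_fun :: "nat \<Rightarrow> (complex ^ 'm \<Rightarrow> complex) \<Rightarrow> bool" where
  "homogeneous_fun d f \<longleftrightarrow> polynomial_fun f \<and> (\<forall>c x. f (c *s x) = c ^ d * f x)"

definition zariski_affine :: "(complex ^ 'm) set \<Rightarrow> (complex ^ 'm) topology" where
  "zariski_affine S = topology_generated_by {{x \<in> S. f x \<noteq> 0} | f. polynomial_fun f}"

definition Gr :: "nat \<Rightarrow> 'n::{finite,linorder} vsp set set" where
  "Gr k = {U. vec.subspace U \<and> vec.dim U = k}"

text \<open>
  The affine cone, without its vertex, over the Pluecker point of a \<open>k\<close>-dimensional subspace
  \<open>U\<close>: a list of \<open>k\<close> vectors spanning \<open>U\<close> is a basis of \<open>U\<close>.
\<close>

definition pluecker ::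
    "nat \<Rightarrow> 'n::{finite,linorder} vsp set \<Rightarrow> 'n ext set" where
  "pluecker k U = {wedge_list us | us. length us = k \<and> vec.span (set us) = U}"

definition zariski_Gr :: "nat \<Rightarrow> 'n::{finite,linorder} vsp set topology" where
  "zariski_Gr k = topology_generated_by
     {{U \<in> Gr k. \<forall>p\<in>pluecker k U. f p \<noteq> 0} | f. \<exists>d. homogeneous_fun d f}"

text \<open>
  Morphisms between subvarieties of \<open>G(k, V)\<close> and \<open>G(l, V)\<close>, seen as projective varieties: locally
  given in Pluecker coordinates by homogeneous polynomials of a common degree.
\<close>

definition regular_map ::
    "nat \<Rightarrow> 'n::{finite,linorder} vsp set set \<Rightarrow> nat \<Rightarrow> 'n vsp set set \<Rightarrow>
     ('n vsp set \<Rightarrow> 'n vsp set) \<Rightarrow> bool" where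
  "regular_map k X l Y \<phi> \<longleftrightarrow>
     \<phi> ` X \<subseteq> Y \<and>
     (\<forall>U\<in>X. \<exists>d (F :: 'n ext \<Rightarrow> 'n ext).
        (\<forall>I. homogeneous_fun d (\<lambda>p. F p $ I)) \<and>
        (\<forall>p\<in>pluecker k U. F p \<noteq> 0) \<and>
        (\<forall>U'\<in>X. \<forall>p\<in>pluecker k U'. F p \<noteq> 0 \<longrightarrow> F p \<in> pluecker l (\<phi> U')))"

definition isomorphic_varieties ::
    "nat \<Rightarrow> 'n::{finite,linorder} vsp set set \<Rightarrow> nat \<Rightarrow> 'n vsp set set \<Rightarrow> bool" where
  "isomorphic_varieties k X l Y \<longleftrightarrow>
     (\<exists>\<phi> \<psi>. regular_map k X l Y \<phi> \<and> regular_map l Y k X \<psi> \<and>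
        (\<forall>U\<in>X. \<psi> (\<phi> U) = U) \<and> (\<forall>U\<in>Y. \<phi> (\<psi> U) = U))"

section \<open>The Pfaffian hypersurface\<close>

text \<open>
  Let \<open>U\<close> have basis \<open>u1, u2\<close> and let \<open>p = u1 \<and> u2\<close>. Multiplication by \<open>p\<close> identifies the exterior
  powers of \<open>V / U\<close> with subspaces of those of \<open>V\<close>, and \<open>det (V / U)\<close> with the top exterior power
  of \<open>V\<close>, which is \<open>complex\<close> through the coordinate \<open>UNIV\<close>. The skew form on \<open>V / U\<close> with values in
  \<open>det (V / U)\<close> that corresponds to the image of \<open>w\<close> in the fourth exterior power of \<open>V / U\<close> is
  \<open>(x, y) \<mapsto> w \<and> x \<and> y\<close>. Below is the matrix of its pullback to \<open>V\<close>, which has the same rank.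
\<close>

definition quot_skew_form :: "8 ext \<Rightarrow> 8 ext \<Rightarrow> 8 endo" where
  "quot_skew_form w p =
     (\<chi> i j. wedge w (wedge (ext_vec (axis i 1)) (wedge (ext_vec (axis j 1)) p)) $ UNIV)"

definition D_Z1 :: "8 ext \<Rightarrow> 8 vsp set set" where
  "D_Z1 w = {U \<in> Gr 2. \<forall>p\<in>pluecker 2 U. rank (quot_skew_form w p) \<le> 4}"

section \<open>Grassmannian duality\<close>

text \<open>
  \<open>Hom(U, V / U)\<close> is presented as the quotient of \<open>End V\<close> by the matrices mapping \<open>U\<close> to itself.
  \<open>tangent_space H U\<close> is the preimage in \<open>End V\<close> of the Zariski tangent space at \<open>U\<close> of \<open>H\<close>
  (with its reduced structure): the \<open>A\<close> along which all homogeneous equations of \<open>H\<close> in Pluecker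
  coordinates vanish to first order at \<open>t = 0\<close> on the curve \<open>(1 + t A) U\<close>.
\<close>

definition tangent_space ::
    "'n::{finite,linorder} vsp set set \<Rightarrow> 'n vsp set \<Rightarrow> 'n endo set" where
  "tangent_space H U =
     {A. \<forall>f d u1 u2. homogeneous_fun d f \<longrightarrow> (\<forall>W\<in>H. \<forall>p\<in>pluecker 2 W. f p = 0) \<longrightarrow>
           vec.span {u1, u2} = U \<longrightarrow>
           ((\<lambda>t. f (wedge_list [u1 + t *s (A *v u1), u2 + t *s (A *v u2)]))
              has_field_derivative 0) (at 0)}"

text \<open>
  The space \<open>Hom(V / U, U)\<close>; it is dual to \<open>Hom(U, V / U)\<close> by \<open>(N, A) \<mapsto> trace (N ** A)\<close>.
\<close>

definition Hom_quot_sub :: "'n::{finite,linorder} vsp set \<Rightarrow> 'n endo set" where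
  "Hom_quot_sub U = {N. (\<forall>x\<in>U. N *v x = 0) \<and> range (\<lambda>x. N *v x) \<subseteq> U}"

text \<open>
  \<open>U\<close> is a smooth point of the hypersurface \<open>H\<close> (its Zariski tangent space has the dimension
  of \<open>H\<close>, i.e. is a hyperplane), and \<open>N\<close> generates the line in \<open>Hom(V / U, U)\<close> orthogonal to the tangent space.
\<close>

definition conormal_generator ::
    "'n::{finite,linorder} vsp set set \<Rightarrow> 'n vsp set \<Rightarrow> 'n endo \<Rightarrow> bool" where
  "conormal_generator H U N \<longleftrightarrow>
     U \<in> H \<and> N \<in> Hom_quot_sub U \<and> N \<noteq> 0 \<and> tangent_space H U = {A. trace (N ** A) = 0}"

text \<open>
  The graph of the map from \<open>H\<close> to \<open>G(n - 2, V)\<close>; it is single valued, since \<open>N\<close> is unique up to a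
  scalar. The preimage in \<open>V\<close> of the kernel of \<open>N\<close> on \<open>V / U\<close> is the kernel of the matrix \<open>N\<close>.
\<close>

definition gr_dual_point ::
    "'n::{finite,linorder} vsp set set \<Rightarrow> 'n vsp set \<Rightarrow> 'n vsp set \<Rightarrow> bool" where
  "gr_dual_point H U U' \<longleftrightarrow>
     (\<exists>N. conormal_generator H U N \<and> range (\<lambda>x. N *v x) = U \<and> U' = {x. N *v x = 0})"

text \<open>
  \<open>H\<close> is a nonempty closed set and the map is defined at a general point of \<open>H\<close>, i.e. on a dense
  open subset. In particular the tangent space is a hyperplane at a general point; since the
  Zariski tangent space at a general point of a variety has the dimension of the variety, this
  includes that \<open>H\<close> is a hypersurface (pure of codimension one).
\<close>

definition has_gr_dual :: "'n::{finite,linorder} vsp set set \<Rightarrow> bool" where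
  "has_gr_dual H \<longleftrightarrow> H \<noteq> {} \<and> closedin (zariski_Gr 2) H \<and>
     (\<exists>O'. openin (subtopology (zariski_Gr 2) H) O' \<and> H \<subseteq> zariski_Gr 2 closure_of O' \<and>
        (\<forall>U\<in>O'. \<exists>U'. gr_dual_point H U U'))"

definition gr_dual :: "'n::{finite,linorder} vsp set set \<Rightarrow> 'n vsp set set" where
  "gr_dual H = zariski_Gr (CARD('n) - 2) closure_of {U'. \<exists>U. gr_dual_point H U U'}"

text \<open>The identification of \<open>G(k, V\<^sup>*)\<close> with \<open>G(n - k, V)\<close>.\<close>

definition orth :: "'n::{finite,linorder} vsp set \<Rightarrow> 'n vsp set" where
  "orth U = {x. \<forall>\<xi>\<in>U. (\<Sum>i\<in>UNIV. \<xi> $ i * x $ i) = 0}"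

end

theory Submission
  imports Defs
begin

text \<open>
  Let \<open>\<Omega> = vol_dual 1 v\<close>. The plane \<open>\<langle>u, w\<rangle>\<close> lies on the hypersurface iff the skew form \<open>\<Omega>(u, w, -, -)\<close> on
  \<open>V / \<langle>u, w\<rangle>\<close> is degenerate. Its cube is a quadratic function of \<open>u \<and> w\<close> times a volume form, so the
  hypersurface is given by a polynomial that is quadratic in \<open>u\<close> and in \<open>w\<close>, and it is irreducible as soon as
  a discriminant does not vanish. At a smooth point \<open>U2 = \<langle>u, w\<rangle>\<close> the form has a \<open>4\<close>-dimensional kernel \<open>U4 \<supseteq> U2\<close>
  and the two partial gradients of the equation cut out \<open>U6 \<supseteq> U4\<close>, the Grassmannian dual point. The flag is
  characterized by equations that become the same equations for \<open>v\<close> on the annihilators, so that \<open>U6\<close> is a point of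
  the dual hypersurface and its own dual point is \<open>U2\<close>. Irreducibility then gives equality of the
  closures.

  For the isomorphism, a general form is the image under some \<open>k\<close> in \<open>GL\<^sub>8\<close> of an element of a Cartan subspace
  of the graded Lie algebra \<open>e\<^sub>7 = sl\<^sub>8 \<oplus> \<Lambda>\<^sup>4\<close> all of whose elements are fixed by \<open>v \<mapsto> v\<^sup>\<or>\<close>, so \<open>v\<close> and its dual are in the
  same orbit up to a scalar.
\<close>

section \<open>Exterior algebra\<close>

text \<open>Three places carry the difficulty. Tangent spaces are cut out by every homogeneous
  equation of the hypersurface, and generators of that ideal are not at hand; instead, at a smooth
  point, each direction killed by the differential of the Pfaffian is realized by a curve inside the
  hypersurface. Irreducibility enters as a statement on zero sets: if a product of two polynomials
  vanishes where the Pfaffian does, so does one factor. It comes from taking norms for a quadratic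
  equation whose discriminant is not a square. It gives density, and it covers dual points at places
  where the gradients of the Pfaffian are not known to be independent. Conjugacy to the Cartan
  subspace uses no structure theory: a Gram determinant on the orbit directions replaces regularity,
  an open mapping theorem gives a local slice, and a complex line minus finitely many points is
  connected. The Cartan subspace is fixed by the duality because all shuffle signs of the affine
  planes involved are +1. One explicit point of it shows that the genericity conditions can be
  met.\<close>

notation wedge (infixr "\<odot>" 70)

abbreviation basis_vec :: "'n::finite \<Rightarrow> 'n vsp" where
  "basis_vec i \<equiv> axis i 1"

text \<open>Bilinear, without conjugation: it pairs a covector in the dual basis with a vector. As
  \<open>V\<close> and its dual share a type, it serves on both, and on the exterior algebra
  too.\<close>

definition bdot :: "complex ^ 'm \<Rightarrow> complex ^ 'm \<Rightarrow> complex" where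
  "bdot x y = (\<Sum>i\<in>UNIV. x $ i * y $ i)"

text \<open>Interior product with the covector \<open>x\<close>; \<open>shuffle_sign {i} K\<close>
  is the sign for moving the index \<open>i\<close> in front of \<open>K\<close>.\<close>

definition contr :: "'n::{finite,linorder} vsp \<Rightarrow> 'n ext \<Rightarrow> 'n ext" where
  "contr x a = (\<chi> K. \<Sum>i\<in>-K. shuffle_sign {i} K * x $ i * a $ insert i K)"

lemma axis_nth_if: "axis i c $ j = (if j = i then c else 0)"
  by (simp add: axis_def)

lemma bdot_commute: "bdot x y = bdot y x"
  by (simp add: bdot_def mult.commute)

lemma bdot_add_left: "bdot (x + y) z = bdot x z + bdot y z"
  and bdot_add_right: "bdot z (x + y) = bdot z x + bdot z y"
  and bdot_diff_left: "bdot (x - y) z = bdot x z - bdot y z"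
  and bdot_diff_right: "bdot z (x - y) = bdot z x - bdot z y"
  and bdot_minus_left: "bdot (- x) z = - bdot x z"
  and bdot_minus_right: "bdot z (- x) = - bdot z x"
  and bdot_scale_left: "bdot (c *s x) z = c * bdot x z"
  and bdot_scale_right: "bdot z (c *s x) = c * bdot z x"
  and bdot_zero_left [simp]: "bdot 0 z = 0"
  and bdot_zero_right [simp]: "bdot z 0 = 0"
  by (simp_all add: bdot_def algebra_simps sum.distrib sum_distrib_left sum_subtractf sum_negf)

lemmas bdot_simps = bdot_add_left bdot_add_right bdot_diff_left bdot_diff_right bdot_minus_left
  bdot_minus_right bdot_scale_left bdot_scale_right

lemma bdot_sum_right: "bdot z (sum f A) = (\<Sum>x\<in>A. bdot z (f x))"
  by (induction A rule: infinite_finite_induct) (auto simp: bdot_simps)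

lemma bdot_axis [simp]: "bdot x (axis i c) = x $ i * c" "bdot (axis i c) x = c * x $ i"
proof -
  have "(\<Sum>j\<in>UNIV. x $ j * axis i c $ j) = (\<Sum>j\<in>UNIV. if j = i then x $ i * c else 0)"
    by (intro sum.cong) (auto simp: axis_def)
  then show *: "bdot x (axis i c) = x $ i * c" by (simp add: bdot_def)
  show "bdot (axis i c) x = c * x $ i" by (subst bdot_commute) (simp add: *)
qed

lemma bdot_eqI: "(\<And>z. bdot x z = bdot y z) \<Longrightarrow> x = y"
  by (metis bdot_axis(1) mult.right_neutral vec_eq_iff)

lemma bdot_matrix: "bdot (A *v x) y = bdot x (transpose A *v y)" for A :: "complex ^ 'n ^ 'm"
proof -
  have "bdot (A *v x) y = (\<Sum>i\<in>UNIV. \<Sum>j\<in>UNIV. A $ i $ j * x $ j * y $ i)"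
    by (simp add: bdot_def matrix_vector_mult_def sum_distrib_right)
  also have "\<dots> = (\<Sum>j\<in>UNIV. \<Sum>i\<in>UNIV. A $ i $ j * x $ j * y $ i)" by (rule sum.swap)
  also have "\<dots> = bdot x (transpose A *v y)"
    by (simp add: bdot_def matrix_vector_mult_def sum_distrib_left transpose_def ac_simps)
  finally show ?thesis .
qed

section \<open>Shuffle signs\<close>

lemma shuffle_sign_Un_left:
  assumes "I \<inter> I' = {}"
  shows "shuffle_sign (I \<union> I') J = shuffle_sign I J * shuffle_sign I' J"
proof -
  have "{(i, j). i \<in> I \<union> I' \<and> j \<in> J \<and> j < i} =
    {(i, j). i \<in> I \<and> j \<in> J \<and> j < i} \<union> {(i, j). i \<in> I' \<and> j \<in> J \<and> j < i}" by auto
  moreover have "card \<dots> = card {(i, j). i \<in> I \<and> j \<in> J \<and> j < i} + card {(i, j). i \<in> I' \<and> j \<in> J \<and> j < i}"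
    using assms by (intro card_Un_disjoint) auto
  ultimately show ?thesis unfolding shuffle_sign_def by (simp add: power_add)
qed

lemma shuffle_sign_Un_right:
  assumes "J \<inter> J' = {}"
  shows "shuffle_sign I (J \<union> J') = shuffle_sign I J * shuffle_sign I J'"
proof -
  have "{(i, j). i \<in> I \<and> j \<in> J \<union> J' \<and> j < i} =
    {(i, j). i \<in> I \<and> j \<in> J \<and> j < i} \<union> {(i, j). i \<in> I \<and> j \<in> J' \<and> j < i}" by auto
  moreover have "card \<dots> = card {(i, j). i \<in> I \<and> j \<in> J \<and> j < i} + card {(i, j). i \<in> I \<and> j \<in> J' \<and> j < i}"
    using assms by (intro card_Un_disjoint) auto
  ultimately show ?thesis unfolding shuffle_sign_def by (simp add: power_add)
qed

lemma shuffle_sign_insert_left: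
  "i \<notin> I \<Longrightarrow> shuffle_sign (insert i I) J = shuffle_sign {i} J * shuffle_sign I J"
  using shuffle_sign_Un_left[of "{i}" I J] by simp

lemma shuffle_sign_insert_right:
  "i \<notin> J \<Longrightarrow> shuffle_sign I (insert i J) = shuffle_sign I {i} * shuffle_sign I J"
  using shuffle_sign_Un_right[of "{i}" J I] by simp

lemma shuffle_sign_square [simp]: "shuffle_sign I J * shuffle_sign I J = 1"
  by (simp add: shuffle_sign_def flip: power_add)

lemma shuffle_sign_square_left [simp]: "shuffle_sign I J * (shuffle_sign I J * x) = x"
  by (simp flip: mult.assoc)

lemma shuffle_sign_empty [simp]: "shuffle_sign {} J = 1" "shuffle_sign I {} = 1"
  by (simp_all add: shuffle_sign_def)

lemma shuffle_sign_nonzero [simp]: "shuffle_sign I J \<noteq> 0"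
  by (simp add: shuffle_sign_def)

lemma shuffle_sign_singletons: "shuffle_sign {i} {j} = (if j < i then - 1 else 1)"
proof -
  have "{(i', j'). i' \<in> {i} \<and> j' \<in> {j} \<and> j' < i'} = (if j < i then {(i, j)} else {})" by auto
  then show ?thesis unfolding shuffle_sign_def by simp
qed

text \<open>Every pair in \<open>I \<times> J\<close> is an inversion for exactly one of the two
  orders, so the two inversion counts add up to \<open>card I * card J\<close>.\<close>

lemma shuffle_sign_swap:
  assumes "I \<inter> J = {}"
  shows "shuffle_sign J I = (- 1) ^ (card I * card J) * shuffle_sign I J"
proof -
  let ?A = "{(i, j). i \<in> I \<and> j \<in> J \<and> j < i}" and ?B = "{(j, i). j \<in> J \<and> i \<in> I \<and> i < j}"
  have "card ?B = card (prod.swap ` ?B)" by (rule card_image[symmetric]) simp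
  also have "prod.swap ` ?B = {(i, j). i \<in> I \<and> j \<in> J \<and> i < j}" by (auto simp: image_def)
  finally have B: "card ?B = card {(i, j). i \<in> I \<and> j \<in> J \<and> i < j}" .
  have "I \<times> J = ?A \<union> {(i, j). i \<in> I \<and> j \<in> J \<and> i < j}"
    using assms by (auto simp: not_less order_le_less)
  then have "card I * card J = card (?A \<union> {(i, j). i \<in> I \<and> j \<in> J \<and> i < j})"
    by (simp flip: card_cartesian_product)
  also have "\<dots> = card ?A + card {(i, j). i \<in> I \<and> j \<in> J \<and> i < j}"
    by (intro card_Un_disjoint) auto
  finally have "card I * card J = card ?A + card ?B" using B by simp
  moreover have "(- 1) ^ (m + n) * (- 1 :: complex) ^ m = (- 1) ^ n" for m n :: nat
    by (cases "even m"; cases "even n") auto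
  moreover have "shuffle_sign J I = (- 1) ^ card ?B" "shuffle_sign I J = (- 1) ^ card ?A"
    by (simp_all add: shuffle_sign_def)
  ultimately show ?thesis by presburger
qed

section \<open>The exterior product\<close>

lemma wedge_nth: "(a \<odot> b) $ K = (\<Sum>I\<in>Pow K. shuffle_sign I (K - I) * a $ I * b $ (K - I))"
  by (simp add: wedge_def)

lemma wedge_add_left: "(a + b) \<odot> c = a \<odot> c + b \<odot> c"
  and wedge_add_right: "c \<odot> (a + b) = c \<odot> a + c \<odot> b"
  and wedge_diff_left: "(a - b) \<odot> c = a \<odot> c - b \<odot> c"
  and wedge_diff_right: "c \<odot> (a - b) = c \<odot> a - c \<odot> b"
  and wedge_minus_left: "(- a) \<odot> c = - (a \<odot> c)"
  and wedge_minus_right: "c \<odot> (- a) = - (c \<odot> a)"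
  and wedge_scale_left: "(k *s a) \<odot> c = k *s (a \<odot> c)"
  and wedge_scale_right: "c \<odot> (k *s a) = k *s (c \<odot> a)"
  and wedge_zero_left [simp]: "0 \<odot> a = 0"
  and wedge_zero_right [simp]: "a \<odot> 0 = 0"
  by (simp_all add: vec_eq_iff wedge_nth algebra_simps sum.distrib sum_distrib_left sum_subtractf sum_negf)

lemmas wedge_simps = wedge_add_left wedge_add_right wedge_diff_left wedge_diff_right
  wedge_minus_left wedge_minus_right wedge_scale_left wedge_scale_right

lemma wedge_sum_left: "sum f A \<odot> b = (\<Sum>x\<in>A. f x \<odot> b)"
  and wedge_sum_right: "b \<odot> sum f A = (\<Sum>x\<in>A. b \<odot> f x)"
  by (induction A rule: infinite_finite_induct) (auto simp: wedge_simps)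

text \<open>Both sides run over the ordered partitions of \<open>K\<close> into three blocks, and
  both signs factor into the three pairwise shuffle signs.\<close>

lemma wedge_assoc: "(a \<odot> b) \<odot> c = a \<odot> b \<odot> c"
proof (rule vec_eq_iff[THEN iffD2], rule allI)
  fix K
  have "((a \<odot> b) \<odot> c) $ K = (\<Sum>S\<in>Pow K. \<Sum>I\<in>Pow S. shuffle_sign S (K - S) *
      (shuffle_sign I (S - I) * a $ I * b $ (S - I)) * c $ (K - S))"
    by (simp add: wedge_nth sum_distrib_left sum_distrib_right)
  also have "\<dots> = (\<Sum>(S, I)\<in>Sigma (Pow K) Pow. shuffle_sign S (K - S) *
      (shuffle_sign I (S - I) * a $ I * b $ (S - I)) * c $ (K - S))"
    by (subst sum.Sigma) auto
  also have "\<dots> = (\<Sum>(I, J)\<in>Sigma (Pow K) (\<lambda>I. Pow (K - I)). shuffle_sign I (K - I) * a $ I *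
      (shuffle_sign J (K - I - J) * b $ J * c $ (K - I - J)))"
  proof (rule sum.reindex_bij_witness[of _ "\<lambda>(I, J). (I \<union> J, I)" "\<lambda>(S, I). (I, S - I)"])
    fix p assume "p \<in> Sigma (Pow K) Pow"
    then obtain S I where p: "p = (S, I)" "S \<subseteq> K" "I \<subseteq> S" by auto
    have eq: "K - I - (S - I) = K - S" "K - I = (S - I) \<union> (K - S)" "S = I \<union> (S - I)" using p by auto
    have "shuffle_sign S (K - S) = shuffle_sign I (K - S) * shuffle_sign (S - I) (K - S)"
      using shuffle_sign_Un_left[of I "S - I" "K - S"] eq(3) by (metis Diff_disjoint)
    moreover have "shuffle_sign I (K - I) = shuffle_sign I (S - I) * shuffle_sign I (K - S)"
      by (subst eq(2)) (use p in \<open>auto intro: shuffle_sign_Un_right\<close>)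
    ultimately show "(case case p of (S, I) \<Rightarrow> (I, S - I) of (I, J) \<Rightarrow> shuffle_sign I (K - I) * a $ I *
        (shuffle_sign J (K - I - J) * b $ J * c $ (K - I - J))) = (case p of (S, I) \<Rightarrow>
        shuffle_sign S (K - S) * (shuffle_sign I (S - I) * a $ I * b $ (S - I)) * c $ (K - S))"
      by (simp add: p eq(1) ac_simps)
  qed auto
  also have "\<dots> = (a \<odot> b \<odot> c) $ K"
    by (subst sum.Sigma[symmetric]) (auto simp: wedge_nth sum_distrib_left)
  finally show "((a \<odot> b) \<odot> c) $ K = (a \<odot> b \<odot> c) $ K" .
qed

lemma ext_one_left [simp]: "ext_one \<odot> a = a"
proof -
  have "(ext_one \<odot> a) $ K = (\<Sum>I\<in>{{}}. shuffle_sign I (K - I) * ext_one $ I * a $ (K - I))" for K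
    unfolding wedge_nth by (rule sum.mono_neutral_right) (auto simp: ext_one_def axis_def)
  then show ?thesis by (simp add: vec_eq_iff ext_one_def)
qed

lemma ext_one_right [simp]: "a \<odot> ext_one = a"
proof -
  have "(a \<odot> ext_one) $ K = (\<Sum>I\<in>{K}. shuffle_sign I (K - I) * a $ I * ext_one $ (K - I))" for K
    unfolding wedge_nth by (rule sum.mono_neutral_right) (auto simp: ext_one_def axis_def)
  then show ?thesis by (simp add: vec_eq_iff ext_one_def)
qed

lemma graded_commute:
  assumes "a \<in> ext_power p" "b \<in> ext_power q"
  shows "b \<odot> a = (- 1) ^ (p * q) *s (a \<odot> b)"
proof (rule vec_eq_iff[THEN iffD2], rule allI)
  fix K
  have "(b \<odot> a) $ K = (\<Sum>I\<in>Pow K. shuffle_sign (K - I) I * b $ (K - I) * a $ I)"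
    unfolding wedge_nth
    by (rule sum.reindex_bij_witness[of _ "\<lambda>I. K - I" "\<lambda>I. K - I"]) (auto simp: double_diff)
  also have "\<dots> = (\<Sum>I\<in>Pow K. (- 1) ^ (p * q) * (shuffle_sign I (K - I) * a $ I * b $ (K - I)))"
  proof (rule sum.cong[OF refl])
    fix I assume "I \<in> Pow K"
    show "shuffle_sign (K - I) I * b $ (K - I) * a $ I =
        (- 1) ^ (p * q) * (shuffle_sign I (K - I) * a $ I * b $ (K - I))"
    proof (cases "card I = p \<and> card (K - I) = q")
      case True
      then show ?thesis using shuffle_sign_swap[of I "K - I"] by auto
    next
      case False
      then have "a $ I = 0 \<or> b $ (K - I) = 0" using assms by (auto simp: ext_power_def)
      then show ?thesis by auto
    qed
  qed
  also have "\<dots> = ((- 1) ^ (p * q) *s (a \<odot> b)) $ K" by (simp add: wedge_nth sum_distrib_left)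
  finally show "(b \<odot> a) $ K = ((- 1) ^ (p * q) *s (a \<odot> b)) $ K" .
qed

lemma ext_vec_nth: "ext_vec x $ {i} = x $ i"
  by (simp add: ext_vec_def)

lemma ext_vec_nth_zero: "card I \<noteq> 1 \<Longrightarrow> ext_vec x $ I = 0"
  by (auto simp: ext_vec_def intro!: sum.neutral)

lemma ext_vec_power: "ext_vec x \<in> ext_power 1"
  by (simp add: ext_power_def ext_vec_nth_zero)

lemma ext_vec_add: "ext_vec (x + y) = ext_vec x + ext_vec y"
  and ext_vec_diff: "ext_vec (x - y) = ext_vec x - ext_vec y"
  and ext_vec_minus: "ext_vec (- x) = - ext_vec x"
  and ext_vec_scale: "ext_vec (c *s x) = c *s ext_vec x"
  and ext_vec_zero [simp]: "ext_vec 0 = 0"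
  by (simp_all add: vec_eq_iff ext_vec_def sum.distrib sum_subtractf sum_distrib_left sum_negf)

lemmas ext_vec_simps = ext_vec_add ext_vec_diff ext_vec_minus ext_vec_scale

lemma ext_vec_sum: "ext_vec (sum f A) = (\<Sum>x\<in>A. ext_vec (f x))"
  by (induction A rule: infinite_finite_induct) (auto simp: ext_vec_simps)

lemma ext_vec_inject: "ext_vec x = ext_vec y \<longleftrightarrow> x = y"
  by (metis ext_vec_nth vec_eq_iff)

lemma ext_vec_eq_0: "ext_vec x = 0 \<longleftrightarrow> x = 0"
  by (metis ext_vec_inject ext_vec_zero)

lemma ext_vec_anticommute: "ext_vec y \<odot> ext_vec x = - (ext_vec x \<odot> ext_vec y)"
  using graded_commute[OF ext_vec_power ext_vec_power, of x y] by simp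

lemma ext_vec_anticommute_left: "ext_vec y \<odot> ext_vec x \<odot> a = - (ext_vec x \<odot> ext_vec y \<odot> a)"
  by (metis ext_vec_anticommute wedge_assoc wedge_minus_left)

lemma ext_vec_square [simp]: "ext_vec x \<odot> ext_vec x = 0"
  using ext_vec_anticommute[of x x] by (simp add: vec_eq_iff)

lemma ext_vec_square_left [simp]: "ext_vec x \<odot> ext_vec x \<odot> a = 0"
  by (metis ext_vec_square wedge_assoc wedge_zero_left)

lemma basis_vec_wedge:
  "(ext_vec (basis_vec i) \<odot> a) $ K = (if i \<in> K then shuffle_sign {i} (K - {i}) * a $ (K - {i}) else 0)"
proof -
  have e: "ext_vec (basis_vec i) $ I = (if I = {i} then 1 else 0)" for I
  proof (cases "card I = 1")
    case True
    then obtain j where "I = {j}" by (auto simp: card_1_singleton_iff)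
    then show ?thesis by (simp add: ext_vec_nth axis_def)
  qed (auto simp: ext_vec_nth_zero)
  have "(ext_vec (basis_vec i) \<odot> a) $ K = (\<Sum>I\<in>Pow K. if I = {i} then shuffle_sign {i} (K - {i}) * a $ (K - {i}) else 0)"
    unfolding wedge_nth by (intro sum.cong) (auto simp: e)
  then show ?thesis by simp
qed

lemma basis_vec_wedge_axis:
  assumes "\<And>j. j \<in> J \<Longrightarrow> i < j"
  shows "ext_vec (basis_vec i) \<odot> axis J 1 = axis (insert i J) 1"
proof -
  have s: "shuffle_sign {i} J = 1"
  proof -
    have "{(i', j). i' \<in> {i} \<and> j \<in> J \<and> j < i'} = {}" using assms by fastforce
    then show ?thesis unfolding shuffle_sign_def by (simp only: card.empty power_0)
  qed
  have "i \<notin> J" using assms by blast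
  then show ?thesis
    by (auto simp: vec_eq_iff basis_vec_wedge axis_nth_if s insert_absorb)
qed

text \<open>Left multiplications by basis vectors generate everything from \<open>ext_one\<close>,
  because \<open>axis I 1\<close> arises by inserting smaller and smaller indices. Identities linear
  in an element are proved this way below.\<close>

lemma ext_induct [case_names add scale one wedge]:
  fixes a :: "'n::{finite,linorder} ext"
  assumes add: "\<And>a b. P a \<Longrightarrow> P b \<Longrightarrow> P (a + b)"
    and scale: "\<And>c a. P a \<Longrightarrow> P (c *s a)"
    and one: "P ext_one"
    and wedge: "\<And>i a. P a \<Longrightarrow> P (ext_vec (basis_vec i) \<odot> a)"
  shows "P a"
proof -
  have b: "P (axis I 1)" if "finite I" for I :: "'n set"
    using that
  proof (induction I rule: finite_linorder_min_induct)
    case empty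
    then show ?case using one by (simp add: ext_one_def)
  next
    case (insert i I)
    then show ?case using wedge[of "axis I 1" i] basis_vec_wedge_axis[of I i] by simp
  qed
  have z: "P 0" using scale[OF one, of 0] by simp
  have "P (\<Sum>I\<in>S. a $ I *s axis I 1)" if "finite S" for S
    using that by (induction S rule: finite_induct) (auto intro!: add[OF scale[OF b]] z)
  from this[of UNIV] show ?thesis by (simp add: basis_expansion)
qed

section \<open>Contractions\<close>

lemma contr_nth: "contr x a $ K = (\<Sum>i\<in>-K. shuffle_sign {i} K * x $ i * a $ insert i K)"
  by (simp add: contr_def)

lemma contr_add_left: "contr (x + y) c = contr x c + contr y c"
  and contr_add_right: "contr x (a + b) = contr x a + contr x b"
  and contr_diff_left: "contr (x - y) c = contr x c - contr y c"
  and contr_diff_right: "contr x (a - b) = contr x a - contr x b"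
  and contr_minus_left: "contr (- x) c = - contr x c"
  and contr_minus_right: "contr x (- a) = - contr x a"
  and contr_scale_left: "contr (k *s x) c = k *s contr x c"
  and contr_scale_right: "contr x (k *s a) = k *s contr x a"
  and contr_zero_left [simp]: "contr 0 a = 0"
  and contr_zero_right [simp]: "contr x 0 = 0"
  by (simp_all add: vec_eq_iff contr_nth algebra_simps sum.distrib sum_distrib_left sum_subtractf sum_negf)

lemmas contr_simps = contr_add_left contr_add_right contr_diff_left contr_diff_right
  contr_minus_left contr_minus_right contr_scale_left contr_scale_right

lemma contr_basis_vec:
  "contr (basis_vec i) a $ K = (if i \<in> K then 0 else shuffle_sign {i} K * a $ insert i K)"
proof -
  have "contr (basis_vec i) a $ K = (\<Sum>j\<in>-K. if j = i then shuffle_sign {i} K * a $ insert i K else 0)"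
    unfolding contr_nth by (intro sum.cong) (auto simp: axis_def)
  then show ?thesis by simp
qed

lemma contr_one [simp]: "contr x ext_one = 0"
  by (auto simp: vec_eq_iff contr_nth ext_one_def axis_def intro!: sum.neutral)

text \<open>For \<open>i \<noteq> j\<close>, adding \<open>i\<close> and removing \<open>j\<close>
  in the two possible orders gives signs that differ by
  \<open>shuffle_sign {i} {j} * shuffle_sign {j} {i} = - 1\<close>.\<close>

lemma contr_basis_wedge:
  "contr (basis_vec i) (ext_vec (basis_vec j) \<odot> a) =
     (if i = j then a else 0) - ext_vec (basis_vec j) \<odot> contr (basis_vec i) a"
proof (rule vec_eq_iff[THEN iffD2], rule allI)
  fix K
  show "contr (basis_vec i) (ext_vec (basis_vec j) \<odot> a) $ K =
     ((if i = j then a else 0) - ext_vec (basis_vec j) \<odot> contr (basis_vec i) a) $ K"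
  proof (cases "i = j")
    case True
    then show ?thesis by (auto simp: contr_basis_vec basis_vec_wedge insert_absorb)
  next
    case False
    show ?thesis
    proof (cases "j \<in> K \<and> i \<notin> K")
      case True
      define L where "L = K - {j}"
      have L: "K = insert j L" "j \<notin> L" "i \<notin> L" using True by (auto simp: L_def)
      have "insert i (insert j L) - {j} = insert i L" using False L by auto
      moreover have "shuffle_sign {i} {j} * shuffle_sign {j} {i} = - 1"
        using False by (auto simp: shuffle_sign_singletons)
      then have "shuffle_sign {i} {j} * (shuffle_sign {j} {i} * z) = - z" for z
        by (metis mult.assoc mult_minus1)
      moreover have "shuffle_sign {j} (insert i L) = shuffle_sign {j} {i} * shuffle_sign {j} L"
        "shuffle_sign {i} (insert j L) = shuffle_sign {i} {j} * shuffle_sign {i} L"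
        using L by (auto intro: shuffle_sign_insert_right)
      ultimately show ?thesis using False L
        by (simp add: contr_basis_vec basis_vec_wedge mult.assoc mult.left_commute[of "shuffle_sign {i} L"])
    qed (use False in \<open>auto simp: contr_basis_vec basis_vec_wedge\<close>)
  qed
qed

lemma contr_wedge: "contr \<xi> (ext_vec x \<odot> a) = bdot \<xi> x *s a - ext_vec x \<odot> contr \<xi> a"
proof -
  have 1: "contr (basis_vec i) (ext_vec x \<odot> a) = x $ i *s a - ext_vec x \<odot> contr (basis_vec i) a" for i
  proof -
    have "contr (basis_vec i) (ext_vec (\<Sum>j\<in>S. x $ j *s basis_vec j) \<odot> a) =
      (if i \<in> S then x $ i *s a else 0) - ext_vec (\<Sum>j\<in>S. x $ j *s basis_vec j) \<odot> contr (basis_vec i) a"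
      if "finite S" for S
      using that
      by (induction S rule: finite_induct)
        (auto simp: ext_vec_simps wedge_simps contr_simps contr_basis_wedge vec.scale_right_diff_distrib)
    from this[of UNIV] show ?thesis by (simp add: basis_expansion)
  qed
  have "contr (\<Sum>i\<in>S. \<xi> $ i *s basis_vec i) (ext_vec x \<odot> a) =
      (\<Sum>i\<in>S. \<xi> $ i * x $ i) *s a - ext_vec x \<odot> contr (\<Sum>i\<in>S. \<xi> $ i *s basis_vec i) a" if "finite S" for S
    using that
    by (induction S rule: finite_induct)
      (auto simp: wedge_simps contr_simps 1 vec.scale_right_diff_distrib vec.scale_left_distrib)
  from this[of UNIV] show ?thesis by (simp add: basis_expansion bdot_def)
qed

lemma contr_ext_vec: "contr \<xi> (ext_vec x) = bdot \<xi> x *s ext_one"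
  using contr_wedge[of \<xi> x ext_one] by simp

lemma contr_anticommute: "contr x (contr y a) = - contr y (contr x a)"
proof (induction a rule: ext_induct)
  case (wedge i a)
  then show ?case by (simp add: contr_wedge contr_simps wedge_simps)
qed (simp_all add: contr_simps)

lemma contr_square [simp]: "contr x (contr x a) = 0"
  using contr_anticommute[of x x a] by (simp add: vec_eq_iff)

lemma bdot_wedge: "bdot (ext_vec x \<odot> a) b = bdot a (contr x b)"
proof -
  have 1: "bdot (ext_vec (basis_vec i) \<odot> a) b = bdot a (contr (basis_vec i) b)" for i
  proof -
    have "bdot (ext_vec (basis_vec i) \<odot> a) b =
        (\<Sum>K\<in>{K. i \<in> K}. shuffle_sign {i} (K - {i}) * a $ (K - {i}) * b $ K)"
      unfolding bdot_def basis_vec_wedge by (rule sum.mono_neutral_cong_right) auto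
    also have "\<dots> = (\<Sum>K\<in>{K. i \<notin> K}. shuffle_sign {i} K * a $ K * b $ insert i K)"
      by (rule sum.reindex_bij_witness[of _ "\<lambda>K. insert i K" "\<lambda>K. K - {i}"]) (auto simp: insert_absorb)
    also have "\<dots> = bdot a (contr (basis_vec i) b)"
      unfolding bdot_def contr_basis_vec by (rule sum.mono_neutral_cong_left) auto
    finally show ?thesis .
  qed
  have "bdot (ext_vec (\<Sum>i\<in>S. x $ i *s basis_vec i) \<odot> a) b = bdot a (contr (\<Sum>i\<in>S. x $ i *s basis_vec i) b)"
    if "finite S" for S
    using that by (induction S rule: finite_induct) (auto simp: ext_vec_simps wedge_simps bdot_simps contr_simps 1)
  from this[of UNIV] show ?thesis by (simp add: basis_expansion)
qed

text \<open>The parity automorphism: the sign that the antiderivation \<open>contr x\<close> picks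
  up when it passes a factor of mixed degree.\<close>

definition grade_inv :: "'n::{finite,linorder} ext \<Rightarrow> 'n ext" where
  "grade_inv a = (\<chi> K. (- 1) ^ card K * a $ K)"

lemma grade_inv_simps: "grade_inv (a + b) = grade_inv a + grade_inv b"
  "grade_inv (c *s a) = c *s grade_inv a" "grade_inv ext_one = ext_one"
  by (simp_all add: grade_inv_def vec_eq_iff algebra_simps ext_one_def axis_def)

lemma grade_inv_power: "a \<in> ext_power k \<Longrightarrow> grade_inv a = (- 1) ^ k *s a"
  by (auto simp: grade_inv_def vec_eq_iff ext_power_def)

lemma grade_inv_wedge: "grade_inv (ext_vec (basis_vec i) \<odot> a) = - (ext_vec (basis_vec i) \<odot> grade_inv a)"
proof (rule vec_eq_iff[THEN iffD2], rule allI)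
  fix K
  show "grade_inv (ext_vec (basis_vec i) \<odot> a) $ K = (- (ext_vec (basis_vec i) \<odot> grade_inv a)) $ K"
  proof (cases "i \<in> K")
    case True
    then have "card K = Suc (card (K - {i}))" by (intro card.remove) auto
    then have "(- 1 :: complex) ^ card K = - ((- 1) ^ card (K - {i}))" by simp
    then show ?thesis using True by (simp add: grade_inv_def basis_vec_wedge del: card_Diff_singleton)
  qed (simp add: grade_inv_def basis_vec_wedge)
qed

lemma contr_wedge_grade: "contr x (a \<odot> b) = contr x a \<odot> b + grade_inv a \<odot> contr x b"
proof (induction a rule: ext_induct)
  case (wedge i a)
  then show ?case by (simp add: wedge_assoc contr_wedge wedge_simps grade_inv_wedge)
qed (simp_all add: wedge_simps contr_simps grade_inv_simps algebra_simps vec.scale_right_distrib)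

lemma contr_wedge_even:
  "a \<in> ext_power k \<Longrightarrow> even k \<Longrightarrow> contr x (a \<odot> b) = contr x a \<odot> b + a \<odot> contr x b"
  by (simp add: contr_wedge_grade grade_inv_power)

lemma even_commute: "a \<in> ext_power p \<Longrightarrow> b \<in> ext_power q \<Longrightarrow> even p \<or> even q \<Longrightarrow> b \<odot> a = a \<odot> b"
  by (auto simp: graded_commute[of a p b q])

lemma ext_power_wedge: "a \<in> ext_power p \<Longrightarrow> b \<in> ext_power q \<Longrightarrow> a \<odot> b \<in> ext_power (p + q)"
proof -
  assume a: "a \<in> ext_power p" "b \<in> ext_power q"
  have "(a \<odot> b) $ K = 0" if K: "card K \<noteq> p + q" for K
    unfolding wedge_nth
  proof (rule sum.neutral, rule ballI)
    fix I assume "I \<in> Pow K"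
    then have "card K = card I + card (K - I)"
      by (metis PowD card_Diff_subset card_mono finite le_add_diff_inverse)
    then have "card I \<noteq> p \<or> card (K - I) \<noteq> q" using K by auto
    then show "shuffle_sign I (K - I) * a $ I * b $ (K - I) = 0" using a by (auto simp: ext_power_def)
  qed
  then show ?thesis by (simp add: ext_power_def)
qed

lemma ext_power_contr: "a \<in> ext_power (Suc k) \<Longrightarrow> contr x a \<in> ext_power k"
  by (auto simp: ext_power_def contr_nth intro!: sum.neutral)

lemma contr_power_0: "a \<in> ext_power 0 \<Longrightarrow> contr x a = 0"
  by (auto simp: vec_eq_iff ext_power_def contr_nth intro!: sum.neutral)

lemma ext_power_closed: "0 \<in> ext_power k" "a \<in> ext_power k \<Longrightarrow> b \<in> ext_power k \<Longrightarrow> a + b \<in> ext_power k"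
  "a \<in> ext_power k \<Longrightarrow> b \<in> ext_power k \<Longrightarrow> a - b \<in> ext_power k"
  "a \<in> ext_power k \<Longrightarrow> c *s a \<in> ext_power k" "a \<in> ext_power k \<Longrightarrow> - a \<in> ext_power k"
  by (auto simp: ext_power_def)

lemma ext_one_power: "ext_one \<in> ext_power 0"
  by (auto simp: ext_power_def ext_one_def axis_def)

lemma wedge_list_simps [simp]: "wedge_list [] = ext_one"
  "wedge_list (x # xs) = ext_vec x \<odot> wedge_list xs"
  by (simp_all add: wedge_list_def)

lemma wedge_list_power: "wedge_list xs \<in> ext_power (length xs)"
proof (induction xs)
  case (Cons x xs)
  then show ?case using ext_power_wedge[OF ext_vec_power, of "wedge_list xs" "length xs" x] by simp
qed (simp add: ext_one_power)

text \<open>This characterizes \<open>vol_dual 1\<close> as a Hodge star: pairing with it is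
  multiplying by \<open>v\<close> and reading off the top coefficient. Identities for the star
  follow by testing against all elements.\<close>

lemma bdot_star: "bdot (vol_dual 1 v) x = (v \<odot> x) $ UNIV"
proof -
  have "(v \<odot> x) $ UNIV = (\<Sum>I\<in>UNIV. shuffle_sign I (- I) * v $ I * x $ (- I))"
    by (simp add: wedge_nth Compl_eq_Diff_UNIV)
  also have "\<dots> = (\<Sum>J\<in>UNIV. shuffle_sign (- J) J * v $ (- J) * x $ J)"
    by (rule sum.reindex_bij_witness[of _ uminus uminus]) auto
  finally show ?thesis by (simp add: bdot_def vol_dual_def)
qed

text \<open>The adjunction \<open>bdot_wedge\<close> moves \<open>x\<close> across the pairing.
  Through this, equations on contractions of a form become equations on products with its
  dual.\<close>

lemma contr_star: "contr x (vol_dual 1 a) = vol_dual 1 (a \<odot> ext_vec x)"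
  by (rule bdot_eqI) (metis bdot_commute bdot_star bdot_wedge wedge_assoc)

lemma vol_dual_linear: "vol_dual c (a + b) = vol_dual c a + vol_dual c b"
  "vol_dual c (k *s a) = k *s vol_dual c a" "vol_dual c 0 = 0"
  by (simp_all add: vol_dual_def vec_eq_iff algebra_simps)

lemma vol_dual_eq_0: "vol_dual 1 a = 0 \<longleftrightarrow> a = 0"
proof
  assume "vol_dual 1 a = 0"
  then have "shuffle_sign (- J) J * a $ (- J) = 0" for J by (simp add: vol_dual_def vec_eq_iff)
  then have "a $ (- J) = 0" for J by (metis mult_eq_0_iff shuffle_sign_nonzero)
  then show "a = 0" by (metis double_complement vec_eq_iff zero_index)
qed (simp add: vol_dual_linear)

lemma vol_dual_power:
  "(a :: 'n::{finite,linorder} ext) \<in> ext_power k \<Longrightarrow> k \<le> CARD('n) \<Longrightarrow> vol_dual c a \<in> ext_power (CARD('n) - k)"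
proof -
  assume a: "a \<in> ext_power k" "k \<le> CARD('n)"
  have "vol_dual c a $ J = 0" if "card J \<noteq> CARD('n) - k" for J
  proof -
    have "card J + card (- J) = CARD('n)"
      using card_Un_disjoint[of J "- J"] by (simp add: Compl_partition)
    then have "card (- J) \<noteq> k" using a that by linarith
    then show ?thesis using a by (simp add: vol_dual_def ext_power_def)
  qed
  then show ?thesis by (simp add: ext_power_def)
qed

lemma vol_dual_vol_dual_even:
  assumes "(a :: 'n::{finite,linorder} ext) \<in> ext_power k" "even k"
  shows "vol_dual 1 (vol_dual c a) = c *s a"
proof (rule vec_eq_iff[THEN iffD2], rule allI)
  fix I :: "'n set"
  have "shuffle_sign (- I) I * shuffle_sign I (- I) = (- 1) ^ (card I * card (- I))"
    using shuffle_sign_swap[of I "- I"] by (simp add: ac_simps)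
  then show "vol_dual 1 (vol_dual c a) $ I = (c *s a) $ I"
    using assms by (cases "card I = k") (auto simp: vol_dual_def ext_power_def)
qed

section \<open>Duality and rank of skew forms\<close>

lemma orth_bdot: "orth U = {x. \<forall>\<xi>\<in>U. bdot \<xi> x = 0}"
  by (simp add: orth_def bdot_def)

lemma subspace_orth: "vec.subspace (orth U)"
  by (auto simp: orth_bdot vec.subspace_def bdot_simps)

lemma subspace_kernel_bdot: "vec.subspace {x. bdot \<xi> x = 0}" "vec.subspace {\<xi>. bdot \<xi> x = 0}"
  by (auto simp: vec.subspace_def bdot_simps)

lemma orth_span: "orth (vec.span S) = orth S"
proof
  show "orth (vec.span S) \<subseteq> orth S" by (auto simp: orth_bdot vec.span_base)
  show "orth S \<subseteq> orth (vec.span S)"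
  proof
    fix x assume "x \<in> orth S"
    then have "vec.span S \<subseteq> {\<xi>. bdot \<xi> x = 0}"
      by (intro vec.span_minimal subspace_kernel_bdot) (auto simp: orth_bdot)
    then show "x \<in> orth (vec.span S)" by (auto simp: orth_bdot)
  qed
qed

lemma dual_covector:
  fixes B :: "'n::{finite,linorder} vsp set"
  assumes "vec.independent B" "b \<in> B"
  shows "\<exists>\<eta>. bdot \<eta> b = 1 \<and> (\<forall>b'\<in>B - {b}. bdot \<eta> b' = 0)"
proof -
  \<comment> \<open>The extension theorem is used with values in \<open>V\<close>; the row of the
    matrix at an arbitrary index \<open>i0\<close> is then the covector.\<close>
  obtain i0 :: 'n where True by blast
  obtain g :: "'n vsp \<Rightarrow> 'n vsp" where g: "Vector_Spaces.linear (*s) (*s) g"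
    "\<forall>x\<in>B. g x = (if x = b then axis i0 1 else 0)"
    using vec.linear_independent_extend[OF assms(1), of "\<lambda>x. if x = b then axis i0 1 else 0"] by blast
  define \<eta> where "\<eta> = matrix g $ i0"
  have "bdot \<eta> x = g x $ i0" for x
  proof -
    have "bdot \<eta> x = (matrix g *v x) $ i0"
      by (simp add: \<eta>_def bdot_def matrix_vector_mult_def)
    then show ?thesis using matrix_works[OF g(1)] by simp
  qed
  then show ?thesis using g(2) assms(2) by (intro exI[of _ \<eta>]) auto
qed

lemma separating_covector:
  fixes S :: "'n::{finite,linorder} vsp set"
  assumes "z \<notin> vec.span S"
  shows "\<exists>\<eta>. bdot \<eta> z = 1 \<and> (\<forall>x\<in>S. bdot \<eta> x = 0)"
proof -
  obtain B where B: "B \<subseteq> S" "vec.independent B" "S \<subseteq> vec.span B"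
    using vec.maximal_independent_subset by blast
  have z: "z \<notin> vec.span B" using assms vec.span_mono[OF B(1)] by blast
  then obtain \<eta> where \<eta>: "bdot \<eta> z = 1" "\<forall>b\<in>insert z B - {z}. bdot \<eta> b = 0"
    using dual_covector[of "insert z B" z] B(2) vec.independent_insertI by blast
  have "z \<notin> B" using z vec.span_base by blast
  then have "B \<subseteq> {x. bdot \<eta> x = 0}" using \<eta>(2) by blast
  then have "vec.span B \<subseteq> {x. bdot \<eta> x = 0}"
    by (intro vec.span_minimal subspace_kernel_bdot)
  then show ?thesis using \<eta> B(3) by blast
qed

lemma orth_orth:
  assumes "vec.subspace S"
  shows "orth (orth S) = S"
proof
  show "S \<subseteq> orth (orth S)" by (auto simp: orth_bdot bdot_commute)
  show "orth (orth S) \<subseteq> S"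
  proof (rule ccontr)
    assume "\<not> orth (orth S) \<subseteq> S"
    then obtain z where z: "z \<in> orth (orth S)" "z \<notin> S" by blast
    then obtain \<eta> where "bdot \<eta> z = 1" "\<forall>x\<in>S. bdot \<eta> x = 0"
      using separating_covector[of z S] assms by (metis vec.span_eq_iff)
    then show False using z(1) by (auto simp: orth_bdot bdot_commute)
  qed
qed

text \<open>A new independent vector \<open>x\<close> lowers the annihilator by exactly one
  dimension: a covector \<open>y\<close> that kills \<open>B\<close> but not \<open>x\<close> spans
  a complement.\<close>

lemma dim_orth_independent:
  fixes B :: "'n::{finite,linorder} vsp set"
  assumes "vec.independent B"
  shows "vec.dim (orth B) + card B = CARD('n)"
proof -
  have "finite B" using assms by (rule vec.finiteI_independent)
  then show ?thesis using assms
  proof (induction B rule: finite_induct)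
    case empty
    have "orth {} = (UNIV :: 'n vsp set)" by (simp add: orth_def)
    then show ?case by (simp only: vec_dim_card) simp
  next
    case (insert x B)
    have ind: "vec.independent B" "x \<notin> vec.span B"
      using insert.prems insert.hyps by (auto simp: vec.independent_insert)
    obtain y where y: "bdot y x = 1" "\<forall>b\<in>B. bdot y b = 0"
      using separating_covector[OF ind(2)] by blast
    have y_in: "y \<in> orth B" using y by (auto simp: orth_bdot bdot_commute)
    have y_notin: "y \<notin> vec.span (orth (insert x B))"
      using y subspace_orth[of "insert x B"] by (auto simp: orth_bdot bdot_commute vec.span_eq_iff[THEN iffD2])
    have "orth B \<subseteq> vec.span (insert y (orth (insert x B)))"
    proof
      fix z assume z: "z \<in> orth B"
      have "z - bdot x z *s y \<in> orth (insert x B)"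
        using z y by (auto simp: orth_bdot bdot_simps bdot_commute)
      then show "z \<in> vec.span (insert y (orth (insert x B)))"
        by (metis vec.span_base vec.span_breakdown_eq)
    qed
    moreover have "insert y (orth (insert x B)) \<subseteq> orth B" using y_in by (auto simp: orth_bdot)
    ultimately have "vec.dim (orth B) = vec.dim (insert y (orth (insert x B)))"
      by (metis vec.dim_subset vec.dim_span le_antisym)
    also have "\<dots> = vec.dim (orth (insert x B)) + 1" using y_notin by (simp add: vec.dim_insert)
    finally show ?case using insert ind by simp
  qed
qed

lemma dim_orth: "vec.dim (orth (S :: 'n::{finite,linorder} vsp set)) + vec.dim S = CARD('n)"
proof -
  obtain B where B: "B \<subseteq> S" "vec.independent B" "S \<subseteq> vec.span B" "card B = vec.dim S"
    using vec.basis_exists by metis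
  then have "vec.span S = vec.span B"
    by (meson subset_antisym vec.span_minimal vec.span_mono vec.subspace_span)
  then show ?thesis using dim_orth_independent[OF B(2)] B(4) by (metis orth_span)
qed

lemma orth_Gr: "U \<in> Gr k \<Longrightarrow> orth U \<in> (Gr (CARD('n) - k) :: 'n::{finite,linorder} vsp set set)"
  using dim_orth[of U] by (auto simp: Gr_def subspace_orth)

lemma contr_wedge_list_zero: "(\<And>u. u \<in> set us \<Longrightarrow> bdot \<eta> u = 0) \<Longrightarrow> contr \<eta> (wedge_list us) = 0"
  by (induction us) (auto simp: contr_wedge)

text \<open>A covector that is 1 on the head and 0 on the tail strips the head off the
  product.\<close>

lemma wedge_list_nonzero:
  assumes "distinct us" "vec.independent (set us)"
  shows "wedge_list us \<noteq> 0"
  using assms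
proof (induction us)
  case Nil
  then show ?case by (auto simp: ext_one_def vec_eq_iff axis_nth_if)
next
  case (Cons u us)
  then have ind: "vec.independent (set us)" "u \<notin> vec.span (set us)"
    by (auto simp: vec.independent_insert)
  obtain \<eta> where "bdot \<eta> u = 1" "\<forall>x\<in>set us. bdot \<eta> x = 0"
    using separating_covector[OF ind(2)] by blast
  then have "contr \<eta> (wedge_list (u # us)) = wedge_list us"
    by (simp add: contr_wedge contr_wedge_list_zero)
  then show ?case using Cons ind by auto
qed

lemma wedge_span_zero:
  assumes "u \<in> vec.span (set us)"
  shows "ext_vec u \<odot> wedge_list us = 0"
proof -
  have 1: "ext_vec u \<odot> wedge_list us = 0" if "u \<in> set us" for u us
    using that
  proof (induction us)
    case (Cons v us)
    then show ?case by (auto simp: ext_vec_anticommute_left[of u v])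
  qed simp
  have "vec.span (set us) \<subseteq> {u. ext_vec u \<odot> wedge_list us = 0}"
    by (rule vec.span_minimal) (auto simp: 1 vec.subspace_def ext_vec_simps wedge_simps)
  then show ?thesis using assms by blast
qed

lemma wedge_zero_span:
  assumes "distinct us" "vec.independent (set us)" "ext_vec u \<odot> wedge_list us = 0"
  shows "u \<in> vec.span (set us)"
proof (rule ccontr)
  assume n: "u \<notin> vec.span (set us)"
  then have "u \<notin> set us" using vec.span_base by blast
  then show False
    using wedge_list_nonzero[of "u # us"] assms n vec.independent_insertI by auto
qed

section \<open>Two-forms and their rank\<close>

lemma ext_power_1_vec: "a \<in> ext_power 1 \<Longrightarrow> a = ext_vec (\<chi> i. a $ {i})"
proof (rule vec_eq_iff[THEN iffD2], rule allI)
  fix I assume a: "a \<in> ext_power 1"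
  show "a $ I = ext_vec (\<chi> i. a $ {i}) $ I"
  proof (cases "card I = 1")
    case True
    then obtain i where "I = {i}" by (auto simp: card_1_singleton_iff)
    then show ?thesis by (simp add: ext_vec_nth)
  next
    case False
    then show ?thesis using a by (simp add: ext_vec_nth_zero) (simp add: ext_power_def)
  qed
qed

definition form_vec :: "'n::{finite,linorder} ext \<Rightarrow> 'n vsp \<Rightarrow> 'n vsp" where
  "form_vec M x = (\<chi> i. contr x M $ {i})"

text \<open>Row \<open>i\<close> is \<open>form_vec M (basis_vec i)\<close>; the order of the two
  contractions is chosen to agree with \<open>quot_skew_form\<close>.\<close>

definition form_matrix :: "'n::{finite,linorder} ext \<Rightarrow> 'n endo" where
  "form_matrix M = (\<chi> i j. contr (basis_vec j) (contr (basis_vec i) M) $ {})"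

lemma contr_form_vec: "M \<in> ext_power 2 \<Longrightarrow> contr x M = ext_vec (form_vec M x)"
  unfolding form_vec_def by (rule ext_power_1_vec) (simp add: ext_power_contr numeral_2_eq_2)

lemma contr_contr_form_vec:
  "M \<in> ext_power 2 \<Longrightarrow> contr y (contr x M) = bdot y (form_vec M x) *s ext_one"
  by (simp add: contr_form_vec contr_ext_vec)

lemma form_vec_skew: "M \<in> ext_power 2 \<Longrightarrow> bdot y (form_vec M x) = - bdot x (form_vec M y)"
proof -
  assume M: "M \<in> ext_power 2"
  have "bdot y (form_vec M x) *s ext_one = (- bdot x (form_vec M y)) *s (ext_one :: 'a ext)"
    using contr_anticommute[of y x M] by (simp add: contr_contr_form_vec[OF M] vec.scale_minus_left)
  then show ?thesis by (auto simp: vec_eq_iff ext_one_def axis_nth_if dest!: spec[of _ "{}"])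
qed

lemma form_vec_linear: "form_vec M (x + y) = form_vec M x + form_vec M y"
  "form_vec M (c *s x) = c *s form_vec M x" "form_vec M (x - y) = form_vec M x - form_vec M y"
  by (simp_all add: form_vec_def vec_eq_iff contr_simps)

lemma form_matrix_row: "M \<in> ext_power 2 \<Longrightarrow> form_matrix M $ i = form_vec M (basis_vec i)"
  by (simp add: form_matrix_def vec_eq_iff contr_contr_form_vec ext_one_def axis_nth_if)

lemma rank_form_matrix_le:
  assumes "M \<in> ext_power 2" "finite S" "\<And>x. form_vec M x \<in> vec.span S"
  shows "rank (form_matrix M) \<le> card S"
proof -
  have "rows (form_matrix M) \<subseteq> vec.span S"
    using assms by (auto simp: rows_def row_def form_matrix_row)
  then show ?thesis unfolding row_rank_def_gen using assms(2) by (rule vec.dim_le_card)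
qed

lemma two_form_cube_contr:
  assumes M: "M \<in> ext_power 2"
  shows "contr x (M \<odot> M) = 2 *s (contr x M \<odot> M)"
    and "contr x (M \<odot> M \<odot> M) = 3 *s (contr x M \<odot> M \<odot> M)"
proof -
  have 2: "even (2::nat)" by simp
  have c: "M \<odot> contr x M = contr x M \<odot> M"
    by (rule even_commute[OF _ M, of _ 1]) (use M in \<open>auto intro: ext_power_contr simp: numeral_2_eq_2\<close>)
  then have c': "M \<odot> contr x M \<odot> M = contr x M \<odot> M \<odot> M" by (simp flip: wedge_assoc)
  have numeral_vec: "a + a = 2 *s a" "a + 2 *s a = 3 *s a" for a :: "'a ext"
    by (simp_all add: vec_eq_iff)
  show sq: "contr x (M \<odot> M) = 2 *s (contr x M \<odot> M)"
    by (simp add: contr_wedge_even[OF M 2] c numeral_vec)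
  have "contr x (M \<odot> M \<odot> M) = contr x M \<odot> M \<odot> M + M \<odot> (2 *s (contr x M \<odot> M))"
    by (subst contr_wedge_even[OF M 2]) (simp only: sq)
  also have "\<dots> = contr x M \<odot> M \<odot> M + 2 *s (contr x M \<odot> M \<odot> M)"
    by (simp only: wedge_scale_right c')
  finally show "contr x (M \<odot> M \<odot> M) = 3 *s (contr x M \<odot> M \<odot> M)"
    by (simp only: numeral_vec)
qed

text \<open>Contracting the cube with a pair \<open>x, y\<close> on which the form is nonzero
  expresses the square of \<open>M\<close> by \<open>\<alpha>\<close>, \<open>\<beta>\<close> and
  \<open>M\<close>. If the form is nonzero on a second pair in the complement, two more contractions
  write \<open>M\<close> as a sum of two products; otherwise all values lie in the span of
  \<open>\<alpha>\<close> and \<open>\<beta>\<close>.\<close>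

lemma two_form_cube_zero_rank:
  fixes M :: "'n::{finite,linorder} ext"
  assumes M: "M \<in> ext_power 2" and cube: "M \<odot> M \<odot> M = 0"
  shows "rank (form_matrix M) \<le> 4"
proof (cases "\<exists>x y. bdot y (form_vec M x) \<noteq> 0")
  case False
  then have "form_vec M x = 0" for x by (metis bdot_axis(2) mult_1 vec_eq_iff zero_index)
  then have "rank (form_matrix M) \<le> card ({} :: 'n vsp set)"
    by (intro rank_form_matrix_le M) (auto simp: vec.span_zero)
  then show ?thesis by simp
next
  case True
  then obtain x y where m: "bdot y (form_vec M x) \<noteq> 0" by blast
  define m where "m = bdot y (form_vec M x)"
  have m0: "m \<noteq> 0" using m by (simp add: m_def)
  define \<alpha> where "\<alpha> = form_vec M x" define \<beta> where "\<beta> = form_vec M y"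
  have xx: "bdot x \<alpha> = 0" "bdot y \<beta> = 0" "bdot y \<alpha> = m" "bdot x \<beta> = - m"
    using form_vec_skew[OF M, of x x] form_vec_skew[OF M, of y y] form_vec_skew[OF M, of x y]
    by (auto simp: \<alpha>_def \<beta>_def m_def)
  note cM = contr_form_vec[OF M]
  have c1: "ext_vec \<alpha> \<odot> M \<odot> M = 0"
  proof -
    have "3 *s (ext_vec \<alpha> \<odot> M \<odot> M) = 0"
      using two_form_cube_contr(2)[OF M, of x] cube by (simp add: cM \<alpha>_def)
    then show ?thesis by (simp add: vec_eq_iff)
  qed
  have c2: "m *s (M \<odot> M) = 2 *s (ext_vec \<alpha> \<odot> ext_vec \<beta> \<odot> M)"
  proof -
    have "m *s (M \<odot> M) - ext_vec \<alpha> \<odot> (2 *s (ext_vec \<beta> \<odot> M)) = 0"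
      using arg_cong[OF c1, of "contr y"] by (simp add: contr_wedge xx two_form_cube_contr(1)[OF M] cM \<beta>_def)
    then show ?thesis by (simp add: wedge_simps)
  qed
  show ?thesis
  proof (cases "\<exists>z t. bdot z \<alpha> = 0 \<and> bdot z \<beta> = 0 \<and> bdot t \<alpha> = 0 \<and> bdot t \<beta> = 0 \<and> bdot t (form_vec M z) \<noteq> 0")
    case True
    then obtain z t where zt: "bdot z \<alpha> = 0" "bdot z \<beta> = 0" "bdot t \<alpha> = 0" "bdot t \<beta> = 0"
      "bdot t (form_vec M z) \<noteq> 0" by blast
    define n where "n = bdot t (form_vec M z)"
    have n0: "n \<noteq> 0" using zt by (simp add: n_def)
    define \<gamma> where "\<gamma> = form_vec M z" define \<delta> where "\<delta> = form_vec M t"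
    have c3: "m *s (ext_vec \<gamma> \<odot> M) = ext_vec \<alpha> \<odot> ext_vec \<beta> \<odot> ext_vec \<gamma>"
    proof -
      have "m *s (2 *s (ext_vec \<gamma> \<odot> M)) = 2 *s (ext_vec \<alpha> \<odot> ext_vec \<beta> \<odot> ext_vec \<gamma>)"
        using arg_cong[OF c2, of "contr z"]
        by (simp add: contr_wedge zt two_form_cube_contr(1)[OF M] cM \<gamma>_def contr_simps wedge_simps)
      then show ?thesis by (simp add: vec_eq_iff)
    qed
    have "m *s (n *s M - ext_vec \<gamma> \<odot> ext_vec \<delta>) = n *s (ext_vec \<alpha> \<odot> ext_vec \<beta>)"
      using arg_cong[OF c3, of "contr t"]
      by (simp add: contr_wedge zt cM n_def \<gamma>_def \<delta>_def contr_simps wedge_simps contr_ext_vec)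
    then have Meq: "M = (1/n) *s (ext_vec \<gamma> \<odot> ext_vec \<delta>) + (1/m) *s (ext_vec \<alpha> \<odot> ext_vec \<beta>)"
      using m0 n0 by (simp add: vec_eq_iff field_simps)
    have "form_vec M q \<in> vec.span {\<alpha>, \<beta>, \<gamma>, \<delta>}" for q
    proof -
      have "ext_vec (form_vec M q) = contr q M" by (simp add: cM)
      also have "\<dots> = ext_vec ((1/n * bdot q \<gamma>) *s \<delta> - (1/n * bdot q \<delta>) *s \<gamma> + (1/m * bdot q \<alpha>) *s \<beta> - (1/m * bdot q \<beta>) *s \<alpha>)"
        by (subst Meq) (simp add: contr_simps contr_wedge contr_ext_vec ext_vec_simps wedge_simps vec.scale_right_diff_distrib)
      finally have "form_vec M q = (1/n * bdot q \<gamma>) *s \<delta> - (1/n * bdot q \<delta>) *s \<gamma> + (1/m * bdot q \<alpha>) *s \<beta> - (1/m * bdot q \<beta>) *s \<alpha>"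
        by (simp only: ext_vec_inject)
      then show ?thesis
        by (simp only:) (intro vec.span_add vec.span_diff vec.span_scale vec.span_base; simp)
    qed
    then have "rank (form_matrix M) \<le> card {\<alpha>, \<beta>, \<gamma>, \<delta>}" by (intro rank_form_matrix_le M) auto
    also have "\<dots> \<le> 4" using card_length[of "[\<alpha>, \<beta>, \<gamma>, \<delta>]"] by simp
    finally show ?thesis .
  next
    case False
    \<comment> \<open>The projection to the complement of the hyperbolic plane spanned by
      \<open>x\<close> and \<open>y\<close>, orthogonal for the skew form.\<close>
    define pr where "pr t = t - (bdot t \<alpha> / m) *s y + (bdot t \<beta> / m) *s x" for t
    have pr: "bdot (pr t) \<alpha> = 0" "bdot (pr t) \<beta> = 0" for t
      using m0 by (simp_all add: pr_def bdot_simps xx)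
    have form_pr: "form_vec M (pr q) = 0" for q
    proof -
      have "bdot t (form_vec M (pr q)) = 0" for t
      proof -
        have "bdot (pr t) (form_vec M (pr q)) = 0" using False pr by blast
        moreover have "bdot y (form_vec M (pr q)) = 0" "bdot x (form_vec M (pr q)) = 0"
          using form_vec_skew[OF M, of y "pr q"] form_vec_skew[OF M, of x "pr q"] pr
          by (auto simp: \<alpha>_def \<beta>_def)
        ultimately show ?thesis by (simp add: pr_def bdot_simps)
      qed
      then show ?thesis by (intro bdot_eqI) (simp add: bdot_commute)
    qed
    have "form_vec M q \<in> vec.span {\<alpha>, \<beta>}" for q
    proof -
      have "form_vec M (pr q) = form_vec M q - (bdot q \<alpha> / m) *s \<beta> + (bdot q \<beta> / m) *s \<alpha>"
        by (simp add: pr_def form_vec_linear \<alpha>_def \<beta>_def)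
      then have "form_vec M q = (bdot q \<alpha> / m) *s \<beta> - (bdot q \<beta> / m) *s \<alpha>"
        using form_pr[of q] by (simp add: vec_eq_iff algebra_simps)
      then show ?thesis by (simp only:) (intro vec.span_diff vec.span_scale vec.span_base; simp)
    qed
    then have "rank (form_matrix M) \<le> card {\<alpha>, \<beta>}" by (intro rank_form_matrix_le M) auto
    also have "\<dots> \<le> 4" using card_length[of "[\<alpha>, \<beta>]"] by simp
    finally show ?thesis .
  qed
qed

lemma form_kernel:
  fixes M :: "'n::{finite,linorder} ext"
  assumes M: "M \<in> ext_power 2"
  shows "orth (rows (form_matrix M)) = {y. contr y M = 0}"
proof -
  have "(\<forall>i. bdot (form_vec M (basis_vec i)) y = 0) \<longleftrightarrow> contr y M = 0" for y
  proof -
    have "bdot (form_vec M (basis_vec i)) y = - form_vec M y $ i" for i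
      using form_vec_skew[OF M, of y "basis_vec i"] by (simp add: bdot_commute)
    then show ?thesis by (simp add: contr_form_vec[OF M] ext_vec_eq_0) (simp add: vec_eq_iff)
  qed
  then show ?thesis
    by (auto simp: orth_bdot rows_def row_def form_matrix_row[OF M])
qed

lemma rank_le_4_kernel:
  assumes "M \<in> ext_power 2" "rank (form_matrix M) \<le> 4"
  shows "vec.dim {y :: 8 vsp. contr y M = 0} \<ge> 4"
  using dim_orth[of "rows (form_matrix M)"] assms by (simp add: form_kernel row_rank_def_gen)

lemma contr_zero_decompose: "ext_vec y \<odot> a = 0 \<Longrightarrow> bdot \<eta> y = 1 \<Longrightarrow> a = ext_vec y \<odot> contr \<eta> a"
  by (metis contr_wedge contr_zero_right eq_iff_diff_eq_0 vec.scale_one)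

lemma independent_extend:
  fixes B :: "'n::{finite,linorder} vsp set"
  assumes "vec.independent B" "B \<subseteq> S" "vec.subspace S" "card B < vec.dim S"
  shows "\<exists>y\<in>S. y \<notin> vec.span B \<and> y \<notin> B \<and> vec.independent (insert y B)"
proof -
  have "\<not> S \<subseteq> vec.span B"
    using assms vec.dim_le_card[of S B] vec.finiteI_independent[OF assms(1)] by auto
  then show ?thesis using assms(1) vec.independent_insertI vec.span_base by blast
qed

text \<open>The star of \<open>A\<close> is a bivector that each kernel vector divides. A nonzero
  bivector has at most a plane of divisors, so three independent ones force it to vanish.\<close>

lemma six_form_zero:
  fixes A :: "8 ext"
  assumes A: "A \<in> ext_power 6" and K: "vec.dim {y. contr y A = 0} \<ge> 3"
  shows "A = 0"
proof -
  let ?K = "{y. contr y A = 0}"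
  have sub: "vec.subspace ?K" by (auto simp: vec.subspace_def contr_simps)
  define Z where "Z = vol_dual 1 A"
  have Z2: "Z \<in> ext_power 2" using vol_dual_power[OF A, of 1] by (simp add: Z_def)
  have A_Z: "A = vol_dual 1 Z" using vol_dual_vol_dual_even[OF A, of 1] by (simp add: Z_def)
  have KZ: "ext_vec y \<odot> Z = 0" if "y \<in> ?K" for y
  proof -
    have "vol_dual 1 (Z \<odot> ext_vec y) = 0" using that by (simp add: A_Z contr_star)
    then have "Z \<odot> ext_vec y = 0" by (simp add: vol_dual_eq_0)
    then show ?thesis by (simp add: even_commute[OF Z2 ext_vec_power])
  qed
  obtain y1 where y1: "y1 \<in> ?K" "vec.independent {y1}"
    using independent_extend[of "{}" ?K] sub K by (auto simp: vec.independent_empty)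
  obtain y2 where y2: "y2 \<in> ?K" "y2 \<noteq> y1" "vec.independent {y2, y1}"
    using independent_extend[of "{y1}" ?K] sub K y1 by auto
  obtain y3 where y3: "y3 \<in> ?K" "y3 \<notin> {y2, y1}" "vec.independent {y3, y2, y1}"
    using independent_extend[of "{y2, y1}" ?K] sub K y1 y2 by auto
  have "y1 \<notin> vec.span {}" using y1 by (metis vec.dependent_zero vec.span_empty singletonD singletonI)
  then obtain \<eta> where \<eta>: "bdot \<eta> y1 = 1" using separating_covector by blast
  have "contr \<eta> Z \<in> ext_power 1" using ext_power_contr[of Z 1 \<eta>] Z2 by (simp add: numeral_2_eq_2)
  then obtain z where z: "contr \<eta> Z = ext_vec z" using ext_power_1_vec by blast
  have Z_eq: "Z = ext_vec y1 \<odot> ext_vec z"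
    using contr_zero_decompose[OF KZ[OF y1(1)] \<eta>] by (simp add: z)
  have in_span: "z \<in> vec.span {y, y1}" if "y \<in> ?K" "y \<noteq> y1" "vec.independent {y, y1}" for y
  proof (rule wedge_zero_span[of "[y, y1]", simplified])
    have "ext_vec z \<odot> ext_vec y \<odot> ext_vec y1 = ext_vec y \<odot> ext_vec y1 \<odot> ext_vec z"
      by (metis ext_vec_anticommute ext_vec_anticommute_left minus_minus wedge_minus_right)
    then show "ext_vec z \<odot> ext_vec y \<odot> ext_vec y1 = 0" using KZ[OF that(1)] Z_eq by simp
  qed (use that in auto)
  have "z \<in> vec.span {y2, y1}" "z \<in> vec.span {y3, y1}"
    using y1 y2 y3 in_span[of y2] in_span[of y3] vec.independent_mono[OF y3(3), of "{y3, y1}"] by auto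
  then have "z \<in> vec.span {y1}"
  proof -
    assume a: "z \<in> vec.span {y2, y1}" "z \<in> vec.span {y3, y1}"
    show "z \<in> vec.span {y1}"
    proof (rule ccontr)
      assume "z \<notin> vec.span {y1}"
      then have "y3 \<in> vec.span {z, y1}" using vec.in_span_insert[OF a(2)] by simp
      moreover have "vec.span {z, y1} \<subseteq> vec.span {y2, y1}"
        using a(1) by (intro vec.span_minimal vec.subspace_span) (auto simp: vec.span_base)
      ultimately have "y3 \<in> vec.span {y2, y1}" by blast
      then show False using y3 vec.independent_insert[of y3 "{y2, y1}"] by auto
    qed
  qed
  then have "Z = 0"
    using wedge_span_zero[of z "[y1]"] Z_eq ext_vec_anticommute[of y1 z] by simp
  then show ?thesis by (simp add: A_Z vol_dual_linear)
qed

lemma two_form_rank_cube_zero: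
  assumes M: "(M :: 8 ext) \<in> ext_power 2" and r: "rank (form_matrix M) \<le> 4"
  shows "M \<odot> M \<odot> M = 0"
proof (rule six_form_zero)
  show "M \<odot> M \<odot> M \<in> ext_power 6"
    using ext_power_wedge[OF M ext_power_wedge[OF M M]] by simp
  have "{y. contr y M = 0} \<subseteq> {y. contr y (M \<odot> M \<odot> M) = 0}"
    by (auto simp: two_form_cube_contr(2)[OF M])
  from vec.dim_subset[OF this] show "3 \<le> vec.dim {y. contr y (M \<odot> M \<odot> M) = 0}"
    using rank_le_4_kernel[OF M r] by linarith
qed

section \<open>Polynomial functions\<close>

text \<open>Polynomials in an arbitrary set of functions on an arbitrary domain, so that vectors,
  pairs, longer tuples and forms with an extra scalar are treated alike.\<close>

inductive_set poly_alg :: "('a \<Rightarrow> complex) set \<Rightarrow> ('a \<Rightarrow> complex) set" for G where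
  gen: "g \<in> G \<Longrightarrow> g \<in> poly_alg G"
| const: "(\<lambda>x. c) \<in> poly_alg G"
| add: "f \<in> poly_alg G \<Longrightarrow> g \<in> poly_alg G \<Longrightarrow> (\<lambda>x. f x + g x) \<in> poly_alg G"
| mult: "f \<in> poly_alg G \<Longrightarrow> g \<in> poly_alg G \<Longrightarrow> (\<lambda>x. f x * g x) \<in> poly_alg G"

lemma poly_alg_uminus: "f \<in> poly_alg G \<Longrightarrow> (\<lambda>x. - f x) \<in> poly_alg G"
  using poly_alg.mult[OF poly_alg.const[of "- 1"], of f G] by simp

lemma poly_alg_diff: "f \<in> poly_alg G \<Longrightarrow> g \<in> poly_alg G \<Longrightarrow> (\<lambda>x. f x - g x) \<in> poly_alg G"
  using poly_alg.add[OF _ poly_alg_uminus, of f G g] by simp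

lemma poly_alg_power: "f \<in> poly_alg G \<Longrightarrow> (\<lambda>x. f x ^ n) \<in> poly_alg G"
  by (induction n) (auto intro: poly_alg.const poly_alg.mult)

lemma poly_alg_sum:
  "(\<And>i. i \<in> S \<Longrightarrow> f i \<in> poly_alg G) \<Longrightarrow> (\<lambda>x. \<Sum>i\<in>S. f i x) \<in> poly_alg G"
  by (induction S rule: infinite_finite_induct) (auto intro: poly_alg.const poly_alg.add)

lemma poly_alg_prod:
  "(\<And>i. i \<in> S \<Longrightarrow> f i \<in> poly_alg G) \<Longrightarrow> (\<lambda>x. \<Prod>i\<in>S. f i x) \<in> poly_alg G"
  by (induction S rule: infinite_finite_induct) (auto intro: poly_alg.const poly_alg.mult)

lemmas poly_alg_intros = poly_alg.const poly_alg.add poly_alg.mult poly_alg_uminus poly_alg_diff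
  poly_alg_power poly_alg_sum

lemma poly_alg_comp:
  assumes "f \<in> poly_alg G" "\<And>g. g \<in> G \<Longrightarrow> (\<lambda>x. g (\<Phi> x)) \<in> poly_alg G'"
  shows "(\<lambda>x. f (\<Phi> x)) \<in> poly_alg G'"
  using assms(1) by induction (auto intro: assms(2) poly_alg_intros)

definition coords :: "(complex ^ 'm \<Rightarrow> complex) set" where
  "coords = range (\<lambda>i x. x $ i)"

lemma polynomial_fun_iff: "polynomial_fun f \<longleftrightarrow> f \<in> poly_alg coords"
proof
  show "polynomial_fun f \<Longrightarrow> f \<in> poly_alg coords"
    by (induction rule: polynomial_fun.induct) (auto intro: poly_alg.intros simp: coords_def)
  show "f \<in> poly_alg coords \<Longrightarrow> polynomial_fun f"
    by (induction rule: poly_alg.induct) (auto intro: polynomial_fun.intros simp: coords_def)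
qed

definition poly_map :: "('a \<Rightarrow> complex) set \<Rightarrow> ('a \<Rightarrow> complex ^ 'm) \<Rightarrow> bool" where
  "poly_map G \<Phi> \<longleftrightarrow> (\<forall>i. (\<lambda>x. \<Phi> x $ i) \<in> poly_alg G)"

lemma poly_map_nth: "poly_map G \<Phi> \<Longrightarrow> (\<lambda>x. \<Phi> x $ i) \<in> poly_alg G"
  by (simp add: poly_map_def)

lemma polynomial_fun_comp: "polynomial_fun f \<Longrightarrow> poly_map G \<Phi> \<Longrightarrow> (\<lambda>x. f (\<Phi> x)) \<in> poly_alg G"
  unfolding polynomial_fun_iff by (erule poly_alg_comp) (auto simp: coords_def poly_map_def)

lemma poly_map_id: "poly_map coords (\<lambda>x. x)"
  by (auto simp: poly_map_def coords_def intro: poly_alg.gen)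

lemma poly_map_const: "poly_map G (\<lambda>x. c)"
  by (auto simp: poly_map_def intro: poly_alg.const)

lemma poly_map_add: "poly_map G f \<Longrightarrow> poly_map G g \<Longrightarrow> poly_map G (\<lambda>x. f x + g x)"
  by (auto simp: poly_map_def intro: poly_alg.add)

lemma poly_map_diff: "poly_map G f \<Longrightarrow> poly_map G g \<Longrightarrow> poly_map G (\<lambda>x. f x - g x)"
  by (auto simp: poly_map_def intro: poly_alg_diff)

lemma poly_map_scale: "c \<in> poly_alg G \<Longrightarrow> poly_map G g \<Longrightarrow> poly_map G (\<lambda>x. c x *s g x)"
  by (auto simp: poly_map_def intro: poly_alg.mult)

lemma poly_map_sum: "(\<And>i. i \<in> S \<Longrightarrow> poly_map G (f i)) \<Longrightarrow> poly_map G (\<lambda>x. \<Sum>i\<in>S. f i x)"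
  by (auto simp: poly_map_def intro: poly_alg_sum)

lemma poly_map_lambda: "(\<And>i. (\<lambda>x. f x i) \<in> poly_alg G) \<Longrightarrow> poly_map G (\<lambda>x. \<chi> i. f x i)"
  by (simp add: poly_map_def)

lemma poly_map_wedge: "poly_map G f \<Longrightarrow> poly_map G g \<Longrightarrow> poly_map G (\<lambda>x. f x \<odot> g x)"
  unfolding poly_map_def wedge_nth by (auto intro!: poly_alg_intros)

lemma poly_map_contr: "poly_map G f \<Longrightarrow> poly_map G g \<Longrightarrow> poly_map G (\<lambda>x. contr (f x) (g x))"
  unfolding poly_map_def contr_nth by (auto intro!: poly_alg_intros)

lemma poly_map_ext_vec: "poly_map G f \<Longrightarrow> poly_map G (\<lambda>x. ext_vec (f x))"
  unfolding poly_map_def ext_vec_def by (auto intro!: poly_alg_intros)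

lemma poly_map_vol_dual: "poly_map G f \<Longrightarrow> poly_map G (\<lambda>x. vol_dual c (f x))"
  unfolding poly_map_def vol_dual_def by (auto intro!: poly_alg_intros)

lemmas poly_map_intros = poly_map_const poly_map_add poly_map_diff poly_map_scale
  poly_map_lambda poly_map_wedge poly_map_contr poly_map_ext_vec poly_map_vol_dual

text \<open>Real lines are used because \<open>*\<^sub>R\<close> makes sense on all tuples of
  vectors at once; infinitely many real parameters already determine a complex polynomial.\<close>

definition line_poly :: "('a::real_vector \<Rightarrow> complex) \<Rightarrow> bool" where
  "line_poly f \<longleftrightarrow> (\<forall>x y. \<exists>P. \<forall>t::real. f (x + t *\<^sub>R y) = poly P (complex_of_real t))"

lemma poly_alg_line_poly:
  assumes "f \<in> poly_alg G" "\<And>g. g \<in> G \<Longrightarrow> line_poly g"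
  shows "line_poly f"
  using assms(1)
proof induction
  case (const c)
  show ?case unfolding line_poly_def by (auto intro!: exI[of _ "[:c:]"])
next
  case (add f g)
  show ?case unfolding line_poly_def
  proof (intro allI)
    fix x y :: 'a
    obtain P Q where "\<forall>t::real. f (x + t *\<^sub>R y) = poly P (complex_of_real t)"
      "\<forall>t::real. g (x + t *\<^sub>R y) = poly Q (complex_of_real t)"
      using add by (metis line_poly_def)
    then show "\<exists>P. \<forall>t::real. f (x + t *\<^sub>R y) + g (x + t *\<^sub>R y) = poly P (complex_of_real t)"
      by (intro exI[of _ "P + Q"]) simp
  qed
next
  case (mult f g)
  show ?case unfolding line_poly_def
  proof (intro allI)
    fix x y :: 'a
    obtain P Q where "\<forall>t::real. f (x + t *\<^sub>R y) = poly P (complex_of_real t)"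
      "\<forall>t::real. g (x + t *\<^sub>R y) = poly Q (complex_of_real t)"
      using mult by (metis line_poly_def)
    then show "\<exists>P. \<forall>t::real. f (x + t *\<^sub>R y) * g (x + t *\<^sub>R y) = poly P (complex_of_real t)"
      by (intro exI[of _ "P * Q"]) simp
  qed
qed (use assms(2) in auto)

lemma infinite_complex_of_real: "infinite (range complex_of_real)"
  using finite_imageD[of complex_of_real UNIV] inj_of_real infinite_UNIV_char_0[where 'a = real] by blast

lemma poly_eq_on_reals:
  assumes "\<And>t. poly P (complex_of_real t) = poly Q (complex_of_real t)"
  shows "P = Q"
proof (rule ccontr)
  assume "P \<noteq> Q"
  then have "finite {z. poly (P - Q) z = 0}" by (intro poly_roots_finite) simp
  moreover have "range complex_of_real \<subseteq> {z. poly (P - Q) z = 0}" using assms by auto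
  ultimately show False using infinite_complex_of_real finite_subset by blast
qed

text \<open>On the line joining \<open>x\<close> to \<open>y\<close> both restrictions are nonzero
  polynomials, hence so is their product. This is the irreducibility of an affine space in the form
  used below.\<close>

lemma line_poly_common_nonzero:
  assumes "line_poly f" "line_poly g" "f x \<noteq> 0" "g y \<noteq> 0"
  shows "\<exists>z. f z \<noteq> 0 \<and> g z \<noteq> 0"
proof (rule ccontr)
  assume n: "\<not> (\<exists>z. f z \<noteq> 0 \<and> g z \<noteq> 0)"
  obtain P Q where P: "\<And>t::real. f (x + t *\<^sub>R (y - x)) = poly P (complex_of_real t)"
      and Q: "\<And>t::real. g (x + t *\<^sub>R (y - x)) = poly Q (complex_of_real t)"
    using assms(1,2) by (metis line_poly_def)
  have "poly (P * Q) (complex_of_real t) = poly 0 (complex_of_real t)" for t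
    using n P[of t] Q[of t] by (metis mult_eq_0_iff poly_0 poly_mult)
  then have "P * Q = 0" by (rule poly_eq_on_reals)
  moreover have "P \<noteq> 0" using P[of 0] assms(3) by auto
  moreover have "Q \<noteq> 0" using Q[of 1] assms(4) by auto
  ultimately show False by simp
qed

lemma quadratic_root:
  fixes a b c :: complex
  assumes "a \<noteq> 0"
  shows "\<exists>s. a * s ^ 2 + b * s + c = 0"
proof -
  define d where "d = csqrt (b ^ 2 - 4 * a * c)"
  have d: "d * d = b * b - 4 * a * c"
    unfolding d_def by (metis power2_csqrt power2_eq_square)
  have "a * ((d - b) / (2 * a)) ^ 2 + b * ((d - b) / (2 * a)) + c = (d * d - (b * b - 4 * a * c)) / (4 * a)"
    using assms by (simp add: field_simps power2_eq_square)
  also have "\<dots> = 0" using d by simp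
  finally show ?thesis by (rule exI)
qed

text \<open>With nonzero discriminant the factor of degree at most two has a simple root; there the
  left side has odd order and the right side even order.\<close>

lemma quadratic_times_square:
  fixes p q :: "complex poly"
  assumes eq: "[:C, B, A:] * p ^ 2 = q ^ 2" and disc: "B ^ 2 - 4 * A * C \<noteq> 0"
  shows "p = 0"
proof (rule ccontr)
  assume p: "p \<noteq> 0"
  let ?D = "[:C, B, A:]"
  have D0: "?D \<noteq> 0" using disc by auto
  obtain r where r: "poly ?D r = 0"
  proof (cases "A = 0")
    case True
    then have "poly ?D (- C / B) = 0" using disc by simp
    then show ?thesis by (rule that)
  next
    case False
    obtain r where "A * r ^ 2 + B * r + C = 0" using quadratic_root[OF False] by blast
    then have "poly ?D r = 0" by (simp add: algebra_simps power2_eq_square)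
    then show ?thesis by (rule that)
  qed
  \<comment> \<open>At a root the squared derivative equals the discriminant, so the root is
    simple.\<close>
  have "(2 * A * r + B) ^ 2 = B ^ 2 - 4 * A * C + 4 * A * poly ?D r"
    by (simp add: algebra_simps power2_eq_square)
  then have "2 * A * r + B \<noteq> 0" using r disc by auto
  moreover have "poly (pderiv ?D) r = 2 * A * r + B" by (simp add: pderiv_pCons algebra_simps)
  ultimately have d: "poly (pderiv ?D) r \<noteq> 0" by simp
  have "order r ?D = Suc (order r (pderiv ?D))"
    using r D0 d by (intro order_pderiv) (auto simp: order_root)
  then have "order r ?D = 1" using d by (simp add: order_0I)
  moreover have "order r (?D * p ^ 2) = order r ?D + order r (p ^ 2)"
    by (intro order_mult no_zero_divisors D0) (simp add: p)
  ultimately have "odd (order r (?D * p ^ 2))"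
    using p by (simp add: order_mult power2_eq_square)
  moreover have "?D * p ^ 2 \<noteq> 0" by (intro no_zero_divisors D0) (simp add: p)
  then have "q \<noteq> 0" by (metis eq power_zero_numeral)
  then have "even (order r (q ^ 2))" by (simp add: power2_eq_square order_mult)
  ultimately show False using eq by simp
qed

text \<open>Pseudo-division by the quadratic in \<open>s\<close>: a power of the leading coefficient
  clears denominators and leaves a remainder of degree at most one.\<close>

lemma poly_alg_reduce_quadratic:
  fixes G :: "('a \<Rightarrow> complex) set"
  assumes F: "F \<in> poly_alg ((\<lambda>g (x, s). g x) ` G \<union> {snd})"
    and abc: "a \<in> poly_alg G" "b \<in> poly_alg G" "c \<in> poly_alg G"
  shows "\<exists>k. \<exists>\<alpha>\<in>poly_alg G. \<exists>\<beta>\<in>poly_alg G. \<forall>x s. a x * s ^ 2 + b x * s + c x = 0 \<longrightarrow>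
    a x ^ k * F (x, s) = \<alpha> x * s + \<beta> x"
  using F
proof induction
  case (gen g)
  then consider h where "h \<in> G" "g = (\<lambda>(x, s). h x)" | "g = snd" by auto
  then show ?case
  proof cases
    case 1
    then show ?thesis
      by (intro exI[of _ 0] bexI[of _ "\<lambda>x. 0"] bexI[of _ h]) (auto intro: poly_alg.intros)
  next
    case 2
    then show ?thesis
      by (intro exI[of _ 0] bexI[of _ "\<lambda>x. 1"] bexI[of _ "\<lambda>x. 0"]) (auto intro: poly_alg.intros)
  qed
next
  case (const d)
  show ?case
    by (intro exI[of _ 0] bexI[of _ "\<lambda>x. 0"] bexI[of _ "\<lambda>x. d"]) (auto intro: poly_alg.intros)
next
  case (add f g)
  then obtain k1 \<alpha>1 \<beta>1 k2 \<alpha>2 \<beta>2 where *: "\<alpha>1 \<in> poly_alg G" "\<beta>1 \<in> poly_alg G" "\<alpha>2 \<in> poly_alg G" "\<beta>2 \<in> poly_alg G"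
    "\<And>x s. a x * s ^ 2 + b x * s + c x = 0 \<Longrightarrow> a x ^ k1 * f (x, s) = \<alpha>1 x * s + \<beta>1 x"
    "\<And>x s. a x * s ^ 2 + b x * s + c x = 0 \<Longrightarrow> a x ^ k2 * g (x, s) = \<alpha>2 x * s + \<beta>2 x" by metis
  show ?case
  proof (rule exI[of _ "k1 + k2"], rule bexI[of _ "\<lambda>x. a x ^ k2 * \<alpha>1 x + a x ^ k1 * \<alpha>2 x"],
      rule bexI[of _ "\<lambda>x. a x ^ k2 * \<beta>1 x + a x ^ k1 * \<beta>2 x"], intro allI impI)
    fix x s assume q: "a x * s ^ 2 + b x * s + c x = 0"
    have "a x ^ (k1 + k2) * (f (x, s) + g (x, s)) =
      a x ^ k2 * (a x ^ k1 * f (x, s)) + a x ^ k1 * (a x ^ k2 * g (x, s))"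
      by (simp add: algebra_simps power_add)
    then show "a x ^ (k1 + k2) * (f (x, s) + g (x, s)) =
       (a x ^ k2 * \<alpha>1 x + a x ^ k1 * \<alpha>2 x) * s + (a x ^ k2 * \<beta>1 x + a x ^ k1 * \<beta>2 x)"
      by (simp only: *(5,6)[OF q]) (simp add: algebra_simps)
  qed (use * abc in \<open>auto intro!: poly_alg_intros\<close>)
next
  case (mult f g)
  then obtain k1 \<alpha>1 \<beta>1 k2 \<alpha>2 \<beta>2 where *: "\<alpha>1 \<in> poly_alg G" "\<beta>1 \<in> poly_alg G" "\<alpha>2 \<in> poly_alg G" "\<beta>2 \<in> poly_alg G"
    "\<And>x s. a x * s ^ 2 + b x * s + c x = 0 \<Longrightarrow> a x ^ k1 * f (x, s) = \<alpha>1 x * s + \<beta>1 x"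
    "\<And>x s. a x * s ^ 2 + b x * s + c x = 0 \<Longrightarrow> a x ^ k2 * g (x, s) = \<alpha>2 x * s + \<beta>2 x" by metis
  show ?case
  \<comment> \<open>The additional factor \<open>a x\<close> pays for replacing
    \<open>a x * s ^ 2\<close> in the product of two linear remainders.\<close>
  proof (rule exI[of _ "k1 + k2 + 1"], rule bexI[of _ "\<lambda>x. a x * (\<alpha>1 x * \<beta>2 x + \<beta>1 x * \<alpha>2 x) - b x * (\<alpha>1 x * \<alpha>2 x)"],
      rule bexI[of _ "\<lambda>x. a x * (\<beta>1 x * \<beta>2 x) - c x * (\<alpha>1 x * \<alpha>2 x)"], intro allI impI)
    fix x s assume q: "a x * s ^ 2 + b x * s + c x = 0"
    have "a x ^ (k1 + k2 + 1) * (f (x, s) * g (x, s)) =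
      a x * ((a x ^ k1 * f (x, s)) * (a x ^ k2 * g (x, s)))"
      by (simp add: algebra_simps power_add)
    also have "\<dots> = a x * ((\<alpha>1 x * s + \<beta>1 x) * (\<alpha>2 x * s + \<beta>2 x))" by (simp only: *(5,6)[OF q])
    also have "\<dots> = (a x * (\<alpha>1 x * \<beta>2 x + \<beta>1 x * \<alpha>2 x) - b x * (\<alpha>1 x * \<alpha>2 x)) * s +
        (a x * (\<beta>1 x * \<beta>2 x) - c x * (\<alpha>1 x * \<alpha>2 x)) + \<alpha>1 x * \<alpha>2 x * (a x * s ^ 2 + b x * s + c x)"
      by (simp add: algebra_simps power2_eq_square)
    finally show "a x ^ (k1 + k2 + 1) * (f (x, s) * g (x, s)) =
       (a x * (\<alpha>1 x * \<beta>2 x + \<beta>1 x * \<alpha>2 x) - b x * (\<alpha>1 x * \<alpha>2 x)) * s +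
        (a x * (\<beta>1 x * \<beta>2 x) - c x * (\<alpha>1 x * \<alpha>2 x))" using q by simp
  qed (use * abc in \<open>auto intro!: poly_alg_intros\<close>)
qed

section \<open>The Pfaffian and its irreducibility\<close>

definition form2 :: "'n::{finite,linorder} ext \<Rightarrow> 'n vsp \<Rightarrow> 'n vsp \<Rightarrow> 'n ext" where
  "form2 \<Omega> u w = contr w (contr u \<Omega>)"

text \<open>
  The cube of \<open>form2 \<Omega> u w\<close> is \<open>pfaff \<Omega> u w\<close> times the volume form of the quotient by \<open>\<langle>u, w\<rangle>\<close>: one of the
  three factors can be replaced by \<open>\<Omega>\<close> itself, which makes the Pfaffian quadratic in \<open>u \<and> w\<close>.
\<close>

definition pol :: "'n::{finite,linorder} ext \<Rightarrow> 'n vsp \<Rightarrow> 'n vsp \<Rightarrow> 'n vsp \<Rightarrow> 'n vsp \<Rightarrow> complex" where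
  "pol \<Omega> u w x y = (form2 \<Omega> u w \<odot> form2 \<Omega> x y \<odot> \<Omega>) $ UNIV"

definition pfaff :: "'n::{finite,linorder} ext \<Rightarrow> 'n vsp \<Rightarrow> 'n vsp \<Rightarrow> complex" where
  "pfaff \<Omega> u w = pol \<Omega> u w u w"

lemma form2_linear: "form2 \<Omega> (u + x) w = form2 \<Omega> u w + form2 \<Omega> x w"
  "form2 \<Omega> u (w + x) = form2 \<Omega> u w + form2 \<Omega> u x"
  "form2 \<Omega> (u - x) w = form2 \<Omega> u w - form2 \<Omega> x w"
  "form2 \<Omega> u (w - x) = form2 \<Omega> u w - form2 \<Omega> u x"
  "form2 \<Omega> (c *s u) w = c *s form2 \<Omega> u w" "form2 \<Omega> u (c *s w) = c *s form2 \<Omega> u w"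
  "form2 \<Omega> 0 w = 0" "form2 \<Omega> u 0 = 0"
  by (simp_all add: form2_def contr_simps)

lemma form2_self [simp]: "form2 \<Omega> u u = 0"
  by (simp add: form2_def)

lemma form2_swap: "form2 \<Omega> w u = - form2 \<Omega> u w"
  unfolding form2_def by (rule contr_anticommute)

lemma form2_power: "\<Omega> \<in> ext_power 4 \<Longrightarrow> form2 \<Omega> u w \<in> ext_power 2"
proof -
  assume "\<Omega> \<in> ext_power 4"
  then have "\<Omega> \<in> ext_power (Suc 3)" by simp
  then have "contr u \<Omega> \<in> ext_power (Suc 2)" by (simp add: ext_power_contr)
  then show ?thesis unfolding form2_def by (rule ext_power_contr)
qed

lemma pol_linear: "pol \<Omega> (u + x') w x y = pol \<Omega> u w x y + pol \<Omega> x' w x y"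
  "pol \<Omega> u (w + x') x y = pol \<Omega> u w x y + pol \<Omega> u x' x y"
  "pol \<Omega> u w (x + x') y = pol \<Omega> u w x y + pol \<Omega> u w x' y"
  "pol \<Omega> u w x (y + x') = pol \<Omega> u w x y + pol \<Omega> u w x x'"
  "pol \<Omega> (c *s u) w x y = c * pol \<Omega> u w x y" "pol \<Omega> u (c *s w) x y = c * pol \<Omega> u w x y"
  "pol \<Omega> u w (c *s x) y = c * pol \<Omega> u w x y" "pol \<Omega> u w x (c *s y) = c * pol \<Omega> u w x y"
  "pol \<Omega> 0 w x y = 0" "pol \<Omega> u 0 x y = 0" "pol \<Omega> u w 0 y = 0" "pol \<Omega> u w x 0 = 0"
  by (simp_all add: pol_def form2_linear wedge_simps)

lemma pol_swap: "pol \<Omega> w u x y = - pol \<Omega> u w x y" "pol \<Omega> u w y x = - pol \<Omega> u w x y"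
  by (simp_all add: pol_def form2_swap[of \<Omega> w u] form2_swap[of \<Omega> y x] wedge_simps)

lemma pol_self [simp]: "pol \<Omega> u u x y = 0" "pol \<Omega> u w x x = 0"
  by (simp_all add: pol_def)

lemma pol_sym: "\<Omega> \<in> ext_power 4 \<Longrightarrow> pol \<Omega> x y u w = pol \<Omega> u w x y"
  using even_commute[of "form2 \<Omega> u w" 2 "form2 \<Omega> x y" 2] by (simp add: pol_def form2_power flip: wedge_assoc)

lemma pfaff_add_right: "\<Omega> \<in> ext_power 4 \<Longrightarrow>
    pfaff \<Omega> u (w + s *s y) = pfaff \<Omega> u w + 2 * s * pol \<Omega> u w u y + s ^ 2 * pfaff \<Omega> u y"
  using pol_sym[of \<Omega> u y u w] by (simp add: pfaff_def pol_linear algebra_simps power2_eq_square)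

lemma pfaff_add_left: "\<Omega> \<in> ext_power 4 \<Longrightarrow>
    pfaff \<Omega> (u + s *s x) w = pfaff \<Omega> u w + 2 * s * pol \<Omega> u w x w + s ^ 2 * pfaff \<Omega> x w"
  using pol_sym[of \<Omega> x w u w] by (simp add: pfaff_def pol_linear algebra_simps power2_eq_square)

lemma pfaff_shear: "pfaff \<Omega> (u + c *s w) w = pfaff \<Omega> u w" "pfaff \<Omega> u (w + c *s u) = pfaff \<Omega> u w"
  by (simp_all add: pfaff_def pol_linear)

lemma poly_alg_pol:
  assumes "poly_map G O'" "poly_map G a" "poly_map G b" "poly_map G c" "poly_map G d"
  shows "(\<lambda>x. pol (O' x) (a x) (b x) (c x) (d x)) \<in> poly_alg G"
  unfolding pol_def form2_def using assms by (intro poly_map_nth poly_map_intros)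

lemma poly_alg_pfaff:
  "poly_map G O' \<Longrightarrow> poly_map G a \<Longrightarrow> poly_map G b \<Longrightarrow> (\<lambda>x. pfaff (O' x) (a x) (b x)) \<in> poly_alg G"
  unfolding pfaff_def by (intro poly_alg_pol)

text \<open>Real-linear along lines and defined on any real vector space, so the coordinates of
  tuples of complex vectors qualify.\<close>

definition lin_funs :: "('a::real_vector \<Rightarrow> complex) set" where
  "lin_funs = {g. \<forall>x y t. g (x + t *\<^sub>R y) = g x + complex_of_real t * g y}"

lemma lin_funs_line_poly: "f \<in> poly_alg lin_funs \<Longrightarrow> line_poly f"
proof (erule poly_alg_line_poly)
  fix g :: "'a \<Rightarrow> complex" assume "g \<in> lin_funs"
  then have "g (x + t *\<^sub>R y) = poly [:g x, g y:] (complex_of_real t)" for x y t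
    by (simp add: lin_funs_def mult.commute)
  then show "line_poly g" unfolding line_poly_def by blast
qed

lemma line_poly_comp:
  assumes "line_poly f" "\<And>x y t. \<Phi> (x + t *\<^sub>R y) = \<Phi> x + t *\<^sub>R L y"
  shows "line_poly (\<lambda>x. f (\<Phi> x))"
  using assms unfolding line_poly_def by metis

lemma line_poly_mult: "line_poly f \<Longrightarrow> line_poly g \<Longrightarrow> line_poly (\<lambda>x. f x * g x)"
  using poly_alg_line_poly[of "\<lambda>x. f x * g x" "{f, g}"] by (auto intro: poly_alg.mult poly_alg.gen)

lemmas complex_scaleR = scaleR_conv_of_real[where 'a = complex]

lemma scaleR_vec: "t *\<^sub>R (y :: complex ^ 'm) = complex_of_real t *s y"
  by (simp add: vec_eq_iff complex_scaleR)

lemma poly_map_lin_funs: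
  "poly_map lin_funs (\<lambda>x :: complex ^ 'm. x)"
  "poly_map lin_funs (\<lambda>x :: (complex ^ 'm) \<times> ('b::real_vector). fst x)"
  "poly_map lin_funs (\<lambda>x :: ('b::real_vector) \<times> (complex ^ 'm). snd x)"
  "poly_map lin_funs (\<lambda>x :: ('b::real_vector) \<times> (complex ^ 'm) \<times> ('c::real_vector). fst (snd x))"
  "poly_map lin_funs (\<lambda>x :: ('b::real_vector) \<times> ('c::real_vector) \<times> (complex ^ 'm). snd (snd x))"
  "poly_map lin_funs (\<lambda>x :: ('b::real_vector) \<times> ('c::real_vector) \<times> (complex ^ 'm) \<times> ('d::real_vector). fst (snd (snd x)))"
  "poly_map lin_funs (\<lambda>x :: ('b::real_vector) \<times> ('c::real_vector) \<times> ('d::real_vector) \<times> (complex ^ 'm). snd (snd (snd x)))"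
  by (auto simp: poly_map_def lin_funs_def complex_scaleR intro!: poly_alg.gen)

definition pair_coords :: "((complex ^ 'm) \<times> (complex ^ 'm) \<Rightarrow> complex) set" where
  "pair_coords = range (\<lambda>i x. fst x $ i) \<union> range (\<lambda>i x. snd x $ i)"

lemma poly_map_pair_coords: "poly_map pair_coords fst" "poly_map pair_coords snd"
  by (auto simp: poly_map_def pair_coords_def intro!: poly_alg.gen)

lemma poly_alg_pair_comp:
  assumes "f \<in> poly_alg pair_coords" "poly_map G a" "poly_map G b"
  shows "(\<lambda>x. f (a x, b x)) \<in> poly_alg G"
  by (rule poly_alg_comp[OF assms(1)]) (use assms(2,3) in \<open>auto simp: pair_coords_def poly_map_def\<close>)

text \<open>
  For fixed \<open>u\<close>, \<open>pfaff \<Omega> u\<close> is a quadratic form; its restrictions to the lines \<open>w0 + s w1\<close> have a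
  discriminant that is a quadratic polynomial along \<open>w1 = y0 + t y1\<close>. The discriminant of
  the latter is a multiple of the following quantity.
\<close>

definition double_disc :: "'n::{finite,linorder} ext \<Rightarrow> 'n vsp \<Rightarrow> 'n vsp \<Rightarrow> 'n vsp \<Rightarrow> 'n vsp \<Rightarrow> complex" where
  "double_disc \<Omega> u w y z =
     (2 * (pol \<Omega> u w u y * pol \<Omega> u w u z - pfaff \<Omega> u w * pol \<Omega> u y u z)) ^ 2 -
     4 * ((pol \<Omega> u w u z) ^ 2 - pfaff \<Omega> u w * pfaff \<Omega> u z) *
         ((pol \<Omega> u w u y) ^ 2 - pfaff \<Omega> u w * pfaff \<Omega> u y)"

lemma poly_alg_double_disc:
  assumes "poly_map G O'" "poly_map G a" "poly_map G b" "poly_map G c" "poly_map G d"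
  shows "(\<lambda>x. double_disc (O' x) (a x) (b x) (c x) (d x)) \<in> poly_alg G"
  unfolding double_disc_def using assms by (intro poly_alg_intros poly_alg_pol poly_alg_pfaff)

lemma pfaff_nonzero_exists:
  assumes \<Omega>: "\<Omega> \<in> ext_power 4" and d: "double_disc \<Omega> u0 w0 y0 z0 \<noteq> 0"
  shows "\<exists>w. pfaff \<Omega> u0 w \<noteq> 0"
proof (rule ccontr)
  assume "\<not> (\<exists>w. pfaff \<Omega> u0 w \<noteq> 0)"
  then have n: "pfaff \<Omega> u0 w = 0" for w by blast
  then have "pol \<Omega> u0 w u0 y = 0" for w y
    using pfaff_add_right[OF \<Omega>, of u0 w 1 y] by simp
  then show False using d by (simp add: double_disc_def n)
qed

text \<open>Perturbation argument. If \<open>pfaff \<Omega> u\<close> vanishes identically, the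
  plane stays on the hypersurface when \<open>w\<close> is moved anywhere, and when \<open>u\<close>
  is sheared along \<open>w\<close>; generic such moves reach pairs where \<open>van\<close>
  applies.\<close>

lemma vanish_all_of_vanish_nonzero:
  assumes \<Omega>: "\<Omega> \<in> ext_power 4" and F: "F \<in> poly_alg pair_coords" and nz: "pfaff \<Omega> p q \<noteq> 0"
    and van: "\<And>u w w'. pfaff \<Omega> u w = 0 \<Longrightarrow> pfaff \<Omega> u w' \<noteq> 0 \<Longrightarrow> F (u, w) = 0"
    and z: "pfaff \<Omega> u w = 0"
  shows "F (u, w) = 0"
proof (cases "\<exists>w'. pfaff \<Omega> u w' \<noteq> 0")
  case True
  then show ?thesis using van z by blast
next
  case False
  have caseA: "F (u, w) = 0" if n: "pfaff \<Omega> w w' \<noteq> 0" for w w'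
  proof (rule ccontr)
    assume F0: "F (u, w) \<noteq> 0"
    let ?a = "\<lambda>e :: real. pfaff \<Omega> (u + e *\<^sub>R w) w'" and ?f = "\<lambda>e :: real. F (u + e *\<^sub>R w, w)"
    have l1: "line_poly ?a"
      by (rule line_poly_comp[where \<Phi> = "\<lambda>e. u + e *\<^sub>R w" and L = "\<lambda>e. e *\<^sub>R w"],
          rule lin_funs_line_poly, intro poly_alg_pfaff poly_map_const poly_map_lin_funs)
        (simp add: algebra_simps)
    have l2: "line_poly ?f"
      by (rule line_poly_comp[where \<Phi> = "\<lambda>e. u + e *\<^sub>R w" and L = "\<lambda>e. e *\<^sub>R w" and f = "\<lambda>x. F (x, w)"],
          rule lin_funs_line_poly, intro poly_alg_pair_comp[OF F] poly_map_const poly_map_lin_funs)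
        (simp add: algebra_simps)
    have "\<exists>e. ?a e \<noteq> 0"
    proof (rule ccontr)
      assume "\<not> ?thesis"
      \<comment> \<open>The constant term is zero here, so adding the values at 1 and -1 isolates
        \<open>2 * pfaff \<Omega> w w'\<close>.\<close>
      then have "?a 1 = 0" "?a (- 1) = 0" by blast+
      then show False
        using pfaff_add_left[OF \<Omega>, of u 1 w w'] pfaff_add_left[OF \<Omega>, of u "- 1" w w'] n False
        by (simp add: scaleR_vec)
    qed
    then obtain e0 where "?a e0 \<noteq> 0" by blast
    then obtain e where e: "?a e \<noteq> 0" "?f e \<noteq> 0"
      using line_poly_common_nonzero[OF l1 l2, of e0 0] F0 by auto
    have "pfaff \<Omega> (u + e *\<^sub>R w) w = 0" using False by (simp add: scaleR_vec pfaff_shear)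
    then show False using van e by blast
  qed
  show ?thesis
  proof (rule ccontr)
    assume F0: "F (u, w) \<noteq> 0"
    have "line_poly (\<lambda>y. pfaff \<Omega> y q)"
      by (rule lin_funs_line_poly, intro poly_alg_pfaff poly_map_const poly_map_lin_funs)
    moreover have "line_poly (\<lambda>y. F (u, y))"
      by (rule lin_funs_line_poly, intro poly_alg_pair_comp[OF F] poly_map_const poly_map_lin_funs)
    ultimately obtain y where "pfaff \<Omega> y q \<noteq> 0" "F (u, y) \<noteq> 0"
      using line_poly_common_nonzero nz F0 by meson
    then show False using caseA by blast
  qed
qed

text \<open>\<open>N\<close> is the norm of \<open>F\<close> for the quadratic equation in
  \<open>s\<close> that describes where the line through \<open>w\<close> in direction
  \<open>y\<close> meets the hypersurface. If it vanished identically with \<open>\<alpha>\<close>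
  not zero, the discriminant of this equation would be a square, which \<open>double_disc\<close>
  excludes.\<close>

lemma pfaffian_norm:
  fixes \<Omega> :: "'n::{finite,linorder} ext"
  assumes \<Omega>: "\<Omega> \<in> ext_power 4" and F: "F \<in> poly_alg pair_coords"
    and d: "double_disc \<Omega> u0 w0 y0 z0 \<noteq> 0"
  shows "\<exists>N :: 'n vsp \<times> 'n vsp \<times> 'n vsp \<Rightarrow> complex. line_poly N \<and>
    (\<forall>u w y s. pfaff \<Omega> u (w + s *s y) = 0 \<longrightarrow> pfaff \<Omega> u y \<noteq> 0 \<longrightarrow> F (u, w + s *s y) = 0 \<longrightarrow> N (u, w, y) = 0) \<and>
    ((\<forall>x. N x = 0) \<longrightarrow> (\<forall>u w. pfaff \<Omega> u w = 0 \<longrightarrow> F (u, w) = 0))"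
proof -
  define a where "a = (\<lambda>x :: 'n vsp \<times> 'n vsp \<times> 'n vsp. pfaff \<Omega> (fst x) (snd (snd x)))"
  define b where "b = (\<lambda>x :: 'n vsp \<times> 'n vsp \<times> 'n vsp. 2 * pol \<Omega> (fst x) (fst (snd x)) (fst x) (snd (snd x)))"
  define c where "c = (\<lambda>x :: 'n vsp \<times> 'n vsp \<times> 'n vsp. pfaff \<Omega> (fst x) (fst (snd x)))"
  have abc: "a \<in> poly_alg lin_funs" "b \<in> poly_alg lin_funs" "c \<in> poly_alg lin_funs"
    unfolding a_def b_def c_def
    by (intro poly_alg_pfaff poly_alg.mult poly_alg.const poly_alg_pol poly_map_const poly_map_lin_funs)+
  have quad: "a (u, w, y) * s ^ 2 + b (u, w, y) * s + c (u, w, y) = pfaff \<Omega> u (w + s *s y)" for u w y s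
    by (simp add: a_def b_def c_def pfaff_add_right[OF \<Omega>] algebra_simps)
  let ?L = "(\<lambda>g (x, s). g x) ` (lin_funs :: ('n vsp \<times> 'n vsp \<times> 'n vsp \<Rightarrow> complex) set) \<union> {snd}"
  have lift: "(\<lambda>(x, s). g x) \<in> poly_alg ?L" if "g \<in> lin_funs" for g
    using that by (intro poly_alg.gen) blast
  have "(\<lambda>(x, s). F (fst x, fst (snd x) + s *s snd (snd x))) \<in> poly_alg ?L"
  proof -
    have "(\<lambda>z. F ((\<lambda>(x, s). (fst x, fst (snd x) + s *s snd (snd x))) z)) \<in> poly_alg ?L"
    proof (rule poly_alg_comp[OF F])
      fix g :: "'n vsp \<times> 'n vsp \<Rightarrow> complex" assume "g \<in> pair_coords"
      then consider i where "g = (\<lambda>x. fst x $ i)" | i where "g = (\<lambda>x. snd x $ i)"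
        by (auto simp: pair_coords_def)
      then show "(\<lambda>z. g ((\<lambda>(x, s). (fst x, fst (snd x) + s *s snd (snd x))) z)) \<in> poly_alg ?L"
      proof cases
        case 1
        then show ?thesis
          using lift[of "\<lambda>x. fst x $ i"] by (simp add: case_prod_unfold lin_funs_def complex_scaleR)
      next
        case 2
        have "(\<lambda>z. fst (snd (fst z)) $ i) \<in> poly_alg ?L" "(\<lambda>z. snd (snd (fst z)) $ i) \<in> poly_alg ?L" "snd \<in> poly_alg ?L"
          using lift[of "\<lambda>x. fst (snd x) $ i"] lift[of "\<lambda>x. snd (snd x) $ i"] poly_alg.gen[of snd ?L]
          by (simp_all add: case_prod_unfold lin_funs_def complex_scaleR)
        then have "(\<lambda>z. fst (snd (fst z)) $ i + snd z * (snd (snd (fst z)) $ i)) \<in> poly_alg ?L"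
          by (intro poly_alg.add poly_alg.mult)
        then show ?thesis using 2 by (simp add: case_prod_unfold)
      qed
    qed
    then show ?thesis by (simp add: case_prod_unfold)
  qed
  from poly_alg_reduce_quadratic[OF this abc]
  obtain k \<alpha> \<beta> where ab: "\<alpha> \<in> poly_alg lin_funs" "\<beta> \<in> poly_alg lin_funs"
    and red: "\<And>u w y s. pfaff \<Omega> u (w + s *s y) = 0 \<Longrightarrow>
      a (u, w, y) ^ k * F (u, w + s *s y) = \<alpha> (u, w, y) * s + \<beta> (u, w, y)"
    by (auto simp flip: quad)
  \<comment> \<open>Where \<open>a\<close> is nonzero, this is \<open>a\<close> times the product of
    \<open>\<alpha> * s + \<beta>\<close> over the two roots.\<close>
  define N where "N = (\<lambda>x. \<beta> x ^ 2 * a x - \<alpha> x * \<beta> x * b x + \<alpha> x ^ 2 * c x)"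
  \<comment> \<open>Completing the square: \<open>\<gamma> ^ 2 = 4 * a * N + \<alpha> ^ 2 * (b ^ 2 -
    4 * a * c)\<close>.\<close>
  define \<gamma> where "\<gamma> = (\<lambda>x. 2 * a x * \<beta> x - \<alpha> x * b x)"
  have N: "N \<in> poly_alg lin_funs" unfolding N_def using ab abc by (intro poly_alg_intros)
  have \<gamma>: "\<gamma> \<in> poly_alg lin_funs" unfolding \<gamma>_def using ab abc by (intro poly_alg_intros)
  have N1: "N (u, w, y) = 0" if r: "pfaff \<Omega> u (w + s *s y) = 0" and n: "pfaff \<Omega> u y \<noteq> 0"
    and f: "F (u, w + s *s y) = 0" for u w y s
  proof -
    let ?x = "(u, w, y)"
    have "\<beta> ?x = - \<alpha> ?x * s" using red[OF r] f by (simp add: eq_neg_iff_add_eq_0 add.commute)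
    then have "N ?x = \<alpha> ?x ^ 2 * (a ?x * s ^ 2 + b ?x * s + c ?x)"
      unfolding N_def by (simp only:) (simp add: algebra_simps power2_eq_square)
    then show ?thesis using r quad by simp
  qed
  have N2: "F (u, w) = 0" if N0: "\<forall>x. N x = 0" and z: "pfaff \<Omega> u w = 0" for u w
  proof -
    have a_nz: "\<exists>x. a x \<noteq> 0"
      using pfaff_nonzero_exists[OF \<Omega> d] by (auto simp: a_def)
    have \<alpha>0: "\<alpha> x = 0" for x
    proof (rule ccontr)
      assume nx: "\<alpha> x \<noteq> 0"
      obtain ux wx yx where x: "x = (ux, wx, yx)" by (cases x)
      have l1: "line_poly (\<lambda>X :: 'n vsp \<times> 'n vsp \<times> 'n vsp \<times> 'n vsp. \<alpha> (fst X, fst (snd X), fst (snd (snd X))))"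
        by (rule line_poly_comp[OF lin_funs_line_poly[OF ab(1)],
              where L = "\<lambda>X. (fst X, fst (snd X), fst (snd (snd X)))"]) simp
      have l2: "line_poly (\<lambda>X :: 'n vsp \<times> 'n vsp \<times> 'n vsp \<times> 'n vsp.
          double_disc \<Omega> (fst X) (fst (snd X)) (fst (snd (snd X))) (snd (snd (snd X))))"
        by (rule lin_funs_line_poly, intro poly_alg_double_disc poly_map_const poly_map_lin_funs)
      obtain X where X: "\<alpha> (fst X, fst (snd X), fst (snd (snd X))) \<noteq> 0"
          "double_disc \<Omega> (fst X) (fst (snd X)) (fst (snd (snd X))) (snd (snd (snd X))) \<noteq> 0"
        using line_poly_common_nonzero[OF l1 l2, of "(ux, wx, yx, 0)" "(u0, w0, y0, z0)"] nx d x by auto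
      obtain u w y z where Xe: "X = (u, w, y, z)" by (cases X)
      define C where "C = pol \<Omega> u w u y ^ 2 - pfaff \<Omega> u w * pfaff \<Omega> u y"
      define A where "A = pol \<Omega> u w u z ^ 2 - pfaff \<Omega> u w * pfaff \<Omega> u z"
      define B where "B = 2 * (pol \<Omega> u w u y * pol \<Omega> u w u z - pfaff \<Omega> u w * pol \<Omega> u y u z)"
      have dABC: "B ^ 2 - 4 * A * C \<noteq> 0" using X(2) by (simp add: Xe double_disc_def A_def B_def C_def)
      obtain P where P: "\<And>t :: real. \<alpha> ((u, w, y) + t *\<^sub>R (0, 0, z)) = poly P (complex_of_real t)"
        using lin_funs_line_poly[OF ab(1)] unfolding line_poly_def by meson
      obtain Q where Q: "\<And>t :: real. \<gamma> ((u, w, y) + t *\<^sub>R (0, 0, z)) = poly Q (complex_of_real t)"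
        using lin_funs_line_poly[OF \<gamma>] unfolding line_poly_def by meson
      \<comment> \<open>Along \<open>y + t z\<close> the discriminant of the quadratic in
        \<open>s\<close> is itself quadratic in \<open>t\<close>, with these coefficients;
        \<open>N = 0\<close> makes its product with a square a square.\<close>
      have "[:4 * C, 4 * B, 4 * A:] * P ^ 2 = Q ^ 2"
      proof (rule poly_eq_on_reals)
        fix t :: real
        let ?t = "complex_of_real t" and ?x = "(u, w, y + t *\<^sub>R z)"
        have x: "(u, w, y) + t *\<^sub>R (0, 0, z) = ?x" by simp
        have "b ?x ^ 2 - 4 * a ?x * c ?x = poly [:4 * C, 4 * B, 4 * A:] ?t"
          using pol_sym[OF \<Omega>, of u z u y]
          by (simp add: a_def b_def c_def scaleR_vec pol_linear pfaff_add_right[OF \<Omega>] A_def B_def C_def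
              algebra_simps power2_eq_square)
        moreover have "\<gamma> ?x ^ 2 = 4 * a ?x * N ?x + \<alpha> ?x ^ 2 * (b ?x ^ 2 - 4 * a ?x * c ?x)"
          by (simp add: \<gamma>_def N_def algebra_simps power2_eq_square)
        ultimately have "\<gamma> ?x ^ 2 = poly [:4 * C, 4 * B, 4 * A:] ?t * \<alpha> ?x ^ 2"
          using N0 by simp
        then show "poly ([:4 * C, 4 * B, 4 * A:] * P ^ 2) ?t = poly (Q ^ 2) ?t"
          using P[of t] Q[of t] x by (simp only: poly_mult poly_power)
      qed
      moreover have "(4 * B) ^ 2 - 4 * (4 * A) * (4 * C) \<noteq> 0"
      proof -
        have "(4 * B) ^ 2 - 4 * (4 * A) * (4 * C) = 16 * (B ^ 2 - 4 * A * C)"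
          by (simp add: algebra_simps power2_eq_square)
        then show ?thesis using dABC by (simp add: mult.assoc)
      qed
      ultimately have "P = 0" by (rule quadratic_times_square)
      then show False using P[of 0] X(1) by (simp add: Xe)
    qed
    have \<beta>0: "\<beta> x = 0" for x
    proof (rule ccontr)
      assume "\<beta> x \<noteq> 0"
      then obtain y where "a y \<noteq> 0" "\<beta> y \<noteq> 0"
        using line_poly_common_nonzero[OF lin_funs_line_poly[OF abc(1)] lin_funs_line_poly[OF ab(2)]] a_nz by metis
      moreover have "\<beta> y ^ 2 * a y = 0" using N0[rule_format, of y] \<alpha>0 by (simp add: N_def)
      ultimately show False by simp
    qed
    obtain p q where pq: "pfaff \<Omega> p q \<noteq> 0" using pfaff_nonzero_exists[OF \<Omega> d] by blast
    show ?thesis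
    proof (rule vanish_all_of_vanish_nonzero[OF \<Omega> F pq _ z])
      fix u w w' assume h: "pfaff \<Omega> u w = 0" "pfaff \<Omega> u w' \<noteq> 0"
      have "a (u, w, w') ^ k * F (u, w) = 0" using red[of u w 0 w'] h \<alpha>0 \<beta>0 by simp
      then show "F (u, w) = 0" using h by (simp add: a_def)
    qed
  qed
  show ?thesis using lin_funs_line_poly[OF N] N1 N2 by blast
qed

text \<open>If neither factor vanished on the zero locus, both norms would be nonzero polynomials.
  Where neither is zero and the quadratic in \<open>s\<close> is proper, a root gives a point of the
  hypersurface at which both factors are nonzero.\<close>

theorem pfaff_irreducible:
  fixes \<Omega> :: "'n::{finite,linorder} ext"
  assumes \<Omega>: "\<Omega> \<in> ext_power 4" and F: "F \<in> poly_alg pair_coords" and H: "H \<in> poly_alg pair_coords"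
    and d: "double_disc \<Omega> u0 w0 y0 z0 \<noteq> 0"
    and FH: "\<And>u w. pfaff \<Omega> u w = 0 \<Longrightarrow> F (u, w) * H (u, w) = 0"
  shows "(\<forall>u w. pfaff \<Omega> u w = 0 \<longrightarrow> F (u, w) = 0) \<or> (\<forall>u w. pfaff \<Omega> u w = 0 \<longrightarrow> H (u, w) = 0)"
proof (rule ccontr)
  assume n: "\<not> ?thesis"
  obtain N1 :: "'n vsp \<times> 'n vsp \<times> 'n vsp \<Rightarrow> complex" where N1: "line_poly N1"
    "\<And>u w y s. pfaff \<Omega> u (w + s *s y) = 0 \<Longrightarrow> pfaff \<Omega> u y \<noteq> 0 \<Longrightarrow> F (u, w + s *s y) = 0 \<Longrightarrow> N1 (u, w, y) = 0"
    "\<exists>x. N1 x \<noteq> 0" using pfaffian_norm[OF \<Omega> F d] n by metis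
  obtain N2 :: "'n vsp \<times> 'n vsp \<times> 'n vsp \<Rightarrow> complex" where N2: "line_poly N2"
    "\<And>u w y s. pfaff \<Omega> u (w + s *s y) = 0 \<Longrightarrow> pfaff \<Omega> u y \<noteq> 0 \<Longrightarrow> H (u, w + s *s y) = 0 \<Longrightarrow> N2 (u, w, y) = 0"
    "\<exists>x. N2 x \<noteq> 0" using pfaffian_norm[OF \<Omega> H d] n by metis
  obtain p q where pq: "pfaff \<Omega> p q \<noteq> 0" using pfaff_nonzero_exists[OF \<Omega> d] by blast
  let ?a = "\<lambda>x :: 'n vsp \<times> 'n vsp \<times> 'n vsp. pfaff \<Omega> (fst x) (snd (snd x))"
  have "line_poly ?a" by (rule lin_funs_line_poly, intro poly_alg_pfaff poly_map_const poly_map_lin_funs)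
  moreover have "?a (p, 0, q) \<noteq> 0" using pq by simp
  moreover obtain z where "N1 z \<noteq> 0" "N2 z \<noteq> 0"
    using line_poly_common_nonzero N1(1,3) N2(1,3) by metis
  ultimately obtain x where x: "?a x \<noteq> 0" "N1 x * N2 x \<noteq> 0"
    using line_poly_common_nonzero[OF _ line_poly_mult[OF N1(1) N2(1)], of ?a "(p, 0, q)" z] by auto
  obtain u w y where xe: "x = (u, w, y)" by (cases x)
  obtain s where "pfaff \<Omega> u y * s ^ 2 + (2 * pol \<Omega> u w u y) * s + pfaff \<Omega> u w = 0"
    using quadratic_root[of "pfaff \<Omega> u y"] x(1) xe by auto
  then have r: "pfaff \<Omega> u (w + s *s y) = 0" by (simp add: pfaff_add_right[OF \<Omega>] algebra_simps)
  then show False using FH[OF r] N1(2)[OF r] N2(2)[OF r] x xe by auto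
qed

lemma vol_dual_vol_dual:
  assumes "(a :: 'n::{finite,linorder} ext) \<in> ext_power k"
  shows "vol_dual 1 (vol_dual 1 a) = (- 1) ^ (k * (CARD('n) - k)) *s a"
proof (rule vec_eq_iff[THEN iffD2], rule allI)
  fix I :: "'n set"
  have "shuffle_sign (- I) I * shuffle_sign I (- I) = (- 1) ^ (card I * card (- I))"
    using shuffle_sign_swap[of I "- I"] by (simp add: ac_simps)
  moreover have "card (- I) = CARD('n) - card I"
    by (simp add: Compl_eq_Diff_UNIV card_Diff_subset)
  ultimately show "vol_dual 1 (vol_dual 1 a) $ I = ((- 1) ^ (k * (CARD('n) - k)) *s a) $ I"
    using assms by (cases "card I = k") (auto simp: vol_dual_def ext_power_def)
qed

lemma star_star4: "\<Omega> \<in> ext_power 4 \<Longrightarrow> vol_dual 1 (vol_dual 1 \<Omega>) = \<Omega>"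
  using vol_dual_vol_dual_even[of \<Omega> 4 1] by simp

lemma star_power4: "(v :: 8 ext) \<in> ext_power 4 \<Longrightarrow> vol_dual c v \<in> ext_power 4"
  using vol_dual_power[of v 4 c] by simp

lemma vol_dual_diff: "vol_dual c (a - b) = vol_dual c a - vol_dual c b"
  by (simp add: vol_dual_def vec_eq_iff algebra_simps)

lemma contr_contr_star: "contr w (contr u (vol_dual 1 a)) = vol_dual 1 (a \<odot> ext_vec u \<odot> ext_vec w)"
  by (simp add: contr_star wedge_assoc)

lemma top_form: "(a :: 8 ext) \<in> ext_power 8 \<Longrightarrow> a = a $ UNIV *s vol_dual 1 ext_one"
proof (rule vec_eq_iff[THEN iffD2], rule allI)
  fix J :: "8 set" assume a: "a \<in> ext_power 8"
  show "a $ J = (a $ UNIV *s vol_dual 1 ext_one) $ J"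
  proof (cases "J = UNIV")
    case False
    then have "card J \<noteq> 8" using card_eq_UNIV_imp_eq_UNIV[of J] by auto
    moreover have "- J \<noteq> {}" using False by auto
    ultimately show ?thesis using a by (simp add: ext_power_def vol_dual_def ext_one_def axis_nth_if)
  qed (simp add: vol_dual_def ext_one_def)
qed

text \<open>The square of the form times \<open>\<Omega>\<close> is
  \<open>pfaff \<Omega> u w\<close> times a volume element. Contracting by \<open>u\<close> and
  \<open>w\<close>, which kill the form, turns \<open>\<Omega>\<close> into the third factor and the
  volume element into the star of \<open>u \<and> w\<close>.\<close>

lemma form2_cube:
  assumes \<Omega>: "(\<Omega> :: 8 ext) \<in> ext_power 4"
  shows "form2 \<Omega> u w \<odot> form2 \<Omega> u w \<odot> form2 \<Omega> u w = pfaff \<Omega> u w *s vol_dual 1 (ext_vec u \<odot> ext_vec w)"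
proof -
  let ?M = "form2 \<Omega> u w"
  note M = form2_power[OF \<Omega>, of u w]
  have ev: "even (2::nat)" by simp
  have k: "contr u ?M = 0" "contr w ?M = 0"
    by (simp_all add: form2_def contr_anticommute[of u w])
  have c: "contr x (?M \<odot> ?M \<odot> a) = ?M \<odot> ?M \<odot> contr x a" if "contr x ?M = 0" for x a
    by (simp add: contr_wedge_even[OF M ev] that)
  have "?M \<odot> ?M \<odot> \<Omega> \<in> ext_power 8"
    using ext_power_wedge[OF M ext_power_wedge[OF M \<Omega>]] by simp
  then have "?M \<odot> ?M \<odot> \<Omega> = pfaff \<Omega> u w *s vol_dual 1 ext_one"
    unfolding pfaff_def pol_def by (rule top_form)
  from arg_cong[OF this, of "\<lambda>a. contr w (contr u a)"]
  have "?M \<odot> ?M \<odot> contr w (contr u \<Omega>) = pfaff \<Omega> u w *s vol_dual 1 (ext_vec u \<odot> ext_vec w)"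
    by (simp add: c k contr_simps contr_contr_star)
  then show ?thesis by (simp only: form2_def)
qed

text \<open>The odd part in \<open>N\<close> of the cube: a finite difference in place of a
  derivative.\<close>

lemma cube_polarize:
  assumes M: "M \<in> ext_power 2" and N: "N \<in> ext_power 2"
  shows "(M + N) \<odot> (M + N) \<odot> (M + N) - (M - N) \<odot> (M - N) \<odot> (M - N) =
    6 *s (M \<odot> M \<odot> N) + 2 *s (N \<odot> N \<odot> N)"
proof -
  have c: "N \<odot> M = M \<odot> N" by (rule even_commute[OF M N]) simp
  then have c': "N \<odot> M \<odot> a = M \<odot> N \<odot> a" for a by (metis wedge_assoc)
  show ?thesis by (simp only: wedge_simps c c') (simp add: vec_eq_iff)
qed

text \<open>The derivative of \<open>form2_cube\<close> at a zero of the Pfaffian, where only the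
  differential of the scalar factor survives on the right.\<close>

lemma form2_square_polar:
  assumes \<Omega>: "(\<Omega> :: 8 ext) \<in> ext_power 4" and z: "pfaff \<Omega> u w = 0"
  shows "3 *s (form2 \<Omega> u w \<odot> form2 \<Omega> u w \<odot> form2 \<Omega> x w) = (2 * pol \<Omega> u w x w) *s vol_dual 1 (ext_vec u \<odot> ext_vec w)"
    and "3 *s (form2 \<Omega> u w \<odot> form2 \<Omega> u w \<odot> form2 \<Omega> u x) = (2 * pol \<Omega> u w u x) *s vol_dual 1 (ext_vec u \<odot> ext_vec w)"
proof -
  have cancel: "3 *s A = (2 * b) *s (V :: 8 ext)"
    if "6 *s A + 2 *s (g *s V') = (2 * b + g) *s (V + V') - (- 2 * b + g) *s (V - V')" for A V V' :: "8 ext" and b g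
    using that by (simp add: vec_eq_iff algebra_simps)
  note c = form2_cube[OF \<Omega>]
  have 1: "pfaff \<Omega> (u + x) w = 2 * pol \<Omega> u w x w + pfaff \<Omega> x w" "pfaff \<Omega> (u - x) w = - 2 * pol \<Omega> u w x w + pfaff \<Omega> x w"
    using pfaff_add_left[OF \<Omega>, of u 1 x w] pfaff_add_left[OF \<Omega>, of u "- 1" x w] z by simp_all
  show "3 *s (form2 \<Omega> u w \<odot> form2 \<Omega> u w \<odot> form2 \<Omega> x w) = (2 * pol \<Omega> u w x w) *s vol_dual 1 (ext_vec u \<odot> ext_vec w)"
    using cube_polarize[OF form2_power[OF \<Omega>] form2_power[OF \<Omega>], of u w x w]
    unfolding form2_linear[symmetric] c 1
    by (intro cancel[of _ "pfaff \<Omega> x w" "vol_dual 1 (ext_vec x \<odot> ext_vec w)"])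
      (simp add: ext_vec_simps wedge_simps vol_dual_linear, simp add: vol_dual_linear vol_dual_diff)
  have 2: "pfaff \<Omega> u (w + x) = 2 * pol \<Omega> u w u x + pfaff \<Omega> u x" "pfaff \<Omega> u (w - x) = - 2 * pol \<Omega> u w u x + pfaff \<Omega> u x"
    using pfaff_add_right[OF \<Omega>, of u w 1 x] pfaff_add_right[OF \<Omega>, of u w "- 1" x] z by simp_all
  show "3 *s (form2 \<Omega> u w \<odot> form2 \<Omega> u w \<odot> form2 \<Omega> u x) = (2 * pol \<Omega> u w u x) *s vol_dual 1 (ext_vec u \<odot> ext_vec w)"
    using cube_polarize[OF form2_power[OF \<Omega>] form2_power[OF \<Omega>], of u w u x]
    unfolding form2_linear[symmetric] c 2
    by (intro cancel[of _ "pfaff \<Omega> u x" "vol_dual 1 (ext_vec u \<odot> ext_vec x)"])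
      (simp add: ext_vec_simps wedge_simps vol_dual_linear, simp add: vol_dual_linear vol_dual_diff)
qed

section \<open>Planes\<close>

text \<open>Stated as a nonzero bivector, independence is directly a condition on Pluecker
  coordinates.\<close>

abbreviation lin_indep2 :: "'n::{finite,linorder} vsp \<Rightarrow> 'n vsp \<Rightarrow> bool" where
  "lin_indep2 u w \<equiv> ext_vec u \<odot> ext_vec w \<noteq> 0"

lemma lin_indep2_iff: "lin_indep2 u w \<longleftrightarrow> u \<noteq> w \<and> vec.independent {u, w}"
proof
  assume l: "lin_indep2 u w"
  have "u \<notin> vec.span {w}" using wedge_span_zero[of u "[w]"] l by auto
  moreover have "w \<noteq> 0" using l by auto
  ultimately show "u \<noteq> w \<and> vec.independent {u, w}"
    using vec.independent_insertI[of u "{w}"] vec.span_base[of w "{w}"] by (auto simp: vec.dependent_single)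
next
  assume "u \<noteq> w \<and> vec.independent {u, w}"
  then show "lin_indep2 u w" using wedge_list_nonzero[of "[u, w]"] by simp
qed

lemma lin_indep2_Gr: "lin_indep2 u w \<Longrightarrow> vec.span {u, w} \<in> Gr 2"
  by (simp add: Gr_def lin_indep2_iff vec.dim_eq_card_independent)

lemma span_Gr2_lin_indep2: "vec.span {u, w} \<in> Gr 2 \<Longrightarrow> lin_indep2 u w"
proof -
  assume "vec.span {u, w} \<in> Gr 2"
  then have d: "vec.dim {u, w} = 2" by (simp add: Gr_def)
  have "card {u, w} \<ge> 2" using vec.dim_le_card'[of "{u, w}"] d by simp
  then have "u \<noteq> w" by auto
  moreover have "vec.independent {u, w}"
    using vec.card_le_dim_spanning[of "{u, w}" "{u, w}"] d vec.span_superset[of "{u, w}"] \<open>u \<noteq> w\<close> by simp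
  ultimately show ?thesis by (simp add: lin_indep2_iff)
qed

lemma Gr2_basis: "U \<in> Gr 2 \<Longrightarrow> \<exists>u w. lin_indep2 u w \<and> U = vec.span {u, w}"
proof -
  assume U: "U \<in> Gr 2"
  then obtain B where B: "B \<subseteq> U" "vec.independent B" "U \<subseteq> vec.span B" "card B = 2"
    using vec.basis_exists[of U] by (auto simp: Gr_def)
  then obtain u w where "B = {u, w}" "u \<noteq> w" by (meson card_2_iff)
  moreover have "vec.span B = U"
    using B U by (intro subset_antisym vec.span_minimal) (auto simp: Gr_def)
  ultimately show ?thesis using B by (auto simp: lin_indep2_iff)
qed

lemma span2_mem: "x \<in> vec.span {u, w} \<Longrightarrow> \<exists>a b. x = a *s u + b *s w"
proof -
  assume "x \<in> vec.span {u, w}"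
  then obtain a where "x - a *s u \<in> vec.span {w}" by (metis vec.span_breakdown_eq)
  then obtain b where "x - a *s u = b *s w" by (auto simp: vec.span_singleton)
  then show ?thesis by (metis add.commute diff_add_cancel)
qed

lemma plane_basis_change:
  assumes "lin_indep2 u w" "lin_indep2 u' w'" "u' \<in> vec.span {u, w}" "w' \<in> vec.span {u, w}"
  shows "\<exists>a b c d. u' = a *s u + b *s w \<and> w' = c *s u + d *s w \<and> a * d - b * c \<noteq> 0"
proof -
  obtain a b c d where e: "u' = a *s u + b *s w" "w' = c *s u + d *s w"
    using span2_mem[OF assms(3)] span2_mem[OF assms(4)] by blast
  have "ext_vec u' \<odot> ext_vec w' = (a * d - b * c) *s (ext_vec u \<odot> ext_vec w)"
    by (simp add: e ext_vec_simps wedge_simps ext_vec_anticommute[of w u] algebra_simps)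
  then have "a * d - b * c \<noteq> 0" using assms(2) by auto
  then show ?thesis using e by blast
qed

lemma form2_basis_change:
  assumes "u' = a *s u + b *s w" "w' = c *s u + d *s w"
  shows "form2 \<Omega> u' w' = (a * d - b * c) *s form2 \<Omega> u w"
    "ext_vec u' \<odot> ext_vec w' = (a * d - b * c) *s (ext_vec u \<odot> ext_vec w)"
  by (simp_all add: assms form2_linear form2_swap[of \<Omega> w u] ext_vec_simps wedge_simps
      ext_vec_anticommute[of w u] algebra_simps)

lemma span2_eq:
  assumes "lin_indep2 u' w'" "u' \<in> vec.span {u, w}" "w' \<in> vec.span {u, w}"
  shows "vec.span {u', w'} = vec.span {u, w}"
proof (rule vec.subspace_dim_equal)
  show "vec.span {u', w'} \<subseteq> vec.span {u, w}"
    using assms by (intro vec.span_minimal) auto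
  have "vec.dim (vec.span {u', w'}) = 2"
    using lin_indep2_Gr[OF assms(1)] by (simp add: Gr_def)
  moreover have "vec.dim {u, w} \<le> card {u, w}" by (rule vec.dim_le_card') simp
  moreover have "card {u, w} \<le> 2" using card_length[of "[u, w]"] by simp
  ultimately show "vec.dim (vec.span {u', w'}) \<ge> vec.dim (vec.span {u, w})" by simp
qed simp_all

lemma pluecker2: "pluecker 2 U = {ext_vec u \<odot> ext_vec w | u w. vec.span {u, w} = U}"
proof (intro set_eqI iffI)
  fix p assume "p \<in> pluecker 2 U"
  then obtain us where us: "p = wedge_list us" "length us = 2" "vec.span (set us) = U"
    by (auto simp: pluecker_def)
  then obtain u w where "us = [u, w]" by (auto simp: numeral_2_eq_2 length_Suc_conv)
  then show "p \<in> {ext_vec u \<odot> ext_vec w | u w. vec.span {u, w} = U}" using us by auto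
next
  fix p assume "p \<in> {ext_vec u \<odot> ext_vec w | u w. vec.span {u, w} = U}"
  then obtain u w where uw: "p = ext_vec u \<odot> ext_vec w" "vec.span {u, w} = U" by blast
  then show "p \<in> pluecker 2 U" unfolding pluecker_def
    by (intro CollectI exI[of _ "[u, w]"]) simp
qed

lemma pluecker2_scale:
  assumes "U \<in> Gr 2" "p \<in> pluecker 2 U" "q \<in> pluecker 2 U"
  shows "\<exists>c. c \<noteq> 0 \<and> q = c *s p"
proof -
  obtain u w u' w' where e: "p = ext_vec u \<odot> ext_vec w" "vec.span {u, w} = U"
    "q = ext_vec u' \<odot> ext_vec w'" "vec.span {u', w'} = U"
    using assms by (auto simp: pluecker2)
  then have "lin_indep2 u w" "lin_indep2 u' w'"
    using span_Gr2_lin_indep2[of u w] span_Gr2_lin_indep2[of u' w'] assms(1) by simp_all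
  moreover have "u' \<in> vec.span {u, w}" "w' \<in> vec.span {u, w}" using e by (auto intro: vec.span_base)
  ultimately obtain a b c d where "u' = a *s u + b *s w" "w' = c *s u + d *s w" "a * d - b * c \<noteq> 0"
    using plane_basis_change by blast
  then show ?thesis using form2_basis_change(2)[of u' a u b w w' c d] e by metis
qed

section \<open>The hypersurface in terms of the Pfaffian\<close>

text \<open>The top coefficient is a pairing with the star of \<open>v\<close>, hence an iterated
  contraction of it; carrying two contractions past two others costs no sign.\<close>

lemma quot_skew_form_form2:
  "quot_skew_form v (ext_vec u \<odot> ext_vec w) = form_matrix (form2 (vol_dual 1 v) u w)"
proof -
  have "(v \<odot> ext_vec (basis_vec i) \<odot> ext_vec (basis_vec j) \<odot> ext_vec u \<odot> ext_vec w) $ UNIV =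
      contr (basis_vec j) (contr (basis_vec i) (form2 (vol_dual 1 v) u w)) $ {}" for i j
  proof -
    have "(v \<odot> ext_vec (basis_vec i) \<odot> ext_vec (basis_vec j) \<odot> ext_vec u \<odot> ext_vec w) $ UNIV =
        bdot (ext_vec (basis_vec i) \<odot> ext_vec (basis_vec j) \<odot> ext_vec u \<odot> ext_vec w \<odot> ext_one) (vol_dual 1 v)"
      by (simp add: bdot_star[symmetric] bdot_commute)
    also have "\<dots> = bdot ext_one (contr w (contr u (contr (basis_vec j) (contr (basis_vec i) (vol_dual 1 v)))))"
      by (simp only: bdot_wedge)
    also have "\<dots> = bdot ext_one (contr (basis_vec j) (contr (basis_vec i) (form2 (vol_dual 1 v) u w)))"
      unfolding form2_def
      by (simp add: contr_anticommute[of w "basis_vec _"] contr_anticommute[of u "basis_vec _"] contr_simps)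
    finally show ?thesis by (simp add: ext_one_def)
  qed
  then show ?thesis by (simp add: quot_skew_form_def form_matrix_def)
qed

text \<open>Rank at most four means that the cube vanishes, and the cube is the Pfaffian times a
  nonzero element. Another basis of the plane rescales the form, which covers all Pluecker vectors
  at once.\<close>

lemma D_Z1_span:
  assumes v: "v \<in> ext_power 4" and l: "lin_indep2 u w"
  shows "vec.span {u, w} \<in> D_Z1 v \<longleftrightarrow> pfaff (vol_dual 1 v) u w = 0"
proof -
  note \<Omega> = star_power4[OF v, of 1]
  have *: "rank (form_matrix (form2 (vol_dual 1 v) u w)) \<le> 4 \<longleftrightarrow> pfaff (vol_dual 1 v) u w = 0"
    if l: "lin_indep2 u w" for u w
  proof -
    have "rank (form_matrix (form2 (vol_dual 1 v) u w)) \<le> 4 \<longleftrightarrow>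
      form2 (vol_dual 1 v) u w \<odot> form2 (vol_dual 1 v) u w \<odot> form2 (vol_dual 1 v) u w = 0"
      using two_form_cube_zero_rank two_form_rank_cube_zero form2_power[OF \<Omega>] by blast
    then show ?thesis using l by (simp add: form2_cube[OF \<Omega>] vol_dual_eq_0)
  qed
  show ?thesis
  proof
    assume "vec.span {u, w} \<in> D_Z1 v"
    then have "rank (quot_skew_form v (ext_vec u \<odot> ext_vec w)) \<le> 4"
      by (auto simp: D_Z1_def pluecker2)
    then show "pfaff (vol_dual 1 v) u w = 0" using *[OF l] by (simp add: quot_skew_form_form2)
  next
    assume z: "pfaff (vol_dual 1 v) u w = 0"
    have "rank (quot_skew_form v p) \<le> 4" if p: "p \<in> pluecker 2 (vec.span {u, w})" for p
    proof -
      obtain u' w' where e: "p = ext_vec u' \<odot> ext_vec w'" "vec.span {u', w'} = vec.span {u, w}"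
        using p by (auto simp: pluecker2)
      then have l': "lin_indep2 u' w'" using lin_indep2_Gr[OF l] span_Gr2_lin_indep2 by metis
      have "u' \<in> vec.span {u, w}" "w' \<in> vec.span {u, w}" using e by (auto intro: vec.span_base)
      then obtain a b c d where h: "u' = a *s u + b *s w" "w' = c *s u + d *s w"
        using plane_basis_change[OF l l'] by blast
      have "pfaff (vol_dual 1 v) u' w' = 0"
        using z by (simp add: pfaff_def pol_def form2_basis_change[OF h] wedge_simps)
      then show ?thesis using *[OF l'] by (simp add: e quot_skew_form_form2)
    qed
    then show "vec.span {u, w} \<in> D_Z1 v" using lin_indep2_Gr[OF l] by (simp add: D_Z1_def)
  qed
qed

lemma D_Z1_obtain:
  assumes "v \<in> ext_power 4" "U \<in> D_Z1 v"
  obtains u w where "lin_indep2 u w" "U = vec.span {u, w}" "pfaff (vol_dual 1 v) u w = 0"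
proof -
  have "U \<in> Gr 2" using assms by (simp add: D_Z1_def)
  then obtain u w where "lin_indep2 u w" "U = vec.span {u, w}" using Gr2_basis by blast
  then show thesis using that D_Z1_span assms by blast
qed

section \<open>The flag of a smooth point\<close>

text \<open>Partial gradient of \<open>pfaff \<Omega> u w\<close> in its first vector; the factor 2
  comes from its being quadratic there. \<open>grad2\<close> is the same for the second
  vector.\<close>

definition grad1 :: "'n::{finite,linorder} ext \<Rightarrow> 'n vsp \<Rightarrow> 'n vsp \<Rightarrow> 'n vsp" where
  "grad1 \<Omega> u w = (\<chi> i. 2 * pol \<Omega> u w (basis_vec i) w)"

definition grad2 :: "'n::{finite,linorder} ext \<Rightarrow> 'n vsp \<Rightarrow> 'n vsp \<Rightarrow> 'n vsp" where
  "grad2 \<Omega> u w = (\<chi> i. 2 * pol \<Omega> u w u (basis_vec i))"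

lemma bdot_grad: "bdot (grad1 \<Omega> u w) x = 2 * pol \<Omega> u w x w" "bdot (grad2 \<Omega> u w) x = 2 * pol \<Omega> u w u x"
proof -
  have "pol \<Omega> u w (\<Sum>i\<in>S. x $ i *s basis_vec i) w = (\<Sum>i\<in>S. x $ i * pol \<Omega> u w (basis_vec i) w)"
    "pol \<Omega> u w u (\<Sum>i\<in>S. x $ i *s basis_vec i) = (\<Sum>i\<in>S. x $ i * pol \<Omega> u w u (basis_vec i))" if "finite S" for S
    using that by (induction S rule: finite_induct) (simp_all add: pol_linear)
  from this[of UNIV] have
    "pol \<Omega> u w x w = (\<Sum>i\<in>UNIV. x $ i * pol \<Omega> u w (basis_vec i) w)"
    "pol \<Omega> u w u x = (\<Sum>i\<in>UNIV. x $ i * pol \<Omega> u w u (basis_vec i))"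
    by (simp_all add: basis_expansion)
  then show "bdot (grad1 \<Omega> u w) x = 2 * pol \<Omega> u w x w" "bdot (grad2 \<Omega> u w) x = 2 * pol \<Omega> u w u x"
    by (simp_all add: bdot_def grad1_def grad2_def sum_distrib_left ac_simps)
qed

text \<open>Contracting \<open>form2_square_polar\<close> by two kernel vectors leaves the square of
  the form untouched, so the gradients are proportional to the covectors that remain when
  \<open>k1, k2\<close> and \<open>w\<close> or \<open>u\<close> are put into
  \<open>\<Omega>\<close>.\<close>

lemma grad_formula:
  assumes \<Omega>: "(\<Omega> :: 8 ext) \<in> ext_power 4" and z: "pfaff \<Omega> u w = 0"
    and k: "contr k1 (form2 \<Omega> u w) = 0" "contr k2 (form2 \<Omega> u w) = 0"
    and t: "contr k2 (contr k1 (contr u \<Omega>)) = ext_vec t" "contr k2 (contr k1 (contr w \<Omega>)) = ext_vec s"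
  shows "bdot (grad1 \<Omega> u w) x *s vol_dual 1 (ext_vec u \<odot> ext_vec w \<odot> ext_vec k1 \<odot> ext_vec k2) =
      (- 3 * bdot x s) *s (form2 \<Omega> u w \<odot> form2 \<Omega> u w)"
    and "bdot (grad2 \<Omega> u w) x *s vol_dual 1 (ext_vec u \<odot> ext_vec w \<odot> ext_vec k1 \<odot> ext_vec k2) =
      (3 * bdot x t) *s (form2 \<Omega> u w \<odot> form2 \<Omega> u w)"
proof -
  let ?M = "form2 \<Omega> u w"
  note M = form2_power[OF \<Omega>, of u w]
  have ev: "even (2::nat)" by simp
  have c: "contr k2 (contr k1 (?M \<odot> ?M \<odot> a)) = ?M \<odot> ?M \<odot> contr k2 (contr k1 a)" for a
    by (simp add: contr_wedge_even[OF M ev] k)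
  have v: "contr k2 (contr k1 (vol_dual 1 (ext_vec u \<odot> ext_vec w))) =
      vol_dual 1 (ext_vec u \<odot> ext_vec w \<odot> ext_vec k1 \<odot> ext_vec k2)"
    by (simp add: contr_contr_star wedge_assoc)
  have m: "contr k2 (contr k1 (contr x Y)) = contr x (contr k2 (contr k1 Y))" for Y
    by (simp add: contr_anticommute[of k1 x] contr_anticommute[of k2 x] contr_simps)
  have "form2 \<Omega> x w = - contr x (contr w \<Omega>)" "form2 \<Omega> u x = contr x (contr u \<Omega>)"
    by (simp_all add: form2_def contr_anticommute[of w x])
  then have f: "contr k2 (contr k1 (form2 \<Omega> u x)) = bdot x t *s ext_one"
    "contr k2 (contr k1 (form2 \<Omega> x w)) = (- bdot x s) *s ext_one"
    by (simp_all only: contr_minus_right m t contr_ext_vec vec.scale_minus_left)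
  show "bdot (grad2 \<Omega> u w) x *s vol_dual 1 (ext_vec u \<odot> ext_vec w \<odot> ext_vec k1 \<odot> ext_vec k2) =
      (3 * bdot x t) *s (?M \<odot> ?M)"
    using arg_cong[OF form2_square_polar(2)[OF \<Omega> z, of x], of "\<lambda>a. contr k2 (contr k1 a)"]
    unfolding contr_scale_right c f v bdot_grad by (simp add: wedge_simps)
  show "bdot (grad1 \<Omega> u w) x *s vol_dual 1 (ext_vec u \<odot> ext_vec w \<odot> ext_vec k1 \<odot> ext_vec k2) =
      (- 3 * bdot x s) *s (?M \<odot> ?M)"
    using arg_cong[OF form2_square_polar(1)[OF \<Omega> z, of x], of "\<lambda>a. contr k2 (contr k1 a)"]
    unfolding contr_scale_right c f v bdot_grad by (simp add: wedge_simps)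
qed

lemma in_all_faces_zero:
  fixes B :: "'n::{finite,linorder} vsp set"
  assumes B: "vec.independent B" "b \<in> B" and z: "\<And>x. x \<in> B \<Longrightarrow> z \<in> vec.span (B - {x})"
  shows "z = 0"
proof -
  have fin: "finite B" using B by (simp add: vec.finiteI_independent)
  have "z \<in> vec.span B" using z[OF B(2)] vec.span_mono[of "B - {b}" B] by blast
  then obtain c where c: "z = (\<Sum>x\<in>B. c x *s x)" using vec.span_finite[OF fin] by auto
  have "c x = 0" if x: "x \<in> B" for x
  proof -
    obtain \<eta> where \<eta>: "bdot \<eta> x = 1" "\<forall>y\<in>B - {x}. bdot \<eta> y = 0" using dual_covector[OF B(1) x] by blast
    have "vec.span (B - {x}) \<subseteq> {y. bdot \<eta> y = 0}"
      by (intro vec.span_minimal subspace_kernel_bdot) (use \<eta> in auto)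
    then have "bdot \<eta> z = 0" using z[OF x] by blast
    moreover have "bdot \<eta> z = (\<Sum>y\<in>B. if y = x then c x else 0)"
      unfolding c bdot_sum_right by (intro sum.cong) (use \<eta> in \<open>auto simp: bdot_scale_right\<close>)
    ultimately show ?thesis using x fin by simp
  qed
  then show ?thesis using c by simp
qed

text \<open>
  A form of degree \<open>7\<close> on an \<open>8\<close>-dimensional space is the contraction of a volume form with a
  vector, which lies in the span of \<open>x, y, z\<close> as soon as its contraction by \<open>x, y, z\<close> vanishes.
\<close>

lemma flag_wedge_zero:
  fixes \<Omega> :: "8 ext"
  assumes \<Omega>: "\<Omega> \<in> ext_power 4" and d: "distinct [a, b, c, d]" "vec.independent {a, b, c, d}"
    and ann: "\<And>x. x \<in> {a, b, c, d} \<Longrightarrow> bdot x \<xi>1 = 0 \<and> bdot x \<xi>2 = 0 \<and> bdot x \<kappa> = 0"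
    and t: "contr c (contr b (contr a \<Omega>)) \<odot> ext_vec \<xi>1 \<odot> ext_vec \<xi>2 = 0"
      "contr d (contr b (contr a \<Omega>)) \<odot> ext_vec \<xi>1 \<odot> ext_vec \<xi>2 = 0"
      "contr d (contr c (contr a \<Omega>)) \<odot> ext_vec \<xi>1 \<odot> ext_vec \<xi>2 = 0"
      "contr d (contr c (contr b \<Omega>)) \<odot> ext_vec \<xi>1 \<odot> ext_vec \<xi>2 = 0"
  shows "\<Omega> \<odot> ext_vec \<xi>1 \<odot> ext_vec \<xi>2 \<odot> ext_vec \<kappa> = 0"
proof -
  let ?Q = "ext_vec \<xi>1 \<odot> ext_vec \<xi>2 \<odot> ext_vec \<kappa>"
  define A where "A = \<Omega> \<odot> ?Q"
  have "?Q \<in> ext_power (1 + (1 + 1))" by (intro ext_power_wedge ext_vec_power)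
  then have A7: "A \<in> ext_power 7" unfolding A_def using ext_power_wedge[OF \<Omega>, of ?Q 3] by (simp add: numeral_3_eq_3)
  have "vol_dual 1 A \<in> ext_power 1" using vol_dual_power[OF A7, of 1] by simp
  then obtain z where z: "vol_dual 1 A = ext_vec z" using ext_power_1_vec by blast
  have A_z: "A = - vol_dual 1 (ext_vec z)"
    using vol_dual_vol_dual[OF A7] by (simp add: z)
  have k: "contr x (Y \<odot> ?Q) = contr x Y \<odot> ?Q" if "x \<in> {a, b, c, d}" for x Y
    using ann[OF that] by (simp add: contr_wedge_grade contr_wedge contr_ext_vec)
  have assoc: "Y \<odot> ?Q = (Y \<odot> ext_vec \<xi>1 \<odot> ext_vec \<xi>2) \<odot> ext_vec \<kappa>" for Y
    by (simp add: wedge_assoc)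
  have tr: "z \<in> vec.span {x, y, w}"
    if s: "x \<in> {a, b, c, d}" "y \<in> {a, b, c, d}" "w \<in> {a, b, c, d}" "distinct [x, y, w]"
      and e: "contr w (contr y (contr x \<Omega>)) \<odot> ext_vec \<xi>1 \<odot> ext_vec \<xi>2 = 0" for x y w
  proof -
    have "contr w (contr y (contr x A)) = 0"
      unfolding A_def using s(1-3) by (simp only: k) (simp only: assoc e wedge_zero_left)
    then have "ext_vec z \<odot> ext_vec x \<odot> ext_vec y \<odot> ext_vec w = 0"
      by (simp add: A_z contr_simps contr_star wedge_assoc vol_dual_eq_0)
    then show ?thesis
      using wedge_zero_span[of "[x, y, w]" z] s vec.independent_mono[OF d(2), of "{x, y, w}"] by auto
  qed
  have f: "{a, b, c, d} - {d} = {a, b, c}" "{a, b, c, d} - {c} = {a, b, d}"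
    "{a, b, c, d} - {b} = {a, c, d}" "{a, b, c, d} - {a} = {b, c, d}" using d(1) by auto
  have "z = 0"
  proof (rule in_all_faces_zero[OF d(2), of a])
    fix x assume "x \<in> {a, b, c, d}"
    then consider "x = a" | "x = b" | "x = c" | "x = d" by blast
    then show "z \<in> vec.span ({a, b, c, d} - {x})"
      by cases (use d(1) in \<open>simp_all only: f, auto intro!: tr[OF _ _ _ _ t(1)] tr[OF _ _ _ _ t(2)] tr[OF _ _ _ _ t(3)] tr[OF _ _ _ _ t(4)]\<close>)
  qed simp
  then show ?thesis using A_z by (simp add: A_def vol_dual_linear)
qed

text \<open>The converse passage: contracting the two vanishing products puts \<open>t\<close> into
  the span of \<open>\<xi>1, \<xi>2, \<kappa>\<close> for \<open>\<kappa> = \<kappa>1\<close> and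
  for \<open>\<kappa> = \<kappa>2\<close>, and these spaces meet in the plane of
  \<open>\<xi>1\<close> and \<open>\<xi>2\<close>.\<close>

lemma flag_contr_span:
  fixes \<Omega> :: "8 ext"
  assumes \<Omega>: "\<Omega> \<in> ext_power 4" and d: "distinct [\<xi>1, \<xi>2, \<kappa>1, \<kappa>2]" "vec.independent {\<xi>1, \<xi>2, \<kappa>1, \<kappa>2}"
    and ann: "\<And>\<eta>. \<eta> \<in> {\<xi>1, \<xi>2, \<kappa>1, \<kappa>2} \<Longrightarrow> bdot a \<eta> = 0 \<and> bdot b \<eta> = 0 \<and> bdot c \<eta> = 0"
    and w: "\<Omega> \<odot> ext_vec \<xi>1 \<odot> ext_vec \<xi>2 \<odot> ext_vec \<kappa>1 = 0" "\<Omega> \<odot> ext_vec \<xi>1 \<odot> ext_vec \<xi>2 \<odot> ext_vec \<kappa>2 = 0"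
    and t: "contr c (contr b (contr a \<Omega>)) = ext_vec t"
  shows "t \<in> vec.span {\<xi>1, \<xi>2}"
proof -
  have s: "t \<in> vec.span {\<xi>1, \<xi>2, \<kappa>}" if k: "\<kappa> \<in> {\<kappa>1, \<kappa>2}" for \<kappa>
  proof -
    let ?Q = "ext_vec \<xi>1 \<odot> ext_vec \<xi>2 \<odot> ext_vec \<kappa>"
    have kl: "contr x (Y \<odot> ?Q) = contr x Y \<odot> ?Q" if "x \<in> {a, b, c}" for x Y
      using that k ann[of \<xi>1] ann[of \<xi>2] ann[of \<kappa>] by (auto simp: contr_wedge_grade contr_wedge contr_ext_vec)
    have "contr c (contr b (contr a (\<Omega> \<odot> ?Q))) = 0" using w k by auto
    then have "ext_vec t \<odot> ?Q = 0" by (simp add: kl t)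
    then show ?thesis
      using wedge_zero_span[of "[\<xi>1, \<xi>2, \<kappa>]" t] k d vec.independent_mono[OF d(2), of "{\<xi>1, \<xi>2, \<kappa>}"] by auto
  qed
  show ?thesis
  proof (rule ccontr)
    assume n: "t \<notin> vec.span {\<xi>1, \<xi>2}"
    have "t \<in> vec.span (insert \<kappa>1 {\<xi>1, \<xi>2})" using s[of \<kappa>1] by (simp add: insert_commute)
    then have "\<kappa>1 \<in> vec.span (insert t {\<xi>1, \<xi>2})" using vec.in_span_insert n by blast
    moreover have "vec.span (insert t {\<xi>1, \<xi>2}) \<subseteq> vec.span {\<xi>1, \<xi>2, \<kappa>2}"
      using s[of \<kappa>2] by (intro vec.span_minimal vec.subspace_span) (auto simp: vec.span_base)
    ultimately have "\<kappa>1 \<in> vec.span {\<xi>1, \<xi>2, \<kappa>2}" by blast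
    moreover have "{\<xi>1, \<xi>2, \<kappa>1, \<kappa>2} = insert \<kappa>1 {\<xi>1, \<xi>2, \<kappa>2}" "\<kappa>1 \<notin> {\<xi>1, \<xi>2, \<kappa>2}" using d(1) by auto
    ultimately show False using d(2) vec.independent_insert by metis
  qed
qed

text \<open>So the kernel of the dual skew form is read off from products with
  \<open>\<Omega>\<close>.\<close>

lemma star_wedge3_contr: "contr \<kappa> (form2 (vol_dual 1 \<Omega>) \<xi>1 \<xi>2) = vol_dual 1 (\<Omega> \<odot> ext_vec \<xi>1 \<odot> ext_vec \<xi>2 \<odot> ext_vec \<kappa>)"
  by (simp add: form2_def contr_star wedge_assoc)

lemma extend_plane_kernel:
  fixes S :: "'n::{finite,linorder} vsp set"
  assumes l: "lin_indep2 u w" and S: "vec.subspace S" "u \<in> S" "w \<in> S" "vec.dim S \<ge> 4"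
  obtains k1 k2 where "k1 \<in> S" "k2 \<in> S" "distinct [u, w, k1, k2]" "vec.independent {u, w, k1, k2}"
proof -
  have l': "u \<noteq> w" "vec.independent {u, w}" using l by (auto simp: lin_indep2_iff)
  obtain k1 where k1: "k1 \<in> S" "k1 \<notin> {u, w}" "vec.independent (insert k1 {u, w})"
    using independent_extend[of "{u, w}" S] S l' by auto
  obtain k2 where k2: "k2 \<in> S" "k2 \<notin> insert k1 {u, w}" "vec.independent (insert k2 (insert k1 {u, w}))"
    using independent_extend[of "insert k1 {u, w}" S] S l' k1 by auto
  have "insert k2 (insert k1 {u, w}) = {u, w, k1, k2}" by auto
  then show thesis using that[OF k1(1) k2(1)] l' k1 k2 by auto
qed

text \<open>The kernel of \<open>form2 \<Omega> u w\<close> has dimension at least 4, so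
  \<open>u, w\<close> can be completed by \<open>k1, k2\<close> in it. Contractions of
  \<open>\<Omega>\<close> with both \<open>k1, k2\<close> and one of \<open>u, w\<close> are
  multiples of the gradients; those with \<open>u, w\<close> and one \<open>k\<close> vanish. Hence
  all four triple contractions die when multiplied by both gradients, as
  \<open>flag_wedge_zero\<close> requires.\<close>

theorem smooth_flag:
  fixes \<Omega> :: "8 ext"
  assumes \<Omega>: "\<Omega> \<in> ext_power 4" and z: "pfaff \<Omega> u w = 0"
    and l: "lin_indep2 (grad1 \<Omega> u w) (grad2 \<Omega> u w)"
  shows "\<exists>k1 k2. distinct [u, w, k1, k2] \<and> vec.independent {u, w, k1, k2} \<and>
    contr k1 (form2 \<Omega> u w) = 0 \<and> contr k2 (form2 \<Omega> u w) = 0 \<and>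
    (\<forall>x\<in>{u, w, k1, k2}. bdot x (grad1 \<Omega> u w) = 0 \<and> bdot x (grad2 \<Omega> u w) = 0) \<and>
    (\<forall>\<kappa>\<in>orth {u, w, k1, k2}. \<Omega> \<odot> ext_vec (grad1 \<Omega> u w) \<odot> ext_vec (grad2 \<Omega> u w) \<odot> ext_vec \<kappa> = 0)"
proof -
  let ?M = "form2 \<Omega> u w" and ?\<xi>1 = "grad1 \<Omega> u w" and ?\<xi>2 = "grad2 \<Omega> u w"
  note M = form2_power[OF \<Omega>, of u w]
  have luw: "lin_indep2 u w"
  proof
    assume "ext_vec u \<odot> ext_vec w = 0"
    then have "?\<xi>1 $ i = 0" for i
      using form2_square_polar(1)[OF \<Omega> z] l bdot_grad(1)
    proof -
      have "?M = 0"
      proof (cases "w = 0")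
        case False
        have "u \<in> vec.span {w}"
          using wedge_zero_span[of "[w]" u] \<open>ext_vec u \<odot> ext_vec w = 0\<close> False by (simp add: vec.dependent_single)
        then show ?thesis by (auto simp: vec.span_singleton form2_linear)
      qed (simp add: form2_linear)
      then show "?\<xi>1 $ i = 0" by (simp add: grad1_def pol_def)
    qed
    then have "?\<xi>1 = 0" by (simp add: vec_eq_iff)
    then show False using l by simp
  qed
  let ?K = "{y. contr y ?M = 0}"
  have "?M \<odot> ?M \<odot> ?M = 0" using form2_cube[OF \<Omega>, of u w] z by simp
  then have Kdim: "vec.dim ?K \<ge> 4" using rank_le_4_kernel[OF M two_form_cube_zero_rank[OF M]] by simp
  have Ksub: "vec.subspace ?K" by (auto simp: vec.subspace_def contr_simps)
  have uwK: "u \<in> ?K" "w \<in> ?K" by (simp_all add: form2_def contr_anticommute[of u w])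
  obtain k1 k2 where kK: "k1 \<in> ?K" "k2 \<in> ?K"
    and d: "distinct [u, w, k1, k2]" "vec.independent {u, w, k1, k2}"
    by (rule extend_plane_kernel[OF luw Ksub uwK Kdim])
  have k: "contr k1 ?M = 0" "contr k2 ?M = 0" using kK by simp_all
  let ?v4 = "vol_dual 1 (ext_vec u \<odot> ext_vec w \<odot> ext_vec k1 \<odot> ext_vec k2)"
  have v4: "?v4 \<noteq> 0"
    using wedge_list_nonzero[of "[u, w, k1, k2]"] d by (simp add: vol_dual_eq_0)
  have p1: "contr k2 (contr k1 (contr y \<Omega>)) \<in> ext_power 1" for y
  proof -
    have "\<Omega> \<in> ext_power (Suc (Suc (Suc 1)))" using \<Omega> by (simp add: numeral_eq_Suc)
    then show ?thesis by (intro ext_power_contr)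
  qed
  obtain t s where ts: "contr k2 (contr k1 (contr u \<Omega>)) = ext_vec t" "contr k2 (contr k1 (contr w \<Omega>)) = ext_vec s"
    using p1 ext_power_1_vec by metis
  note gf = grad_formula[OF \<Omega> z k ts]
  have MM: "?M \<odot> ?M \<noteq> 0"
  proof
    assume "?M \<odot> ?M = 0"
    then have "bdot ?\<xi>1 x = 0" for x using gf(1)[of x] v4 by simp
    then have "?\<xi>1 = 0" by (intro bdot_eqI) simp
    then show False using l by simp
  qed
  obtain J where J: "?v4 $ J \<noteq> 0" using v4 by (auto simp: vec_eq_iff)
  \<comment> \<open>Reading \<open>gf\<close> at a coordinate where the star of the four-vector is
    nonzero gives the common factor between the gradients and \<open>s, t\<close>.\<close>
  define \<mu> where "\<mu> = 3 * (?M \<odot> ?M) $ J / ?v4 $ J"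
  have g1: "?\<xi>1 = (- \<mu>) *s s"
  proof (rule bdot_eqI)
    fix x
    have "bdot ?\<xi>1 x * ?v4 $ J = - 3 * bdot x s * (?M \<odot> ?M) $ J"
      using arg_cong[OF gf(1)[of x], of "\<lambda>a. a $ J"] by simp
    then show "bdot ?\<xi>1 x = bdot ((- \<mu>) *s s) x"
      using J by (simp add: \<mu>_def bdot_simps bdot_commute field_simps)
  qed
  have g2: "?\<xi>2 = \<mu> *s t"
  proof (rule bdot_eqI)
    fix x
    have "bdot ?\<xi>2 x * ?v4 $ J = 3 * bdot x t * (?M \<odot> ?M) $ J"
      using arg_cong[OF gf(2)[of x], of "\<lambda>a. a $ J"] by simp
    then show "bdot ?\<xi>2 x = bdot (\<mu> *s t) x"
      using J by (simp add: \<mu>_def bdot_simps bdot_commute field_simps)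
  qed
  have \<mu>0: "\<mu> \<noteq> 0" using g2 l by auto
  have st: "s = (- 1 / \<mu>) *s ?\<xi>1" "t = (1 / \<mu>) *s ?\<xi>2"
    unfolding g1 g2 using \<mu>0 by (simp_all add: vec_eq_iff)
  have b: "bdot ?\<xi>1 u = 0" "bdot ?\<xi>2 w = 0" "bdot ?\<xi>1 w = 0" "bdot ?\<xi>2 u = 0"
    using z by (simp_all add: bdot_grad pfaff_def)
  have kk: "bdot x s = 0 \<and> bdot x t = 0" if x: "x \<in> {k1, k2}" for x
  proof -
    have e: "contr x (contr k2 (contr k1 Y)) = 0" for Y
      using x contr_anticommute[of k1 k2 "contr k1 Y"] by (auto simp: contr_simps)
    have "bdot x t *s ext_one = (0 :: 8 ext)" "bdot x s *s ext_one = (0 :: 8 ext)"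
      using e[of "contr u \<Omega>"] e[of "contr w \<Omega>"] by (simp_all only: ts contr_ext_vec)
    then show ?thesis by (auto simp: ext_one_def vec_eq_iff axis_nth_if dest!: spec[of _ "{}"])
  qed
  have ann: "bdot x ?\<xi>1 = 0 \<and> bdot x ?\<xi>2 = 0" if "x \<in> {u, w, k1, k2}" for x
    using that b kk[of k1] kk[of k2] by (auto simp: g1 g2 bdot_commute bdot_simps)
  have kM: "contr k (contr w (contr u \<Omega>)) = 0" if "k \<in> {k1, k2}" for k
    using k that by (auto simp: form2_def)
  have w4: "\<Omega> \<odot> ext_vec ?\<xi>1 \<odot> ext_vec ?\<xi>2 \<odot> ext_vec \<kappa> = 0" if \<kappa>: "\<kappa> \<in> orth {u, w, k1, k2}" for \<kappa>
  proof (rule flag_wedge_zero[OF \<Omega> d])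
    show "bdot x ?\<xi>1 = 0 \<and> bdot x ?\<xi>2 = 0 \<and> bdot x \<kappa> = 0" if "x \<in> {u, w, k1, k2}" for x
      using ann[OF that] \<kappa> that by (auto simp: orth_bdot)
    have "ext_vec t \<odot> ext_vec ?\<xi>1 \<odot> ext_vec ?\<xi>2 = 0" "ext_vec s \<odot> ext_vec ?\<xi>1 \<odot> ext_vec ?\<xi>2 = 0"
      unfolding st by (simp_all add: ext_vec_simps wedge_simps ext_vec_anticommute_left[of ?\<xi>2 ?\<xi>1])
    then show "contr k2 (contr k1 (contr u \<Omega>)) \<odot> ext_vec ?\<xi>1 \<odot> ext_vec ?\<xi>2 = 0"
      "contr k2 (contr k1 (contr w \<Omega>)) \<odot> ext_vec ?\<xi>1 \<odot> ext_vec ?\<xi>2 = 0" by (simp_all only: ts)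
  qed (simp_all add: kM)
  show ?thesis using d k ann w4 by blast
qed

text \<open>The dual form is killed by the 4-dimensional annihilator of the flag space, more than
  the cube can have in its kernel without being zero.\<close>

theorem dual_pfaff_zero:
  fixes \<Omega> :: "8 ext"
  assumes \<Omega>: "\<Omega> \<in> ext_power 4" and z: "pfaff \<Omega> u w = 0"
    and l: "lin_indep2 (grad1 \<Omega> u w) (grad2 \<Omega> u w)"
  shows "pfaff (vol_dual 1 \<Omega>) (grad1 \<Omega> u w) (grad2 \<Omega> u w) = 0"
proof -
  let ?\<xi>1 = "grad1 \<Omega> u w" and ?\<xi>2 = "grad2 \<Omega> u w"
  let ?N = "form2 (vol_dual 1 \<Omega>) ?\<xi>1 ?\<xi>2"
  note v = star_power4[OF \<Omega>, of 1]
  note N = form2_power[OF v, of ?\<xi>1 ?\<xi>2]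
  obtain k1 k2 where k: "distinct [u, w, k1, k2]" "vec.independent {u, w, k1, k2}"
    and k3: "\<And>\<kappa>. \<kappa> \<in> orth {u, w, k1, k2} \<Longrightarrow> \<Omega> \<odot> ext_vec ?\<xi>1 \<odot> ext_vec ?\<xi>2 \<odot> ext_vec \<kappa> = 0"
    using smooth_flag[OF \<Omega> z l] by blast
  have sub: "orth {u, w, k1, k2} \<subseteq> {y. contr y (?N \<odot> ?N \<odot> ?N) = 0}"
    using k3 by (auto simp: two_form_cube_contr(2)[OF N] star_wedge3_contr vol_dual_linear)
  have "vec.dim (orth {u, w, k1, k2}) = 4"
    using dim_orth_independent[OF k(2)] k(1) by simp
  then have "vec.dim {y. contr y (?N \<odot> ?N \<odot> ?N) = 0} \<ge> 3"
    using vec.dim_subset[OF sub] by linarith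
  moreover have "?N \<odot> ?N \<odot> ?N \<in> ext_power 6"
    using ext_power_wedge[OF N ext_power_wedge[OF N N]] by simp
  ultimately have "?N \<odot> ?N \<odot> ?N = 0" by (intro six_form_zero)
  then show ?thesis using form2_cube[OF v, of ?\<xi>1 ?\<xi>2] l by (simp add: vol_dual_eq_0)
qed

text \<open>Biduality: the flag equations of \<open>v\<close> at \<open>\<xi>1, \<xi>2\<close>, read
  through the star, describe the kernel of the dual form at \<open>a1, a2\<close> and place the
  contractions that determine its gradients in the original plane.\<close>

theorem double_dual_plane:
  fixes v :: "8 ext"
  assumes v: "v \<in> ext_power 4" and z: "pfaff v \<xi>1 \<xi>2 = 0" and l\<xi>: "lin_indep2 \<xi>1 \<xi>2"
    and a: "a1 = grad1 v \<xi>1 \<xi>2" "a2 = grad2 v \<xi>1 \<xi>2" "lin_indep2 a1 a2"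
    and b: "b1 = grad1 (vol_dual 1 v) a1 a2" "b2 = grad2 (vol_dual 1 v) a1 a2" "lin_indep2 b1 b2"
  shows "vec.span {b1, b2} = vec.span {\<xi>1, \<xi>2}"
proof -
  let ?\<Omega> = "vol_dual 1 v"
  note \<Omega> = star_power4[OF v, of 1]
  have v_\<Omega>: "vol_dual 1 ?\<Omega> = v" by (rule star_star4[OF v])
  obtain \<kappa>1 \<kappa>2 where k: "distinct [\<xi>1, \<xi>2, \<kappa>1, \<kappa>2]" "vec.independent {\<xi>1, \<xi>2, \<kappa>1, \<kappa>2}"
    "contr \<kappa>1 (form2 v \<xi>1 \<xi>2) = 0" "contr \<kappa>2 (form2 v \<xi>1 \<xi>2) = 0"
    "\<And>x. x \<in> {\<xi>1, \<xi>2, \<kappa>1, \<kappa>2} \<Longrightarrow> bdot x a1 = 0 \<and> bdot x a2 = 0"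
    "\<And>k. k \<in> orth {\<xi>1, \<xi>2, \<kappa>1, \<kappa>2} \<Longrightarrow> v \<odot> ext_vec a1 \<odot> ext_vec a2 \<odot> ext_vec k = 0"
    using smooth_flag[OF v z a(3)[unfolded a(1,2)]] unfolding a(1,2)[symmetric] by blast
  let ?U4 = "orth {\<xi>1, \<xi>2, \<kappa>1, \<kappa>2}"
  have F1: "contr k (form2 ?\<Omega> a1 a2) = 0" if "k \<in> ?U4" for k
    using k(6)[OF that] by (simp add: star_wedge3_contr vol_dual_linear)
  have FA: "?\<Omega> \<odot> ext_vec \<xi>1 \<odot> ext_vec \<xi>2 \<odot> ext_vec \<kappa>1 = 0" "?\<Omega> \<odot> ext_vec \<xi>1 \<odot> ext_vec \<xi>2 \<odot> ext_vec \<kappa>2 = 0"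
    using k(3,4) star_wedge3_contr[of _ ?\<Omega> \<xi>1 \<xi>2] by (simp_all add: v_\<Omega> vol_dual_eq_0)
  have "vec.dim ?U4 = 4" using dim_orth_independent[OF k(2)] k(1) by simp
  moreover have "a1 \<in> ?U4" "a2 \<in> ?U4" using k(5) by (auto simp: orth_bdot bdot_commute)
  \<comment> \<open>The kernel vectors are taken inside \<open>?U4\<close>, not from a new
    application of \<open>smooth_flag\<close>, to keep them tied to
    \<open>\<xi>1, \<xi>2\<close>.\<close>
  ultimately obtain k1 k2 where kk: "k1 \<in> ?U4" "k2 \<in> ?U4" "distinct [a1, a2, k1, k2]" "vec.independent {a1, a2, k1, k2}"
    using extend_plane_kernel[OF a(3) subspace_orth, of "{\<xi>1, \<xi>2, \<kappa>1, \<kappa>2}"] by auto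
  have z\<Omega>: "pfaff ?\<Omega> a1 a2 = 0" using dual_pfaff_zero[OF v z] a by simp
  have p1: "contr k2 (contr k1 (contr y ?\<Omega>)) \<in> ext_power 1" for y
  proof -
    have "?\<Omega> \<in> ext_power (Suc (Suc (Suc 1)))" using \<Omega> by (simp add: numeral_eq_Suc)
    then show ?thesis by (intro ext_power_contr)
  qed
  obtain t s where ts: "contr k2 (contr k1 (contr a1 ?\<Omega>)) = ext_vec t" "contr k2 (contr k1 (contr a2 ?\<Omega>)) = ext_vec s"
    using p1 ext_power_1_vec by metis
  note gf = grad_formula[OF \<Omega> z\<Omega> F1[OF kk(1)] F1[OF kk(2)] ts]
  have v4: "vol_dual 1 (ext_vec a1 \<odot> ext_vec a2 \<odot> ext_vec k1 \<odot> ext_vec k2) \<noteq> 0"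
    using wedge_list_nonzero[of "[a1, a2, k1, k2]"] kk(3,4) by (simp add: vol_dual_eq_0)
  have ann: "bdot a1 \<eta> = 0 \<and> bdot a2 \<eta> = 0 \<and> bdot k1 \<eta> = 0 \<and> bdot k2 \<eta> = 0" if "\<eta> \<in> {\<xi>1, \<xi>2, \<kappa>1, \<kappa>2}" for \<eta>
    using k(5)[OF that] kk(1,2) that by (auto simp: orth_bdot bdot_commute)
  have ts_span: "t \<in> vec.span {\<xi>1, \<xi>2}" "s \<in> vec.span {\<xi>1, \<xi>2}"
    using flag_contr_span[OF \<Omega> k(1,2) _ FA ts(1)] flag_contr_span[OF \<Omega> k(1,2) _ FA ts(2)] ann by blast+
  have "bdot b1 x = 0 \<and> bdot b2 x = 0" if x: "x \<in> orth {\<xi>1, \<xi>2}" for x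
  proof -
    have "x \<in> orth (vec.span {\<xi>1, \<xi>2})" using x by (simp add: orth_span)
    then have "bdot x t = 0" "bdot x s = 0" using ts_span by (auto simp: orth_bdot bdot_commute)
    then show ?thesis using gf[of x] v4 b by simp
  qed
  then have "b1 \<in> orth (orth (vec.span {\<xi>1, \<xi>2}))" "b2 \<in> orth (orth (vec.span {\<xi>1, \<xi>2}))"
    by (auto simp: orth_span orth_bdot[of "orth {\<xi>1, \<xi>2}"] bdot_commute)
  then have "b1 \<in> vec.span {\<xi>1, \<xi>2}" "b2 \<in> vec.span {\<xi>1, \<xi>2}" by (simp_all add: orth_orth)
  then show ?thesis by (rule span2_eq[OF b(3)])
qed

section \<open>Zariski topology on the Grassmannian\<close>

lemma homogeneous_fun_mult:
  "homogeneous_fun d f \<Longrightarrow> homogeneous_fun e g \<Longrightarrow> homogeneous_fun (d + e) (\<lambda>x. f x * g x)"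
  by (auto simp: homogeneous_fun_def power_add intro: polynomial_fun.mult)

definition basic_open :: "nat \<Rightarrow> ('n::{finite,linorder} ext \<Rightarrow> complex) \<Rightarrow> 'n vsp set set" where
  "basic_open k f = {U \<in> Gr k. \<forall>p\<in>pluecker k U. f p \<noteq> 0}"

lemma openin_basic_open: "homogeneous_fun d f \<Longrightarrow> openin (zariski_Gr k) (basic_open k f)"
  unfolding zariski_Gr_def basic_open_def by (intro topology_generated_by_Basis) blast

lemma topspace_zariski_Gr: "topspace (zariski_Gr k :: 'n::{finite,linorder} vsp set topology) = Gr k"
proof
  show "topspace (zariski_Gr k :: 'n vsp set topology) \<subseteq> Gr k"
    unfolding zariski_Gr_def topology_generated_by_topspace by blast
  have "homogeneous_fun 0 (\<lambda>p :: 'n ext. 1)"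
    by (simp add: homogeneous_fun_def polynomial_fun.const)
  from openin_basic_open[OF this, of k] show "Gr k \<subseteq> topspace (zariski_Gr k :: 'n vsp set topology)"
    by (auto dest!: openin_subset simp: basic_open_def)
qed

text \<open>Products of homogeneous functions are homogeneous, so the generating sets are stable
  under finite intersections and form a base.\<close>

lemma zariski_Gr_basis:
  assumes "openin (zariski_Gr k) T" "U \<in> T"
  shows "\<exists>d f. homogeneous_fun d f \<and> U \<in> basic_open k f \<and> basic_open k f \<subseteq> T"
proof -
  have "generate_topology_on {{U \<in> Gr k. \<forall>p\<in>pluecker k U. f p \<noteq> 0} | f. \<exists>d. homogeneous_fun d f} T"
    using assms(1) by (simp add: zariski_Gr_def openin_topology_generated_by_iff)
  then show ?thesis using assms(2)
  proof (induction arbitrary: U)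
    case (Int a b)
    obtain d f e g where "homogeneous_fun d f" "U \<in> basic_open k f" "basic_open k f \<subseteq> a"
      "homogeneous_fun e g" "U \<in> basic_open k g" "basic_open k g \<subseteq> b"
      using Int.IH(1)[of U] Int.IH(2)[of U] Int.prems by blast
    then show ?case
      by (intro exI[of _ "d + e"] exI[of _ "\<lambda>x. f x * g x"] conjI homogeneous_fun_mult)
        (auto simp: basic_open_def)
  next
    case (UN K)
    then obtain a where "a \<in> K" "U \<in> a" by blast
    then show ?case using UN.IH[of a U] by blast
  next
    case (Basis s)
    then show ?case by (auto simp: basic_open_def)
  qed simp
qed

lemma wedge_pair_nth:
  assumes "i < j"
  shows "(ext_vec u \<odot> ext_vec w) $ {i, j} = u $ i * w $ j - u $ j * w $ i"
proof -
  have ij: "i \<noteq> j" using assms by simp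
  have b: "(ext_vec (basis_vec k) \<odot> ext_vec w) $ {i, j} = (if k = i then w $ j else if k = j then - w $ i else 0)" for k
  proof -
    have "{i, j} - {i} = {j}" "{i, j} - {j} = {i}" using ij by auto
    moreover have "\<not> j < i" using assms by simp
    ultimately show ?thesis using assms ij by (simp add: basis_vec_wedge ext_vec_nth shuffle_sign_singletons)
  qed
  have "ext_vec u \<odot> ext_vec w = (\<Sum>k\<in>UNIV. u $ k *s (ext_vec (basis_vec k) \<odot> ext_vec w))"
    by (simp only: ext_vec_scale[symmetric] wedge_scale_left[symmetric] wedge_sum_left[symmetric]
        ext_vec_sum[symmetric] basis_expansion)
  then have "(ext_vec u \<odot> ext_vec w) $ {i, j} = (\<Sum>k\<in>UNIV. u $ k * (if k = i then w $ j else if k = j then - w $ i else 0))"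
    by (simp add: b)
  also have "\<dots> = (\<Sum>k\<in>{i, j}. u $ k * (if k = i then w $ j else if k = j then - w $ i else 0))"
    by (rule sum.mono_neutral_right) auto
  also have "\<dots> = u $ i * w $ j - u $ j * w $ i" using ij by simp
  finally show ?thesis .
qed

text \<open>Used to rewrite the Pfaffian and the minors of its gradients as homogeneous polynomials
  in Pluecker coordinates.\<close>

lemma alternating_bilinear_pluecker:
  fixes B :: "'n::{finite,linorder} vsp \<Rightarrow> 'n vsp \<Rightarrow> complex ^ 'm"
  assumes lin: "\<And>x y z. B (x + y) z = B x z + B y z" "\<And>c x z. B (c *s x) z = c *s B x z"
      "\<And>x y z. B z (x + y) = B z x + B z y" "\<And>c x z. B z (c *s x) = c *s B z x"
    and alt: "\<And>x. B x x = 0"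
  shows "B u w = (\<Sum>(i, j)\<in>{(i, j). i < j}. (ext_vec u \<odot> ext_vec w) $ {i, j} *s B (basis_vec i) (basis_vec j))"
proof -
  have z: "B 0 y = 0" "B y 0 = 0" for y using lin(2)[of 0 0 y] lin(4)[of y 0 0] by simp_all
  have s1: "B (sum f S) y = (\<Sum>k\<in>S. B (f k) y)" for f y and S :: "'n set"
    by (induction S rule: infinite_finite_induct) (auto simp: lin z)
  have s2: "B y (sum f S) = (\<Sum>k\<in>S. B y (f k))" for f y and S :: "'n set"
    by (induction S rule: infinite_finite_induct) (auto simp: lin z)
  have skew: "B y x = - B x y" for x y
    using alt[of "x + y"] alt[of x] alt[of y] by (simp add: lin eq_neg_iff_add_eq_0 add.commute)
  let ?b = "\<lambda>i j. (u $ i * w $ j) *s B (basis_vec i) (basis_vec j)"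
  have "B u w = B (\<Sum>i\<in>UNIV. u $ i *s basis_vec i) (\<Sum>j\<in>UNIV. w $ j *s basis_vec j)"
    by (simp add: basis_expansion)
  also have "\<dots> = (\<Sum>i\<in>UNIV. \<Sum>j\<in>UNIV. ?b i j)"
    by (simp add: s1 s2 lin vec.scale_sum_right) (subst sum.swap, simp add: mult.commute)
  also have "\<dots> = (\<Sum>(i, j)\<in>UNIV \<times> UNIV. ?b i j)" by (simp add: sum.cartesian_product)
  also have "UNIV \<times> UNIV = {(i, j). i < j} \<union> ({(i, j). j < i} \<union> {(i, j). i = (j :: 'n)})" by auto
  also have "(\<Sum>(i, j)\<in>\<dots>. ?b i j) = (\<Sum>(i, j)\<in>{(i, j). i < j}. ?b i j) +
      ((\<Sum>(i, j)\<in>{(i, j). j < i}. ?b i j) + (\<Sum>(i, j)\<in>{(i, j). i = j}. ?b i j))"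
    by (subst sum.union_disjoint; (subst sum.union_disjoint)?) auto
  also have "(\<Sum>(i, j)\<in>{(i, j). i = j}. ?b i j) = 0" by (rule sum.neutral) (auto simp: alt)
  also have "(\<Sum>(i, j)\<in>{(i, j). j < i}. ?b i j) = (\<Sum>(i, j)\<in>{(i, j). i < j}. ?b j i)"
    by (rule sum.reindex_bij_witness[of _ prod.swap prod.swap]) auto
  also have "(\<Sum>(i, j)\<in>{(i, j). i < j}. ?b i j) + ((\<Sum>(i, j)\<in>{(i, j). i < j}. ?b j i) + 0) =
      (\<Sum>(i, j)\<in>{(i, j). i < j}. (ext_vec u \<odot> ext_vec w) $ {i, j} *s B (basis_vec i) (basis_vec j))"
    unfolding add_0_right sum.distrib[symmetric]
  proof (rule sum.cong[OF refl], clarify)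
    fix i j :: 'n assume "i < j"
    then show "?b i j + ?b j i = (ext_vec u \<odot> ext_vec w) $ {i, j} *s B (basis_vec i) (basis_vec j)"
      by (simp add: wedge_pair_nth skew[of "basis_vec j" "basis_vec i"] vec.scale_left_diff_distrib)
  qed
  finally show ?thesis .
qed

text \<open>Linear extension of \<open>form2 \<Omega>\<close> from decomposable bivectors to the
  whole exterior algebra.\<close>

definition mform :: "'n::{finite,linorder} ext \<Rightarrow> 'n ext \<Rightarrow> 'n ext" where
  "mform \<Omega> p = (\<Sum>(i, j)\<in>{(i, j). i < j}. p $ {i, j} *s form2 \<Omega> (basis_vec i) (basis_vec j))"

definition pfaff_fun :: "'n::{finite,linorder} ext \<Rightarrow> 'n ext \<Rightarrow> complex" where
  "pfaff_fun \<Omega> p = (mform \<Omega> p \<odot> mform \<Omega> p \<odot> \<Omega>) $ UNIV"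

text \<open>The \<open>i, j\<close> minor of the two gradients. With \<open>mform \<Omega> p\<close>
  held fixed it is alternating in the remaining occurrences of \<open>u\<close> and
  \<open>w\<close>, which the sum over \<open>a < b\<close> resolves; hence degree three in
  \<open>p\<close>. The 4 is the product of the factors 2 of the gradients.\<close>

definition minor_fun :: "'n::{finite,linorder} ext \<Rightarrow> 'n \<Rightarrow> 'n \<Rightarrow> 'n ext \<Rightarrow> complex" where
  "minor_fun \<Omega> i j p = (\<Sum>(a, b)\<in>{(a, b). a < b}. p $ {a, b} * (4 *
     ((mform \<Omega> p \<odot> form2 \<Omega> (basis_vec i) (basis_vec b) \<odot> \<Omega>) $ UNIV *
      (mform \<Omega> p \<odot> form2 \<Omega> (basis_vec a) (basis_vec j) \<odot> \<Omega>) $ UNIV -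
      (mform \<Omega> p \<odot> form2 \<Omega> (basis_vec j) (basis_vec b) \<odot> \<Omega>) $ UNIV *
      (mform \<Omega> p \<odot> form2 \<Omega> (basis_vec a) (basis_vec i) \<odot> \<Omega>) $ UNIV)))"

lemma mform_wedge: "mform \<Omega> (ext_vec u \<odot> ext_vec w) = form2 \<Omega> u w"
  unfolding mform_def by (rule alternating_bilinear_pluecker[symmetric]) (simp_all add: form2_linear)

lemma pfaff_fun_wedge: "pfaff_fun \<Omega> (ext_vec u \<odot> ext_vec w) = pfaff \<Omega> u w"
  by (simp add: pfaff_fun_def pfaff_def pol_def mform_wedge)

lemma minor_fun_wedge:
  assumes "i < j"
  shows "minor_fun \<Omega> i j (ext_vec u \<odot> ext_vec w) = (ext_vec (grad1 \<Omega> u w) \<odot> ext_vec (grad2 \<Omega> u w)) $ {i, j}"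
proof -
  define B :: "'a vsp \<Rightarrow> 'a vsp \<Rightarrow> complex ^ 1" where "B x y = (\<chi> k. 4 * (pol \<Omega> u w (basis_vec i) y * pol \<Omega> u w x (basis_vec j) -
      pol \<Omega> u w (basis_vec j) y * pol \<Omega> u w x (basis_vec i)))" for x y
  have "B u w = (\<Sum>(a, b)\<in>{(a, b). a < b}. (ext_vec u \<odot> ext_vec w) $ {a, b} *s B (basis_vec a) (basis_vec b))"
  proof (rule alternating_bilinear_pluecker)
    show "B x x = 0" for x
      by (simp add: B_def vec_eq_iff pol_swap(2)[of \<Omega> u w x "basis_vec i"] pol_swap(2)[of \<Omega> u w x "basis_vec j"])
  qed (simp_all add: B_def vec_eq_iff pol_linear algebra_simps)
  then have "B u w $ 1 = (\<Sum>(a, b)\<in>{(a, b). a < b}. (ext_vec u \<odot> ext_vec w) $ {a, b} * B (basis_vec a) (basis_vec b) $ 1)"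
    by (simp add: case_prod_unfold)
  then show ?thesis
    by (simp add: minor_fun_def mform_wedge wedge_pair_nth[OF assms] grad1_def grad2_def pol_def[symmetric] B_def)
qed

lemma poly_map_mform: "poly_map coords (mform \<Omega>)"
  unfolding mform_def case_prod_unfold
  by (intro poly_map_sum poly_map_scale poly_map_const poly_map_nth[OF poly_map_id])

lemma mform_scale: "mform \<Omega> (c *s p) = c *s mform \<Omega> p"
  by (simp add: mform_def vec.scale_sum_right case_prod_unfold)

lemma homogeneous_pfaff_fun: "homogeneous_fun 2 (pfaff_fun \<Omega>)"
  unfolding homogeneous_fun_def polynomial_fun_iff
proof
  show "pfaff_fun \<Omega> \<in> poly_alg coords"
    unfolding pfaff_fun_def by (intro poly_map_nth poly_map_wedge poly_map_mform poly_map_const)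
qed (simp add: pfaff_fun_def mform_scale wedge_simps power2_eq_square)

lemma homogeneous_minor_fun: "homogeneous_fun 3 (minor_fun \<Omega> i j)"
  unfolding homogeneous_fun_def polynomial_fun_iff
proof
  have "(\<lambda>p. (mform \<Omega> p \<odot> a \<odot> \<Omega>) $ UNIV) \<in> poly_alg coords" for a
    by (intro poly_map_nth poly_map_wedge poly_map_mform poly_map_const)
  then show "minor_fun \<Omega> i j \<in> poly_alg coords"
    unfolding minor_fun_def case_prod_unfold
    by (intro poly_alg_sum poly_alg.mult poly_alg.const poly_alg_diff poly_map_nth[OF poly_map_id])
  show "\<forall>c p. minor_fun \<Omega> i j (c *s p) = c ^ 3 * minor_fun \<Omega> i j p"
    unfolding minor_fun_def sum_distrib_left
    by (auto intro!: sum.cong simp: mform_scale wedge_simps power3_eq_cube algebra_simps)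
qed

lemma homogeneous_fun_zero: "homogeneous_fun d f \<Longrightarrow> d > 0 \<Longrightarrow> f 0 = 0"
proof -
  assume a: "homogeneous_fun d f" "d > 0"
  have "f (0 *s 0) = 0 ^ d * f 0" using a(1) unfolding homogeneous_fun_def by blast
  then show ?thesis using a(2) by (simp add: zero_power)
qed

section \<open>Tangent spaces\<close>

text \<open>Induction on the construction of \<open>f\<close> yields partial derivatives that are
  polynomials again; irreducibility is later applied to expressions in them.\<close>

lemma polynomial_fun_chain:
  assumes "polynomial_fun (f :: complex ^ 'm \<Rightarrow> complex)"
  shows "\<exists>D. (\<forall>i. polynomial_fun (D i)) \<and> (\<forall>\<gamma> \<gamma>' z. (\<forall>i. ((\<lambda>t. \<gamma> t $ i) has_field_derivative \<gamma>' $ i) (at z)) \<longrightarrow>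
     ((\<lambda>t. f (\<gamma> t)) has_field_derivative (\<Sum>i\<in>UNIV. D i (\<gamma> z) * \<gamma>' $ i)) (at z))"
  using assms
proof induction
  case (const c)
  show ?case by (intro exI[of _ "\<lambda>i x. 0"]) (auto intro: polynomial_fun.const)
next
  case (coord j)
  have "(\<Sum>i\<in>UNIV. (if i = j then 1 else 0) * (y :: complex ^ 'm) $ i) = y $ j" for y
    by (subst sum.cong[OF refl, of _ _ "\<lambda>i. if i = j then y $ j else 0"]) auto
  then show ?case by (intro exI[of _ "\<lambda>i x. if i = j then 1 else 0"]) (auto intro: polynomial_fun.const)
next
  case (add f g)
  then obtain D E where D: "\<forall>i. polynomial_fun (D i)" "\<And>\<gamma> \<gamma>' z. (\<forall>i. ((\<lambda>t. \<gamma> t $ i) has_field_derivative \<gamma>' $ i) (at z)) \<Longrightarrow>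
     ((\<lambda>t. f (\<gamma> t)) has_field_derivative (\<Sum>i\<in>UNIV. D i (\<gamma> z) * \<gamma>' $ i)) (at z)"
   and E: "\<forall>i. polynomial_fun (E i)" "\<And>\<gamma> \<gamma>' z. (\<forall>i. ((\<lambda>t. \<gamma> t $ i) has_field_derivative \<gamma>' $ i) (at z)) \<Longrightarrow>
     ((\<lambda>t. g (\<gamma> t)) has_field_derivative (\<Sum>i\<in>UNIV. E i (\<gamma> z) * \<gamma>' $ i)) (at z)" by blast
  show ?case
  proof (intro exI[of _ "\<lambda>i x. D i x + E i x"] conjI allI impI)
    fix \<gamma> :: "complex \<Rightarrow> complex ^ 'm" and \<gamma>' z assume h: "\<forall>i. ((\<lambda>t. \<gamma> t $ i) has_field_derivative \<gamma>' $ i) (at z)"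
    show "((\<lambda>t. f (\<gamma> t) + g (\<gamma> t)) has_field_derivative (\<Sum>i\<in>UNIV. (D i (\<gamma> z) + E i (\<gamma> z)) * \<gamma>' $ i)) (at z)"
      using DERIV_add[OF D(2)[OF h] E(2)[OF h]] by (simp add: algebra_simps sum.distrib)
  qed (use D E in \<open>auto intro: polynomial_fun.add\<close>)
next
  case (mult f g)
  then obtain D E where D: "\<forall>i. polynomial_fun (D i)" "\<And>\<gamma> \<gamma>' z. (\<forall>i. ((\<lambda>t. \<gamma> t $ i) has_field_derivative \<gamma>' $ i) (at z)) \<Longrightarrow>
     ((\<lambda>t. f (\<gamma> t)) has_field_derivative (\<Sum>i\<in>UNIV. D i (\<gamma> z) * \<gamma>' $ i)) (at z)"
   and E: "\<forall>i. polynomial_fun (E i)" "\<And>\<gamma> \<gamma>' z. (\<forall>i. ((\<lambda>t. \<gamma> t $ i) has_field_derivative \<gamma>' $ i) (at z)) \<Longrightarrow>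
     ((\<lambda>t. g (\<gamma> t)) has_field_derivative (\<Sum>i\<in>UNIV. E i (\<gamma> z) * \<gamma>' $ i)) (at z)" by blast
  show ?case
  proof (intro exI[of _ "\<lambda>i x. D i x * g x + E i x * f x"] conjI allI impI)
    fix \<gamma> :: "complex \<Rightarrow> complex ^ 'm" and \<gamma>' z assume h: "\<forall>i. ((\<lambda>t. \<gamma> t $ i) has_field_derivative \<gamma>' $ i) (at z)"
    show "((\<lambda>t. f (\<gamma> t) * g (\<gamma> t)) has_field_derivative
        (\<Sum>i\<in>UNIV. (D i (\<gamma> z) * g (\<gamma> z) + E i (\<gamma> z) * f (\<gamma> z)) * \<gamma>' $ i)) (at z)"
      using DERIV_mult[OF D(2)[OF h] E(2)[OF h]]
      by (simp add: algebra_simps sum.distrib sum_distrib_left sum_distrib_right)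
  qed (use D E mult.hyps in \<open>auto intro!: polynomial_fun.add polynomial_fun.mult\<close>)
qed

definition pgrad :: "('n::{finite,linorder} ext \<Rightarrow> complex) \<Rightarrow> 'n set \<Rightarrow> 'n ext \<Rightarrow> complex" where
  "pgrad f = (SOME D. (\<forall>i. polynomial_fun (D i)) \<and> (\<forall>\<gamma> \<gamma>' z. (\<forall>i. ((\<lambda>t. \<gamma> t $ i) has_field_derivative \<gamma>' $ i) (at z)) \<longrightarrow>
     ((\<lambda>t. f (\<gamma> t)) has_field_derivative (\<Sum>i\<in>UNIV. D i (\<gamma> z) * \<gamma>' $ i)) (at z)))"

lemma pgrad:
  assumes "polynomial_fun f"
  shows "polynomial_fun (pgrad f i)"
    and "(\<And>i. ((\<lambda>t. \<gamma> t $ i) has_field_derivative \<gamma>' $ i) (at z)) \<Longrightarrow>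
     ((\<lambda>t. f (\<gamma> t)) has_field_derivative (\<Sum>i\<in>UNIV. pgrad f i (\<gamma> z) * \<gamma>' $ i)) (at z)"
  using someI_ex[OF polynomial_fun_chain[OF assms]] unfolding pgrad_def[symmetric] by blast+

text \<open>Partial gradient in \<open>u\<close> of an arbitrary equation \<open>f\<close> in
  Pluecker coordinates, the counterpart of \<open>grad1\<close>; \<open>pd2\<close> belongs to
  \<open>w\<close>.\<close>

definition pd1 :: "('n::{finite,linorder} ext \<Rightarrow> complex) \<Rightarrow> 'n vsp \<Rightarrow> 'n vsp \<Rightarrow> 'n vsp" where
  "pd1 f u w = (\<chi> i. \<Sum>I\<in>UNIV. pgrad f I (ext_vec u \<odot> ext_vec w) * (ext_vec (basis_vec i) \<odot> ext_vec w) $ I)"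

definition pd2 :: "('n::{finite,linorder} ext \<Rightarrow> complex) \<Rightarrow> 'n vsp \<Rightarrow> 'n vsp \<Rightarrow> 'n vsp" where
  "pd2 f u w = (\<chi> i. \<Sum>I\<in>UNIV. pgrad f I (ext_vec u \<odot> ext_vec w) * (ext_vec u \<odot> ext_vec (basis_vec i)) $ I)"

lemma bdot_functional:
  assumes "\<And>x y. L (x + y) = L x + L y" "\<And>c x. L (c *s x) = c * L x"
  shows "bdot (\<chi> i. L (basis_vec i)) x = L x"
proof -
  have z: "L 0 = 0" using assms(2)[of 0 0] by simp
  have "L (\<Sum>i\<in>S. x $ i *s basis_vec i) = (\<Sum>i\<in>S. x $ i * L (basis_vec i))" if "finite S" for S
    using that by (induction S rule: finite_induct) (auto simp: assms z)
  from this[of UNIV] show ?thesis by (simp add: basis_expansion bdot_def mult.commute)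
qed

lemma bdot_pd:
  "bdot (pd1 f u w) x = (\<Sum>I\<in>UNIV. pgrad f I (ext_vec u \<odot> ext_vec w) * (ext_vec x \<odot> ext_vec w) $ I)"
  "bdot (pd2 f u w) x = (\<Sum>I\<in>UNIV. pgrad f I (ext_vec u \<odot> ext_vec w) * (ext_vec u \<odot> ext_vec x) $ I)"
  unfolding pd1_def pd2_def
  by (rule bdot_functional; simp add: ext_vec_simps wedge_simps algebra_simps sum.distrib sum_distrib_left)+

lemma poly_map_pd:
  assumes "polynomial_fun f"
  shows "poly_map pair_coords (\<lambda>x. pd1 f (fst x) (snd x))" "poly_map pair_coords (\<lambda>x. pd2 f (fst x) (snd x))"
  unfolding pd1_def pd2_def
  by (intro poly_map_lambda poly_alg_sum poly_alg.mult polynomial_fun_comp[OF pgrad(1)[OF assms]]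
      poly_map_nth poly_map_wedge poly_map_ext_vec poly_map_const poly_map_pair_coords)+

lemma deriv_along_curve:
  fixes s :: "complex \<Rightarrow> complex"
  assumes f: "polynomial_fun f" and s: "(s has_field_derivative 0) (at 0)" "s 0 = 0"
  shows "((\<lambda>t. f (ext_vec (u + t *s x) \<odot> ext_vec (w + t *s y + s t *s b))) has_field_derivative
    (bdot (pd1 f u w) x + bdot (pd2 f u w) y)) (at 0)"
proof -
  let ?\<gamma> = "\<lambda>t. ext_vec (u + t *s x) \<odot> ext_vec (w + t *s y + s t *s b)"
  let ?\<gamma>' = "ext_vec x \<odot> ext_vec w + ext_vec u \<odot> ext_vec y"
  have "((\<lambda>t. f (?\<gamma> t)) has_field_derivative (\<Sum>I\<in>UNIV. pgrad f I (?\<gamma> 0) * ?\<gamma>' $ I)) (at 0)"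
  proof (rule pgrad(2)[OF f])
    fix I
    have e: "?\<gamma> t $ I = (ext_vec u \<odot> ext_vec w) $ I + t * (ext_vec x \<odot> ext_vec w) $ I + t * (ext_vec u \<odot> ext_vec y) $ I +
        t * t * (ext_vec x \<odot> ext_vec y) $ I + s t * (ext_vec u \<odot> ext_vec b) $ I + s t * t * (ext_vec x \<odot> ext_vec b) $ I" for t
      by (simp add: ext_vec_simps wedge_simps algebra_simps)
    show "((\<lambda>t. ?\<gamma> t $ I) has_field_derivative ?\<gamma>' $ I) (at 0)"
      unfolding e by (rule derivative_eq_intros s(1) refl | simp add: s(2))+
  qed
  then show ?thesis by (simp add: bdot_pd s(2) algebra_simps sum.distrib)
qed

text \<open>The roots sum to \<open>- b / a\<close>, so the larger one has norm at least half of
  that; their product \<open>c / a\<close> then bounds the smaller one. The explicit bound replaces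
  an implicit function theorem.\<close>

lemma small_root:
  fixes a b c :: complex
  assumes "b \<noteq> 0"
  shows "\<exists>s. a * s ^ 2 + b * s + c = 0 \<and> norm s \<le> 2 * norm c / norm b"
proof (cases "a = 0")
  case True
  then show ?thesis using assms by (intro exI[of _ "- c / b"]) (simp add: norm_divide divide_right_mono)
next
  case False
  obtain r where r: "a * r ^ 2 + b * r + c = 0" using quadratic_root[OF False] by blast
  define r' where "r' = - b / a - r"
  have sum: "a * (r + r') = - b" using False by (simp add: r'_def field_simps)
  have prod: "a * r * r' = c"
  proof -
    have "a * r * r' = r * (a * (r + r')) - a * r ^ 2" by (simp add: algebra_simps power2_eq_square)
    then have "a * r * r' = - b * r - a * r ^ 2" by (simp add: sum)
    also have "\<dots> = c - (a * r ^ 2 + b * r + c)" by simp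
    finally show ?thesis using r by simp
  qed
  have r': "a * r' ^ 2 + b * r' + c = 0"
  proof -
    have "a * r' ^ 2 + b * r' + c = a * r' ^ 2 - a * (r + r') * r' + a * r * r'" using sum prod by simp
    then show ?thesis by (simp add: algebra_simps power2_eq_square)
  qed
  have *: "norm x \<le> 2 * norm c / norm b"
    if le: "norm x \<le> norm y" and sum: "a * (x + y) = - b" and prod: "a * x * y = c" for x y
  proof -
    have "norm b = norm a * norm (x + y)" using sum by (metis norm_minus_cancel norm_mult)
    also have "\<dots> \<le> norm a * (2 * norm y)"
      using le norm_triangle_ineq[of x y] by (intro mult_left_mono) auto
    finally have "norm x * norm b \<le> norm x * (norm a * (2 * norm y))" by (simp add: mult_left_mono)
    also have "\<dots> = 2 * norm c" using prod by (simp flip: prod add: norm_mult)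
    finally show ?thesis using assms by (simp add: field_simps)
  qed
  show ?thesis
  proof (cases "norm r \<le> norm r'")
    case True
    then show ?thesis using r *[OF True sum prod] by blast
  next
    case False
    then have "norm r' \<le> 2 * norm c / norm b"
      using *[of r' r] sum prod by (simp add: add.commute mult.commute mult.left_commute)
    then show ?thesis using r' by blast
  qed
qed

lemma pfaff_curve:
  assumes "\<Omega> \<in> ext_power 4"
  shows "pfaff \<Omega> (u + t *s x) (w + t *s y) = pfaff \<Omega> u w + t * (bdot (grad1 \<Omega> u w) x + bdot (grad2 \<Omega> u w) y) +
    t ^ 2 * (pfaff \<Omega> x w + 2 * pol \<Omega> x w u y + 2 * pol \<Omega> u w x y + pfaff \<Omega> u y) +
    t ^ 3 * (2 * pol \<Omega> x w x y + 2 * pol \<Omega> u y x y) + t ^ 4 * pfaff \<Omega> x y"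
  by (simp add: pfaff_add_right[OF assms] pfaff_add_left[OF assms] pol_linear bdot_grad)
    (simp add: algebra_simps power2_eq_square power3_eq_cube power4_eq_xxxx)

lemma pfaff_curve_deriv:
  assumes "\<Omega> \<in> ext_power 4"
  shows "((\<lambda>t. pfaff \<Omega> (u + t *s x) (w + t *s y)) has_field_derivative
    (bdot (grad1 \<Omega> u w) x + bdot (grad2 \<Omega> u w) y)) (at 0)"
  unfolding pfaff_curve[OF assms] by (rule derivative_eq_intros refl | simp)+

text \<open>
  The tangent direction \<open>A\<close> is realized by a curve inside the hypersurface: along
  \<open>(u + t A u, w + t A w + s b)\<close> the Pfaffian is quadratic in \<open>s\<close> and has a root \<open>s = o(t)\<close>.
\<close>

lemma hypersurface_curve:
  assumes \<Omega>: "\<Omega> \<in> ext_power 4" and z: "pfaff \<Omega> u w = 0" and b: "bdot (grad2 \<Omega> u w) b \<noteq> 0"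
    and A: "bdot (grad1 \<Omega> u w) x + bdot (grad2 \<Omega> u w) y = 0"
  obtains s where "(s has_field_derivative 0) (at 0)" "s 0 = 0"
    "\<forall>\<^sub>F t in at 0. pfaff \<Omega> (u + t *s x) (w + t *s y + s t *s b) = 0"
proof -
  define c where "c t = pfaff \<Omega> (u + t *s x) (w + t *s y)" for t
  define m where "m t = 2 * pol \<Omega> (u + t *s x) (w + t *s y) (u + t *s x) b" for t
  define a where "a t = pfaff \<Omega> (u + t *s x) b" for t
  have m_eq: "m t = bdot (grad2 \<Omega> u w) b + t * (2 * (pol \<Omega> u w x b + pol \<Omega> u y u b + pol \<Omega> x w u b)) +
      t ^ 2 * (2 * (pol \<Omega> u y x b + pol \<Omega> x w x b + pol \<Omega> x y u b)) + t ^ 3 * (2 * pol \<Omega> x y x b)" for t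
    by (simp add: m_def pol_linear bdot_grad) (simp add: algebra_simps power2_eq_square power3_eq_cube)
  have "\<exists>s. m t \<noteq> 0 \<longrightarrow> a t * s ^ 2 + m t * s + c t = 0 \<and> norm s \<le> 2 * norm (c t) / norm (m t)" for t
    using small_root[of "m t" "a t" "c t"] by blast
  then obtain s0 where s0: "\<And>t. m t \<noteq> 0 \<Longrightarrow> a t * s0 t ^ 2 + m t * s0 t + c t = 0"
    "\<And>t. m t \<noteq> 0 \<Longrightarrow> norm (s0 t) \<le> 2 * norm (c t) / norm (m t)" by metis
  have c0: "c 0 = 0" using z by (simp add: c_def)
  have m_lim: "(m \<longlongrightarrow> bdot (grad2 \<Omega> u w) b) (at 0)"
    unfolding m_eq by (rule tendsto_eq_intros refl | simp)+
  have m_ev: "\<forall>\<^sub>F t in at 0. m t \<noteq> 0" by (rule tendsto_imp_eventually_ne[OF m_lim b])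
  have m0: "m 0 \<noteq> 0" using b by (simp add: m_eq)
  have s00: "s0 0 = 0" using s0(2)[OF m0] c0 by simp
  \<comment> \<open>Tangency makes \<open>c\<close> of order o(t), while \<open>m\<close> stays away
    from zero; the bound on the small root transfers this order to \<open>s0\<close>.\<close>
  have "(c has_field_derivative 0) (at 0)"
    using pfaff_curve_deriv[OF \<Omega>, of u x w y] A unfolding c_def by simp
  then have c_lim: "((\<lambda>t. c t / t) \<longlongrightarrow> 0) (at 0)"
    by (simp add: has_field_derivative_iff c0)
  have "((\<lambda>t. 2 * norm (c t / t) / norm (m t)) \<longlongrightarrow> 2 * norm (0 :: complex) / norm (bdot (grad2 \<Omega> u w) b)) (at 0)"
    using b by (intro tendsto_intros c_lim m_lim) simp
  then have lim: "((\<lambda>t. 2 * norm (c t / t) / norm (m t)) \<longlongrightarrow> 0) (at 0)" by simp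
  have "\<forall>\<^sub>F t in at 0. norm (s0 t / t) \<le> 2 * norm (c t / t) / norm (m t)"
    using m_ev
  proof eventually_elim
    case (elim t)
    have "norm (s0 t) / norm t \<le> (2 * norm (c t) / norm (m t)) / norm t"
      using s0(2)[OF elim] by (rule divide_right_mono) simp
    then show ?case by (simp add: norm_divide field_simps)
  qed
  then have "((\<lambda>t. s0 t / t) \<longlongrightarrow> 0) (at 0)" using lim by (rule Lim_null_comparison)
  then have d: "(s0 has_field_derivative 0) (at 0)" by (simp add: has_field_derivative_iff s00)
  have "\<forall>\<^sub>F t in at 0. pfaff \<Omega> (u + t *s x) (w + t *s y + s0 t *s b) = 0"
    using m_ev
  proof eventually_elim
    case (elim t)
    show ?case
      using s0(1)[OF elim]
      unfolding a_def m_def c_def pfaff_add_right[OF \<Omega>, of "u + t *s x" "w + t *s y" "s0 t" b]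
      by (simp add: ac_simps)
  qed
  then show thesis using that d s00 by blast
qed

text \<open>An equation vanishes along the curve inside the hypersurface, so its differential kills
  the direction of the curve. No description of the ideal of the hypersurface is needed.\<close>

lemma tangent_vanish:
  assumes \<Omega>: "\<Omega> \<in> ext_power 4" and z: "pfaff \<Omega> u w = 0" and g: "grad2 \<Omega> u w \<noteq> 0"
    and A: "bdot (grad1 \<Omega> u w) x + bdot (grad2 \<Omega> u w) y = 0"
    and f: "polynomial_fun f" "\<And>u w. pfaff \<Omega> u w = 0 \<Longrightarrow> f (ext_vec u \<odot> ext_vec w) = 0"
  shows "bdot (pd1 f u w) x + bdot (pd2 f u w) y = 0"
proof -
  obtain b where b: "bdot (grad2 \<Omega> u w) b \<noteq> 0" using g bdot_eqI[of "grad2 \<Omega> u w" 0] by auto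
  obtain s where s: "(s has_field_derivative 0) (at 0)" "s 0 = 0"
    "\<forall>\<^sub>F t in at 0. pfaff \<Omega> (u + t *s x) (w + t *s y + s t *s b) = 0"
    by (rule hypersurface_curve[OF \<Omega> z b A])
  let ?F = "\<lambda>t. f (ext_vec (u + t *s x) \<odot> ext_vec (w + t *s y + s t *s b))"
  have "(?F has_field_derivative (bdot (pd1 f u w) x + bdot (pd2 f u w) y)) (at 0)"
    by (rule deriv_along_curve[OF f(1) s(1,2)])
  moreover have "(?F has_field_derivative 0) (at 0)"
  proof -
    have "\<forall>\<^sub>F t in at 0. ?F t = 0" using s(3) by eventually_elim (simp add: f(2))
    then have "\<forall>\<^sub>F t in nhds 0. ?F t = 0"
      using f(2)[of u w] z s(2) by (simp add: eventually_nhds_conv_at)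
    then show ?thesis by (subst has_field_derivative_cong_ev[where g = "\<lambda>t. 0"]) (auto simp: z f(2) s(2))
  qed
  ultimately show ?thesis by (rule DERIV_unique)
qed

text \<open>The differential with partial gradients \<open>g1, g2\<close>, moved by the trace
  pairing into maps with image in the plane of \<open>u\<close> and \<open>w\<close>.\<close>

definition conormal_matrix :: "'n::{finite,linorder} vsp \<Rightarrow> 'n vsp \<Rightarrow> 'n vsp \<Rightarrow> 'n vsp \<Rightarrow> 'n endo" where
  "conormal_matrix g1 g2 u w = (\<chi> i j. u $ i * g1 $ j + w $ i * g2 $ j)"

lemma conormal_matrix_apply: "conormal_matrix g1 g2 u w *v x = bdot g1 x *s u + bdot g2 x *s w"
  by (simp add: conormal_matrix_def vec_eq_iff matrix_vector_mult_def bdot_def sum.distrib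
      sum_distrib_left algebra_simps)

lemma trace_conormal_matrix: "trace (conormal_matrix g1 g2 u w ** A) = bdot g1 (A *v u) + bdot g2 (A *v w)"
proof -
  have "trace (conormal_matrix g1 g2 u w ** A) = (\<Sum>i\<in>UNIV. \<Sum>k\<in>UNIV. (u $ i * g1 $ k + w $ i * g2 $ k) * A $ k $ i)"
    by (simp add: trace_def conormal_matrix_def matrix_matrix_mult_def)
  also have "\<dots> = (\<Sum>k\<in>UNIV. \<Sum>i\<in>UNIV. (u $ i * g1 $ k + w $ i * g2 $ k) * A $ k $ i)" by (rule sum.swap)
  also have "\<dots> = bdot g1 (A *v u) + bdot g2 (A *v w)"
    by (simp add: bdot_def matrix_vector_mult_def sum_distrib_left sum.distrib algebra_simps)
  finally show ?thesis .
qed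

lemma trace_mult_elementary: "trace (N ** (\<chi> a b. if a = j \<and> b = i then 1 else 0)) = N $ i $ j"
  for N :: "complex ^ 'n ^ 'n"
proof -
  have "N $ a $ k * (if k = j \<and> a = i then 1 else 0) = (if k = j then (if a = i then N $ a $ k else 0) else 0)" for a k
    by simp
  then show ?thesis by (simp add: trace_def matrix_matrix_mult_def)
qed

lemma trace_linear: "trace (N ** (A - c *k B)) = trace (N ** A) - c * trace (N ** B)"
  if "c *k B = (\<chi> i j. c * B $ i $ j)" for N A B :: "complex ^ 'n ^ 'n" and smul (infixr "*k" 70)
  by (simp add: that trace_def matrix_matrix_mult_def right_diff_distrib sum_subtractf sum_distrib_left ac_simps)

text \<open>A nonzero functional is determined by its kernel up to a scalar; elementary matrices
  read off the entries.\<close>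

lemma proportional_of_kernel:
  fixes N N' :: "complex ^ 'n ^ 'n"
  assumes "\<And>A. trace (N ** A) = 0 \<Longrightarrow> trace (N' ** A) = 0" "N \<noteq> 0"
  shows "\<exists>c. \<forall>i j. N' $ i $ j = c * N $ i $ j"
proof -
  obtain i0 j0 where n: "N $ i0 $ j0 \<noteq> 0" using assms(2) by (auto simp: vec_eq_iff)
  let ?E = "\<lambda>i j. (\<chi> a b. if a = j \<and> b = i then 1 else 0) :: complex ^ 'n ^ 'n"
  have "N' $ i $ j = (N' $ i0 $ j0 / N $ i0 $ j0) * N $ i $ j" for i j
  proof -
    let ?c = "N $ i $ j / N $ i0 $ j0"
    let ?B = "\<chi> a b. ?c * ?E i0 j0 $ a $ b"
    have "trace (M ** (?E i j - ?B)) = M $ i $ j - ?c * M $ i0 $ j0" for M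
      using trace_linear[of "\<lambda>c B. \<chi> i j. c * B $ i $ j", OF refl, of M "?E i j" ?c "?E i0 j0"]
      by (simp only: trace_mult_elementary)
    then have "N' $ i $ j - ?c * N' $ i0 $ j0 = 0" using assms(1)[of "?E i j - ?B"] n by simp
    then show ?thesis by simp
  qed
  then show ?thesis by blast
qed

lemma lin_indep2_solve:
  assumes "lin_indep2 g1 g2"
  shows "\<exists>x. bdot g1 x = a \<and> bdot g2 x = b"
proof -
  have i: "g1 \<noteq> g2" "vec.independent {g1, g2}" using assms by (auto simp: lin_indep2_iff)
  obtain x y where "bdot x g1 = 1" "bdot x g2 = 0" "bdot y g2 = 1" "bdot y g1 = 0"
    using dual_covector[OF i(2), of g1] dual_covector[OF i(2), of g2] i(1) by auto
  then show ?thesis by (intro exI[of _ "a *s x + b *s y"]) (simp add: bdot_simps bdot_commute)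
qed

lemma lin_indep2_combo: "lin_indep2 u w \<Longrightarrow> a *s u + b *s w = 0 \<Longrightarrow> a = 0 \<and> b = 0"
proof -
  assume l: "lin_indep2 u w" and e: "a *s u + b *s w = 0"
  obtain x y where "bdot u x = 1" "bdot w x = 0" "bdot u y = 0" "bdot w y = 1"
    using lin_indep2_solve[OF l] by meson
  then show ?thesis using arg_cong[OF e, of "bdot x"] arg_cong[OF e, of "bdot y"]
    by (simp add: bdot_simps bdot_commute[of x] bdot_commute[of y])
qed

lemma lin_indep2_of_grad:
  assumes "lin_indep2 (grad1 \<Omega> u w) (grad2 \<Omega> u w)"
  shows "lin_indep2 u w"
proof
  assume e: "ext_vec u \<odot> ext_vec w = 0"
  have f: "form2 \<Omega> u w = 0" by (metis e mform_wedge form2_linear(7) ext_vec_zero wedge_zero_left)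
  have "grad1 \<Omega> u w = 0"
    by (intro vec_eq_iff[THEN iffD2]) (simp add: grad1_def pol_def f)
  then show False using assms by simp
qed

lemma range_conormal_matrix:
  assumes "lin_indep2 g1 g2"
  shows "range (\<lambda>x. conormal_matrix g1 g2 u w *v x) = vec.span {u, w}"
proof
  show "range (\<lambda>x. conormal_matrix g1 g2 u w *v x) \<subseteq> vec.span {u, w}"
  proof clarify
    fix x
    show "conormal_matrix g1 g2 u w *v x \<in> vec.span {u, w}"
      unfolding conormal_matrix_apply by (intro vec.span_add vec.span_scale vec.span_base) auto
  qed
  show "vec.span {u, w} \<subseteq> range (\<lambda>x. conormal_matrix g1 g2 u w *v x)"
  proof
    fix y assume "y \<in> vec.span {u, w}"
    then obtain a b where y: "y = a *s u + b *s w" using span2_mem by blast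
    obtain x where "bdot g1 x = a" "bdot g2 x = b" using lin_indep2_solve[OF assms] by blast
    then show "y \<in> range (\<lambda>x. conormal_matrix g1 g2 u w *v x)"
      by (intro image_eqI[of _ _ x]) (auto simp: y conormal_matrix_apply)
  qed
qed

lemma kernel_conormal_matrix:
  assumes "lin_indep2 u w"
  shows "{x. conormal_matrix g1 g2 u w *v x = 0} = orth (vec.span {g1, g2})"
  unfolding orth_span by (auto simp: conormal_matrix_apply orth_bdot dest: lin_indep2_combo[OF assms])

lemma D_Z1_equation:
  assumes v: "v \<in> ext_power 4"
  shows "(\<forall>W\<in>D_Z1 v. \<forall>p\<in>pluecker 2 W. f p = 0) \<longleftrightarrow>
    (\<forall>u w. lin_indep2 u w \<longrightarrow> pfaff (vol_dual 1 v) u w = 0 \<longrightarrow> f (ext_vec u \<odot> ext_vec w) = 0)"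
proof safe
  fix u w assume h: "\<forall>W\<in>D_Z1 v. \<forall>p\<in>pluecker 2 W. f p = 0" "pfaff (vol_dual 1 v) u w = 0" "lin_indep2 u w"
  then have "vec.span {u, w} \<in> D_Z1 v" using D_Z1_span[OF v] by blast
  then show "f (ext_vec u \<odot> ext_vec w) = 0" using h(1) by (auto simp: pluecker2)
next
  fix W p assume h: "\<forall>u w. lin_indep2 u w \<longrightarrow> pfaff (vol_dual 1 v) u w = 0 \<longrightarrow> f (ext_vec u \<odot> ext_vec w) = 0"
    and W: "W \<in> D_Z1 v" and p: "p \<in> pluecker 2 W"
  then obtain u w where uw: "p = ext_vec u \<odot> ext_vec w" "vec.span {u, w} = W" by (auto simp: pluecker2)
  have l: "lin_indep2 u w" using W uw span_Gr2_lin_indep2 by (auto simp: D_Z1_def)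
  then show "f p = 0" using h D_Z1_span[OF v l] W uw by blast
qed

lemma homogeneous_vanish_all:
  assumes h: "homogeneous_fun d f" and z: "\<And>u w. lin_indep2 u w \<Longrightarrow> pfaff \<Omega> u w = 0 \<Longrightarrow> f (ext_vec u \<odot> ext_vec w) = 0"
    and ne: "lin_indep2 u0 w0" "pfaff \<Omega> u0 w0 = 0"
    and p: "pfaff \<Omega> u w = 0"
  shows "f (ext_vec u \<odot> ext_vec w) = 0"
proof (cases "lin_indep2 u w")
  case False
  \<comment> \<open>This covers degree 0 too: there \<open>0 ^ d\<close> is 1 and the constant
    already vanishes at \<open>u0, w0\<close>.\<close>
  have "f (0 *s (ext_vec u0 \<odot> ext_vec w0)) = 0 ^ d * f (ext_vec u0 \<odot> ext_vec w0)"
    using h unfolding homogeneous_fun_def by blast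
  then show ?thesis using z[OF ne] False by simp
qed (use z p in blast)

text \<open>One inclusion tests the single equation \<open>pfaff_fun \<Omega>\<close>; the other is
  \<open>tangent_vanish\<close> for every equation. Another basis of the plane only multiplies
  values by a power of its determinant.\<close>

lemma tangent_space_conormal:
  assumes v: "v \<in> ext_power 4" and \<Omega>: "\<Omega> = vol_dual 1 v" and l: "lin_indep2 u w" and z: "pfaff \<Omega> u w = 0"
    and g: "lin_indep2 (grad1 \<Omega> u w) (grad2 \<Omega> u w)"
  shows "tangent_space (D_Z1 v) (vec.span {u, w}) = {A. trace (conormal_matrix (grad1 \<Omega> u w) (grad2 \<Omega> u w) u w ** A) = 0}"
proof (intro set_eqI iffI CollectI)
  have \<Omega>4: "\<Omega> \<in> ext_power 4" using star_power4[OF v] \<Omega> by simp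
  fix A assume "A \<in> tangent_space (D_Z1 v) (vec.span {u, w})"
  moreover have "\<forall>W\<in>D_Z1 v. \<forall>p\<in>pluecker 2 W. pfaff_fun \<Omega> p = 0"
    unfolding D_Z1_equation[OF v] by (simp add: pfaff_fun_wedge \<Omega>)
  ultimately have "((\<lambda>t. pfaff_fun \<Omega> (wedge_list [u + t *s (A *v u), w + t *s (A *v w)])) has_field_derivative 0) (at 0)"
    using homogeneous_pfaff_fun unfolding tangent_space_def by blast
  then have "((\<lambda>t. pfaff \<Omega> (u + t *s (A *v u)) (w + t *s (A *v w))) has_field_derivative 0) (at 0)"
    by (simp add: pfaff_fun_wedge)
  then have "bdot (grad1 \<Omega> u w) (A *v u) + bdot (grad2 \<Omega> u w) (A *v w) = 0"
    using DERIV_unique pfaff_curve_deriv[OF \<Omega>4] by blast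
  then show "trace (conormal_matrix (grad1 \<Omega> u w) (grad2 \<Omega> u w) u w ** A) = 0"
    by (simp add: trace_conormal_matrix)
next
  have \<Omega>4: "\<Omega> \<in> ext_power 4" using star_power4[OF v] \<Omega> by simp
  fix A assume "A \<in> {A. trace (conormal_matrix (grad1 \<Omega> u w) (grad2 \<Omega> u w) u w ** A) = 0}"
  then have A: "bdot (grad1 \<Omega> u w) (A *v u) + bdot (grad2 \<Omega> u w) (A *v w) = 0"
    by (simp add: trace_conormal_matrix)
  have g2: "grad2 \<Omega> u w \<noteq> 0" using g by auto
  show "A \<in> tangent_space (D_Z1 v) (vec.span {u, w})" unfolding tangent_space_def
  proof (intro CollectI allI impI)
    fix f d u' w' assume f: "homogeneous_fun d f" "\<forall>W\<in>D_Z1 v. \<forall>p\<in>pluecker 2 W. f p = 0"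
      and s: "vec.span {u', w'} = vec.span {u, w}"
    have f0: "f (ext_vec p \<odot> ext_vec q) = 0" if "pfaff \<Omega> p q = 0" for p q
      by (rule homogeneous_vanish_all[OF f(1) _ l z that]) (use f(2) in \<open>simp add: D_Z1_equation[OF v] \<Omega>\<close>)
    have pf: "polynomial_fun f" using f(1) by (simp add: homogeneous_fun_def)
    have d0: "bdot (pd1 f u w) (A *v u) + bdot (pd2 f u w) (A *v w) = 0"
      by (rule tangent_vanish[OF \<Omega>4 z g2 A pf f0])
    have der: "((\<lambda>t. f (ext_vec (u + t *s (A *v u)) \<odot> ext_vec (w + t *s (A *v w)))) has_field_derivative 0) (at 0)"
      using deriv_along_curve[OF pf, of "\<lambda>t. 0" u "A *v u" w "A *v w" 0] d0 by simp
    have l': "lin_indep2 u' w'" using s lin_indep2_Gr[OF l] span_Gr2_lin_indep2 by metis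
    have "u' \<in> vec.span {u, w}" "w' \<in> vec.span {u, w}" using s by (metis insertCI vec.span_base)+
    then obtain a b c e where h: "u' = a *s u + b *s w" "w' = c *s u + e *s w"
      using plane_basis_change[OF l l'] by blast
    have hc: "u' + t *s (A *v u') = a *s (u + t *s (A *v u)) + b *s (w + t *s (A *v w))"
      "w' + t *s (A *v w') = c *s (u + t *s (A *v u)) + e *s (w + t *s (A *v w))" for t
      by (simp_all add: h matrix_vector_right_distrib vector_scalar_commute vec.scale_right_distrib algebra_simps)
    have "f (wedge_list [u' + t *s (A *v u'), w' + t *s (A *v w')]) =
        (a * e - b * c) ^ d * f (ext_vec (u + t *s (A *v u)) \<odot> ext_vec (w + t *s (A *v w)))" for t
      unfolding wedge_list_simps ext_one_right form2_basis_change(2)[OF hc]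
      using f(1) unfolding homogeneous_fun_def by blast
    then show "((\<lambda>t. f (wedge_list [u' + t *s (A *v u'), w' + t *s (A *v w')])) has_field_derivative 0) (at 0)"
      using DERIV_cmult[OF der, of "(a * e - b * c) ^ d"] by simp
  qed
qed

lemma smooth_gr_dual_point:
  assumes v: "v \<in> ext_power 4" and \<Omega>: "\<Omega> = vol_dual 1 v" and z: "pfaff \<Omega> u w = 0"
    and g: "lin_indep2 (grad1 \<Omega> u w) (grad2 \<Omega> u w)"
  shows "gr_dual_point (D_Z1 v) (vec.span {u, w}) (orth (vec.span {grad1 \<Omega> u w, grad2 \<Omega> u w}))"
proof -
  let ?N = "conormal_matrix (grad1 \<Omega> u w) (grad2 \<Omega> u w) u w"
  have l: "lin_indep2 u w" by (rule lin_indep2_of_grad[OF g])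
  have U: "vec.span {u, w} \<in> D_Z1 v" using D_Z1_span[OF v l] z \<Omega> by simp
  have "?N *v x = 0" if x: "x \<in> vec.span {u, w}" for x
  proof -
    obtain a b where "x = a *s u + b *s w" using span2_mem[OF x] by blast
    then show ?thesis using z by (simp add: conormal_matrix_apply bdot_simps bdot_grad pol_linear pfaff_def)
  qed
  then have H: "?N \<in> Hom_quot_sub (vec.span {u, w})"
    using range_conormal_matrix[OF g, of u w] by (simp add: Hom_quot_sub_def)
  have "?N \<noteq> 0"
  proof
    assume "?N = 0"
    then have "range (\<lambda>x. ?N *v x) \<subseteq> {0}" by auto
    then have "u = 0" using range_conormal_matrix[OF g, of u w] vec.span_base[of u "{u, w}"] by auto
    then show False using l by simp
  qed
  then have "conormal_generator (D_Z1 v) (vec.span {u, w}) ?N"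
    using U H tangent_space_conormal[OF v \<Omega> l z g] by (simp add: conormal_generator_def)
  then show ?thesis unfolding gr_dual_point_def
    using range_conormal_matrix[OF g, of u w] kernel_conormal_matrix[OF l, of "grad1 \<Omega> u w" "grad2 \<Omega> u w"] by blast
qed

lemma wedge_pair_nonzero_coord:
  assumes "lin_indep2 a (b :: 'n::{finite,linorder} vsp)"
  shows "\<exists>i j. i < j \<and> (ext_vec a \<odot> ext_vec b) $ {i, j} \<noteq> 0"
proof -
  obtain K where K: "(ext_vec a \<odot> ext_vec b) $ K \<noteq> 0" using assms by (auto simp: vec_eq_iff)
  have "ext_vec a \<odot> ext_vec b \<in> ext_power (1 + 1)" by (intro ext_power_wedge ext_vec_power)
  then have "card K = 2" using K by (auto simp: ext_power_def numeral_2_eq_2)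
  then obtain i j where "K = {i, j}" "i \<noteq> j" by (meson card_2_iff)
  then show ?thesis using K by (metis insert_commute linorder_neqE)
qed

lemma poly_map_grad:
  assumes "poly_map G O'" "poly_map G a" "poly_map G b"
  shows "poly_map G (\<lambda>x. grad1 (O' x) (a x) (b x))" "poly_map G (\<lambda>x. grad2 (O' x) (a x) (b x))"
  unfolding grad1_def grad2_def using assms
  by (auto intro!: poly_map_lambda poly_alg.mult poly_alg.const poly_alg_pol poly_map_const)

lemma poly_alg_pluecker: "polynomial_fun f \<Longrightarrow> (\<lambda>x. f (ext_vec (fst x) \<odot> ext_vec (snd x))) \<in> poly_alg pair_coords"
  by (erule polynomial_fun_comp) (intro poly_map_wedge poly_map_ext_vec poly_map_pair_coords)

lemma span_basic_open:
  assumes h: "homogeneous_fun d f" and l: "lin_indep2 u w" and n: "f (ext_vec u \<odot> ext_vec w) \<noteq> 0"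
  shows "vec.span {u, w} \<in> basic_open 2 f"
proof -
  have G: "vec.span {u, w} \<in> Gr 2" by (rule lin_indep2_Gr[OF l])
  have "f q \<noteq> 0" if q: "q \<in> pluecker 2 (vec.span {u, w})" for q
  proof -
    have "ext_vec u \<odot> ext_vec w \<in> pluecker 2 (vec.span {u, w})" by (auto simp: pluecker2)
    then obtain c where "c \<noteq> 0" "q = c *s (ext_vec u \<odot> ext_vec w)" using pluecker2_scale[OF G _ q] by blast
    then show ?thesis using h n by (simp add: homogeneous_fun_def)
  qed
  then show ?thesis using G by (simp add: basic_open_def)
qed

text \<open>A minor of the gradients that is nonzero at the given smooth point cuts out an open set
  of good points. Irreducibility makes it meet every open set that meets the hypersurface.\<close>

theorem has_gr_dual_D_Z1:
  assumes v: "v \<in> ext_power 4" and \<Omega>: "\<Omega> = vol_dual 1 v" and dd: "double_disc \<Omega> u1 w1 y1 z1 \<noteq> 0"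
    and z: "pfaff \<Omega> u0 w0 = 0" and g: "lin_indep2 (grad1 \<Omega> u0 w0) (grad2 \<Omega> u0 w0)"
  shows "has_gr_dual (D_Z1 v)"
proof -
  have \<Omega>4: "\<Omega> \<in> ext_power 4" using star_power4[OF v] \<Omega> by simp
  have l0: "lin_indep2 u0 w0" by (rule lin_indep2_of_grad[OF g])
  obtain i j where ij: "i < j" "(ext_vec (grad1 \<Omega> u0 w0) \<odot> ext_vec (grad2 \<Omega> u0 w0)) $ {i, j} \<noteq> 0"
    using wedge_pair_nonzero_coord[OF g] by blast
  let ?m = "minor_fun \<Omega> i j"
  define O' where "O' = D_Z1 v \<inter> basic_open 2 ?m"
  have "openin (subtopology (zariski_Gr 2) (D_Z1 v)) O'"
    unfolding O'_def using openin_basic_open[OF homogeneous_minor_fun, of 2 \<Omega> i j] by (auto simp: openin_subtopology)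
  moreover have "D_Z1 v \<subseteq> zariski_Gr 2 closure_of O'"
  proof
    fix U assume U: "U \<in> D_Z1 v"
    then obtain u w where uw: "lin_indep2 u w" "U = vec.span {u, w}" "pfaff \<Omega> u w = 0"
      using D_Z1_obtain[OF v U] \<Omega> by metis
    show "U \<in> zariski_Gr 2 closure_of O'" unfolding in_closure_of
    proof (intro conjI allI impI)
      show "U \<in> topspace (zariski_Gr 2)" using U by (simp add: topspace_zariski_Gr D_Z1_def)
      fix T assume T: "U \<in> T \<and> openin (zariski_Gr 2) T"
      then obtain d f where f: "homogeneous_fun d f" "U \<in> basic_open 2 f" "basic_open 2 f \<subseteq> T"
        using zariski_Gr_basis by blast
      let ?F = "\<lambda>x. f (ext_vec (fst x) \<odot> ext_vec (snd x))" and ?H = "\<lambda>x. ?m (ext_vec (fst x) \<odot> ext_vec (snd x))"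
      have FH: "?F \<in> poly_alg pair_coords" "?H \<in> poly_alg pair_coords"
        using f(1) homogeneous_minor_fun by (auto simp: homogeneous_fun_def intro!: poly_alg_pluecker)
      have "?F (u, w) \<noteq> 0" using f(2) uw by (auto simp: basic_open_def pluecker2)
      moreover have "?H (u0, w0) \<noteq> 0" using ij by (simp add: minor_fun_wedge)
      ultimately have "\<exists>u w. pfaff \<Omega> u w = 0 \<and> ?F (u, w) * ?H (u, w) \<noteq> 0"
        using pfaff_irreducible[OF \<Omega>4 FH dd] uw z by blast
      then obtain u' w' where h: "pfaff \<Omega> u' w' = 0" "f (ext_vec u' \<odot> ext_vec w') \<noteq> 0" "?m (ext_vec u' \<odot> ext_vec w') \<noteq> 0"
        by auto
      have l: "lin_indep2 u' w'" using h(3) homogeneous_fun_zero[OF homogeneous_minor_fun, of \<Omega> i j] by auto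
      have "vec.span {u', w'} \<in> D_Z1 v" using D_Z1_span[OF v l] h \<Omega> by simp
      then show "\<exists>y. y \<in> O' \<and> y \<in> T"
        using span_basic_open[OF f(1) l h(2)] span_basic_open[OF homogeneous_minor_fun l h(3)] f(3)
        by (auto simp: O'_def)
    qed
  qed
  moreover have "\<exists>U'. gr_dual_point (D_Z1 v) U U'" if U: "U \<in> O'" for U
  proof -
    obtain u w where uw: "lin_indep2 u w" "U = vec.span {u, w}" "pfaff \<Omega> u w = 0"
      using D_Z1_obtain[OF v, of U] U \<Omega> unfolding O'_def by (metis IntD1)
    have "?m (ext_vec u \<odot> ext_vec w) \<noteq> 0" using U uw by (auto simp: O'_def basic_open_def pluecker2)
    then have "lin_indep2 (grad1 \<Omega> u w) (grad2 \<Omega> u w)" by (auto simp: minor_fun_wedge[OF ij(1)])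
    then show ?thesis using smooth_gr_dual_point[OF v \<Omega> uw(3)] uw(2) by blast
  qed
  moreover have "D_Z1 v \<noteq> {}" using D_Z1_span[OF v l0] z \<Omega> by auto
  moreover have "closedin (zariski_Gr 2) (D_Z1 v)"
  proof -
    have sub: "D_Z1 v \<subseteq> Gr 2" by (auto simp: D_Z1_def)
    have "Gr 2 - D_Z1 v = basic_open 2 (pfaff_fun \<Omega>)"
    proof (intro set_eqI iffI)
      fix U assume "U \<in> Gr 2 - D_Z1 v"
      then obtain u w where uw: "lin_indep2 u w" "U = vec.span {u, w}" "U \<notin> D_Z1 v" using Gr2_basis by blast
      then have "pfaff_fun \<Omega> (ext_vec u \<odot> ext_vec w) \<noteq> 0" using D_Z1_span[OF v uw(1)] by (simp add: pfaff_fun_wedge \<Omega>)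
      then show "U \<in> basic_open 2 (pfaff_fun \<Omega>)" using span_basic_open[OF homogeneous_pfaff_fun uw(1)] uw by blast
    next
      fix U assume U: "U \<in> basic_open 2 (pfaff_fun \<Omega>)"
      then obtain u w where uw: "lin_indep2 u w" "U = vec.span {u, w}" using Gr2_basis[of U] unfolding basic_open_def by blast
      then have "ext_vec u \<odot> ext_vec w \<in> pluecker 2 U" by (auto simp: pluecker2)
      then have "pfaff \<Omega> u w \<noteq> 0" using U by (auto simp: basic_open_def simp flip: pfaff_fun_wedge)
      then show "U \<in> Gr 2 - D_Z1 v" using U D_Z1_span[OF v uw(1)] uw \<Omega> by (auto simp: basic_open_def)
    qed
    then show ?thesis using openin_basic_open[OF homogeneous_pfaff_fun, of 2 \<Omega>] sub
      by (simp add: closedin_def topspace_zariski_Gr)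
  qed
  ultimately show ?thesis unfolding has_gr_dual_def by blast
qed

section \<open>The dual hypersurface\<close>

text \<open>The star of \<open>p\<close> is divisible by \<open>\<xi>1\<close> and
  \<open>\<xi>2\<close>, because they annihilate the factors of \<open>p\<close>; so it is a
  multiple of their product.\<close>

lemma pluecker6:
  fixes \<xi>1 \<xi>2 :: "8 vsp"
  assumes l: "lin_indep2 \<xi>1 \<xi>2" and p: "p \<in> pluecker 6 (orth (vec.span {\<xi>1, \<xi>2}))"
  shows "\<exists>c. c \<noteq> 0 \<and> vol_dual 1 p = c *s (ext_vec \<xi>1 \<odot> ext_vec \<xi>2)"
proof -
  let ?U = "orth (vec.span {\<xi>1, \<xi>2})"
  obtain us where us: "p = wedge_list us" "length us = 6" "vec.span (set us) = ?U"
    using p by (auto simp: pluecker_def)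
  have "?U \<in> Gr 6" using orth_Gr[OF lin_indep2_Gr[OF l]] by simp
  then have dim: "vec.dim (set us) = 6" using us(3) vec.dim_span[of "set us"] by (simp add: Gr_def)
  then have c: "card (set us) = 6"
    using vec.dim_le_card'[of "set us"] card_length[of us] us(2) by simp
  then have d: "distinct us" using us(2) by (simp add: card_distinct)
  have "vec.independent (set us)"
    using vec.card_le_dim_spanning[of "set us" "set us"] dim c vec.span_superset[of "set us"] by simp
  then have p0: "p \<noteq> 0" using us(1) wedge_list_nonzero[OF d] by simp
  have p6: "p \<in> ext_power 6" using wedge_list_power[of us] us by simp
  have b2: "vol_dual 1 p \<in> ext_power 2" using vol_dual_power[OF p6, of 1] by simp
  have pb: "p = vol_dual 1 (vol_dual 1 p)" using vol_dual_vol_dual_even[OF p6, of 1] by simp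
  have z: "ext_vec \<xi> \<odot> vol_dual 1 p = 0" if "\<xi> \<in> {\<xi>1, \<xi>2}" for \<xi>
  proof -
    have "set us \<subseteq> orth {\<xi>1, \<xi>2}" using us(3) vec.span_superset[of "set us"] by (simp add: orth_span)
    then have "contr \<xi> p = 0" unfolding us(1)
      using that by (intro contr_wedge_list_zero) (auto simp: orth_bdot)
    then have "vol_dual 1 (vol_dual 1 p \<odot> ext_vec \<xi>) = 0" by (metis pb contr_star)
    then show ?thesis by (simp add: vol_dual_eq_0 even_commute[OF b2 ext_vec_power])
  qed
  obtain \<eta> where \<eta>: "bdot \<eta> \<xi>1 = 1" using lin_indep2_solve[OF l] by (metis bdot_commute)
  have "contr \<eta> (vol_dual 1 p) \<in> ext_power 1" using ext_power_contr[of "vol_dual 1 p" 1 \<eta>] b2 by (simp add: numeral_2_eq_2)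
  then obtain y where y: "contr \<eta> (vol_dual 1 p) = ext_vec y" using ext_power_1_vec by blast
  have e: "vol_dual 1 p = ext_vec \<xi>1 \<odot> ext_vec y"
    using contr_zero_decompose[OF z \<eta>] by (simp add: y)
  have "ext_vec y \<odot> ext_vec \<xi>2 \<odot> ext_vec \<xi>1 = ext_vec \<xi>2 \<odot> ext_vec \<xi>1 \<odot> ext_vec y"
    by (metis ext_vec_anticommute ext_vec_anticommute_left minus_minus wedge_minus_right)
  then have "ext_vec y \<odot> ext_vec \<xi>2 \<odot> ext_vec \<xi>1 = 0" using z[of \<xi>2] e by simp
  then have "y \<in> vec.span {\<xi>2, \<xi>1}"
    using wedge_zero_span[of "[\<xi>2, \<xi>1]" y] l by (simp add: lin_indep2_iff insert_commute) blast
  then obtain a b where ab: "y = a *s \<xi>2 + b *s \<xi>1" using span2_mem by blast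
  have eq: "vol_dual 1 p = a *s (ext_vec \<xi>1 \<odot> ext_vec \<xi>2)"
    unfolding e ab by (simp add: ext_vec_simps wedge_simps)
  moreover have "a \<noteq> 0"
  proof
    assume "a = 0"
    then show False using eq p0 by (simp add: vol_dual_eq_0)
  qed
  ultimately show ?thesis by blast
qed

lemma pluecker_nonempty: "U \<in> Gr k \<Longrightarrow> pluecker k U \<noteq> {}"
proof -
  assume U: "U \<in> Gr k"
  then obtain B where B: "B \<subseteq> U" "vec.independent B" "U \<subseteq> vec.span B" "card B = k"
    using vec.basis_exists[of U] by (auto simp: Gr_def)
  obtain us where us: "set us = B" "distinct us"
    using finite_distinct_list[OF vec.finiteI_independent[OF B(2)]] by blast
  have "vec.span B = U" using B U by (intro subset_antisym vec.span_minimal) (auto simp: Gr_def)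
  then have "wedge_list us \<in> pluecker k U"
    unfolding pluecker_def using us B distinct_card[of us] by (intro CollectI exI[of _ us]) simp
  then show ?thesis by blast
qed

lemma homogeneous_star:
  assumes "homogeneous_fun d f"
  shows "homogeneous_fun d (\<lambda>p. f (vol_dual 1 p))"
proof -
  have "polynomial_fun f" using assms by (simp add: homogeneous_fun_def)
  then have "(\<lambda>p. f (vol_dual 1 p)) \<in> poly_alg coords"
    by (rule polynomial_fun_comp) (intro poly_map_vol_dual poly_map_id)
  then show ?thesis using assms by (simp add: homogeneous_fun_def polynomial_fun_iff vol_dual_linear)
qed

lemma orth_basic_open:
  fixes \<xi>1 \<xi>2 :: "8 vsp"
  assumes l: "lin_indep2 \<xi>1 \<xi>2" and h: "homogeneous_fun d f"
  shows "orth (vec.span {\<xi>1, \<xi>2}) \<in> basic_open 6 f \<longleftrightarrow> f (vol_dual 1 (ext_vec \<xi>1 \<odot> ext_vec \<xi>2)) \<noteq> 0"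
proof -
  let ?U = "orth (vec.span {\<xi>1, \<xi>2})" and ?q = "vol_dual 1 (ext_vec \<xi>1 \<odot> ext_vec \<xi>2)"
  have U: "?U \<in> Gr 6" using orth_Gr[OF lin_indep2_Gr[OF l]] by simp
  have e: "\<exists>c. c \<noteq> 0 \<and> p = c *s ?q" if p: "p \<in> pluecker 6 ?U" for p
  proof -
    obtain c where c: "c \<noteq> 0" "vol_dual 1 p = c *s (ext_vec \<xi>1 \<odot> ext_vec \<xi>2)" using pluecker6[OF l p] by blast
    obtain us where "p = wedge_list us" "length us = 6" using p by (auto simp: pluecker_def)
    then have "p \<in> ext_power 6" using wedge_list_power[of us] by simp
    then have "p = vol_dual 1 (vol_dual 1 p)" using vol_dual_vol_dual_even[of p 6 1] by simp
    then show ?thesis using c by (metis vol_dual_linear(2))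
  qed
  have fe: "f p \<noteq> 0 \<longleftrightarrow> f ?q \<noteq> 0" if p: "p \<in> pluecker 6 ?U" for p
    using e[OF p] h by (auto simp: homogeneous_fun_def)
  obtain p0 where "p0 \<in> pluecker 6 ?U" using pluecker_nonempty[OF U] by blast
  then show ?thesis using U fe by (auto simp: basic_open_def)
qed

lemma pfaff_scale: "pfaff (c *s \<Omega>) u w = c ^ 3 * pfaff \<Omega> u w"
  by (simp add: pfaff_def pol_def form2_def contr_simps wedge_simps power3_eq_cube)

text \<open>The star of \<open>vol_dual c v\<close> is \<open>c *s v\<close>, so the dual
  hypersurface is governed by the Pfaffian of \<open>v\<close> itself, up to the factor
  \<open>c ^ 3\<close>.\<close>

lemma D_Z1_vol_dual_span:
  assumes v: "v \<in> ext_power 4" and c: "c \<noteq> 0" and l: "lin_indep2 \<xi>1 \<xi>2"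
  shows "vec.span {\<xi>1, \<xi>2} \<in> D_Z1 (vol_dual c v) \<longleftrightarrow> pfaff v \<xi>1 \<xi>2 = 0"
  using D_Z1_span[OF star_power4[OF v, of c] l] vol_dual_vol_dual_even[OF v, of c] c by (simp add: pfaff_scale)

text \<open>A dual point may come from a place where the gradients of the Pfaffian are not known to
  be independent. Its conormal line is then given by another equation \<open>f\<close>. Where the
  gradients are independent, the differential of \<open>f\<close> is a multiple of that of the
  Pfaffian and \<open>dual_pfaff_zero\<close> applies; irreducibility extends the conclusion to all
  points.\<close>

lemma gr_dual_point_in_dual:
  assumes v: "v \<in> ext_power 4" and \<Omega>: "\<Omega> = vol_dual 1 v" and c: "c \<noteq> 0"
    and dd: "double_disc \<Omega> u1 w1 y1 z1 \<noteq> 0"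
    and z0: "pfaff \<Omega> u0 w0 = 0" and g0: "lin_indep2 (grad1 \<Omega> u0 w0) (grad2 \<Omega> u0 w0)"
    and dp: "gr_dual_point (D_Z1 v) U U'"
  shows "U' \<in> orth ` D_Z1 (vol_dual c v)"
proof -
  have \<Omega>4: "\<Omega> \<in> ext_power 4" using star_power4[OF v] \<Omega> by simp
  have l0: "lin_indep2 u0 w0" by (rule lin_indep2_of_grad[OF g0])
  obtain N where N: "conormal_generator (D_Z1 v) U N" "range (\<lambda>x. N *v x) = U" "U' = {x. N *v x = 0}"
    using dp by (auto simp: gr_dual_point_def)
  have U: "U \<in> D_Z1 v" "N \<noteq> 0" "tangent_space (D_Z1 v) U = {A. trace (N ** A) = 0}"
    using N(1) by (auto simp: conormal_generator_def)
  \<comment> \<open>An elementary matrix that pairs nontrivially with \<open>N\<close> is not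
    tangent, hence some equation \<open>f\<close> has a nonzero derivative along it.\<close>
  obtain i j where "N $ i $ j \<noteq> 0" using U(2) by (auto simp: vec_eq_iff)
  then have "(\<chi> a b. if a = j \<and> b = i then 1 else 0) \<notin> tangent_space (D_Z1 v) U"
    by (simp add: U(3) trace_mult_elementary)
  then obtain A where A: "A \<notin> tangent_space (D_Z1 v) U" by blast
  then obtain f d u w where f: "homogeneous_fun d f" "\<forall>W\<in>D_Z1 v. \<forall>p\<in>pluecker 2 W. f p = 0"
    and s: "vec.span {u, w} = U"
    and nd: "\<not> ((\<lambda>t. f (wedge_list [u + t *s (A *v u), w + t *s (A *v w)])) has_field_derivative 0) (at 0)"
    unfolding tangent_space_def by blast
  have pf: "polynomial_fun f" using f(1) by (simp add: homogeneous_fun_def)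
  have l: "lin_indep2 u w" using U(1) s span_Gr2_lin_indep2 by (auto simp: D_Z1_def)
  have z: "pfaff \<Omega> u w = 0" using D_Z1_span[OF v l] U(1) s \<Omega> by simp
  have f0: "f (ext_vec p \<odot> ext_vec q) = 0" if "pfaff \<Omega> p q = 0" for p q
    by (rule homogeneous_vanish_all[OF f(1) _ l z that]) (use f(2) in \<open>simp add: D_Z1_equation[OF v] \<Omega>\<close>)
  let ?Nf = "conormal_matrix (pd1 f u w) (pd2 f u w) u w"
  have der: "((\<lambda>t. f (wedge_list [u + t *s (B *v u), w + t *s (B *v w)])) has_field_derivative trace (?Nf ** B)) (at 0)" for B
    using deriv_along_curve[OF pf, of "\<lambda>t. 0" u "B *v u" w "B *v w" 0] by (simp add: trace_conormal_matrix)
  have tA: "trace (?Nf ** A) \<noteq> 0" using nd der[of A] by metis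
  have "trace (?Nf ** B) = 0" if "trace (N ** B) = 0" for B
  proof -
    have "B \<in> tangent_space (D_Z1 v) U" using that U(3) by blast
    then have "((\<lambda>t. f (wedge_list [u + t *s (B *v u), w + t *s (B *v w)])) has_field_derivative 0) (at 0)"
      using f s unfolding tangent_space_def by blast
    then show ?thesis using der[of B] DERIV_unique by blast
  qed
  then obtain c' where c': "\<And>i j. ?Nf $ i $ j = c' * N $ i $ j" using proportional_of_kernel[of N ?Nf] U(2) by blast
  have c'0: "c' \<noteq> 0"
  proof
    assume "c' = 0"
    then have "?Nf = 0" using c' by (simp add: vec_eq_iff)
    then show False using tA by (simp add: trace_def matrix_matrix_mult_def)
  qed
  have Nf_apply: "?Nf *v x = c' *s (N *v x)" for x
    by (simp add: vec_eq_iff matrix_vector_mult_def c' sum_distrib_left ac_simps)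
  let ?g1 = "pd1 f u w" and ?g2 = "pd2 f u w"
  \<comment> \<open>\<open>N\<close> maps onto the plane, so the two partial gradients of
    \<open>f\<close> take arbitrary values simultaneously.\<close>
  have solve: "\<exists>x. bdot ?g1 x = a \<and> bdot ?g2 x = b" for a b
  proof -
    have "(1 / c') *s (a *s u + b *s w) \<in> U" unfolding s[symmetric]
      by (intro vec.span_scale vec.span_add vec.span_base) auto
    then obtain x where "N *v x = (1 / c') *s (a *s u + b *s w)" using N(2) by (metis imageE)
    then have "bdot ?g1 x *s u + bdot ?g2 x *s w = a *s u + b *s w"
      using Nf_apply[of x] c'0 by (simp add: conormal_matrix_apply)
    then have "(bdot ?g1 x - a) *s u + (bdot ?g2 x - b) *s w = 0" by (simp add: algebra_simps)
    from lin_indep2_combo[OF l this] show ?thesis by auto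
  qed
  have lg: "lin_indep2 ?g1 ?g2"
  proof
    assume e: "ext_vec ?g1 \<odot> ext_vec ?g2 = 0"
    obtain x y where xy: "bdot ?g1 x = 1" "bdot ?g2 x = 0" "bdot ?g1 y = 0" "bdot ?g2 y = 1" using solve by meson
    have "contr y (contr x (ext_vec ?g1 \<odot> ext_vec ?g2)) = ext_one"
      by (simp add: contr_wedge contr_ext_vec xy bdot_commute[of x] bdot_commute[of y] contr_simps wedge_simps)
    then show False using e by (auto simp: ext_one_def vec_eq_iff axis_nth_if dest!: spec[of _ "{}"])
  qed
  have U'_eq: "U' = orth (vec.span {?g1, ?g2})"
    unfolding kernel_conormal_matrix[OF l, symmetric] N(3) Nf_apply using c'0 by simp
  obtain i j where ij: "i < j" "(ext_vec (grad1 \<Omega> u0 w0) \<odot> ext_vec (grad2 \<Omega> u0 w0)) $ {i, j} \<noteq> 0"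
    using wedge_pair_nonzero_coord[OF g0] by blast
  let ?H = "\<lambda>x. (ext_vec (grad1 \<Omega> (fst x) (snd x)) \<odot> ext_vec (grad2 \<Omega> (fst x) (snd x))) $ {i, j}"
  let ?P = "\<lambda>x. pfaff v (pd1 f (fst x) (snd x)) (pd2 f (fst x) (snd x))"
  have "?H \<in> poly_alg pair_coords"
    by (intro poly_map_nth poly_map_wedge poly_map_ext_vec poly_map_grad poly_map_const poly_map_pair_coords)
  moreover have "?P \<in> poly_alg pair_coords"
    by (intro poly_alg_pfaff poly_map_const poly_map_pd pf)
  \<comment> \<open>A nonzero minor forces both partial gradients of \<open>f\<close> to be the same
    multiple \<open>e\<close> of those of the Pfaffian, so \<open>?P\<close> is \<open>e ^ 4\<close>
    times a vanishing quantity.\<close>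
  moreover have "?P (p, q) * ?H (p, q) = 0" if pq: "pfaff \<Omega> p q = 0" for p q
  proof (rule ccontr)
    assume "?P (p, q) * ?H (p, q) \<noteq> 0"
    then have n: "pfaff v (pd1 f p q) (pd2 f p q) \<noteq> 0" and g: "lin_indep2 (grad1 \<Omega> p q) (grad2 \<Omega> p q)" by auto
    have lpq: "lin_indep2 p q" by (rule lin_indep2_of_grad[OF g])
    let ?M = "conormal_matrix (grad1 \<Omega> p q) (grad2 \<Omega> p q) p q" and ?Mf = "conormal_matrix (pd1 f p q) (pd2 f p q) p q"
    have g2: "grad2 \<Omega> p q \<noteq> 0" using g by auto
    have "trace (?Mf ** B) = 0" if "trace (?M ** B) = 0" for B
      using tangent_vanish[OF \<Omega>4 pq g2 _ pf f0, of "B *v p" "B *v q"] that by (simp add: trace_conormal_matrix)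
    moreover have "?M \<noteq> 0"
    proof
      assume "?M = 0"
      then have "range (\<lambda>x. ?M *v x) \<subseteq> {0}" by auto
      then have "p = 0" using range_conormal_matrix[OF g, of p q] vec.span_base[of p "{p, q}"] by auto
      then show False using lpq by simp
    qed
    ultimately obtain e where e: "\<And>i j. ?Mf $ i $ j = e * ?M $ i $ j" using proportional_of_kernel by blast
    have "?Mf *v x = e *s (?M *v x)" for x
      by (simp add: vec_eq_iff matrix_vector_mult_def e sum_distrib_left ac_simps)
    then have "(bdot (pd1 f p q) x - e * bdot (grad1 \<Omega> p q) x) *s p + (bdot (pd2 f p q) x - e * bdot (grad2 \<Omega> p q) x) *s q = 0" for x
      by (simp add: conormal_matrix_apply algebra_simps)
    from lin_indep2_combo[OF lpq this]
    have "bdot (pd1 f p q) x = e * bdot (grad1 \<Omega> p q) x" "bdot (pd2 f p q) x = e * bdot (grad2 \<Omega> p q) x" for x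
      by simp_all
    then have "pd1 f p q = e *s grad1 \<Omega> p q" "pd2 f p q = e *s grad2 \<Omega> p q"
      by (auto intro!: bdot_eqI simp: bdot_scale_left)
    then have "pfaff v (pd1 f p q) (pd2 f p q) = e ^ 4 * pfaff v (grad1 \<Omega> p q) (grad2 \<Omega> p q)"
      by (simp add: pfaff_def pol_linear power4_eq_xxxx)
    moreover have "pfaff v (grad1 \<Omega> p q) (grad2 \<Omega> p q) = 0"
      using dual_pfaff_zero[OF \<Omega>4 pq g] star_star4[OF v] \<Omega> by simp
    ultimately show False using n by simp
  qed
  ultimately have "(\<forall>u w. pfaff \<Omega> u w = 0 \<longrightarrow> ?P (u, w) = 0) \<or> (\<forall>u w. pfaff \<Omega> u w = 0 \<longrightarrow> ?H (u, w) = 0)"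
    using pfaff_irreducible[OF \<Omega>4, of ?P ?H] dd by blast
  moreover have "?H (u0, w0) \<noteq> 0" using ij by simp
  ultimately have "?P (u, w) = 0" using z0 z by blast
  then have "vec.span {?g1, ?g2} \<in> D_Z1 (vol_dual c v)" using D_Z1_vol_dual_span[OF v c lg] by simp
  then show ?thesis using U'_eq by blast
qed

text \<open>The right side is closed and contains all dual points. For density, take a point of the
  dual hypersurface where the minor of the second gradients is nonzero: its gradient plane is a
  smooth point of the original, with dual point the given one by \<open>double_dual_plane\<close>.
  Irreducibility for \<open>v\<close> supplies enough such points.\<close>

theorem gr_dual_D_Z1:
  fixes v :: "8 ext"
  assumes v: "v \<in> ext_power 4" and \<Omega>: "\<Omega> = vol_dual 1 v" and c: "c \<noteq> 0"
    and dd: "double_disc \<Omega> u1 w1 y1 z1 \<noteq> 0" and ddv: "double_disc v u2 w2 y2 z2 \<noteq> 0"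
    and z: "pfaff v \<xi>1 \<xi>2 = 0"
    and g: "lin_indep2 (grad1 \<Omega> (grad1 v \<xi>1 \<xi>2) (grad2 v \<xi>1 \<xi>2)) (grad2 \<Omega> (grad1 v \<xi>1 \<xi>2) (grad2 v \<xi>1 \<xi>2))"
  shows "has_gr_dual (D_Z1 v)" "gr_dual (D_Z1 v) = orth ` D_Z1 (vol_dual c v)"
proof -
  have \<Omega>4: "\<Omega> \<in> ext_power 4" using star_power4[OF v] \<Omega> by simp
  have la: "lin_indep2 (grad1 v \<xi>1 \<xi>2) (grad2 v \<xi>1 \<xi>2)" by (rule lin_indep2_of_grad[OF g])
  have za: "pfaff \<Omega> (grad1 v \<xi>1 \<xi>2) (grad2 v \<xi>1 \<xi>2) = 0" using dual_pfaff_zero[OF v z la] \<Omega> by simp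
  show "has_gr_dual (D_Z1 v)" by (rule has_gr_dual_D_Z1[OF v \<Omega> dd za g])
  let ?S = "{U'. \<exists>U. gr_dual_point (D_Z1 v) U U'}" and ?E = "orth ` D_Z1 (vol_dual c v)"
  have SE: "?S \<subseteq> ?E" using gr_dual_point_in_dual[OF v \<Omega> c dd za g] by blast
  have vd4: "vol_dual c v \<in> ext_power 4" by (rule star_power4[OF v])
  have E_repr: "\<exists>\<xi>1 \<xi>2. lin_indep2 \<xi>1 \<xi>2 \<and> pfaff v \<xi>1 \<xi>2 = 0 \<and> W = orth (vec.span {\<xi>1, \<xi>2})" if "W \<in> ?E" for W
  proof -
    obtain U where U: "U \<in> D_Z1 (vol_dual c v)" "W = orth U" using \<open>W \<in> ?E\<close> by blast
    obtain p q where "lin_indep2 p q" "U = vec.span {p, q}" using U(1) Gr2_basis[of U] unfolding D_Z1_def by blast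
    then show ?thesis using U D_Z1_vol_dual_span[OF v c] by blast
  qed
  have EGr: "?E \<subseteq> Gr 6"
    using E_repr orth_Gr[OF lin_indep2_Gr] by fastforce
  let ?f = "\<lambda>p. pfaff_fun v (vol_dual 1 p)"
  note hf = homogeneous_star[OF homogeneous_pfaff_fun, of v]
  have two: "ext_vec a \<odot> ext_vec b \<in> ext_power 2" for a b :: "8 vsp"
    using ext_power_wedge[OF ext_vec_power ext_vec_power, of a b] by (simp add: numeral_2_eq_2)
  have ss: "vol_dual 1 (vol_dual 1 (ext_vec a \<odot> ext_vec b)) = ext_vec a \<odot> ext_vec b" for a b :: "8 vsp"
    using vol_dual_vol_dual_even[OF two, of 1] by simp
  have "Gr 6 - ?E = basic_open 6 ?f"
  proof (intro set_eqI)
    fix W :: "8 vsp set"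
    show "W \<in> Gr 6 - ?E \<longleftrightarrow> W \<in> basic_open 6 ?f"
    proof (cases "W \<in> Gr 6")
      case True
      have "orth W \<in> Gr 2" using orth_Gr[OF True] by simp
      then obtain p q where pq: "lin_indep2 p q" "orth W = vec.span {p, q}" using Gr2_basis by blast
      have W: "W = orth (vec.span {p, q})" using True pq(2)[symmetric] by (simp add: Gr_def orth_orth)
      have inj: "orth U = W \<Longrightarrow> U = vec.span {p, q}" if "U \<in> D_Z1 (vol_dual c v)" for U
        using that pq(2) by (metis (mono_tags, lifting) D_Z1_def Gr_def mem_Collect_eq orth_orth)
      have "W \<in> ?E \<longleftrightarrow> pfaff v p q = 0"
        using W inj D_Z1_vol_dual_span[OF v c pq(1)] by blast
      then show ?thesis using orth_basic_open[OF pq(1) hf] W True by (simp add: ss pfaff_fun_wedge)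
    qed (simp add: basic_open_def)
  qed
  then have "closedin (zariski_Gr 6) ?E"
    using openin_basic_open[OF hf, of 6] EGr by (simp add: closedin_def topspace_zariski_Gr)
  then have "zariski_Gr 6 closure_of ?S \<subseteq> ?E" using SE by (intro closure_of_minimal)
  moreover have "?E \<subseteq> zariski_Gr 6 closure_of ?S"
  proof
    fix W assume W: "W \<in> ?E"
    obtain p q where pq: "lin_indep2 p q" "pfaff v p q = 0" "W = orth (vec.span {p, q})" using E_repr[OF W] by blast
    show "W \<in> zariski_Gr 6 closure_of ?S" unfolding in_closure_of
    proof (intro conjI allI impI)
      show "W \<in> topspace (zariski_Gr 6)" using W EGr by (auto simp: topspace_zariski_Gr)
      fix T assume T: "W \<in> T \<and> openin (zariski_Gr 6) T"
      then obtain d f where f: "homogeneous_fun d f" "W \<in> basic_open 6 f" "basic_open 6 f \<subseteq> T"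
        using zariski_Gr_basis by blast
      let ?a1 = "\<lambda>x. grad1 v (fst x) (snd x)" and ?a2 = "\<lambda>x. grad2 v (fst x) (snd x)"
      obtain i j where ij: "(ext_vec (grad1 \<Omega> (?a1 (\<xi>1, \<xi>2)) (?a2 (\<xi>1, \<xi>2))) \<odot>
          ext_vec (grad2 \<Omega> (?a1 (\<xi>1, \<xi>2)) (?a2 (\<xi>1, \<xi>2)))) $ {i, j} \<noteq> 0"
        using wedge_pair_nonzero_coord[OF g] by auto
      let ?H = "\<lambda>x. (ext_vec (grad1 \<Omega> (?a1 x) (?a2 x)) \<odot> ext_vec (grad2 \<Omega> (?a1 x) (?a2 x))) $ {i, j}"
      let ?F = "\<lambda>x. f (vol_dual 1 (ext_vec (fst x) \<odot> ext_vec (snd x)))"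
      have "?H \<in> poly_alg pair_coords"
        by (intro poly_map_nth poly_map_wedge poly_map_ext_vec poly_map_grad poly_map_const poly_map_pair_coords)
      moreover have "?F \<in> poly_alg pair_coords"
        using f(1) by (intro polynomial_fun_comp[of f] poly_map_vol_dual poly_map_wedge poly_map_ext_vec poly_map_pair_coords)
          (simp add: homogeneous_fun_def)
      moreover have "?F (p, q) \<noteq> 0" using f(2) orth_basic_open[OF pq(1) f(1)] pq(3) by simp
      moreover have "?H (\<xi>1, \<xi>2) \<noteq> 0" using ij by simp
      ultimately have "\<exists>p q. pfaff v p q = 0 \<and> ?F (p, q) * ?H (p, q) \<noteq> 0"
        using pfaff_irreducible[OF v, of ?F ?H] ddv pq(2) z by blast
      then obtain p' q' where h: "pfaff v p' q' = 0" "?F (p', q') \<noteq> 0" "?H (p', q') \<noteq> 0" by auto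
      define a1 where "a1 = grad1 v p' q'" define a2 where "a2 = grad2 v p' q'"
      have lb: "lin_indep2 (grad1 \<Omega> a1 a2) (grad2 \<Omega> a1 a2)" using h(3) by (auto simp: a1_def a2_def)
      have la': "lin_indep2 a1 a2" by (rule lin_indep2_of_grad[OF lb])
      have lp: "lin_indep2 p' q'" using la' unfolding a1_def a2_def by (rule lin_indep2_of_grad)
      have s: "vec.span {grad1 \<Omega> a1 a2, grad2 \<Omega> a1 a2} = vec.span {p', q'}"
        using double_dual_plane[OF v h(1) lp a1_def a2_def la'] lb \<Omega> by simp
      have za': "pfaff \<Omega> a1 a2 = 0" using dual_pfaff_zero[OF v h(1)] la' \<Omega> by (simp add: a1_def a2_def)
      have "orth (vec.span {p', q'}) \<in> ?S" using smooth_gr_dual_point[OF v \<Omega> za' lb] s by auto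
      moreover have "orth (vec.span {p', q'}) \<in> T" using orth_basic_open[OF lp f(1)] h(2) f(3) by auto
      ultimately show "\<exists>y. y \<in> ?S \<and> y \<in> T" by blast
    qed
  qed
  ultimately show "gr_dual (D_Z1 v) = ?E" by (simp add: gr_dual_def)
qed

section \<open>Action of linear maps on the exterior algebra\<close>

text \<open>The increasing order matches the convention for \<open>e_I\<close>, so
  \<open>ext_map\<close> sends \<open>e_I\<close> to the product of the images without a
  sign.\<close>

definition sorted_wedge :: "('n::{finite,linorder} \<Rightarrow> 'n vsp) \<Rightarrow> 'n set \<Rightarrow> 'n ext" where
  "sorted_wedge x I = wedge_list (map x (sorted_list_of_set I))"

definition ext_map :: "'n::{finite,linorder} endo \<Rightarrow> 'n ext \<Rightarrow> 'n ext" where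
  "ext_map k a = (\<Sum>I\<in>UNIV. a $ I *s sorted_wedge (\<lambda>i. k *v basis_vec i) I)"

lemma sorted_wedge_insert_min:
  assumes "\<And>j. j \<in> J \<Longrightarrow> i < j"
  shows "sorted_wedge x (insert i J) = ext_vec (x i) \<odot> sorted_wedge x J"
proof -
  have "i \<notin> J" using assms by blast
  moreover have "insort i (sorted_list_of_set J) = i # sorted_list_of_set J"
    by (rule insort_is_Cons) (use assms in \<open>auto intro: less_imp_le\<close>)
  ultimately show ?thesis by (simp add: sorted_wedge_def sorted_list_of_set_insert_remove)
qed

lemma wedge_sorted_wedge_in: "i \<in> J \<Longrightarrow> ext_vec (x i) \<odot> sorted_wedge x J = 0"
  unfolding sorted_wedge_def by (rule wedge_span_zero) (auto intro: vec.span_base)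

text \<open>The new factor moves right to its sorted place and changes sign once for each smaller
  index.\<close>

lemma wedge_sorted_wedge:
  assumes "i \<notin> J"
  shows "ext_vec (x i) \<odot> sorted_wedge x J = shuffle_sign {i} J *s sorted_wedge x (insert i J)"
  using finite[of J] assms
proof (induction J rule: finite_linorder_min_induct)
  case empty
  show ?case using sorted_wedge_insert_min[of "{}" i x] by simp
next
  case (insert j J)
  show ?case
  proof (cases "i < j")
    case True
    have lt: "\<And>l. l \<in> insert j J \<Longrightarrow> i < l" using True insert.hyps by auto
    then have "{(i', l). i' \<in> {i} \<and> l \<in> insert j J \<and> l < i'} = {}" by fastforce
    then have "shuffle_sign {i} (insert j J) = 1" unfolding shuffle_sign_def by (simp only: card.empty power_0)
    then show ?thesis using sorted_wedge_insert_min[of "insert j J" i x, OF lt] by simp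
  next
    case False
    then have ji: "j < i" using insert.prems by auto
    have jJ: "j \<notin> J" "i \<notin> J" using insert by auto
    have s: "shuffle_sign {i} (insert j J) = - shuffle_sign {i} J"
      using shuffle_sign_insert_right[of j J "{i}"] jJ ji by (simp add: shuffle_sign_singletons)
    have "ext_vec (x i) \<odot> sorted_wedge x (insert j J) = - (ext_vec (x j) \<odot> ext_vec (x i) \<odot> sorted_wedge x J)"
      using sorted_wedge_insert_min[of J j x] insert.hyps ext_vec_anticommute_left by auto
    also have "\<dots> = - (shuffle_sign {i} J *s (ext_vec (x j) \<odot> sorted_wedge x (insert i J)))"
      by (simp add: insert.IH[OF jJ(2)] wedge_simps)
    also have "ext_vec (x j) \<odot> sorted_wedge x (insert i J) = sorted_wedge x (insert j (insert i J))"
    proof -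
      have lt: "\<And>l. l \<in> insert i J \<Longrightarrow> j < l" using insert.hyps ji by auto
      show ?thesis using sorted_wedge_insert_min[of "insert i J" j x, OF lt] by simp
    qed
    finally show ?thesis by (simp add: s insert_commute vec.scale_minus_left)
  qed
qed

lemma ext_map_linear: "ext_map k (a + b) = ext_map k a + ext_map k b"
  "ext_map k (c *s a) = c *s ext_map k a" "ext_map k (a - b) = ext_map k a - ext_map k b" "ext_map k 0 = 0"
  by (simp_all add: ext_map_def vec_eq_iff sum.distrib sum_subtractf algebra_simps sum_distrib_left)

lemma ext_map_axis: "ext_map k (axis J 1) = sorted_wedge (\<lambda>i. k *v basis_vec i) J"
proof -
  have "ext_map k (axis J 1) = (\<Sum>I\<in>UNIV. if I = J then sorted_wedge (\<lambda>i. k *v basis_vec i) J else 0)"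
    unfolding ext_map_def by (intro sum.cong) (auto simp: axis_nth_if)
  then show ?thesis by simp
qed

lemma basis_wedge_axis:
  "ext_vec (basis_vec i) \<odot> axis J 1 = (if i \<in> J then 0 else shuffle_sign {i} J *s axis (insert i J) 1)"
proof (rule vec_eq_iff[THEN iffD2], rule allI)
  fix K
  show "(ext_vec (basis_vec i) \<odot> axis J 1) $ K = (if i \<in> J then 0 else shuffle_sign {i} J *s axis (insert i J) 1) $ K"
  proof (cases "i \<in> K \<and> K - {i} = J")
    case True
    then show ?thesis by (auto simp: basis_vec_wedge axis_nth_if insert_absorb)
  next
    case False
    then have "K \<noteq> insert i J \<or> i \<in> J" by auto
    then show ?thesis using False by (auto simp: basis_vec_wedge axis_nth_if)
  qed
qed

lemma ext_map_wedge_basis: "ext_map k (ext_vec (basis_vec i) \<odot> a) = ext_vec (k *v basis_vec i) \<odot> ext_map k a"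
proof -
  have 1: "ext_map k (ext_vec (basis_vec i) \<odot> axis J 1) = ext_vec (k *v basis_vec i) \<odot> ext_map k (axis J 1)" for J
    using wedge_sorted_wedge_in[of i J "\<lambda>i. k *v basis_vec i"] wedge_sorted_wedge[of i J "\<lambda>i. k *v basis_vec i"]
    by (simp add: basis_wedge_axis ext_map_linear ext_map_axis)
  have "ext_map k (ext_vec (basis_vec i) \<odot> (\<Sum>J\<in>S. a $ J *s axis J 1)) =
      ext_vec (k *v basis_vec i) \<odot> ext_map k (\<Sum>J\<in>S. a $ J *s axis J 1)" if "finite S" for S
    using that by (induction S rule: finite_induct) (auto simp: ext_map_linear wedge_simps 1)
  from this[of UNIV] show ?thesis by (simp add: basis_expansion)
qed

lemma ext_map_wedge_vec: "ext_map k (ext_vec y \<odot> a) = ext_vec (k *v y) \<odot> ext_map k a"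
proof -
  have "ext_map k (ext_vec (\<Sum>i\<in>S. y $ i *s basis_vec i) \<odot> a) =
      ext_vec (k *v (\<Sum>i\<in>S. y $ i *s basis_vec i)) \<odot> ext_map k a" if "finite S" for S
    using that by (induction S rule: finite_induct)
      (auto simp: ext_map_linear wedge_simps ext_vec_simps ext_map_wedge_basis matrix_vector_right_distrib vector_scalar_commute)
  from this[of UNIV] show ?thesis by (simp add: basis_expansion)
qed

lemma ext_map_one [simp]: "ext_map k ext_one = ext_one"
  unfolding ext_one_def ext_map_axis by (simp add: sorted_wedge_def ext_one_def)

lemma ext_map_wedge: "ext_map k (a \<odot> b) = ext_map k a \<odot> ext_map k b"
  by (induction a rule: ext_induct) (simp_all add: wedge_simps ext_map_linear wedge_assoc ext_map_wedge_vec)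

lemma ext_map_vec: "ext_map k (ext_vec y) = ext_vec (k *v y)"
  using ext_map_wedge_vec[of k y ext_one] by simp

lemma ext_map_compose: "ext_map (k ** l) a = ext_map k (ext_map l a)"
  by (induction a rule: ext_induct) (simp_all add: ext_map_linear ext_map_wedge_vec matrix_vector_mul_assoc)

lemma ext_map_id [simp]: "ext_map (mat 1) a = a"
  by (induction a rule: ext_induct) (simp_all add: ext_map_linear ext_map_wedge_vec)

lemma ext_map_power:
  assumes "a \<in> ext_power d"
  shows "ext_map k a \<in> ext_power d"
proof -
  have "sorted_wedge x I \<in> ext_power (card I)" for x :: "'a \<Rightarrow> 'a vsp" and I
    using wedge_list_power[of "map x (sorted_list_of_set I)"] by (simp add: sorted_wedge_def)
  then have "a $ I *s sorted_wedge x I \<in> ext_power d" for x I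
    using assms by (cases "card I = d") (auto simp: ext_power_def)
  then have "(\<Sum>I\<in>S. a $ I *s sorted_wedge x I) \<in> ext_power d" for x S
    by (induction S rule: infinite_finite_induct) (auto intro: ext_power_closed)
  then show ?thesis by (simp add: ext_map_def)
qed

lemma contr_ext_map: "contr \<xi> (ext_map k b) = ext_map k (contr (transpose k *v \<xi>) b)"
proof (induction b rule: ext_induct)
  case (wedge i b)
  have "bdot (transpose k *v \<xi>) (basis_vec i) = bdot \<xi> (k *v basis_vec i)"
    using bdot_matrix[of k "basis_vec i" \<xi>] by (simp only: bdot_commute)
  then show ?case using wedge by (simp only: ext_map_wedge_vec contr_wedge ext_map_linear)
qed (simp_all add: ext_map_linear contr_simps)

lemma bdot_ext_map: "bdot (ext_map (transpose k) a) b = bdot a (ext_map k b)"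
proof (induction a arbitrary: b rule: ext_induct)
  case one
  have "ext_map k c $ {} = c $ {}" for c
  proof (induction c rule: ext_induct)
    case (wedge i c)
    have "(ext_vec x \<odot> y) $ {} = 0" for x :: "'a vsp" and y
      by (simp add: wedge_nth ext_vec_nth_zero)
    then show ?case by (simp add: ext_map_wedge_vec)
  qed (simp_all add: ext_map_linear)
  then show ?case unfolding ext_map_one by (simp add: ext_one_def)
next
  case (wedge i a)
  have "bdot (ext_map (transpose k) (ext_vec (basis_vec i) \<odot> a)) b = bdot a (ext_map k (contr (transpose k *v basis_vec i) b))"
    unfolding ext_map_wedge_vec bdot_wedge wedge ..
  then show ?case by (simp only: bdot_wedge contr_ext_map)
qed (simp_all add: ext_map_linear bdot_simps)

text \<open>The determinant as the action on the top degree, which makes multiplicativity immediate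
  and needs no comparison with \<open>det\<close>.\<close>

definition ext_det :: "'n::{finite,linorder} endo \<Rightarrow> complex" where
  "ext_det k = ext_map k (axis UNIV 1) $ UNIV"

lemma ext_map_top: "ext_map k a $ UNIV = ext_det k * a $ UNIV"
proof -
  have z: "sorted_wedge x I $ UNIV = 0" if "I \<noteq> UNIV" for x :: "'a \<Rightarrow> 'a vsp" and I
  proof -
    have "card I \<noteq> CARD('a)" using that card_eq_UNIV_imp_eq_UNIV[of I] by auto
    then show ?thesis using wedge_list_power[of "map x (sorted_list_of_set I)"]
      by (simp add: sorted_wedge_def ext_power_def)
  qed
  have "ext_map k a $ UNIV = (\<Sum>I :: 'a set \<in> UNIV. if I = UNIV then a $ UNIV * sorted_wedge (\<lambda>i. k *v basis_vec i) UNIV $ UNIV else 0)"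
    unfolding ext_map_def sum_component by (intro sum.cong) (auto simp: z)
  then show ?thesis by (simp add: ext_det_def ext_map_axis)
qed

lemma ext_det_mult: "ext_det (k ** l) = ext_det k * ext_det l"
  unfolding ext_det_def[of "k ** l"] ext_map_compose ext_map_top by simp

lemma ext_det_id: "ext_det (mat 1) = 1"
  by (simp add: ext_det_def)

lemma ext_det_nonzero: "k ** l = mat 1 \<Longrightarrow> ext_det k \<noteq> 0"
  by (metis ext_det_mult ext_det_id mult_zero_left zero_neq_one)

text \<open>The star intertwines the action of \<open>k\<close> with the contragredient action, up
  to the determinant: adjointness turns the claim into multiplicativity of \<open>ext_map\<close> on
  top forms.\<close>

lemma star_ext_map: "ext_map (transpose k) (vol_dual 1 (ext_map k v)) = ext_det k *s vol_dual 1 v"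
proof (rule bdot_eqI)
  fix x
  show "bdot (ext_map (transpose k) (vol_dual 1 (ext_map k v))) x = bdot (ext_det k *s vol_dual 1 v) x"
    by (simp add: bdot_ext_map bdot_star bdot_scale_left ext_map_top flip: ext_map_wedge)
qed

lemma pfaff_ext_map: "pfaff (ext_map m \<Omega>) u w = ext_det m * pfaff \<Omega> (transpose m *v u) (transpose m *v w)"
  by (simp add: pfaff_def pol_def form2_def contr_ext_map ext_map_top flip: ext_map_wedge)

text \<open>Both Pfaffians reduce to that of \<open>x\<close>: for the star of \<open>v\<close>
  after applying \<open>k'\<close> to the vectors, for \<open>v\<close> after applying
  \<open>transpose k\<close>. So \<open>m\<close> has to satisfy
  \<open>transpose k ** m = k'\<close>.\<close>

lemma pfaff_self_dual:
  assumes k: "k ** k' = mat 1" "k' ** k = mat 1" and x: "vol_dual 1 x = x" and v: "v = ext_map k x"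
    and m: "m = transpose k' ** k'"
  shows "pfaff (vol_dual 1 v) u w = 0 \<longleftrightarrow> pfaff v (m *v u) (m *v w) = 0"
proof -
  have d: "ext_det k \<noteq> 0" by (rule ext_det_nonzero[OF k(1)])
  have t: "transpose k ** transpose k' = mat 1" using arg_cong[OF k(2), of transpose]
    by (simp add: matrix_transpose_mul transpose_mat)
  then have dt: "ext_det (transpose k) \<noteq> 0" by (rule ext_det_nonzero)
  have "ext_det (transpose k) * pfaff (vol_dual 1 v) (k *v (k' *v u)) (k *v (k' *v w)) =
      pfaff (ext_map (transpose k) (vol_dual 1 v)) (k' *v u) (k' *v w)" by (simp add: pfaff_ext_map)
  also have "\<dots> = ext_det k ^ 3 * pfaff x (k' *v u) (k' *v w)"
    unfolding v star_ext_map x pfaff_scale ..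
  finally have 1: "pfaff (vol_dual 1 v) u w = 0 \<longleftrightarrow> pfaff x (k' *v u) (k' *v w) = 0"
    using d dt unfolding matrix_vector_mul_assoc k matrix_vector_mul_lid
    by (metis mult_eq_0_iff power_eq_0_iff)
  have "pfaff v (m *v u) (m *v w) = ext_det k * pfaff x (k' *v u) (k' *v w)"
    unfolding v pfaff_ext_map m matrix_vector_mul_assoc matrix_mul_assoc t by simp
  then show ?thesis using 1 d by simp
qed

lemma span_image_matrix: "vec.span {m *v u, m *v w} = (*v) m ` vec.span {u, w}"
proof -
  have "vec.span ((*v) m ` {u, w}) = (*v) m ` vec.span {u, w}"
    using matrix_vector_mul_linear_gen[of m] by (rule vec.linear_span_image)
  then show ?thesis by simp
qed

lemma lin_indep2_matrix:
  fixes m m' :: "'n::{finite,linorder} endo"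
  assumes "m' ** m = mat 1" "lin_indep2 u w"
  shows "lin_indep2 (m *v u) (m *v w)"
proof
  assume "ext_vec (m *v u) \<odot> ext_vec (m *v w) = 0"
  then have "ext_map m' (ext_map m (ext_vec u \<odot> ext_vec w)) = 0"
    by (simp add: ext_map_wedge_vec ext_map_vec ext_map_linear)
  then show False using assms by (simp flip: ext_map_compose)
qed

lemma regular_map_linear:
  fixes m m' :: "'n::{finite,linorder} endo"
  assumes m: "m' ** m = mat 1" and X: "X \<subseteq> Gr 2" and im: "\<And>U. U \<in> X \<Longrightarrow> (*v) m ` U \<in> Y"
  shows "regular_map 2 X 2 Y (\<lambda>U. (*v) m ` U)"
  unfolding regular_map_def
proof (intro conjI ballI exI[of _ 1] exI[of _ "ext_map m"] allI impI)
  show "(\<lambda>U. (*v) m ` U) ` X \<subseteq> Y" using im by blast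
  fix U assume U: "U \<in> X"
  show "homogeneous_fun 1 (\<lambda>p. ext_map m p $ I)" for I
  proof -
    have "poly_map coords (\<lambda>p. ext_map m p)" unfolding ext_map_def
      by (intro poly_map_sum poly_map_scale poly_map_const poly_map_nth[OF poly_map_id])
    then show ?thesis by (simp add: homogeneous_fun_def polynomial_fun_iff poly_map_def ext_map_linear)
  qed
  fix p assume p: "p \<in> pluecker 2 U"
  then obtain u w where uw: "p = ext_vec u \<odot> ext_vec w" "vec.span {u, w} = U" by (auto simp: pluecker2)
  then have "lin_indep2 u w" using U X span_Gr2_lin_indep2 by blast
  from lin_indep2_matrix[OF m this] show "ext_map m p \<noteq> 0" by (simp add: uw ext_map_wedge_vec ext_map_vec)
next
  fix U' p assume U: "U' \<in> X" and p: "p \<in> pluecker 2 U'"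
  then obtain u w where uw: "p = ext_vec u \<odot> ext_vec w" "vec.span {u, w} = U'" by (auto simp: pluecker2)
  then show "ext_map m p \<in> pluecker 2 ((*v) m ` U')"
    unfolding pluecker2 using span_image_matrix[of m u w]
    by (intro CollectI exI[of _ "m *v u"] exI[of _ "m *v w"]) (simp add: ext_map_wedge_vec ext_map_vec)
qed

theorem isomorphic_of_self_dual:
  assumes k: "k ** k' = mat 1" "k' ** k = mat 1" and x: "x \<in> ext_power 4" "vol_dual 1 x = x"
    and v: "v = ext_map k x" and c: "c \<noteq> 0"
  shows "isomorphic_varieties 2 (D_Z1 v) 2 (D_Z1 (vol_dual c v))"
proof -
  define m where "m = transpose k' ** k'"
  define m' where "m' = k ** transpose k"
  have v4: "v \<in> ext_power 4" using ext_map_power[OF x(1)] v by simp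
  have t: "transpose k ** transpose k' = mat 1" "transpose k' ** transpose k = mat 1"
    using arg_cong[OF k(2), of transpose] arg_cong[OF k(1), of transpose]
    by (simp_all add: matrix_transpose_mul transpose_mat)
  have mm: "m' ** m = mat 1"
  proof -
    have "m' ** m = k ** (transpose k ** transpose k') ** k'" by (simp add: m_def m'_def matrix_mul_assoc)
    then show ?thesis by (simp add: t k)
  qed
  have mm': "m ** m' = mat 1"
  proof -
    have "m ** m' = transpose k' ** (k' ** k) ** transpose k" by (simp add: m_def m'_def matrix_mul_assoc)
    then show ?thesis by (simp add: t k)
  qed
  note eq = pfaff_self_dual[OF k x(2) v m_def]
  have inv: "(*v) m' ` (*v) m ` U = U" "(*v) m ` (*v) m' ` U = U" for U
    by (simp_all add: image_image matrix_vector_mul_assoc mm mm')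
  have im: "(*v) m ` U \<in> D_Z1 (vol_dual c v)" if U: "U \<in> D_Z1 v" for U
  proof -
    obtain u w where uw: "lin_indep2 u w" "U = vec.span {u, w}" "pfaff (vol_dual 1 v) u w = 0"
      by (rule D_Z1_obtain[OF v4 U])
    then show ?thesis
      using D_Z1_vol_dual_span[OF v4 c lin_indep2_matrix[OF mm uw(1)]] eq[of u w] span_image_matrix[of m u w] by simp
  qed
  have im': "(*v) m' ` U \<in> D_Z1 v" if U: "U \<in> D_Z1 (vol_dual c v)" for U
  proof -
    have "U \<in> Gr 2" using U by (simp add: D_Z1_def)
    then obtain p q where pq: "lin_indep2 p q" "U = vec.span {p, q}" using Gr2_basis by blast
    then have "pfaff v p q = 0" using U D_Z1_vol_dual_span[OF v4 c pq(1)] by simp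
    then have "pfaff (vol_dual 1 v) (m' *v p) (m' *v q) = 0"
      using eq[of "m' *v p" "m' *v q"] by (simp add: matrix_vector_mul_assoc mm')
    then show ?thesis
      using D_Z1_span[OF v4 lin_indep2_matrix[OF mm' pq(1)]] span_image_matrix[of m' p q] pq by simp
  qed
  have sub: "D_Z1 w \<subseteq> Gr 2" for w by (auto simp: D_Z1_def)
  show ?thesis unfolding isomorphic_varieties_def
    using regular_map_linear[OF mm sub im] regular_map_linear[OF mm' sub im'] inv by blast
qed

section \<open>The infinitesimal action and conjugacy to a Cartan subspace\<close>

text \<open>The derivation extending \<open>X\<close>, which is the derivative of the action
  \<open>ext_map\<close> at the identity.\<close>

definition lie :: "'n::{finite,linorder} endo \<Rightarrow> 'n ext \<Rightarrow> 'n ext" where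
  "lie X a = (\<Sum>j\<in>UNIV. ext_vec (X *v basis_vec j) \<odot> contr (basis_vec j) a)"

definition top_pair :: "'n::{finite,linorder} ext \<Rightarrow> 'n ext \<Rightarrow> complex" where
  "top_pair a b = (a \<odot> b) $ UNIV"

lemma top_pair_linear: "top_pair (a + b) c = top_pair a c + top_pair b c" "top_pair c (a + b) = top_pair c a + top_pair c b"
  "top_pair (a - b) c = top_pair a c - top_pair b c" "top_pair c (a - b) = top_pair c a - top_pair c b"
  "top_pair (k *s a) c = k * top_pair a c" "top_pair c (k *s a) = k * top_pair c a"
  "top_pair 0 c = 0" "top_pair c 0 = 0"
  by (simp_all add: top_pair_def wedge_simps)

lemma top_pair_sum: "top_pair (sum f A) c = (\<Sum>x\<in>A. top_pair (f x) c)" "top_pair c (sum f A) = (\<Sum>x\<in>A. top_pair c (f x))"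
  by (simp_all add: top_pair_def wedge_sum_left wedge_sum_right)

lemma top_pair_commute: "a \<in> ext_power 4 \<Longrightarrow> b \<in> ext_power 4 \<Longrightarrow> top_pair b a = top_pair a b"
  using even_commute[of a 4 b 4] by (simp add: top_pair_def)

lemma lie_linear: "lie X (a + b) = lie X a + lie X b" "lie X (c *s a) = c *s lie X a" "lie X 0 = 0"
  "lie X (a - b) = lie X a - lie X b"
  "lie (X + Y) a = lie X a + lie Y a" "lie (X - Y) a = lie X a - lie Y a" "lie 0 a = 0"
  by (simp_all add: lie_def contr_simps wedge_simps sum.distrib sum_subtractf vec.scale_sum_right
      matrix_vector_mult_add_rdistrib matrix_vector_mult_diff_rdistrib ext_vec_simps)

lemma lie_one [simp]: "lie X ext_one = 0"
  by (simp add: lie_def)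

lemma lie_wedge_vec: "lie X (ext_vec y \<odot> a) = ext_vec (X *v y) \<odot> a + ext_vec y \<odot> lie X a"
proof -
  have "lie X (ext_vec y \<odot> a) = (\<Sum>j\<in>UNIV. y $ j *s (ext_vec (X *v basis_vec j) \<odot> a)) +
      (\<Sum>j\<in>UNIV. ext_vec y \<odot> ext_vec (X *v basis_vec j) \<odot> contr (basis_vec j) a)"
    by (simp add: lie_def contr_wedge wedge_simps sum.distrib ext_vec_anticommute_left[of "X *v basis_vec _" y])
  also have "(\<Sum>j\<in>UNIV. y $ j *s (ext_vec (X *v basis_vec j) \<odot> a)) = ext_vec (X *v (\<Sum>j\<in>UNIV. y $ j *s basis_vec j)) \<odot> a"
    by (simp only: vec.linear_sum[OF matrix_vector_mul_linear_gen] vector_scalar_commute ext_vec_sum ext_vec_scale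
        wedge_sum_left wedge_scale_left)
  also have "(\<Sum>j\<in>UNIV. ext_vec y \<odot> ext_vec (X *v basis_vec j) \<odot> contr (basis_vec j) a) = ext_vec y \<odot> lie X a"
    by (simp add: lie_def wedge_sum_right)
  finally show ?thesis by (simp add: basis_expansion)
qed

lemma lie_wedge: "lie X (a \<odot> b) = lie X a \<odot> b + a \<odot> lie X b"
  by (induction a rule: ext_induct) (simp_all add: lie_linear wedge_simps wedge_assoc lie_wedge_vec vec.scale_right_distrib algebra_simps)

lemma lie_power: "a \<in> ext_power d \<Longrightarrow> lie X a \<in> ext_power d"
proof -
  assume a: "a \<in> ext_power d"
  have "ext_vec y \<odot> contr z a \<in> ext_power d" for y z
  proof (cases d)
    case 0
    then have "contr z a = 0" using contr_power_0 a by blast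
    then show ?thesis by (simp add: ext_power_closed)
  next
    case (Suc e)
    then show ?thesis using ext_power_wedge[OF ext_vec_power ext_power_contr[of a e z], of y] a by simp
  qed
  then have "(\<Sum>j\<in>S. ext_vec (X *v basis_vec j) \<odot> contr (basis_vec j) a) \<in> ext_power d" for S
    by (induction S rule: infinite_finite_induct) (auto intro: ext_power_closed)
  then show ?thesis by (simp add: lie_def)
qed

lemma lie_ext_map:
  assumes "k' ** k = mat 1"
  shows "ext_map k (lie X a) = lie (k ** X ** k') (ext_map k a)"
proof (induction a rule: ext_induct)
  case (wedge i a)
  have "(k ** X ** k') *v (k *v basis_vec i) = k *v (X *v basis_vec i)"
    by (simp add: matrix_vector_mul_assoc matrix_mul_assoc[symmetric] assms)
  then show ?case using wedge by (simp add: lie_wedge_vec ext_map_wedge_vec ext_map_linear)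
qed (simp_all add: lie_linear ext_map_linear)

text \<open>Adjointness moves each summand onto the top basis element, where it contributes a
  diagonal entry of \<open>X\<close>.\<close>

lemma lie_top: "lie X a $ UNIV = trace X * a $ UNIV"
proof -
  let ?vol = "axis UNIV 1 :: 'a ext"
  have v: "ext_vec y \<odot> ?vol = 0" for y :: "'a vsp"
  proof -
    have "ext_vec (basis_vec j) \<odot> ?vol = 0" for j by (simp add: basis_wedge_axis)
    then have "ext_vec (\<Sum>j\<in>S. y $ j *s basis_vec j) \<odot> ?vol = 0" for S
      by (induction S rule: infinite_finite_induct) (simp_all add: ext_vec_simps wedge_simps)
    from this[of UNIV] show ?thesis by (simp add: basis_expansion)
  qed
  have c: "ext_vec (basis_vec j) \<odot> contr y ?vol = y $ j *s ?vol" for y j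
    using contr_wedge[of y "basis_vec j" ?vol] by (simp add: v)
  have "lie X a $ UNIV = (\<Sum>j\<in>UNIV. bdot (ext_vec (X *v basis_vec j) \<odot> contr (basis_vec j) a) ?vol)"
    by (simp add: lie_def)
  also have "\<dots> = (\<Sum>j\<in>UNIV. bdot (ext_vec (basis_vec j) \<odot> contr (X *v basis_vec j) ?vol) a)"
    by (intro sum.cong refl) (metis bdot_wedge bdot_commute)
  also have "\<dots> = (\<Sum>j\<in>UNIV. (X *v basis_vec j) $ j) * a $ UNIV"
    by (simp add: c bdot_scale_left sum_distrib_right)
  also have "(\<Sum>j\<in>UNIV. (X *v basis_vec j) $ j) = trace X"
    by (simp add: trace_def matrix_vector_mult_def axis_nth_if if_distrib cong: if_cong)
  finally show ?thesis .
qed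

lemma top_pair_lie: "top_pair (lie X a) b + top_pair a (lie X b) = trace X * top_pair a b"
  using lie_top[of X "a \<odot> b"] by (simp add: lie_wedge top_pair_def)

lemma top_pair_ext_map: "top_pair (ext_map k a) (ext_map k b) = ext_det k * top_pair a b"
  by (simp add: top_pair_def ext_map_top flip: ext_map_wedge)

text \<open>
  \<open>commuting a b\<close> says that the bracket of \<open>a\<close> and \<open>b\<close> in the \<open>\<int>/2\<close>-graded Lie algebra
  \<open>e\<^sub>7 = sl\<^sub>8 \<oplus> \<Lambda>\<^sup>4\<close> vanishes; the bracket is dual to the infinitesimal action.
\<close>

definition commuting :: "'n::{finite,linorder} ext \<Rightarrow> 'n ext \<Rightarrow> bool" where
  "commuting a b \<longleftrightarrow> (\<forall>X. trace X = 0 \<longrightarrow> top_pair (lie X a) b = 0)"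

lemma commuting_sym:
  assumes "a \<in> ext_power 4" "b \<in> ext_power 4" "commuting a b"
  shows "commuting b a"
  unfolding commuting_def
proof (intro allI impI)
  fix X :: "'a endo" assume X: "trace X = 0"
  have "top_pair (lie X b) a = top_pair a (lie X b)"
    using top_pair_commute[OF assms(1) lie_power[OF assms(2)]] .
  also have "\<dots> = 0" using top_pair_lie[of X a b] X assms(3) by (simp add: commuting_def)
  finally show "top_pair (lie X b) a = 0" .
qed

lemma commuting_self:
  assumes "a \<in> ext_power 4" shows "commuting a a"
  unfolding commuting_def
proof (intro allI impI)
  fix X :: "'a endo" assume X: "trace X = 0"
  have "top_pair a (lie X a) = top_pair (lie X a) a"
    by (rule top_pair_commute[OF lie_power[OF assms] assms])
  then show "top_pair (lie X a) a = 0" using top_pair_lie[of X a a] X by simp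
qed

lemma trace_commute: "trace (A ** B) = trace (B ** A)" for A B :: "complex ^ 'n ^ 'n"
  unfolding trace_def matrix_matrix_mult_def
  by (simp add: mult.commute[of "A $ _ $ _"]) (rule sum.swap)

lemma commuting_ext_map:
  assumes k: "k ** k' = mat 1" "k' ** k = mat 1" and c: "commuting a b"
  shows "commuting (ext_map k a) (ext_map k b)"
  unfolding commuting_def
proof (intro allI impI)
  fix X :: "'a endo" assume X: "trace X = 0"
  let ?Y = "k' ** X ** k"
  have "trace ?Y = trace (k ** (k' ** X))" by (rule trace_commute)
  then have t: "trace ?Y = 0" using X k by (simp add: matrix_mul_assoc)
  have "k ** ?Y ** k' = (k ** k') ** X ** (k ** k')" by (simp add: matrix_mul_assoc)
  then have "lie X (ext_map k a) = ext_map k (lie ?Y a)"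
    using lie_ext_map[OF k(2), of ?Y a] k by simp
  then show "top_pair (lie X (ext_map k a)) (ext_map k b) = 0"
    using c t by (simp add: top_pair_ext_map commuting_def)
qed

definition lie_elem :: "'n::{finite,linorder} \<times> 'n \<Rightarrow> 'n ext \<Rightarrow> 'n ext" where
  "lie_elem p a = ext_vec (basis_vec (fst p)) \<odot> contr (basis_vec (snd p)) a"

lemma lie_expand: "lie X a = (\<Sum>p\<in>UNIV. X $ fst p $ snd p *s lie_elem p a)"
proof -
  have "ext_vec (X *v basis_vec j) = (\<Sum>i\<in>UNIV. X $ i $ j *s ext_vec (basis_vec i))" for j
  proof -
    have "X *v basis_vec j = (\<Sum>i\<in>UNIV. (X *v basis_vec j) $ i *s basis_vec i)" by (simp add: basis_expansion)
    moreover have "(X *v basis_vec j) $ i = X $ i $ j" for i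
      by (simp add: matrix_vector_mult_def axis_nth_if if_distrib cong: if_cong)
    ultimately show ?thesis by (metis (no_types, lifting) ext_vec_scale ext_vec_sum sum.cong)
  qed
  then have "lie X a = (\<Sum>j\<in>UNIV. \<Sum>i\<in>UNIV. X $ i $ j *s lie_elem (i, j) a)"
    by (simp add: lie_def wedge_sum_left wedge_simps lie_elem_def)
  also have "\<dots> = (\<Sum>i\<in>UNIV. \<Sum>j\<in>UNIV. X $ i $ j *s lie_elem (i, j) a)" by (rule sum.swap)
  also have "\<dots> = (\<Sum>p\<in>UNIV \<times> UNIV. X $ fst p $ snd p *s lie_elem p a)"
    by (simp add: sum.cartesian_product case_prod_unfold)
  finally show ?thesis by simp
qed

text \<open>The pairing restricted to the orbit directions of \<open>a\<close> under all matrices,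
  scalars included. A nonzero determinant says at once that the infinitesimal stabilizer is trivial
  and that the orbit directions have an orthogonal complement; it is a polynomial substitute for
  regularity.\<close>

definition gram :: "'n::{finite,linorder} ext \<Rightarrow> complex ^ ('n \<times> 'n) ^ ('n \<times> 'n)" where
  "gram a = (\<chi> p q. top_pair (lie_elem p a) (lie_elem q a))"

definition vec_matrix :: "complex ^ ('n \<times> 'n) \<Rightarrow> 'n::finite endo" where
  "vec_matrix \<xi> = (\<chi> i j. \<xi> $ (i, j))"

lemma lie_vec_matrix: "lie (vec_matrix \<xi>) a = (\<Sum>p\<in>UNIV. \<xi> $ p *s lie_elem p a)"
  by (simp add: lie_expand vec_matrix_def)

lemma gram_apply: "(gram a *v \<xi>) $ p = top_pair (lie_elem p a) (lie (vec_matrix \<xi>) a)"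
  by (simp add: gram_def matrix_vector_mult_def lie_vec_matrix top_pair_sum top_pair_linear mult.commute)

lemma gram_nondegenerate:
  assumes a: "a \<in> ext_power 4"
  shows "det (gram a) \<noteq> 0 \<longleftrightarrow> (\<forall>X. (\<forall>Y. top_pair (lie X a) (lie Y a) = 0) \<longrightarrow> X = 0)"
proof -
  have inv: "det (gram a) \<noteq> 0 \<longleftrightarrow> (\<forall>\<xi>. gram a *v \<xi> = 0 \<longrightarrow> \<xi> = 0)"
    by (metis invertible_det_nz invertible_left_inverse matrix_left_invertible_ker)
  have surj: "\<exists>\<xi>. X = vec_matrix \<xi>" for X :: "'a endo"
    by (rule exI[of _ "\<chi> p. X $ fst p $ snd p"]) (simp add: vec_matrix_def vec_eq_iff)
  have z: "vec_matrix \<xi> = (0 :: 'a endo) \<longleftrightarrow> \<xi> = 0" for \<xi>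
    by (auto simp: vec_matrix_def vec_eq_iff)
  have "gram a *v \<xi> = 0 \<longleftrightarrow> (\<forall>Y. top_pair (lie (vec_matrix \<xi>) a) (lie Y a) = 0)" for \<xi>
  proof
    assume "gram a *v \<xi> = 0"
    then have "top_pair (lie_elem p a) (lie (vec_matrix \<xi>) a) = 0" for p by (metis gram_apply zero_index)
    then have "top_pair (lie Y a) (lie (vec_matrix \<xi>) a) = 0" for Y
      by (simp add: lie_expand[of Y] top_pair_sum top_pair_linear)
    then show "\<forall>Y. top_pair (lie (vec_matrix \<xi>) a) (lie Y a) = 0"
      using top_pair_commute[OF lie_power[OF a] lie_power[OF a]] by metis
  next
    assume h: "\<forall>Y. top_pair (lie (vec_matrix \<xi>) a) (lie Y a) = 0"
    have "lie_elem p a = lie (vec_matrix (axis p 1)) a" for p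
    proof -
      have "lie (vec_matrix (axis p 1)) a = (\<Sum>q\<in>UNIV. if q = p then lie_elem p a else 0)"
        unfolding lie_vec_matrix by (intro sum.cong) (auto simp: axis_nth_if)
      then show ?thesis by simp
    qed
    then have "top_pair (lie_elem p a) (lie (vec_matrix \<xi>) a) = 0" for p
      using h top_pair_commute[OF lie_power[OF a] lie_power[OF a]] by metis
    then show "gram a *v \<xi> = 0" by (simp add: vec_eq_iff gram_apply)
  qed
  then show ?thesis using inv surj z by metis
qed

text \<open>Conjugation by \<open>k\<close> permutes the matrices and rescales the pairing by
  \<open>ext_det k\<close>, so degeneracy is transported.\<close>

lemma gram_ext_map:
  assumes k: "k ** k' = mat 1" "k' ** k = mat 1" and a: "a \<in> ext_power 4" and g: "det (gram (ext_map k a)) \<noteq> 0"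
  shows "det (gram a) \<noteq> 0"
  unfolding gram_nondegenerate[OF a]
proof (intro allI impI)
  fix X assume X: "\<forall>Y. top_pair (lie X a) (lie Y a) = 0"
  have "top_pair (lie (k ** X ** k') (ext_map k a)) (lie Y (ext_map k a)) = 0" for Y
  proof -
    have "k ** (k' ** Y ** k) ** k' = (k ** k') ** Y ** (k ** k')" by (simp add: matrix_mul_assoc)
    then have "lie Y (ext_map k a) = ext_map k (lie (k' ** Y ** k) a)"
      using lie_ext_map[OF k(2), of "k' ** Y ** k" a] k by simp
    then show ?thesis using X by (simp add: lie_ext_map[OF k(2), symmetric] top_pair_ext_map)
  qed
  then have "k ** X ** k' = 0" using g gram_nondegenerate[OF ext_map_power[OF a]] by blast
  then have "k' ** (k ** X ** k') ** k = k' ** 0 ** k" by simp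
  moreover have "k' ** (k ** X ** k') ** k = (k' ** k) ** X ** (k' ** k)" by (simp add: matrix_mul_assoc)
  moreover have "k' ** 0 ** k = 0" by (simp add: matrix_matrix_mult_def vec_eq_iff)
  ultimately show "X = 0" using k by simp
qed

text \<open>The inverse Gram matrix gives the coefficients of the orthogonal projection onto the
  orbit directions.\<close>

lemma gram_project:
  assumes "det (gram a) \<noteq> 0"
  shows "\<exists>G. \<forall>z Y. top_pair (lie Y a) (z - lie (vec_matrix (G *v (\<chi> p. top_pair (lie_elem p a) z))) a) = 0"
proof -
  obtain G where G: "gram a ** G = mat 1" using assms invertible_det_nz invertible_right_inverse by metis
  have "top_pair (lie Y a) (z - lie (vec_matrix (G *v (\<chi> p. top_pair (lie_elem p a) z))) a) = 0" for z Y
  proof -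
    let ?\<xi> = "G *v (\<chi> p. top_pair (lie_elem p a) z)"
    have "gram a *v ?\<xi> = (\<chi> p. top_pair (lie_elem p a) z)" by (simp add: matrix_vector_mul_assoc G)
    then have "top_pair (lie_elem p a) (lie (vec_matrix ?\<xi>) a) = top_pair (lie_elem p a) z" for p
      using gram_apply[of a ?\<xi> p] by simp
    then have "top_pair (lie_elem p a) (z - lie (vec_matrix ?\<xi>) a) = 0" for p by (simp add: top_pair_linear)
    then show ?thesis unfolding lie_expand[of Y] top_pair_sum(1) top_pair_linear(5) by simp
  qed
  then show ?thesis by blast
qed

section \<open>Differentiability of the action and local slices\<close>

lemma bounded_bilinear_wedge: "bounded_bilinear (\<lambda>a b :: 'n::{finite,linorder} ext. a \<odot> b)"
  unfolding bilinear_conv_bounded_bilinear[symmetric] bilinear_def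
  by (auto intro!: linearI simp: wedge_simps scaleR_vec)

lemma bounded_bilinear_cscale: "bounded_bilinear (\<lambda>(c :: complex) (x :: complex ^ 'm). c *s x)"
  unfolding bilinear_conv_bounded_bilinear[symmetric] bilinear_def
  by (auto intro!: linearI simp: scaleR_vec complex_scaleR vec.scale_left_distrib vec.scale_right_distrib mult.commute)

lemma scaleR_matrix_vec: "(t *\<^sub>R X) *v x = complex_of_real t *s (X *v x)" for X :: "complex ^ 'n ^ 'm"
  by (simp add: matrix_vector_mult_def vec_eq_iff complex_scaleR sum_distrib_left mult.assoc)

lemma bounded_linear_matrix_vec: "bounded_linear (\<lambda>X :: 'n::{finite,linorder} endo. ext_vec (X *v x))"
  unfolding linear_conv_bounded_linear[symmetric]
  by (auto intro!: linearI simp: matrix_vector_mult_add_rdistrib ext_vec_simps scaleR_matrix_vec scaleR_vec)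

text \<open>The product rule in each factor is the derivation rule
  \<open>lie_wedge_vec\<close>.\<close>

lemma wedge_list_has_derivative:
  "((\<lambda>X :: 'n::{finite,linorder} endo. wedge_list (map (\<lambda>i. (mat 1 + X) *v basis_vec i) is)) has_derivative
     (\<lambda>X. lie X (wedge_list (map basis_vec is)))) (at 0)"
proof (induction "is")
  case (Cons i "is")
  have e: "ext_vec ((mat 1 + X) *v basis_vec i) = ext_vec (basis_vec i) + ext_vec (X *v basis_vec i)" for X :: "'n endo"
    by (simp add: matrix_vector_mult_add_rdistrib ext_vec_simps)
  have "((\<lambda>X. ext_vec ((mat 1 + X) *v basis_vec i)) has_derivative (\<lambda>X. 0 + ext_vec (X *v basis_vec i))) (at (0 :: 'n endo))"
    unfolding e by (intro has_derivative_add has_derivative_const bounded_linear_imp_has_derivative bounded_linear_matrix_vec)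
  from bounded_bilinear.FDERIV[OF bounded_bilinear_wedge this Cons.IH]
  show ?case by (simp add: lie_wedge_vec add.commute)
qed (simp add: lie_linear)

lemma sorted_wedge_basis: "sorted_wedge basis_vec I = axis I 1"
  using ext_map_axis[of "mat 1" I] by simp

lemma sorted_wedge_has_derivative:
  "((\<lambda>X :: 'n::{finite,linorder} endo. sorted_wedge (\<lambda>i. (mat 1 + X) *v basis_vec i) I) has_derivative
     (\<lambda>X. lie X (axis I 1))) (at 0)"
  using wedge_list_has_derivative[of "sorted_list_of_set I"] by (simp add: sorted_wedge_def sorted_wedge_basis[unfolded sorted_wedge_def])

lemma sorted_wedge_continuous:
  "continuous_on UNIV (\<lambda>X :: 'n::{finite,linorder} endo. sorted_wedge (\<lambda>i. (mat 1 + X) *v basis_vec i) I)"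
proof -
  have "continuous_on UNIV (\<lambda>X :: 'n endo. wedge_list (map (\<lambda>i. (mat 1 + X) *v basis_vec i) is))" for "is"
  proof (induction "is")
    case (Cons i "is")
    have e: "ext_vec ((mat 1 + X) *v basis_vec i) = ext_vec (basis_vec i) + ext_vec (X *v basis_vec i)" for X :: "'n endo"
      by (simp add: matrix_vector_mult_add_rdistrib ext_vec_simps)
    have "continuous_on UNIV (\<lambda>X :: 'n endo. ext_vec ((mat 1 + X) *v basis_vec i))"
      unfolding e by (intro continuous_on_add continuous_on_const linear_continuous_on bounded_linear_matrix_vec)
    then show ?case using Cons.IH by (simp add: bounded_bilinear.continuous_on[OF bounded_bilinear_wedge])
  qed simp
  then show ?thesis by (simp add: sorted_wedge_def)
qed

lemma ext_map_has_derivative: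
  assumes y: "(y has_derivative y') (at (0, z0))"
  shows "((\<lambda>p :: 'n::{finite,linorder} endo \<times> 'b::real_normed_vector. ext_map (mat 1 + fst p) (y p)) has_derivative
     (\<lambda>p. lie (fst p) (y (0, z0)) + y' p)) (at (0, z0))"
proof -
  have W: "((\<lambda>p :: 'n endo \<times> 'b. sorted_wedge (\<lambda>i. (mat 1 + fst p) *v basis_vec i) I) has_derivative
     (\<lambda>p. lie (fst p) (axis I 1))) (at (0, z0))" for I
  proof -
    have f: "((fst :: 'n endo \<times> 'b \<Rightarrow> 'n endo) has_derivative fst) (at (0, z0))"
      by (rule bounded_linear_imp_has_derivative[OF bounded_linear_fst])
    show ?thesis
      using has_derivative_compose[OF f, of "\<lambda>X. sorted_wedge (\<lambda>i. (mat 1 + X) *v basis_vec i) I" "\<lambda>X. lie X (axis I 1)"]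
        sorted_wedge_has_derivative[of I] by simp
  qed
  have c: "((\<lambda>p. y p $ I) has_derivative (\<lambda>p. y' p $ I)) (at (0, z0))" for I
    by (rule bounded_linear.has_derivative[OF bounded_linear_vec_nth y])
  have "((\<lambda>p. y p $ I *s sorted_wedge (\<lambda>i. (mat 1 + fst p) *v basis_vec i) I) has_derivative
      (\<lambda>p. y (0, z0) $ I *s lie (fst p) (axis I 1) + y' p $ I *s axis I 1)) (at (0, z0))" for I
    using bounded_bilinear.FDERIV[OF bounded_bilinear_cscale c W, of I I] by (simp add: sorted_wedge_basis)
  then have d: "((\<lambda>p. \<Sum>I\<in>UNIV. y p $ I *s sorted_wedge (\<lambda>i. (mat 1 + fst p) *v basis_vec i) I) has_derivative
      (\<lambda>p. \<Sum>I\<in>UNIV. y (0, z0) $ I *s lie (fst p) (axis I 1) + y' p $ I *s axis I 1)) (at (0, z0))"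
    by (rule has_derivative_sum)
  have e: "(\<Sum>I\<in>UNIV. y (0, z0) $ I *s lie (fst p) (axis I 1) + y' p $ I *s axis I 1) = lie (fst p) (y (0, z0)) + y' p" for p
  proof -
    have "lie X (\<Sum>I\<in>S. a $ I *s axis I 1) = (\<Sum>I\<in>S. a $ I *s lie X (axis I 1))" if "finite S" for X and a :: "'n ext" and S
      using that by (induction S rule: finite_induct) (simp_all add: lie_linear)
    from this[of UNIV "fst p" "y (0, z0)"]
    have "(\<Sum>I\<in>UNIV. y (0, z0) $ I *s lie (fst p) (axis I 1)) = lie (fst p) (y (0, z0))"
      by (simp only: finite_code basis_expansion)
    then show ?thesis by (simp only: sum.distrib basis_expansion)
  qed
  show ?thesis using d unfolding ext_map_def e .
qed

lemma ext_map_continuous: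
  assumes "continuous_on UNIV y"
  shows "continuous_on UNIV (\<lambda>p :: 'n::{finite,linorder} endo \<times> 'b::real_normed_vector. ext_map (mat 1 + fst p) (y p))"
  unfolding ext_map_def
proof (intro continuous_on_sum bounded_bilinear.continuous_on[OF bounded_bilinear_cscale])
  fix I
  show "continuous_on UNIV (\<lambda>p. y p $ I)" using assms by (rule continuous_on_component)
  show "continuous_on UNIV (\<lambda>p :: 'n endo \<times> 'b. sorted_wedge (\<lambda>i. (mat 1 + fst p) *v basis_vec i) I)"
    by (rule continuous_on_compose2[OF sorted_wedge_continuous[of I]]) (auto intro: continuous_on_fst continuous_on_id)
qed

lemma continuous_on_det:
  fixes A :: "'a::topological_space \<Rightarrow> complex ^ 'n ^ 'n"
  assumes "continuous_on S A"
  shows "continuous_on S (\<lambda>x. det (A x))"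
  unfolding det_def by (intro continuous_intros continuous_on_component assms)

text \<open>The type \<open>ext\<close> holds all degrees; this projection lets the open mapping
  theorem work on the full type.\<close>

definition grade4 :: "'n::{finite,linorder} ext \<Rightarrow> 'n ext" where
  "grade4 a = (\<chi> I. if card I = 4 then a $ I else 0)"

text \<open>Infinitesimally, \<open>\<Lambda>\<^sup>4\<close> is the direct sum of the orbit directions and their orthogonal complement.\<close>

lemma local_slice:
  fixes v :: "'n::{finite,linorder} ext"
  assumes v: "v \<in> ext_power 4" and g: "det (gram v) \<noteq> 0"
  shows "\<exists>T. open T \<and> v \<in> T \<and> (\<forall>a\<in>T \<inter> ext_power 4. \<exists>k k' y.
    k ** k' = mat 1 \<and> k' ** k = mat 1 \<and> y \<in> ext_power 4 \<and> commuting v y \<and> a = ext_map k y)"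
proof -
  obtain G where G: "\<And>z Y. top_pair (lie Y v) (z - lie (vec_matrix (G *v (\<chi> p. top_pair (lie_elem p v) z))) v) = 0"
    using gram_project[OF g] by blast
  define S where "S z = vec_matrix (G *v (\<chi> p. top_pair (lie_elem p v) (grade4 z)))" for z
  define Q where "Q z = grade4 z - lie (S z) v" for z
  have g4: "grade4 z \<in> ext_power 4" for z :: "'n ext" by (simp add: grade4_def ext_power_def)
  have g4_lin: "grade4 (a + b) = grade4 a + grade4 b" "grade4 (c *s a) = c *s grade4 a" for a b :: "'n ext" and c
    by (simp_all add: grade4_def vec_eq_iff)
  have S_add: "S (a + b) = S a + S b" for a b
  proof -
    have e: "(\<chi> p. top_pair (lie_elem p v) (grade4 (a + b))) = (\<chi> p. top_pair (lie_elem p v) (grade4 a)) + (\<chi> p. top_pair (lie_elem p v) (grade4 b))"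
      by (simp add: vec_eq_iff g4_lin top_pair_linear)
    show ?thesis unfolding S_def e matrix_vector_right_distrib by (simp add: vec_matrix_def vec_eq_iff)
  qed
  have S_scale: "S (t *\<^sub>R a) = t *\<^sub>R S a" for t a
  proof -
    have "(\<chi> p. top_pair (lie_elem p v) (grade4 (t *\<^sub>R a))) = complex_of_real t *s (\<chi> p. top_pair (lie_elem p v) (grade4 a))"
      by (simp add: vec_eq_iff scaleR_vec g4_lin top_pair_linear)
    then show ?thesis
      by (simp add: S_def vector_scalar_commute) (simp add: vec_matrix_def vec_eq_iff complex_scaleR)
  qed
  have lS: "bounded_linear S" unfolding linear_conv_bounded_linear[symmetric] by (intro linearI S_add S_scale)
  have lie_scale: "lie (t *\<^sub>R X) v = t *\<^sub>R lie X v" for t X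
    by (simp add: lie_def scaleR_matrix_vec ext_vec_simps wedge_simps scaleR_vec vec.scale_sum_right)
  have lQ: "bounded_linear Q" unfolding linear_conv_bounded_linear[symmetric]
    by (intro linearI) (simp_all add: Q_def g4_lin S_add S_scale lie_linear lie_scale, simp add: scaleR_vec g4_lin vec.scale_right_diff_distrib)
  have lg4: "bounded_linear (grade4 :: 'n ext \<Rightarrow> 'n ext)" unfolding linear_conv_bounded_linear[symmetric]
    by (intro linearI) (simp_all add: g4_lin scaleR_vec)
  \<comment> \<open>The last summand fills the degrees other than four, so that the derivative at
    the origin is onto the whole space.\<close>
  define F where "F p = ext_map (mat 1 + fst p) (v + Q (snd p)) + (snd p - grade4 (snd p))" for p :: "'n endo \<times> 'n ext"
  have Q4: "Q z \<in> ext_power 4" for z unfolding Q_def by (intro ext_power_closed g4 lie_power v)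
  have Q_orth: "top_pair (lie Y v) (Q z) = 0" for Y z using G[of Y "grade4 z"] by (simp add: Q_def S_def)
  have comm: "commuting v (v + Q z)" for z
    using commuting_self[OF v] Q_orth by (simp add: commuting_def top_pair_linear)
  have Q0: "Q 0 = 0" "grade4 (0 :: 'n ext) = 0" using lQ lg4 by (simp_all add: linear_simps)
  have d1: "((\<lambda>p :: 'n endo \<times> 'n ext. v + Q (snd p)) has_derivative (\<lambda>p. 0 + Q (snd p))) (at (0, 0))"
    by (intro has_derivative_add has_derivative_const bounded_linear_imp_has_derivative bounded_linear_compose[OF lQ] bounded_linear_snd)
  have d2: "((\<lambda>p :: 'n endo \<times> 'n ext. snd p - grade4 (snd p)) has_derivative (\<lambda>p. snd p - grade4 (snd p))) (at (0, 0))"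
    by (intro bounded_linear_imp_has_derivative bounded_linear_sub bounded_linear_compose[OF lg4] bounded_linear_snd)
  have der: "(F has_derivative (\<lambda>p. lie (fst p) v + Q (snd p) + (snd p - grade4 (snd p)))) (at (0, 0))"
    unfolding F_def using has_derivative_add[OF ext_map_has_derivative[OF d1] d2] by (simp add: Q0)
  have cont: "continuous_on UNIV F" unfolding F_def
    by (intro continuous_on_add continuous_on_diff ext_map_continuous continuous_on_const
        linear_continuous_on bounded_linear_snd bounded_linear_compose[OF lg4] bounded_linear_compose[OF lQ])
  define T where "T = {p :: 'n endo \<times> 'n ext. det (mat 1 + fst p) \<noteq> 0}"
  have "open T" unfolding T_def
    by (intro open_Collect_neq continuous_on_det continuous_on_const continuous_on_add continuous_on_fst continuous_on_id)
  moreover have "(0, 0) \<in> T" by (simp add: T_def)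
  ultimately have int: "(0, 0) \<in> interior T" by (simp add: interior_open)
  \<comment> \<open>\<open>Q a\<close> is the part of \<open>a\<close> in degree four minus its
    orbit component \<open>lie (S a) v\<close>, so \<open>a\<close> goes to \<open>(S a, a)\<close>
    and back to \<open>a\<close>: a right inverse of the derivative.\<close>
  have "F (0, 0) \<in> interior (F ` T)"
  proof (rule sussmann_open_mapping[OF open_UNIV cont UNIV_I der])
    show "bounded_linear (\<lambda>a. (S a, a))" by (intro bounded_linear_Pair lS bounded_linear_ident)
    show "(\<lambda>p. lie (fst p) v + Q (snd p) + (snd p - grade4 (snd p))) \<circ> (\<lambda>a. (S a, a)) = id"
      by (simp add: fun_eq_iff Q_def)
  qed (use int in auto)
  then have vT: "v \<in> interior (F ` T)" by (simp add: F_def Q0)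
  have "\<exists>k k' y. k ** k' = mat 1 \<and> k' ** k = mat 1 \<and> y \<in> ext_power 4 \<and> commuting v y \<and> a = ext_map k y"
    if a: "a \<in> interior (F ` T)" "a \<in> ext_power 4" for a
  proof -
    obtain p where "p \<in> T" "a = F p" using a(1) interior_subset[of "F ` T"] by blast
    then obtain X z where p: "(X, z) \<in> T" "a = F (X, z)" by (cases p) blast
    have "invertible (mat 1 + X)" using p(1) by (simp add: T_def invertible_det_nz)
    then obtain k' where k': "(mat 1 + X) ** k' = mat 1" "k' ** (mat 1 + X) = mat 1" by (auto simp: invertible_def)
    have y4: "v + Q z \<in> ext_power 4" by (intro ext_power_closed v Q4)
    \<comment> \<open>Both terms on the right have degree four and the left side has no component
      there, so the auxiliary summand vanishes.\<close>
    have "z - grade4 z = a - ext_map (mat 1 + X) (v + Q z)" using p(2) by (simp add: F_def)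
    then have "z - grade4 z \<in> ext_power 4" using ext_power_closed(3)[OF a(2) ext_map_power[OF y4]] by simp
    then have "(z - grade4 z) $ I = 0" for I by (cases "card I = 4") (auto simp: ext_power_def grade4_def)
    then have "z - grade4 z = 0" by (simp add: vec_eq_iff)
    then show ?thesis using p(2) k' y4 comm by (intro exI[of _ "mat 1 + X"] exI[of _ k'] exI[of _ "v + Q z"]) (simp add: F_def)
  qed
  then show ?thesis using vT by (intro exI[of _ "interior (F ` T)"]) auto
qed

text \<open>Complex lines this time: removing the finitely many zeros of a polynomial leaves a
  connected set, which fails on real lines.\<close>

lemma poly_alg_complex_line:
  assumes "f \<in> poly_alg coords"
  shows "\<exists>P. \<forall>t. f (x + t *s y) = poly P t"
  using assms
proof induction
  case (gen g)
  then obtain i where "g = (\<lambda>x. x $ i)" by (auto simp: coords_def)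
  then show ?case by (intro exI[of _ "[:x $ i, y $ i:]"]) simp
next
  case (const c)
  show ?case by (intro exI[of _ "[:c:]"]) simp
next
  case (add f g)
  then obtain P Q where "\<forall>t. f (x + t *s y) = poly P t" "\<forall>t. g (x + t *s y) = poly Q t" by blast
  then show ?case by (intro exI[of _ "P + Q"]) simp
next
  case (mult f g)
  then obtain P Q where "\<forall>t. f (x + t *s y) = poly P t" "\<forall>t. g (x + t *s y) = poly Q t" by blast
  then show ?case by (intro exI[of _ "P * Q"]) simp
qed

lemma poly_alg_det:
  fixes A :: "'a \<Rightarrow> complex ^ 'n ^ 'n"
  assumes "\<And>i j. (\<lambda>x. A x $ i $ j) \<in> poly_alg G"
  shows "(\<lambda>x. det (A x)) \<in> poly_alg G"
  unfolding det_def by (intro poly_alg_sum poly_alg.mult poly_alg.const poly_alg_prod assms)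

lemma poly_alg_det_gram: "(\<lambda>v. det (gram v)) \<in> poly_alg coords"
proof (rule poly_alg_det)
  have "poly_map coords (lie_elem p)" for p :: "'a \<times> 'a"
    unfolding lie_elem_def by (intro poly_map_wedge poly_map_contr poly_map_const poly_map_id)
  then show "(\<lambda>v :: 'a ext. gram v $ p $ q) \<in> poly_alg coords" for p q
    by (simp add: gram_def top_pair_def) (intro poly_map_nth poly_map_wedge)
qed

text \<open>
  The elements with nondegenerate Gram matrix that are conjugate to \<open>h\<close> form an open subset; so do
  the others, since \<open>commuting\<close> is symmetric. Hence one of the two sets is empty on every line.
\<close>

theorem cartan_conjugacy:
  fixes h :: "'n::{finite,linorder} ext set"
  assumes h4: "h \<subseteq> ext_power 4" and x0: "x0 \<in> h" "det (gram x0) \<noteq> 0"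
    and max: "\<And>x y. x \<in> h \<Longrightarrow> det (gram x) \<noteq> 0 \<Longrightarrow> y \<in> ext_power 4 \<Longrightarrow> commuting x y \<Longrightarrow> y \<in> h"
    and v: "v \<in> ext_power 4" "det (gram v) \<noteq> 0"
  shows "\<exists>k k' x. k ** k' = mat 1 \<and> k' ** k = mat 1 \<and> x \<in> h \<and> v = ext_map k x"
proof -
  define C where "C a \<longleftrightarrow> (\<exists>k k' x. k ** k' = mat 1 \<and> k' ** k = mat 1 \<and> x \<in> h \<and> a = ext_map k x)" for a
  \<comment> \<open>Undoing \<open>k\<close> makes the transform of \<open>b\<close> commute with a
    nondegenerate element of \<open>h\<close>, so maximality puts it into \<open>h\<close>.\<close>
  have key: "C b" if a: "C a" and a4: "a \<in> ext_power 4" and ga: "det (gram a) \<noteq> 0" and b: "b \<in> ext_power 4" "commuting a b" for a b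
  proof -
    obtain k k' x where k: "k ** k' = mat 1" "k' ** k = mat 1" "x \<in> h" "a = ext_map k x" using a by (auto simp: C_def)
    have "det (gram x) \<noteq> 0" using gram_ext_map[OF k(1,2)] k(3,4) h4 ga by blast
    moreover have "commuting x (ext_map k' b)"
      using commuting_ext_map[OF k(2,1) b(2)] by (simp add: k(2) k(4) flip: ext_map_compose)
    ultimately have "ext_map k' b \<in> h" using max[OF k(3)] ext_map_power[OF b(1)] by blast
    moreover have "b = ext_map k (ext_map k' b)" by (simp add: k(1) flip: ext_map_compose)
    ultimately show ?thesis using k unfolding C_def by blast
  qed
  have trans: "C (ext_map k a)" if k: "k ** k' = mat 1" "k' ** k = mat 1" "C a" for k k' a
  proof -
    obtain l l' x where l: "l ** l' = mat 1" "l' ** l = mat 1" "x \<in> h" "a = ext_map l x" using k(3) by (auto simp: C_def)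
    have "(k ** l) ** (l' ** k') = k ** (l ** l') ** k'" "(l' ** k') ** (k ** l) = l' ** (k' ** k) ** l"
      by (simp_all add: matrix_mul_assoc)
    then have "(k ** l) ** (l' ** k') = mat 1" "(l' ** k') ** (k ** l) = mat 1" using k l by simp_all
    moreover have "ext_map k a = ext_map (k ** l) x" by (simp add: l ext_map_compose)
    ultimately show ?thesis using l(3) unfolding C_def by blast
  qed
  have loc: "\<exists>T. open T \<and> a \<in> T \<and> (\<forall>b\<in>T \<inter> ext_power 4. det (gram b) \<noteq> 0 \<longrightarrow> (C b \<longleftrightarrow> C a))"
    if a: "a \<in> ext_power 4" "det (gram a) \<noteq> 0" for a
  proof -
    obtain T where T: "open T" "a \<in> T" and sl: "\<And>b. b \<in> T \<Longrightarrow> b \<in> ext_power 4 \<Longrightarrow> \<exists>k k' y.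
      k ** k' = mat 1 \<and> k' ** k = mat 1 \<and> y \<in> ext_power 4 \<and> commuting a y \<and> b = ext_map k y"
      using local_slice[OF a] by blast
    have "C b \<longleftrightarrow> C a" if b: "b \<in> T" "b \<in> ext_power 4" "det (gram b) \<noteq> 0" for b
    proof -
      obtain k k' y where k: "k ** k' = mat 1" "k' ** k = mat 1" "y \<in> ext_power 4" "commuting a y" "b = ext_map k y"
        using sl[OF b(1,2)] by blast
      have gy: "det (gram y) \<noteq> 0" using gram_ext_map[OF k(1,2,3)] k(5) b(3) by simp
      have y_b: "y = ext_map k' b" by (simp add: k(2,5) flip: ext_map_compose)
      \<comment> \<open>The slice reduces \<open>b\<close> to some \<open>y\<close> commuting with
        \<open>a\<close>; as commuting is symmetric, \<open>key\<close> applies in both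
        directions.\<close>
      have "C b \<longleftrightarrow> C y" using trans[OF k(1,2)] trans[OF k(2,1)] k(5) y_b by metis
      also have "\<dots> \<longleftrightarrow> C a" using key[of y a] key[of a y] a k gy commuting_sym[OF a(1) k(3,4)] by blast
      finally show ?thesis .
    qed
    then show ?thesis using T by blast
  qed
  have C_x0: "C x0" unfolding C_def by (intro exI[of _ "mat 1"] exI[of _ "mat 1"] exI[of _ x0]) (simp add: x0)
  define \<gamma> where "\<gamma> t = x0 + t *s (v - x0)" for t
  have \<gamma>4: "\<gamma> t \<in> ext_power 4" for t
    unfolding \<gamma>_def using x0(1) h4 v(1) by (intro ext_power_closed) auto
  obtain P where P: "\<And>t. det (gram (\<gamma> t)) = poly P t"
    using poly_alg_complex_line[OF poly_alg_det_gram, of x0 "v - x0"] unfolding \<gamma>_def by blast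
  have "P \<noteq> 0" using P[of 0] x0(2) by (auto simp: \<gamma>_def)
  then have fin: "finite {t. poly P t = 0}" by (rule poly_roots_finite)
  let ?Z = "- {t. poly P t = 0}"
  have conn: "connected ?Z"
    using fin by (intro path_connected_imp_connected path_connected_complement_countable countable_finite) auto
  have opZ: "open ?Z" using fin by (simp add: finite_imp_closed open_Compl)
  have cont: "continuous_on UNIV \<gamma>"
  proof -
    have "continuous_on UNIV (\<lambda>t. t *s (v - x0))"
      by (rule bounded_bilinear.continuous_on[OF bounded_bilinear_cscale]) (auto intro: continuous_on_id)
    then show ?thesis unfolding \<gamma>_def by (intro continuous_on_add continuous_on_const)
  qed
  have opn: "open {t \<in> ?Z. C (\<gamma> t) = B}" for B
  proof (subst open_subopen, rule ballI)
    fix t assume t: "t \<in> {t \<in> ?Z. C (\<gamma> t) = B}"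
    then have "det (gram (\<gamma> t)) \<noteq> 0" using P by simp
    then have "\<exists>T. open T \<and> \<gamma> t \<in> T \<and> (\<forall>b\<in>T \<inter> ext_power 4. det (gram b) \<noteq> 0 \<longrightarrow> (C b \<longleftrightarrow> C (\<gamma> t)))"
      by (intro loc \<gamma>4)
    then obtain T where T: "open T" "\<gamma> t \<in> T"
      "\<forall>b\<in>T \<inter> ext_power 4. det (gram b) \<noteq> 0 \<longrightarrow> (C b \<longleftrightarrow> C (\<gamma> t))"
      by (elim exE conjE)
    have "open (\<gamma> -` T \<inter> ?Z)" using open_vimage[OF T(1) cont] opZ by (rule open_Int)
    moreover have "t \<in> \<gamma> -` T \<inter> ?Z" using t T(2) by simp
    moreover have "\<gamma> -` T \<inter> ?Z \<subseteq> {t \<in> ?Z. C (\<gamma> t) = B}"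
    proof
      fix s assume s: "s \<in> \<gamma> -` T \<inter> ?Z"
      then have "\<gamma> s \<in> T \<inter> ext_power 4" "det (gram (\<gamma> s)) \<noteq> 0" using \<gamma>4 P[of s] by simp_all
      then have "C (\<gamma> s) \<longleftrightarrow> C (\<gamma> t)" using T(3) by blast
      then show "s \<in> {t \<in> ?Z. C (\<gamma> t) = B}" using s t by simp
    qed
    ultimately show "\<exists>T. open T \<and> t \<in> T \<and> T \<subseteq> {t \<in> ?Z. C (\<gamma> t) = B}" by blast
  qed
  have "{t \<in> ?Z. C (\<gamma> t) = True} \<inter> ?Z = {} \<or> {t \<in> ?Z. C (\<gamma> t) = False} \<inter> ?Z = {}"
    by (rule connectedD[OF conn opn[of True] opn[of False]]) blast+
  moreover have "0 \<in> {t \<in> ?Z. C (\<gamma> t) = True} \<inter> ?Z"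
    using C_x0 P[of 0] x0(2) by (simp add: \<gamma>_def)
  ultimately have "{t \<in> ?Z. C (\<gamma> t) = False} \<inter> ?Z = {}" by blast
  moreover have "1 \<in> ?Z" using P[of 1] v(2) by (simp add: \<gamma>_def)
  ultimately have "C (\<gamma> 1)" by blast
  then show ?thesis by (simp add: \<gamma>_def C_def)
qed

section \<open>An explicit Cartan subspace\<close>

lemma less8_numeral:
  "(numeral a :: 8) < numeral b \<longleftrightarrow> (numeral a :: int) mod 8 < numeral b mod 8"
  "(0 :: 8) < numeral b \<longleftrightarrow> 0 < (numeral b :: int) mod 8"
  "(1 :: 8) < numeral b \<longleftrightarrow> 1 < (numeral b :: int) mod 8"
  "(numeral a :: 8) < 1 \<longleftrightarrow> (numeral a :: int) mod 8 < 1"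
  "(0 :: 8) < 1"
  by (simp_all add: less_bit0_def bit0.Rep_numeral bit0.Rep_0 bit0.Rep_1)

lemma not_less_0_bit0: "\<not> x < (0 :: 'a::finite bit0)"
  using Rep_bit0[of x] by (simp add: less_bit0_def bit0.Rep_0)

lemma UNIV8: "(UNIV :: 8 set) = {0, 1, 2, 3, 4, 5, 6, 7}"
proof -
  have "card {0, 1, 2, 3, 4, 5, 6, 7 :: 8} = 8" by simp
  then show ?thesis using card_eq_UNIV_imp_eq_UNIV[of "{0, 1, 2, 3, 4, 5, 6, 7 :: 8}"] by simp
qed

lemma shuffle_sign_singleton_insert:
  "j \<notin> J \<Longrightarrow> shuffle_sign {i} (insert j J) = (if j < i then - shuffle_sign {i} J else shuffle_sign {i} J)"
  by (simp add: shuffle_sign_insert_right shuffle_sign_singletons)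

lemma lie_nth:
  "lie X a $ K = (\<Sum>i\<in>K. \<Sum>j\<in>- (K - {i}). X $ i $ j * (shuffle_sign {i} (K - {i}) *
     (shuffle_sign {j} (K - {i}) * a $ insert j (K - {i}))))"
proof -
  have "lie X a $ K = (\<Sum>i\<in>UNIV. \<Sum>j\<in>UNIV. X $ i $ j * lie_elem (i, j) a $ K)"
    by (simp add: lie_expand sum.cartesian_product case_prod_unfold)
  also have "\<dots> = (\<Sum>i\<in>K. \<Sum>j\<in>UNIV. X $ i $ j * lie_elem (i, j) a $ K)"
    by (rule sum.mono_neutral_right) (auto simp: lie_elem_def basis_vec_wedge)
  also have "\<dots> = (\<Sum>i\<in>K. \<Sum>j\<in>- (K - {i}). X $ i $ j * lie_elem (i, j) a $ K)"
    by (intro sum.cong refl sum.mono_neutral_right) (auto simp: lie_elem_def basis_vec_wedge contr_basis_vec)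
  also have "\<dots> = (\<Sum>i\<in>K. \<Sum>j\<in>- (K - {i}). X $ i $ j * (shuffle_sign {i} (K - {i}) *
     (shuffle_sign {j} (K - {i}) * a $ insert j (K - {i}))))"
    by (intro sum.cong refl) (auto simp: lie_elem_def basis_vec_wedge contr_basis_vec)
  finally show ?thesis .
qed

text \<open>
  Reading \<open>0, \<dots>, 7\<close> in binary, the \<open>4\<close>-element sets involved are the \<open>14\<close> affine planes of the \<open>3\<close>-dimensional space over the field
  with two elements. A plane and its complement get the same weight, and the weights are
  distinct powers of \<open>2\<close> so that \<open>cartan_point\<close> is off all the root hyperplanes of \<open>e\<^sub>7\<close>.
\<close>

definition plane_weight :: "bool \<Rightarrow> bool \<Rightarrow> bool \<Rightarrow> bool \<Rightarrow> bool \<Rightarrow> bool \<Rightarrow> bool \<Rightarrow> complex" where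
  "plane_weight b1 b2 b3 b4 b5 b6 b7 =
    (if b1 \<and> b2 \<and> b3 \<and> \<not> b4 \<and> \<not> b5 \<and> \<not> b6 \<and> \<not> b7 then 1 else
     if b1 \<and> \<not> b2 \<and> \<not> b3 \<and> b4 \<and> b5 \<and> \<not> b6 \<and> \<not> b7 then 2 else
     if b1 \<and> \<not> b2 \<and> \<not> b3 \<and> \<not> b4 \<and> \<not> b5 \<and> b6 \<and> b7 then 4 else
     if \<not> b1 \<and> b2 \<and> \<not> b3 \<and> b4 \<and> \<not> b5 \<and> b6 \<and> \<not> b7 then 8 else
     if \<not> b1 \<and> b2 \<and> \<not> b3 \<and> \<not> b4 \<and> b5 \<and> \<not> b6 \<and> b7 then 16 else
     if \<not> b1 \<and> \<not> b2 \<and> b3 \<and> b4 \<and> \<not> b5 \<and> \<not> b6 \<and> b7 then 32 else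
     if \<not> b1 \<and> \<not> b2 \<and> b3 \<and> \<not> b4 \<and> b5 \<and> b6 \<and> \<not> b7 then 64 else 0)"

definition cartan_point :: "8 ext" where
  "cartan_point = (\<chi> K. plane_weight ((1 \<in> K) = (0 \<in> K)) ((2 \<in> K) = (0 \<in> K)) ((3 \<in> K) = (0 \<in> K))
     ((4 \<in> K) = (0 \<in> K)) ((5 \<in> K) = (0 \<in> K)) ((6 \<in> K) = (0 \<in> K)) ((7 \<in> K) = (0 \<in> K)))"

lemma neq8: "(0::8) \<noteq> 1" "(1::8) \<noteq> 0"
  "numeral a = (0::8) \<longleftrightarrow> (numeral a :: int) mod 8 = 0" "(0::8) = numeral a \<longleftrightarrow> (numeral a :: int) mod 8 = 0"
  "numeral a = (1::8) \<longleftrightarrow> (numeral a :: int) mod 8 = 1" "(1::8) = numeral a \<longleftrightarrow> (numeral a :: int) mod 8 = 1"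
  "numeral a = (numeral b::8) \<longleftrightarrow> (numeral a :: int) mod 8 = numeral b mod 8"
  unfolding Rep_bit0_inject[symmetric] bit0.Rep_numeral bit0.Rep_0 bit0.Rep_1 by auto

text \<open>For each row \<open>i\<close> only the column \<open>i\<close> and the four columns
  outside the set contribute. This gives twenty explicit terms that the simplifier can
  evaluate.\<close>

lemma lie_nth4:
  fixes a b c d e f g h :: "'n::{finite,linorder}"
  assumes U: "UNIV = {a, b, c, d, e, f, g, h}" and dist: "distinct [a, b, c, d, e, f, g, h]"
    and t: "\<And>i L. t i L = X $ i $ i * x $ insert i L + (X $ i $ e * (shuffle_sign {i} L * (shuffle_sign {e} L * x $ insert e L)) +
      (X $ i $ f * (shuffle_sign {i} L * (shuffle_sign {f} L * x $ insert f L)) +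
      (X $ i $ g * (shuffle_sign {i} L * (shuffle_sign {g} L * x $ insert g L)) +
       X $ i $ h * (shuffle_sign {i} L * (shuffle_sign {h} L * x $ insert h L)))))"
  shows "lie X x $ {a, b, c, d} = t a {b, c, d} + (t b {a, c, d} + (t c {a, b, d} + t d {a, b, c}))"
proof -
  define q where "q i L = (\<Sum>j\<in>- L. X $ i $ j * (shuffle_sign {i} L * (shuffle_sign {j} L * x $ insert j L)))" for i L
  have D: "{a, b, c, d} - {a} = {b, c, d}" "{a, b, c, d} - {b} = {a, c, d}" "{a, b, c, d} - {c} = {a, b, d}" "{a, b, c, d} - {d} = {a, b, c}"
    using dist by auto
  have C: "- {b, c, d} = {a, e, f, g, h}" "- {a, c, d} = {b, e, f, g, h}" "- {a, b, d} = {c, e, f, g, h}" "- {a, b, c} = {d, e, f, g, h}"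
    using dist unfolding Compl_eq_Diff_UNIV U by auto
  have sq: "shuffle_sign {i} L * (shuffle_sign {i} L * z) = z" for i :: 'n and L z
    by (simp add: shuffle_sign_def flip: power_add mult.assoc)
  have s: "q i L = t i L" if "- L = {i, e, f, g, h}" "i \<notin> {e, f, g, h}" for i L
    using that(2) dist unfolding t q_def that(1) by (simp add: sq)
  have "lie X x $ {a, b, c, d} = (\<Sum>i\<in>{a, b, c, d}. q i ({a, b, c, d} - {i}))"
    unfolding q_def by (rule lie_nth)
  also have "\<dots> = q a {b, c, d} + (q b {a, c, d} + (q c {a, b, d} + q d {a, b, c}))"
    using dist D by simp
  also have "\<dots> = t a {b, c, d} + (t b {a, c, d} + (t c {a, b, d} + t d {a, b, c}))"
    using dist by (simp add: s C)
  finally show ?thesis .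
qed


lemma cartan_point_nth: "cartan_point $ K = plane_weight ((1 \<in> K) = (0 \<in> K)) ((2 \<in> K) = (0 \<in> K)) ((3 \<in> K) = (0 \<in> K))
     ((4 \<in> K) = (0 \<in> K)) ((5 \<in> K) = (0 \<in> K)) ((6 \<in> K) = (0 \<in> K)) ((7 \<in> K) = (0 \<in> K))"
  by (simp add: cartan_point_def)

lemma lie_cartan_point_nth:
  assumes "distinct [a, b, c, d, e, f, g, h :: 8]" and 0: "lie X cartan_point = 0"
  defines "t i L \<equiv> X $ i $ i * cartan_point $ insert i L + (X $ i $ e * (shuffle_sign {i} L * (shuffle_sign {e} L * cartan_point $ insert e L)) +
      (X $ i $ f * (shuffle_sign {i} L * (shuffle_sign {f} L * cartan_point $ insert f L)) +
      (X $ i $ g * (shuffle_sign {i} L * (shuffle_sign {g} L * cartan_point $ insert g L)) +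
       X $ i $ h * (shuffle_sign {i} L * (shuffle_sign {h} L * cartan_point $ insert h L)))))"
  shows "t a {b, c, d} + (t b {a, c, d} + (t c {a, b, d} + t d {a, b, c})) = 0"
proof -
  have "card {a, b, c, d, e, f, g, h} = 8" using distinct_card[OF assms(1)] by simp
  then have "UNIV = {a, b, c, d, e, f, g, h}"
    using card_eq_UNIV_imp_eq_UNIV[of "{a, b, c, d, e, f, g, h}"] by simp
  from lie_nth4[OF this assms(1) refl, of X cartan_point] show ?thesis
    by (simp add: 0 t_def)
qed

lemmas cartan_simps = neq8 shuffle_sign_singleton_insert less8_numeral not_less_0_bit0 cartan_point_nth plane_weight_def shuffle_sign_empty

text \<open>
  The equation \<open>lie X cartan_point = 0\<close> decouples into eight blocks: block \<open>d\<close> involves the entries of \<open>X\<close>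
  in row \<open>i\<close> and column \<open>i xor d\<close>.
\<close>

lemma cartan_point_block0:
  assumes 0: "lie X cartan_point = 0"
  shows "X $ 0 $ 0 = 0 \<and> X $ 1 $ 1 = 0 \<and> X $ 2 $ 2 = 0 \<and> X $ 3 $ 3 = 0 \<and> X $ 4 $ 4 = 0 \<and> X $ 5 $ 5 = 0 \<and> X $ 6 $ 6 = 0 \<and> X $ 7 $ 7 = 0"
proof -
  have e0: "X $ 0 $ 0 + X $ 1 $ 1 + X $ 2 $ 2 + X $ 3 $ 3 = 0"
    using lie_cartan_point_nth[of 0 1 2 3 4 5 6 7, OF _ 0]
    by (simp add: cartan_simps algebra_simps)
  have e1: "2 * X $ 0 $ 0 + 2 * X $ 1 $ 1 + 2 * X $ 4 $ 4 + 2 * X $ 5 $ 5 = 0"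
    using lie_cartan_point_nth[of 0 1 4 5 2 3 6 7, OF _ 0]
    by (simp add: cartan_simps algebra_simps)
  have e2: "4 * X $ 0 $ 0 + 4 * X $ 1 $ 1 + 4 * X $ 6 $ 6 + 4 * X $ 7 $ 7 = 0"
    using lie_cartan_point_nth[of 0 1 6 7 2 3 4 5, OF _ 0]
    by (simp add: cartan_simps algebra_simps)
  have e3: "8 * X $ 0 $ 0 + 8 * X $ 2 $ 2 + 8 * X $ 4 $ 4 + 8 * X $ 6 $ 6 = 0"
    using lie_cartan_point_nth[of 0 2 4 6 1 3 5 7, OF _ 0]
    by (simp add: cartan_simps algebra_simps)
  have e4: "16 * X $ 0 $ 0 + 16 * X $ 2 $ 2 + 16 * X $ 5 $ 5 + 16 * X $ 7 $ 7 = 0"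
    using lie_cartan_point_nth[of 0 2 5 7 1 3 4 6, OF _ 0]
    by (simp add: cartan_simps algebra_simps)
  have e5: "32 * X $ 0 $ 0 + 32 * X $ 3 $ 3 + 32 * X $ 4 $ 4 + 32 * X $ 7 $ 7 = 0"
    using lie_cartan_point_nth[of 0 3 4 7 1 2 5 6, OF _ 0]
    by (simp add: cartan_simps algebra_simps)
  have e6: "64 * X $ 0 $ 0 + 64 * X $ 3 $ 3 + 64 * X $ 5 $ 5 + 64 * X $ 6 $ 6 = 0"
    using lie_cartan_point_nth[of 0 3 5 6 1 2 4 7, OF _ 0]
    by (simp add: cartan_simps algebra_simps)
  have e7: "64 * X $ 1 $ 1 + 64 * X $ 2 $ 2 + 64 * X $ 4 $ 4 + 64 * X $ 7 $ 7 = 0"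
    using lie_cartan_point_nth[of 1 2 4 7 0 3 5 6, OF _ 0]
    by (simp add: cartan_simps algebra_simps)
  have e8: "32 * X $ 1 $ 1 + 32 * X $ 2 $ 2 + 32 * X $ 5 $ 5 + 32 * X $ 6 $ 6 = 0"
    using lie_cartan_point_nth[of 1 2 5 6 0 3 4 7, OF _ 0]
    by (simp add: cartan_simps algebra_simps)
  have e9: "16 * X $ 1 $ 1 + 16 * X $ 3 $ 3 + 16 * X $ 4 $ 4 + 16 * X $ 6 $ 6 = 0"
    using lie_cartan_point_nth[of 1 3 4 6 0 2 5 7, OF _ 0]
    by (simp add: cartan_simps algebra_simps)
  have e10: "8 * X $ 1 $ 1 + 8 * X $ 3 $ 3 + 8 * X $ 5 $ 5 + 8 * X $ 7 $ 7 = 0"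
    using lie_cartan_point_nth[of 1 3 5 7 0 2 4 6, OF _ 0]
    by (simp add: cartan_simps algebra_simps)
  have e11: "4 * X $ 2 $ 2 + 4 * X $ 3 $ 3 + 4 * X $ 4 $ 4 + 4 * X $ 5 $ 5 = 0"
    using lie_cartan_point_nth[of 2 3 4 5 0 1 6 7, OF _ 0]
    by (simp add: cartan_simps algebra_simps)
  have e12: "2 * X $ 2 $ 2 + 2 * X $ 3 $ 3 + 2 * X $ 6 $ 6 + 2 * X $ 7 $ 7 = 0"
    using lie_cartan_point_nth[of 2 3 6 7 0 1 4 5, OF _ 0]
    by (simp add: cartan_simps algebra_simps)
  have e13: "X $ 4 $ 4 + X $ 5 $ 5 + X $ 6 $ 6 + X $ 7 $ 7 = 0"
    using lie_cartan_point_nth[of 4 5 6 7 0 1 2 3, OF _ 0]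
    by (simp add: cartan_simps algebra_simps)
  show ?thesis using e0 e1 e2 e3 e4 e5 e6 e7 e8 e9 e10 e11 e12 e13 by (intro conjI; algebra)
qed
text \<open>Block \<open>d\<close> takes the sets whose four elements have xor \<open>d\<close>.
  Exchanging \<open>i\<close> for an outside index gives a plane only if that index is
  \<open>i xor d\<close>, which leaves four terms per equation. The same choice is made in the
  following blocks.\<close>

lemma cartan_point_block1:
  assumes 0: "lie X cartan_point = 0"
  shows "X $ 0 $ 1 = 0 \<and> X $ 1 $ 0 = 0 \<and> X $ 2 $ 3 = 0 \<and> X $ 3 $ 2 = 0 \<and> X $ 4 $ 5 = 0 \<and> X $ 5 $ 4 = 0 \<and> X $ 6 $ 7 = 0 \<and> X $ 7 $ 6 = 0"
proof -
  have e0: "64 * X $ 0 $ 1 + 32 * X $ 2 $ 3 + 16 * X $ 4 $ 5 + 8 * X $ 7 $ 6 = 0"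
    using lie_cartan_point_nth[of 0 2 4 7 1 3 5 6, OF _ 0]
    by (simp add: cartan_simps algebra_simps)
  have e1: "32 * X $ 0 $ 1 + 64 * X $ 2 $ 3 + 8 * X $ 5 $ 4 + 16 * X $ 6 $ 7 = 0"
    using lie_cartan_point_nth[of 0 2 5 6 1 3 4 7, OF _ 0]
    by (simp add: cartan_simps algebra_simps)
  have e2: "16 * X $ 0 $ 1 + 8 * X $ 3 $ 2 + 64 * X $ 4 $ 5 + 32 * X $ 6 $ 7 = 0"
    using lie_cartan_point_nth[of 0 3 4 6 1 2 5 7, OF _ 0]
    by (simp add: cartan_simps algebra_simps)
  have e3: "8 * X $ 0 $ 1 + 16 * X $ 3 $ 2 + 32 * X $ 5 $ 4 + 64 * X $ 7 $ 6 = 0"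
    using lie_cartan_point_nth[of 0 3 5 7 1 2 4 6, OF _ 0]
    by (simp add: cartan_simps algebra_simps)
  have e4: "8 * X $ 1 $ 0 + 16 * X $ 2 $ 3 + 32 * X $ 4 $ 5 + 64 * X $ 6 $ 7 = 0"
    using lie_cartan_point_nth[of 1 2 4 6 0 3 5 7, OF _ 0]
    by (simp add: cartan_simps algebra_simps)
  have e5: "16 * X $ 1 $ 0 + 8 * X $ 2 $ 3 + 64 * X $ 5 $ 4 + 32 * X $ 7 $ 6 = 0"
    using lie_cartan_point_nth[of 1 2 5 7 0 3 4 6, OF _ 0]
    by (simp add: cartan_simps algebra_simps)
  have e6: "32 * X $ 1 $ 0 + 64 * X $ 3 $ 2 + 8 * X $ 4 $ 5 + 16 * X $ 7 $ 6 = 0"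
    using lie_cartan_point_nth[of 1 3 4 7 0 2 5 6, OF _ 0]
    by (simp add: cartan_simps algebra_simps)
  have e7: "64 * X $ 1 $ 0 + 32 * X $ 3 $ 2 + 16 * X $ 5 $ 4 + 8 * X $ 6 $ 7 = 0"
    using lie_cartan_point_nth[of 1 3 5 6 0 2 4 7, OF _ 0]
    by (simp add: cartan_simps algebra_simps)
  show ?thesis using e0 e1 e2 e3 e4 e5 e6 e7 by (intro conjI; algebra)
qed
lemma cartan_point_block2:
  assumes 0: "lie X cartan_point = 0"
  shows "X $ 0 $ 2 = 0 \<and> X $ 1 $ 3 = 0 \<and> X $ 2 $ 0 = 0 \<and> X $ 3 $ 1 = 0 \<and> X $ 4 $ 6 = 0 \<and> X $ 5 $ 7 = 0 \<and> X $ 6 $ 4 = 0 \<and> X $ 7 $ 5 = 0"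
proof -
  have e0: "- 64 * X $ 0 $ 2 + 32 * X $ 1 $ 3 + 4 * X $ 4 $ 6 + 2 * X $ 7 $ 5 = 0"
    using lie_cartan_point_nth[of 0 1 4 7 2 3 5 6, OF _ 0]
    by (simp add: cartan_simps algebra_simps)
  have e1: "- 32 * X $ 0 $ 2 + 64 * X $ 1 $ 3 - 4 * X $ 5 $ 7 - 2 * X $ 6 $ 4 = 0"
    using lie_cartan_point_nth[of 0 1 5 6 2 3 4 7, OF _ 0]
    by (simp add: cartan_simps algebra_simps)
  have e2: "4 * X $ 0 $ 2 + 2 * X $ 3 $ 1 - 64 * X $ 4 $ 6 + 32 * X $ 5 $ 7 = 0"
    using lie_cartan_point_nth[of 0 3 4 5 1 2 6 7, OF _ 0]
    by (simp add: cartan_simps algebra_simps)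
  have e3: "2 * X $ 0 $ 2 + 4 * X $ 3 $ 1 + 32 * X $ 6 $ 4 - 64 * X $ 7 $ 5 = 0"
    using lie_cartan_point_nth[of 0 3 6 7 1 2 4 5, OF _ 0]
    by (simp add: cartan_simps algebra_simps)
  have e4: "- 4 * X $ 1 $ 3 - 2 * X $ 2 $ 0 - 32 * X $ 4 $ 6 + 64 * X $ 5 $ 7 = 0"
    using lie_cartan_point_nth[of 1 2 4 5 0 3 6 7, OF _ 0]
    by (simp add: cartan_simps algebra_simps)
  have e5: "- 2 * X $ 1 $ 3 - 4 * X $ 2 $ 0 + 64 * X $ 6 $ 4 - 32 * X $ 7 $ 5 = 0"
    using lie_cartan_point_nth[of 1 2 6 7 0 3 4 5, OF _ 0]
    by (simp add: cartan_simps algebra_simps)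
  have e6: "32 * X $ 2 $ 0 - 64 * X $ 3 $ 1 + 2 * X $ 4 $ 6 + 4 * X $ 7 $ 5 = 0"
    using lie_cartan_point_nth[of 2 3 4 7 0 1 5 6, OF _ 0]
    by (simp add: cartan_simps algebra_simps)
  have e7: "64 * X $ 2 $ 0 - 32 * X $ 3 $ 1 - 2 * X $ 5 $ 7 - 4 * X $ 6 $ 4 = 0"
    using lie_cartan_point_nth[of 2 3 5 6 0 1 4 7, OF _ 0]
    by (simp add: cartan_simps algebra_simps)
  show ?thesis using e0 e1 e2 e3 e4 e5 e6 e7 by (intro conjI; algebra)
qed
lemma cartan_point_block3:
  assumes 0: "lie X cartan_point = 0"
  shows "X $ 0 $ 3 = 0 \<and> X $ 1 $ 2 = 0 \<and> X $ 2 $ 1 = 0 \<and> X $ 3 $ 0 = 0 \<and> X $ 4 $ 7 = 0 \<and> X $ 5 $ 6 = 0 \<and> X $ 6 $ 5 = 0 \<and> X $ 7 $ 4 = 0"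
proof -
  have e0: "- 16 * X $ 0 $ 3 + 8 * X $ 1 $ 2 - 4 * X $ 4 $ 7 + 2 * X $ 6 $ 5 = 0"
    using lie_cartan_point_nth[of 0 1 4 6 2 3 5 7, OF _ 0]
    by (simp add: cartan_simps algebra_simps)
  have e1: "- 8 * X $ 0 $ 3 + 16 * X $ 1 $ 2 + 4 * X $ 5 $ 6 - 2 * X $ 7 $ 4 = 0"
    using lie_cartan_point_nth[of 0 1 5 7 2 3 4 6, OF _ 0]
    by (simp add: cartan_simps algebra_simps)
  have e2: "- 4 * X $ 0 $ 3 + 2 * X $ 2 $ 1 - 16 * X $ 4 $ 7 + 8 * X $ 5 $ 6 = 0"
    using lie_cartan_point_nth[of 0 2 4 5 1 3 6 7, OF _ 0]
    by (simp add: cartan_simps algebra_simps)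
  have e3: "- 2 * X $ 0 $ 3 + 4 * X $ 2 $ 1 + 16 * X $ 6 $ 5 - 8 * X $ 7 $ 4 = 0"
    using lie_cartan_point_nth[of 0 2 6 7 1 3 4 5, OF _ 0]
    by (simp add: cartan_simps algebra_simps)
  have e4: "4 * X $ 1 $ 2 - 2 * X $ 3 $ 0 - 8 * X $ 4 $ 7 + 16 * X $ 5 $ 6 = 0"
    using lie_cartan_point_nth[of 1 3 4 5 0 2 6 7, OF _ 0]
    by (simp add: cartan_simps algebra_simps)
  have e5: "2 * X $ 1 $ 2 - 4 * X $ 3 $ 0 + 8 * X $ 6 $ 5 - 16 * X $ 7 $ 4 = 0"
    using lie_cartan_point_nth[of 1 3 6 7 0 2 4 5, OF _ 0]
    by (simp add: cartan_simps algebra_simps)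
  have e6: "16 * X $ 2 $ 1 - 8 * X $ 3 $ 0 - 2 * X $ 4 $ 7 + 4 * X $ 6 $ 5 = 0"
    using lie_cartan_point_nth[of 2 3 4 6 0 1 5 7, OF _ 0]
    by (simp add: cartan_simps algebra_simps)
  have e7: "8 * X $ 2 $ 1 - 16 * X $ 3 $ 0 + 2 * X $ 5 $ 6 - 4 * X $ 7 $ 4 = 0"
    using lie_cartan_point_nth[of 2 3 5 7 0 1 4 6, OF _ 0]
    by (simp add: cartan_simps algebra_simps)
  show ?thesis using e0 e1 e2 e3 e4 e5 e6 e7 by (intro conjI; algebra)
qed
lemma cartan_point_block4:
  assumes 0: "lie X cartan_point = 0"
  shows "X $ 0 $ 4 = 0 \<and> X $ 1 $ 5 = 0 \<and> X $ 2 $ 6 = 0 \<and> X $ 3 $ 7 = 0 \<and> X $ 4 $ 0 = 0 \<and> X $ 5 $ 1 = 0 \<and> X $ 6 $ 2 = 0 \<and> X $ 7 $ 3 = 0"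
proof -
  have e0: "64 * X $ 0 $ 4 - 16 * X $ 1 $ 5 + 4 * X $ 2 $ 6 + X $ 7 $ 3 = 0"
    using lie_cartan_point_nth[of 0 1 2 7 3 4 5 6, OF _ 0]
    by (simp add: cartan_simps algebra_simps)
  have e1: "16 * X $ 0 $ 4 - 64 * X $ 1 $ 5 - 4 * X $ 3 $ 7 - X $ 6 $ 2 = 0"
    using lie_cartan_point_nth[of 0 1 3 6 2 4 5 7, OF _ 0]
    by (simp add: cartan_simps algebra_simps)
  have e2: "4 * X $ 0 $ 4 + 64 * X $ 2 $ 6 - 16 * X $ 3 $ 7 + X $ 5 $ 1 = 0"
    using lie_cartan_point_nth[of 0 2 3 5 1 4 6 7, OF _ 0]
    by (simp add: cartan_simps algebra_simps)
  have e3: "X $ 0 $ 4 + 4 * X $ 5 $ 1 - 16 * X $ 6 $ 2 + 64 * X $ 7 $ 3 = 0"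
    using lie_cartan_point_nth[of 0 5 6 7 1 2 3 4, OF _ 0]
    by (simp add: cartan_simps algebra_simps)
  have e4: "- 4 * X $ 1 $ 5 + 16 * X $ 2 $ 6 - 64 * X $ 3 $ 7 - X $ 4 $ 0 = 0"
    using lie_cartan_point_nth[of 1 2 3 4 0 5 6 7, OF _ 0]
    by (simp add: cartan_simps algebra_simps)
  have e5: "- X $ 1 $ 5 - 4 * X $ 4 $ 0 - 64 * X $ 6 $ 2 + 16 * X $ 7 $ 3 = 0"
    using lie_cartan_point_nth[of 1 4 6 7 0 2 3 5, OF _ 0]
    by (simp add: cartan_simps algebra_simps)
  have e6: "X $ 2 $ 6 - 16 * X $ 4 $ 0 + 64 * X $ 5 $ 1 + 4 * X $ 7 $ 3 = 0"
    using lie_cartan_point_nth[of 2 4 5 7 0 1 3 6, OF _ 0]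
    by (simp add: cartan_simps algebra_simps)
  have e7: "- X $ 3 $ 7 - 64 * X $ 4 $ 0 + 16 * X $ 5 $ 1 - 4 * X $ 6 $ 2 = 0"
    using lie_cartan_point_nth[of 3 4 5 6 0 1 2 7, OF _ 0]
    by (simp add: cartan_simps algebra_simps)
  show ?thesis using e0 e1 e2 e3 e4 e5 e6 e7 by (intro conjI; algebra)
qed
lemma cartan_point_block5:
  assumes 0: "lie X cartan_point = 0"
  shows "X $ 0 $ 5 = 0 \<and> X $ 1 $ 4 = 0 \<and> X $ 2 $ 7 = 0 \<and> X $ 3 $ 6 = 0 \<and> X $ 4 $ 1 = 0 \<and> X $ 5 $ 0 = 0 \<and> X $ 6 $ 3 = 0 \<and> X $ 7 $ 2 = 0"
proof -
  have e0: "32 * X $ 0 $ 5 - 8 * X $ 1 $ 4 - 4 * X $ 2 $ 7 + X $ 6 $ 3 = 0"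
    using lie_cartan_point_nth[of 0 1 2 6 3 4 5 7, OF _ 0]
    by (simp add: cartan_simps algebra_simps)
  have e1: "8 * X $ 0 $ 5 - 32 * X $ 1 $ 4 + 4 * X $ 3 $ 6 - X $ 7 $ 2 = 0"
    using lie_cartan_point_nth[of 0 1 3 7 2 4 5 6, OF _ 0]
    by (simp add: cartan_simps algebra_simps)
  have e2: "- 4 * X $ 0 $ 5 + 32 * X $ 2 $ 7 - 8 * X $ 3 $ 6 + X $ 4 $ 1 = 0"
    using lie_cartan_point_nth[of 0 2 3 4 1 5 6 7, OF _ 0]
    by (simp add: cartan_simps algebra_simps)
  have e3: "- X $ 0 $ 5 + 4 * X $ 4 $ 1 - 32 * X $ 6 $ 3 + 8 * X $ 7 $ 2 = 0"
    using lie_cartan_point_nth[of 0 4 6 7 1 2 3 5, OF _ 0]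
    by (simp add: cartan_simps algebra_simps)
  have e4: "4 * X $ 1 $ 4 + 8 * X $ 2 $ 7 - 32 * X $ 3 $ 6 - X $ 5 $ 0 = 0"
    using lie_cartan_point_nth[of 1 2 3 5 0 4 6 7, OF _ 0]
    by (simp add: cartan_simps algebra_simps)
  have e5: "X $ 1 $ 4 - 4 * X $ 5 $ 0 - 8 * X $ 6 $ 3 + 32 * X $ 7 $ 2 = 0"
    using lie_cartan_point_nth[of 1 5 6 7 0 2 3 4, OF _ 0]
    by (simp add: cartan_simps algebra_simps)
  have e6: "- X $ 2 $ 7 - 32 * X $ 4 $ 1 + 8 * X $ 5 $ 0 + 4 * X $ 6 $ 3 = 0"
    using lie_cartan_point_nth[of 2 4 5 6 0 1 3 7, OF _ 0]
    by (simp add: cartan_simps algebra_simps)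
  have e7: "X $ 3 $ 6 - 8 * X $ 4 $ 1 + 32 * X $ 5 $ 0 - 4 * X $ 7 $ 2 = 0"
    using lie_cartan_point_nth[of 3 4 5 7 0 1 2 6, OF _ 0]
    by (simp add: cartan_simps algebra_simps)
  show ?thesis using e0 e1 e2 e3 e4 e5 e6 e7 by (intro conjI; algebra)
qed
lemma cartan_point_block6:
  assumes 0: "lie X cartan_point = 0"
  shows "X $ 0 $ 6 = 0 \<and> X $ 1 $ 7 = 0 \<and> X $ 2 $ 4 = 0 \<and> X $ 3 $ 5 = 0 \<and> X $ 4 $ 2 = 0 \<and> X $ 5 $ 3 = 0 \<and> X $ 6 $ 0 = 0 \<and> X $ 7 $ 1 = 0"
proof -
  have e0: "- 32 * X $ 0 $ 6 + 16 * X $ 1 $ 7 + 2 * X $ 2 $ 4 + X $ 5 $ 3 = 0"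
    using lie_cartan_point_nth[of 0 1 2 5 3 4 6 7, OF _ 0]
    by (simp add: cartan_simps algebra_simps)
  have e1: "- 16 * X $ 0 $ 6 + 32 * X $ 1 $ 7 - 2 * X $ 3 $ 5 - X $ 4 $ 2 = 0"
    using lie_cartan_point_nth[of 0 1 3 4 2 5 6 7, OF _ 0]
    by (simp add: cartan_simps algebra_simps)
  have e2: "2 * X $ 0 $ 6 - 32 * X $ 2 $ 4 + 16 * X $ 3 $ 5 + X $ 7 $ 1 = 0"
    using lie_cartan_point_nth[of 0 2 3 7 1 4 5 6, OF _ 0]
    by (simp add: cartan_simps algebra_simps)
  have e3: "X $ 0 $ 6 + 16 * X $ 4 $ 2 - 32 * X $ 5 $ 3 + 2 * X $ 7 $ 1 = 0"
    using lie_cartan_point_nth[of 0 4 5 7 1 2 3 6, OF _ 0]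
    by (simp add: cartan_simps algebra_simps)
  have e4: "- 2 * X $ 1 $ 7 - 16 * X $ 2 $ 4 + 32 * X $ 3 $ 5 - X $ 6 $ 0 = 0"
    using lie_cartan_point_nth[of 1 2 3 6 0 4 5 7, OF _ 0]
    by (simp add: cartan_simps algebra_simps)
  have e5: "- X $ 1 $ 7 + 32 * X $ 4 $ 2 - 16 * X $ 5 $ 3 - 2 * X $ 6 $ 0 = 0"
    using lie_cartan_point_nth[of 1 4 5 6 0 2 3 7, OF _ 0]
    by (simp add: cartan_simps algebra_simps)
  have e6: "X $ 2 $ 4 + 2 * X $ 5 $ 3 + 16 * X $ 6 $ 0 - 32 * X $ 7 $ 1 = 0"
    using lie_cartan_point_nth[of 2 5 6 7 0 1 3 4, OF _ 0]
    by (simp add: cartan_simps algebra_simps)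
  have e7: "- X $ 3 $ 5 - 2 * X $ 4 $ 2 + 32 * X $ 6 $ 0 - 16 * X $ 7 $ 1 = 0"
    using lie_cartan_point_nth[of 3 4 6 7 0 1 2 5, OF _ 0]
    by (simp add: cartan_simps algebra_simps)
  show ?thesis using e0 e1 e2 e3 e4 e5 e6 e7 by (intro conjI; algebra)
qed
lemma cartan_point_block7:
  assumes 0: "lie X cartan_point = 0"
  shows "X $ 0 $ 7 = 0 \<and> X $ 1 $ 6 = 0 \<and> X $ 2 $ 5 = 0 \<and> X $ 3 $ 4 = 0 \<and> X $ 4 $ 3 = 0 \<and> X $ 5 $ 2 = 0 \<and> X $ 6 $ 1 = 0 \<and> X $ 7 $ 0 = 0"
proof -
  have e0: "- 64 * X $ 0 $ 7 + 8 * X $ 1 $ 6 - 2 * X $ 2 $ 5 + X $ 4 $ 3 = 0"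
    using lie_cartan_point_nth[of 0 1 2 4 3 5 6 7, OF _ 0]
    by (simp add: cartan_simps algebra_simps)
  have e1: "- 8 * X $ 0 $ 7 + 64 * X $ 1 $ 6 + 2 * X $ 3 $ 4 - X $ 5 $ 2 = 0"
    using lie_cartan_point_nth[of 0 1 3 5 2 4 6 7, OF _ 0]
    by (simp add: cartan_simps algebra_simps)
  have e2: "- 2 * X $ 0 $ 7 - 64 * X $ 2 $ 5 + 8 * X $ 3 $ 4 + X $ 6 $ 1 = 0"
    using lie_cartan_point_nth[of 0 2 3 6 1 4 5 7, OF _ 0]
    by (simp add: cartan_simps algebra_simps)
  have e3: "- X $ 0 $ 7 + 64 * X $ 4 $ 3 - 8 * X $ 5 $ 2 + 2 * X $ 6 $ 1 = 0"
    using lie_cartan_point_nth[of 0 4 5 6 1 2 3 7, OF _ 0]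
    by (simp add: cartan_simps algebra_simps)
  have e4: "2 * X $ 1 $ 6 - 8 * X $ 2 $ 5 + 64 * X $ 3 $ 4 - X $ 7 $ 0 = 0"
    using lie_cartan_point_nth[of 1 2 3 7 0 4 5 6, OF _ 0]
    by (simp add: cartan_simps algebra_simps)
  have e5: "X $ 1 $ 6 + 8 * X $ 4 $ 3 - 64 * X $ 5 $ 2 - 2 * X $ 7 $ 0 = 0"
    using lie_cartan_point_nth[of 1 4 5 7 0 2 3 6, OF _ 0]
    by (simp add: cartan_simps algebra_simps)
  have e6: "- X $ 2 $ 5 + 2 * X $ 4 $ 3 + 64 * X $ 6 $ 1 - 8 * X $ 7 $ 0 = 0"
    using lie_cartan_point_nth[of 2 4 6 7 0 1 3 5, OF _ 0]
    by (simp add: cartan_simps algebra_simps)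
  have e7: "X $ 3 $ 4 - 2 * X $ 5 $ 2 + 8 * X $ 6 $ 1 - 64 * X $ 7 $ 0 = 0"
    using lie_cartan_point_nth[of 3 5 6 7 0 1 2 4, OF _ 0]
    by (simp add: cartan_simps algebra_simps)
  show ?thesis using e0 e1 e2 e3 e4 e5 e6 e7 by (intro conjI; algebra)
qed

section \<open>Nondegeneracy at real self-dual points and the dimension of centralizers\<close>

lemma top_pair_vol_dual: "top_pair a b = bdot (vol_dual 1 a) b"
proof -
  have "top_pair a b = (\<Sum>I\<in>UNIV. shuffle_sign I (- I) * a $ I * b $ (- I))"
    by (simp add: top_pair_def wedge_def Compl_eq_Diff_UNIV)
  also have "\<dots> = (\<Sum>J\<in>UNIV. shuffle_sign (- J) J * a $ (- J) * b $ J)"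
    by (rule sum.reindex_bij_witness[of _ uminus uminus]) auto
  finally show ?thesis by (simp add: bdot_def vol_dual_def)
qed

text \<open>For elementary matrices, multiplication and contraction are adjoint, which exchanges the
  two indices.\<close>

lemma bdot_lie: "bdot a (lie X b) = bdot (lie (transpose X) a) b"
proof -
  have sp: "(\<Sum>p\<in>UNIV. f p) = (\<Sum>i\<in>UNIV. \<Sum>j\<in>UNIV. f (i, j))" for f :: "'a \<times> 'a \<Rightarrow> complex"
    by (simp add: sum.cartesian_product case_prod_unfold)
  have adj: "bdot a (lie_elem (i, j) b) = bdot b (lie_elem (j, i) a)" for i j
    by (simp add: lie_elem_def) (metis bdot_wedge bdot_commute)
  have "bdot a (lie X b) = (\<Sum>i\<in>UNIV. \<Sum>j\<in>UNIV. X $ i $ j * bdot a (lie_elem (i, j) b))"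
    by (simp add: lie_expand bdot_sum_right bdot_simps sp)
  also have "\<dots> = (\<Sum>j\<in>UNIV. \<Sum>i\<in>UNIV. X $ i $ j * bdot b (lie_elem (j, i) a))"
    unfolding adj by (rule sum.swap)
  also have "\<dots> = bdot b (lie (transpose X) a)"
    by (simp add: lie_expand bdot_sum_right bdot_simps sp transpose_def)
  finally show ?thesis by (simp add: bdot_commute)
qed

text \<open>The infinitesimal form of \<open>star_ext_map\<close>: the dual carries the
  contragredient action, twisted by the trace.\<close>

lemma vol_dual_lie: "vol_dual 1 (lie X a) = trace X *s vol_dual 1 a - lie (transpose X) (vol_dual 1 a)"
proof (rule bdot_eqI)
  fix z
  show "bdot (vol_dual 1 (lie X a)) z = bdot (trace X *s vol_dual 1 a - lie (transpose X) (vol_dual 1 a)) z"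
    using top_pair_lie[of X a z] by (simp add: top_pair_vol_dual bdot_simps bdot_lie algebra_simps)
qed

lemma lie_mat: "lie (mat c) a $ K = of_nat (card K) * c * a $ K"
proof -
  have "lie (mat c) a $ K = (\<Sum>i\<in>K. \<Sum>j\<in>- (K - {i}). if j = i then c * a $ K else 0)"
    unfolding lie_nth
    by (intro sum.cong refl) (auto simp: mat_def shuffle_sign_square insert_absorb mult.assoc[symmetric])
  also have "\<dots> = (\<Sum>i\<in>K. c * a $ K)"
    by (intro sum.cong refl) simp
  finally show ?thesis by simp
qed

lemma lie_mat_four: "a \<in> ext_power 4 \<Longrightarrow> lie (mat c) a = (4 * c) *s a"
proof -
  assume a: "a \<in> ext_power 4"
  have "lie (mat c) a $ K = 4 * c * a $ K" for K
    using a by (cases "card K = 4") (auto simp: lie_mat ext_power_def)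
  then show ?thesis by (simp add: vec_eq_iff)
qed

lemma trace_mat_8: "trace (mat c :: 8 endo) = 8 * c"
  by (simp add: trace_def mat_def)

text \<open>Only traceless matrices are tested by \<open>commuting\<close>. The scalar part
  \<open>trace X / 8\<close> acts on degree four as multiplication by
  \<open>trace X / 2\<close>.\<close>

lemma top_pair_lie_commuting:
  fixes a b :: "8 ext"
  assumes "a \<in> ext_power 4" "commuting a b"
  shows "top_pair (lie X a) b = trace X / 2 * top_pair a b"
proof -
  have "trace (X - mat (trace X / 8)) = 0"
    by (simp add: trace_sub trace_mat_8)
  then have "top_pair (lie (X - mat (trace X / 8)) a) b = 0"
    using assms(2) by (simp add: commuting_def)
  then show ?thesis by (simp add: lie_linear lie_mat_four[OF assms(1)] top_pair_linear)
qed

lemma lie_cnj: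
  assumes "\<And>K. cnj (a $ K) = a $ K"
  shows "lie (\<chi> i j. cnj (X $ i $ j)) a $ K = cnj (lie X a $ K)"
proof -
  have "cnj (shuffle_sign I J) = shuffle_sign I J" for I J :: "'a set" by (simp add: shuffle_sign_def)
  then show ?thesis by (simp add: lie_nth assms)
qed

text \<open>A Hermitian argument: with respect to a real self-dual point, the Gram form is
  \<open>(X, Y) \<mapsto> bdot (lie W a) (lie Y a)\<close> with \<open>W = (tr X / 4) 1 - transpose X\<close>, and \<open>Y\<close> can be the conjugate of \<open>W\<close>.\<close>

lemma gram_real_self_dual:
  fixes a :: "8 ext"
  assumes a: "a \<in> ext_power 4" "vol_dual 1 a = a" and re: "\<And>K. cnj (a $ K) = a $ K"
    and inj: "\<And>X. lie X a = 0 \<Longrightarrow> X = 0"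
  shows "det (gram a) \<noteq> 0"
  unfolding gram_nondegenerate[OF a(1)]
proof (intro allI impI)
  fix X assume X: "\<forall>Y. top_pair (lie X a) (lie Y a) = 0"
  \<comment> \<open>The scalar \<open>trace X / 4\<close> acts on degree four as
    \<open>trace X\<close>, the first term of \<open>vol_dual_lie\<close>.\<close>
  define W where "W = mat (trace X / 4) - transpose X"
  define Y where "Y = (\<chi> i j. cnj (W $ i $ j))"
  have "vol_dual 1 (lie X a) = lie W a"
    by (simp add: vol_dual_lie a W_def lie_linear lie_mat_four)
  then have "bdot (lie W a) (lie Y a) = 0" using X by (simp add: top_pair_vol_dual)
  then have "(\<Sum>K\<in>UNIV. complex_of_real ((cmod (lie W a $ K))\<^sup>2)) = 0"
    by (simp add: bdot_def Y_def lie_cnj[OF re] complex_norm_square del: of_real_power)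
  then have "(\<Sum>K\<in>UNIV. (cmod (lie W a $ K))\<^sup>2) = 0"
    unfolding of_real_sum[symmetric] of_real_eq_0_iff .
  then have "lie W a = 0" by (simp add: sum_nonneg_eq_0_iff vec_eq_iff)
  then have "W = 0" by (rule inj)
  then have t: "transpose X = mat (trace X / 4)" by (simp add: W_def)
  \<comment> \<open>Eight diagonal entries \<open>trace X / 4\<close>; since transposing keeps the
    trace, it must be zero.\<close>
  then have "trace (transpose X) = 2 * trace X" by (simp add: trace_mat_8)
  then have "trace X = 0" by (simp add: trace_def transpose_def)
  then show "X = 0" using t by (simp add: vec_eq_iff transpose_def mat_def)
qed

lemma dim_ext_power: "vec.dim (ext_power k :: 8 ext set) = 8 choose k"
proof -
  have "(ext_power k :: 8 ext set) = {x. \<forall>I. I \<notin> {I. card I = k} \<longrightarrow> x $ I = 0}"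
    by (auto simp: ext_power_def)
  then have "vec.dim (ext_power k :: 8 ext set) = card {I :: 8 set. card I = k}"
    by (simp only: dim_substandard_cart)
  then show ?thesis using n_subsets[of "UNIV :: 8 set" k] by simp
qed

lemma subspace_commuting: "vec.subspace {y \<in> ext_power 4. commuting x y}"
  by (auto simp: vec.subspace_def ext_power_def commuting_def top_pair_linear)

text \<open>The orbit directions have dimension 64 in a space of dimension 70, so their orthogonal
  complement has dimension at most 6. Testing traceless matrices only adds the direction of
  \<open>x\<close>, which gives 7.\<close>

lemma dim_commuting:
  fixes x :: "8 ext"
  assumes x: "x \<in> ext_power 4" and g: "det (gram x) \<noteq> 0"
  shows "vec.dim {y \<in> ext_power 4. commuting x y} \<le> 7"
proof -
  define T where "T = range (\<lambda>\<xi>. lie (vec_matrix \<xi>) x)"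
  define C where "C = {y \<in> ext_power 4. \<forall>X. top_pair (lie X x) y = 0}"
  have nd: "Z = 0" if "\<And>X. top_pair (lie X x) (lie Z x) = 0" for Z
  proof -
    have "\<forall>Y. top_pair (lie Z x) (lie Y x) = 0"
      using that by (simp add: top_pair_commute[of "lie Z x"] lie_power x)
    then show ?thesis using g gram_nondegenerate[OF x] by blast
  qed
  have lin: "Vector_Spaces.linear (*s) (*s) (\<lambda>\<xi>. lie (vec_matrix \<xi>) x)"
  proof -
    have "lie (vec_matrix (\<xi> + \<eta>)) x = lie (vec_matrix \<xi>) x + lie (vec_matrix \<eta>) x" for \<xi> \<eta>
      by (simp add: lie_vec_matrix vec.scale_left_distrib sum.distrib)
    moreover have "lie (vec_matrix (c *s \<xi>)) x = c *s lie (vec_matrix \<xi>) x" for c \<xi>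
      by (simp add: lie_vec_matrix vec.scale_sum_right)
    ultimately show ?thesis by (auto intro!: Vector_Spaces.linear_iff[THEN iffD2] vec.vector_space_axioms simp: vec.vector_space_axioms)
  qed
  have vm: "vec_matrix \<xi> = 0 \<longleftrightarrow> \<xi> = 0" for \<xi> :: "complex ^ (8 \<times> 8)"
    by (auto simp: vec_matrix_def vec_eq_iff)
  have inj0: "\<xi> = 0" if "lie (vec_matrix \<xi>) x = 0" for \<xi>
    using nd[of "vec_matrix \<xi>"] that by (simp add: top_pair_linear vm)
  have "inj (\<lambda>\<xi>. lie (vec_matrix \<xi>) x)"
    using vec.linear_inj_iff_eq_0[OF lin] inj0 by blast
  then have "vec.dim T = vec.dim (UNIV :: (complex ^ (8 \<times> 8)) set)"
    unfolding T_def using vec.dim_image_eq[OF lin, of UNIV] by simp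
  then have dT: "vec.dim T = 64" by (simp only: vec_dim_card) simp
  have sT: "vec.subspace T" unfolding T_def by (rule vec.linear_subspace_image[OF lin vec.subspace_UNIV])
  have sC: "vec.subspace C" by (auto simp: C_def vec.subspace_def ext_power_def top_pair_linear)
  have int: "T \<inter> C = {0}"
  proof -
    have "z = 0" if "z \<in> T" "z \<in> C" for z
    proof -
      obtain \<xi> where z: "z = lie (vec_matrix \<xi>) x" using \<open>z \<in> T\<close> by (auto simp: T_def)
      have "vec_matrix \<xi> = 0" using \<open>z \<in> C\<close> by (intro nd) (simp add: C_def z)
      then show "z = 0" by (simp add: z lie_linear)
    qed
    then show ?thesis using sT sC vec.subspace_0 by blast
  qed
  have "{a + b | a b. a \<in> T \<and> b \<in> C} \<subseteq> ext_power 4"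
    using lie_power[OF x] by (auto simp: T_def C_def ext_power_def)
  then have "vec.dim {a + b | a b. a \<in> T \<and> b \<in> C} \<le> 70"
    using vec.dim_subset[of _ "ext_power 4 :: 8 ext set"] by (simp add: dim_ext_power numeral_eq_Suc)
  then have dC: "vec.dim C \<le> 6"
    using vec.dim_sums_Int[OF sT sC] by (simp add: int dT)
  have xT: "x \<in> T"
  proof -
    have "x = lie (vec_matrix (\<chi> p. (mat (1/4) :: 8 endo) $ fst p $ snd p)) x"
      using lie_mat_four[OF x, of "1/4"] by (simp add: vec_matrix_def)
    then show ?thesis unfolding T_def by blast
  qed
  have xx: "top_pair x x \<noteq> 0"
  proof
    assume "top_pair x x = 0"
    then have "x \<in> C" using x top_pair_lie_commuting[OF x commuting_self[OF x]] by (simp add: C_def)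
    then have "x = 0" using xT int by blast
    then have "(mat 1 :: 8 endo) = 0" by (intro nd) (simp add: lie_def top_pair_linear)
    then have "(mat 1 :: 8 endo) $ 0 $ 0 = 0" by simp
    then show False by (simp add: mat_def)
  qed
  have "{y \<in> ext_power 4. commuting x y} \<subseteq> vec.span (insert x C)"
  proof
    fix y assume "y \<in> {y \<in> ext_power 4. commuting x y}"
    then have y: "y \<in> ext_power 4" "commuting x y" by auto
    let ?c = "top_pair x y / top_pair x x"
    have "top_pair (lie X x) (y - ?c *s x) = 0" for X
      using xx by (simp add: top_pair_linear top_pair_lie_commuting[OF x y(2)] top_pair_lie_commuting[OF x commuting_self[OF x]])
    moreover have "y - ?c *s x \<in> ext_power 4"
      using x y(1) by (simp add: ext_power_def)
    ultimately have "y - ?c *s x \<in> C" unfolding C_def by blast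
    then have "(y - ?c *s x) + ?c *s x \<in> vec.span (insert x C)"
      by (intro vec.span_add vec.span_scale vec.span_base) auto
    then show "y \<in> vec.span (insert x C)" by simp
  qed
  from vec.dim_subset[OF this]
  have "vec.dim {y \<in> ext_power 4. commuting x y} \<le> vec.dim (insert x C)"
    by (simp only: vec.dim_span)
  also have "\<dots> \<le> 7" using dC by (simp add: vec.dim_insert)
  finally show ?thesis .
qed

text \<open>The planes through 0: one from each pair of complementary planes.\<close>

definition planes0 :: "8 set set" where
  "planes0 = {{0,1,2,3}, {0,1,4,5}, {0,1,6,7}, {0,2,4,6}, {0,2,5,7}, {0,3,4,7}, {0,3,5,6}}"

definition planes :: "8 set set" where
  "planes = planes0 \<union> uminus ` planes0"

text \<open>Spanned by the seven sums \<open>e_K + e_(-K)\<close>; seven is the rank of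
  \<open>e\<^sub>7\<close>.\<close>

definition cartan_space :: "8 ext set" where
  "cartan_space = {x. (\<forall>K. K \<notin> planes \<longrightarrow> x $ K = 0) \<and> (\<forall>K. x $ (- K) = x $ K)}"

lemma eq_set8: "K = L \<longleftrightarrow> (\<forall>i\<in>{0, 1, 2, 3, 4, 5, 6, 7 :: 8}. i \<in> K \<longleftrightarrow> i \<in> L)"
  unfolding UNIV8[symmetric] by blast

lemma planes0_zero: "K \<in> planes0 \<Longrightarrow> 0 \<in> K"
  by (auto simp: planes0_def)

lemma Compl_planes: "- K \<in> planes \<longleftrightarrow> K \<in> planes"
  by (auto simp: planes_def)

lemma card_Compl8: "card (- K) = 8 - card K" for K :: "8 set"
  by (simp add: Compl_eq_Diff_UNIV card_Diff_subset)

lemma card_planes: "K \<in> planes \<Longrightarrow> card K = 4"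
proof -
  have "card K = 4" if "K \<in> planes0" for K
    using that by (auto simp: planes0_def neq8)
  then show "K \<in> planes \<Longrightarrow> card K = 4" by (auto simp: planes_def card_Compl8)
qed

text \<open>Affine planes over the field with two elements coincide, are disjoint, or meet in a line
  of two points. The proof evaluates the planes through 0 and passes to complements.\<close>

lemma even_planes:
  assumes "K \<in> planes" "L \<in> planes" shows "even (card (K \<inter> L))"
proof -
  have 0: "even (card (K \<inter> L))" if "K \<in> planes0" "L \<in> planes0" for K L
    using that unfolding planes0_def by (elim insertE emptyE) (simp_all add: neq8)
  have c: "even (card (- K \<inter> L)) \<longleftrightarrow> even (card (K \<inter> L))" if "L \<in> planes" for K L
  proof -
    have "card (K \<inter> L) + card (- K \<inter> L) = card L"
      by (subst card_Un_disjoint[symmetric]) (auto intro: arg_cong[where f = card])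
    then have "card (K \<inter> L) + card (- K \<inter> L) = 4" using card_planes[OF that] by simp
    then show ?thesis by presburger
  qed
  have p: "planes0 \<subseteq> planes" by (auto simp: planes_def)
  consider "L \<in> planes0" | "- L \<in> planes0" using assms(2) by (auto simp: planes_def)
  then have 1: "even (card (K \<inter> L))" if "K \<in> planes0" for K
    using 0[of K L] 0[of K "- L"] c[of K L] that p by cases (auto simp: Int_commute)
  show ?thesis
    using assms(1) 1[of K] 1[of "- K"] c[OF assms(2), of K] by (auto simp: planes_def)
qed

lemma Compl_planes0:
  "- {0,1,2,3} = {4,5,6,7::8}" "- {0,1,4,5} = {2,3,6,7::8}" "- {0,1,6,7} = {2,3,4,5::8}" "- {0,2,4,6} = {1,3,5,7::8}"
  "- {0,2,5,7} = {1,3,4,6::8}" "- {0,3,4,7} = {1,2,5,6::8}" "- {0,3,5,6} = {1,2,4,7::8}"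
  by (simp_all add: eq_set8 neq8)

text \<open>The seven planes through 0 are checked by evaluation; swapping complementary sets costs
  no sign, as 4 times 4 is even. These signs are what makes the Cartan subspace self-dual.\<close>

lemma shuffle_sign_planes: "K \<in> planes \<Longrightarrow> shuffle_sign K (- K) = 1"
proof -
  have 0: "shuffle_sign K (- K) = 1" if "K \<in> planes0" for K
  proof -
    have s: "shuffle_sign {a, b, c, d} J = shuffle_sign {a} J * (shuffle_sign {b} J * (shuffle_sign {c} J * shuffle_sign {d} J))"
      if "distinct [a, b, c, d]" for a b c d :: 8 and J
      using that shuffle_sign_insert_left[of a "{b, c, d}" J] shuffle_sign_insert_left[of b "{c, d}" J]
        shuffle_sign_insert_left[of c "{d}" J] by simp
    have "\<forall>K\<in>planes0. shuffle_sign K (- K) = 1"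
      unfolding planes0_def ball_simps Compl_planes0
      by (simp add: s neq8 less8_numeral not_less_0_bit0 shuffle_sign_singleton_insert shuffle_sign_empty)
    then show ?thesis using that by blast
  qed
  show "K \<in> planes \<Longrightarrow> shuffle_sign K (- K) = 1"
    using 0[of K] 0[of "- K"] shuffle_sign_swap[of K "- K"] card_planes[of K] card_planes[of "- K"]
    by (auto simp: planes_def Compl_planes card_Compl8)
qed

lemma cartan_space_power: "cartan_space \<subseteq> ext_power 4"
  using card_planes by (auto simp: cartan_space_def ext_power_def)

lemma cartan_space_self_dual:
  assumes "x \<in> cartan_space" shows "vol_dual 1 x = x"
proof -
  have "shuffle_sign (- K) K * x $ (- K) = x $ K" for K
    using assms shuffle_sign_planes[of "- K"] by (cases "K \<in> planes") (auto simp: cartan_space_def Compl_planes)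
  then show ?thesis by (simp add: vol_dual_def vec_eq_iff)
qed

text \<open>The signs on planes are trivial and \<open>y\<close> agrees on complementary sets, so
  pairing with it is coordinatewise.\<close>

lemma top_pair_cartan_space:
  assumes y: "y \<in> cartan_space"
  shows "top_pair z y = (\<Sum>K\<in>UNIV. z $ K * y $ K)"
proof -
  have e: "shuffle_sign (- K) K * z $ (- K) * y $ K = z $ (- K) * y $ (- K)" for K
    using y shuffle_sign_planes[of "- K"] by (cases "K \<in> planes") (auto simp: cartan_space_def Compl_planes)
  have "top_pair z y = (\<Sum>K\<in>UNIV. shuffle_sign (- K) K * z $ (- K) * y $ K)"
    by (simp add: top_pair_vol_dual bdot_def vol_dual_def)
  also have "\<dots> = (\<Sum>K\<in>UNIV. z $ (- K) * y $ (- K))"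
    by (rule sum.cong[OF refl]) (rule e)
  also have "\<dots> = (\<Sum>K\<in>UNIV. z $ K * y $ K)"
    by (rule sum.reindex_bij_witness[of _ uminus uminus]) auto
  finally show ?thesis .
qed

text \<open>An off-diagonal elementary matrix would turn a plane into one sharing three points with
  it, against \<open>even_planes\<close>. For diagonal ones, complementation shows that the planes
  containing \<open>i\<close> contribute half of the pairing whatever \<open>i\<close> is, so a
  traceless matrix gives zero.\<close>

lemma cartan_space_commuting:
  assumes x: "x \<in> cartan_space" and y: "y \<in> cartan_space"
  shows "commuting x y"
proof -
  define q where "q i = (\<Sum>K | i \<in> K. x $ K * y $ K)" for i :: 8
  note tp = top_pair_cartan_space[OF y]
  have diag: "top_pair (lie_elem (i, i) x) y = q i" for i
    unfolding tp q_def
    by (rule sum.mono_neutral_cong_right) (auto simp: lie_elem_def basis_vec_wedge contr_basis_vec insert_absorb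
      shuffle_sign_square mult.assoc[symmetric])
  have off: "top_pair (lie_elem (i, j) x) y = 0" if "i \<noteq> j" for i j
  proof -
    have "lie_elem (i, j) x $ K * y $ K = 0" for K
    proof (rule ccontr)
      assume n: "lie_elem (i, j) x $ K * y $ K \<noteq> 0"
      then have K: "K \<in> planes" "i \<in> K" "j \<notin> K - {i}" "insert j (K - {i}) \<in> planes"
        using x y by (auto simp: cartan_space_def lie_elem_def basis_vec_wedge contr_basis_vec split: if_splits)
      then have "K \<inter> insert j (K - {i}) = K - {i}" using that by auto
      then have "card (K \<inter> insert j (K - {i})) = 3" using card_planes[OF K(1)] K(2) by simp
      then show False using even_planes[OF K(1) K(4)] by simp
    qed
    then show ?thesis by (simp only: tp sum.neutral_const)
  qed
  have half: "q i = (\<Sum>K\<in>UNIV. x $ K * y $ K) / 2" for i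
  proof -
    have "(\<Sum>K\<in>{K. i \<notin> K}. x $ K * y $ K) = q i"
      unfolding q_def using x y
      by (intro sum.reindex_bij_witness[of _ uminus uminus]) (auto simp: cartan_space_def)
    moreover have "(\<Sum>K\<in>UNIV. x $ K * y $ K) = q i + (\<Sum>K\<in>{K. i \<notin> K}. x $ K * y $ K)"
      unfolding q_def by (subst sum.union_disjoint[symmetric]) (auto intro!: sum.cong)
    ultimately show ?thesis by simp
  qed
  show ?thesis unfolding commuting_def
  proof (intro allI impI)
    fix X :: "8 endo" assume X: "trace X = 0"
    have "top_pair (lie X x) y = (\<Sum>i\<in>UNIV. \<Sum>j\<in>UNIV. X $ i $ j * top_pair (lie_elem (i, j) x) y)"
      by (simp add: lie_expand top_pair_sum top_pair_linear sum.cartesian_product case_prod_unfold)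
    also have "\<dots> = (\<Sum>i\<in>UNIV. \<Sum>j\<in>UNIV. if j = i then X $ i $ i * q i else 0)"
      by (intro sum.cong refl) (auto simp: diag off)
    also have "\<dots> = (\<Sum>i\<in>UNIV. X $ i $ i * q i)" by simp
    also have "\<dots> = trace X * ((\<Sum>K\<in>UNIV. x $ K * y $ K) / 2)"
      unfolding half trace_def sum_distrib_right ..
    finally show "top_pair (lie X x) y = 0" using X by simp
  qed
qed

lemma plane_weight_planes0:
  assumes "0 \<in> K" and "cartan_point $ K \<noteq> 0" shows "K \<in> planes0"
  using assms unfolding cartan_point_nth planes0_def eq_set8
  by (auto simp: plane_weight_def neq8 eq_set8 split: if_splits)

lemma cartan_point_in: "cartan_point \<in> cartan_space"
proof -
  have c: "cartan_point $ (- K) = cartan_point $ K" for K by (simp add: cartan_point_nth)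
  have "K \<in> planes" if "cartan_point $ K \<noteq> 0" for K
    using plane_weight_planes0[of K] plane_weight_planes0[of "- K"] that c[of K]
    by (cases "0 \<in> K") (auto simp: planes_def image_iff intro: bexI[of _ "- K"])
  then show ?thesis using c by (auto simp: cartan_space_def)
qed

lemma lie_cartan_point_eq_0:
  assumes "lie X cartan_point = 0" shows "X = 0"
proof -
  have "\<forall>i\<in>{0, 1, 2, 3, 4, 5, 6, 7}. \<forall>j\<in>{0, 1, 2, 3, 4, 5, 6, 7}. X $ i $ j = 0"
    using cartan_point_block0[OF assms] cartan_point_block1[OF assms] cartan_point_block2[OF assms]
      cartan_point_block3[OF assms] cartan_point_block4[OF assms] cartan_point_block5[OF assms]
      cartan_point_block6[OF assms] cartan_point_block7[OF assms] by simp
  then show ?thesis unfolding UNIV8[symmetric] by (simp add: vec_eq_iff)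
qed

lemma gram_cartan_point: "det (gram cartan_point) \<noteq> 0"
proof (rule gram_real_self_dual)
  show "cartan_point \<in> ext_power 4" using cartan_point_in cartan_space_power by blast
  show "vol_dual 1 cartan_point = cartan_point" by (rule cartan_space_self_dual[OF cartan_point_in])
  show "cnj (cartan_point $ K) = cartan_point $ K" for K by (simp add: cartan_point_nth plane_weight_def)
qed (rule lie_cartan_point_eq_0)

lemma subspace_cartan_space: "vec.subspace cartan_space"
  by (auto simp: cartan_space_def vec.subspace_def)

lemma card_planes0: "card planes0 = 7"
proof -
  have "distinct [{0,1,2,3}, {0,1,4,5}, {0,1,6,7}, {0,2,4,6}, {0,2,5,7}, {0,3,4,7}, {0,3,5,6::8}]"
    by (simp add: eq_set8 neq8)
  from distinct_card[OF this] show ?thesis by (simp add: planes0_def)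
qed

lemma dim_cartan_space: "vec.dim cartan_space \<ge> 7"
proof -
  define P where "P y = (\<chi> K. if K \<in> planes0 then y $ K else 0)" for y :: "8 ext"
  have lin: "Vector_Spaces.linear (*s) (*s) P"
    by (auto intro!: Vector_Spaces.linear_iff[THEN iffD2] simp: vec.vector_space_axioms P_def vec_eq_iff)
  have "{x. \<forall>K. K \<notin> planes0 \<longrightarrow> x $ K = 0} \<subseteq> P ` cartan_space"
  proof
    fix z :: "8 ext" assume z: "z \<in> {x. \<forall>K. K \<notin> planes0 \<longrightarrow> x $ K = 0}"
    define y where "y = (\<chi> K. z $ K + z $ (- K))"
    have "y \<in> cartan_space" using z by (auto simp: y_def cartan_space_def planes_def image_iff)
    moreover have "P y = z"
      using z planes0_zero by (auto simp: P_def y_def vec_eq_iff)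
    ultimately show "z \<in> P ` cartan_space" by blast
  qed
  from vec.dim_subset[OF this] have "7 \<le> vec.dim (P ` cartan_space)"
    by (simp only: dim_substandard_cart card_planes0)
  also have "\<dots> \<le> vec.dim cartan_space" by (rule vec.dim_image_le[OF lin])
  finally show ?thesis .
qed

text \<open>The Cartan subspace lies in the centralizer, and its dimension is at least 7 while that
  of the centralizer is at most 7.\<close>

lemma cartan_space_maximal:
  assumes x: "x \<in> cartan_space" "det (gram x) \<noteq> 0" and y: "y \<in> ext_power 4" "commuting x y"
  shows "y \<in> cartan_space"
proof -
  have x4: "x \<in> ext_power 4" using x(1) cartan_space_power by blast
  have "cartan_space = {y \<in> ext_power 4. commuting x y}"
  proof (rule vec.subspace_dim_equal[OF subspace_cartan_space subspace_commuting])
    show "cartan_space \<subseteq> {y \<in> ext_power 4. commuting x y}"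
      using cartan_space_commuting[OF x(1)] cartan_space_power by blast
    show "vec.dim cartan_space \<ge> vec.dim {y \<in> ext_power 4. commuting x y}"
      using dim_cartan_space dim_commuting[OF x4 x(2)] by linarith
  qed
  then show ?thesis using y by blast
qed

lemma isomorphic_D_Z1:
  assumes v: "v \<in> ext_power 4" "det (gram v) \<noteq> 0" and c: "c \<noteq> 0"
  shows "isomorphic_varieties 2 (D_Z1 v) 2 (D_Z1 (vol_dual c v))"
proof -
  have "\<exists>k k' x. k ** k' = mat 1 \<and> k' ** k = mat 1 \<and> x \<in> cartan_space \<and> v = ext_map k x"
    by (rule cartan_conjugacy[OF cartan_space_power cartan_point_in gram_cartan_point _ v]) (rule cartan_space_maximal)
  then obtain k k' x where k: "k ** k' = mat 1" "k' ** k = mat 1" and x: "x \<in> cartan_space" "v = ext_map k x"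
    by blast
  have "x \<in> ext_power 4" using x(1) cartan_space_power by blast
  from isomorphic_of_self_dual[OF k this cartan_space_self_dual[OF x(1)] x(2) c] show ?thesis .
qed

section \<open>Explicit values at the chosen point\<close>

lemma axis_wedge:
  "(axis I a \<odot> z) $ K = (if I \<subseteq> K then shuffle_sign I (K - I) * a * z $ (K - I) else 0)"
proof -
  have "(axis I a \<odot> z) $ K = (\<Sum>L\<in>Pow K. if L = I then shuffle_sign I (K - I) * a * z $ (K - I) else 0)"
    unfolding wedge_nth by (intro sum.cong refl) (simp add: axis_nth_if)
  then show ?thesis by simp
qed

lemma axis_wedge_axis:
  "axis I a \<odot> axis J b = (if I \<inter> J = {} then axis (I \<union> J) (shuffle_sign I J * a * b) else 0)"
proof (rule vec_eq_iff[THEN iffD2], rule allI)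
  fix K
  show "(axis I a \<odot> axis J b) $ K = (if I \<inter> J = {} then axis (I \<union> J) (shuffle_sign I J * a * b) else 0) $ K"
  proof (cases "I \<subseteq> K \<and> K - I = J")
    case True
    then have "I \<inter> J = {}" "K = I \<union> J" by auto
    then show ?thesis using True by (simp add: axis_wedge axis_nth_if)
  next
    case False
    then have "I \<inter> J = {} \<longrightarrow> K \<noteq> I \<union> J" by blast
    then show ?thesis using False by (cases "I \<inter> J = {}") (auto simp: axis_wedge axis_nth_if)
  qed
qed

lemma contr_axis:
  "contr (basis_vec i) (axis K c) = (if i \<in> K then axis (K - {i}) (shuffle_sign {i} (K - {i}) * c) else 0)"
proof (rule vec_eq_iff[THEN iffD2], rule allI)
  fix L
  have 1: "i \<notin> L \<Longrightarrow> insert i L = K \<longleftrightarrow> i \<in> K \<and> L = K - {i}" by blast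
  have 2: "i \<in> L \<Longrightarrow> L \<noteq> K - {i}" by blast
  show "contr (basis_vec i) (axis K c) $ L = (if i \<in> K then axis (K - {i}) (shuffle_sign {i} (K - {i}) * c) else 0) $ L"
  proof (cases "i \<in> K")
    case True
    then show ?thesis using 1 2 by (cases "i \<in> L") (simp_all add: contr_basis_vec axis_nth_if)
  next
    case False
    then show ?thesis using 1 by (cases "i \<in> L") (simp_all add: contr_basis_vec axis_nth_if)
  qed
qed

lemma cartan_point_expand: "cartan_point =
    (\<Sum>(K, c)\<leftarrow>[({0,1,2,3}, 1), ({0,1,4,5}, 2), ({0,1,6,7}, 4), ({0,2,4,6}, 8), ({0,2,5,7}, 16), ({0,3,4,7}, 32), ({0,3,5,6}, 64),
      ({4,5,6,7}, 1), ({2,3,6,7}, 2), ({2,3,4,5}, 4), ({1,3,5,7}, 8), ({1,3,4,6}, 16), ({1,2,5,6}, 32), ({1,2,4,7}, 64)]. axis K c)"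
  (is "_ = ?S")
proof (rule vec_eq_iff[THEN iffD2], rule allI)
  fix K
  have "planes = set [{0,1,2,3}, {0,1,4,5}, {0,1,6,7}, {0,2,4,6}, {0,2,5,7}, {0,3,4,7}, {0,3,5,6},
      {4,5,6,7}, {2,3,6,7}, {2,3,4,5}, {1,3,5,7}, {1,3,4,6}, {1,2,5,6}, {1,2,4,7}]" (is "_ = set ?L")
    by (simp only: planes_def planes0_def image_insert image_empty Compl_planes0) auto
  then have L: "K \<in> planes \<longleftrightarrow> K \<in> set ?L" by simp
  show "cartan_point $ K = ?S $ K"
  proof (cases "K \<in> planes")
    case False
    then have "cartan_point $ K = 0" using cartan_point_in by (simp add: cartan_space_def)
    then show ?thesis using False unfolding L by (simp add: axis_nth_if)
  next
    case True
    then show ?thesis unfolding L set_simps by (elim insertE emptyE) (simp_all add: axis_nth_if cartan_simps eq_set8)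
  qed
qed

text \<open>By self-duality the top coefficient is a coordinatewise pairing, so each value is a
  single lookup in \<open>cartan_point\<close>.\<close>

lemma pol_axis:
  "(axis I a \<odot> axis J b \<odot> cartan_point) $ UNIV =
    (if I \<inter> J = {} then shuffle_sign I J * a * b * cartan_point $ (I \<union> J) else 0)"
proof -
  have "(axis I a \<odot> axis J b \<odot> cartan_point) $ UNIV = (\<Sum>K\<in>UNIV. (axis I a \<odot> axis J b) $ K * cartan_point $ K)"
    using top_pair_cartan_space[OF cartan_point_in, of "axis I a \<odot> axis J b"] by (simp add: top_pair_def wedge_assoc)
  also have "\<dots> = bdot (axis I a \<odot> axis J b) cartan_point" by (simp add: bdot_def)
  also have "\<dots> = (if I \<inter> J = {} then shuffle_sign I J * a * b * cartan_point $ (I \<union> J) else 0)"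
    by (simp add: axis_wedge_axis)
  finally show ?thesis .
qed

lemma shuffle_sign_insert2: "i \<noteq> j \<Longrightarrow> shuffle_sign {i, j} J = shuffle_sign {i} J * shuffle_sign {j} J"
  using shuffle_sign_insert_left[of i "{j}"] by simp

text \<open>The forms needed for \<open>double_disc\<close>, for the gradients at \<open>e_0\<close>
  and \<open>e_1 + s e_2\<close>, and for the gradients at the dual plane, which lies in the span of
  \<open>e_1, e_2, e_3\<close>.\<close>

lemma form2_cartan_point:
  "form2 cartan_point (basis_vec 0) (basis_vec 1) = axis {2, 3} 1 + axis {4, 5} 2 + axis {6, 7} 4"
  "form2 cartan_point (basis_vec 0) (basis_vec 2) = axis {1, 3} (-1) + axis {4, 6} 8 + axis {5, 7} 16"
  "form2 cartan_point (basis_vec 0) (basis_vec 4) = axis {1, 5} (-2) + axis {2, 6} (-8) + axis {3, 7} (-32)"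
  "form2 cartan_point (basis_vec 2) (basis_vec 1) = axis {0, 3} (-1) + axis {4, 7} (-64) + axis {5, 6} (-32)"
  "form2 cartan_point (basis_vec 3) (basis_vec 1) = axis {0, 2} 1 + axis {4, 6} (-16) + axis {5, 7} (-8)"
  "form2 cartan_point (basis_vec 4) (basis_vec 1) = axis {0, 5} (-2) + axis {2, 7} 64 + axis {3, 6} 16"
  "form2 cartan_point (basis_vec 5) (basis_vec 1) = axis {0, 4} 2 + axis {2, 6} 32 + axis {3, 7} 8"
  "form2 cartan_point (basis_vec 6) (basis_vec 1) = axis {0, 7} (-4) + axis {2, 5} (-32) + axis {3, 4} (-16)"
  "form2 cartan_point (basis_vec 7) (basis_vec 1) = axis {0, 6} 4 + axis {2, 4} (-64) + axis {3, 5} (-8)"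
  "form2 cartan_point (basis_vec 1) (basis_vec 2) = axis {0, 3} 1 + axis {4, 7} 64 + axis {5, 6} 32"
  "form2 cartan_point (basis_vec 3) (basis_vec 2) = axis {0, 1} (-1) + axis {4, 5} (-4) + axis {6, 7} (-2)"
  "form2 cartan_point (basis_vec 4) (basis_vec 2) = axis {0, 6} (-8) + axis {1, 7} (-64) + axis {3, 5} 4"
  "form2 cartan_point (basis_vec 5) (basis_vec 2) = axis {0, 7} (-16) + axis {1, 6} (-32) + axis {3, 4} (-4)"
  "form2 cartan_point (basis_vec 6) (basis_vec 2) = axis {0, 4} 8 + axis {1, 5} 32 + axis {3, 7} 2"
  "form2 cartan_point (basis_vec 7) (basis_vec 2) = axis {0, 5} 16 + axis {1, 4} 64 + axis {3, 6} (-2)"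
  "form2 cartan_point (basis_vec 0) (basis_vec 3) = axis {1, 2} 1 + axis {4, 7} 32 + axis {5, 6} 64"
  "form2 cartan_point (basis_vec 0) (basis_vec 5) = axis {1, 4} 2 + axis {2, 7} (-16) + axis {3, 6} (-64)"
  "form2 cartan_point (basis_vec 0) (basis_vec 6) = axis {1, 7} (-4) + axis {2, 4} 8 + axis {3, 5} 64"
  "form2 cartan_point (basis_vec 0) (basis_vec 7) = axis {1, 6} 4 + axis {2, 5} 16 + axis {3, 4} 32"
  "form2 cartan_point (basis_vec 3) (basis_vec 0) = axis {1, 2} (-1) + axis {4, 7} (-32) + axis {5, 6} (-64)"
  unfolding form2_def cartan_point_expand
  by (simp_all add: contr_simps contr_axis neq8 insert_Diff_if,
      simp_all add: less8_numeral not_less_0_bit0 neq8 shuffle_sign_singleton_insert, (simp_all only: add.commute add.left_commute)?)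

text \<open>Up to sign a Pfaffian value is 6 times the product of three weights: 48 = 6 * 1 * 2 * 4,
  768 = 6 * 1 * 8 * 16, 3072 = 6 * 2 * 8 * 32.\<close>

lemma pol_cartan_point:
  "pol cartan_point (basis_vec 0) (basis_vec 1) (basis_vec 0) (basis_vec 1) = 48"
  "pol cartan_point (basis_vec 0) (basis_vec 1) (basis_vec 0) (basis_vec 2) = 0"
  "pol cartan_point (basis_vec 0) (basis_vec 2) (basis_vec 0) (basis_vec 1) = 0"
  "pol cartan_point (basis_vec 0) (basis_vec 2) (basis_vec 0) (basis_vec 2) = -768"
  "pol cartan_point (basis_vec 0) (basis_vec 1) (basis_vec 1) (basis_vec 2) = 0"
  "pol cartan_point (basis_vec 0) (basis_vec 2) (basis_vec 1) (basis_vec 2) = 0"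
  "pol cartan_point (basis_vec 0) (basis_vec 1) (basis_vec 2) (basis_vec 1) = 0"
  "pol cartan_point (basis_vec 0) (basis_vec 2) (basis_vec 2) (basis_vec 1) = 0"
  "pol cartan_point (basis_vec 0) (basis_vec 1) (basis_vec 3) (basis_vec 1) = 0"
  "pol cartan_point (basis_vec 0) (basis_vec 1) (basis_vec 3) (basis_vec 2) = -61"
  "pol cartan_point (basis_vec 0) (basis_vec 2) (basis_vec 3) (basis_vec 1) = 961"
  "pol cartan_point (basis_vec 0) (basis_vec 2) (basis_vec 3) (basis_vec 2) = 0"
  "pol cartan_point (basis_vec 0) (basis_vec 1) (basis_vec 0) (basis_vec 3) = 0"
  "pol cartan_point (basis_vec 0) (basis_vec 2) (basis_vec 0) (basis_vec 3) = 0"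
  "pol cartan_point (basis_vec 0) (basis_vec 1) (basis_vec 4) (basis_vec 1) = 0"
  "pol cartan_point (basis_vec 0) (basis_vec 1) (basis_vec 4) (basis_vec 2) = 0"
  "pol cartan_point (basis_vec 0) (basis_vec 2) (basis_vec 4) (basis_vec 1) = 0"
  "pol cartan_point (basis_vec 0) (basis_vec 2) (basis_vec 4) (basis_vec 2) = 0"
  "pol cartan_point (basis_vec 0) (basis_vec 1) (basis_vec 0) (basis_vec 4) = 0"
  "pol cartan_point (basis_vec 0) (basis_vec 2) (basis_vec 0) (basis_vec 4) = 0"
  "pol cartan_point (basis_vec 0) (basis_vec 1) (basis_vec 5) (basis_vec 1) = 0"
  "pol cartan_point (basis_vec 0) (basis_vec 1) (basis_vec 5) (basis_vec 2) = 0"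
  "pol cartan_point (basis_vec 0) (basis_vec 2) (basis_vec 5) (basis_vec 1) = 0"
  "pol cartan_point (basis_vec 0) (basis_vec 2) (basis_vec 5) (basis_vec 2) = 0"
  "pol cartan_point (basis_vec 0) (basis_vec 1) (basis_vec 0) (basis_vec 5) = 0"
  "pol cartan_point (basis_vec 0) (basis_vec 2) (basis_vec 0) (basis_vec 5) = 0"
  "pol cartan_point (basis_vec 0) (basis_vec 1) (basis_vec 6) (basis_vec 1) = 0"
  "pol cartan_point (basis_vec 0) (basis_vec 1) (basis_vec 6) (basis_vec 2) = 0"
  "pol cartan_point (basis_vec 0) (basis_vec 2) (basis_vec 6) (basis_vec 1) = 0"
  "pol cartan_point (basis_vec 0) (basis_vec 2) (basis_vec 6) (basis_vec 2) = 0"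
  "pol cartan_point (basis_vec 0) (basis_vec 1) (basis_vec 0) (basis_vec 6) = 0"
  "pol cartan_point (basis_vec 0) (basis_vec 2) (basis_vec 0) (basis_vec 6) = 0"
  "pol cartan_point (basis_vec 0) (basis_vec 1) (basis_vec 7) (basis_vec 1) = 0"
  "pol cartan_point (basis_vec 0) (basis_vec 1) (basis_vec 7) (basis_vec 2) = 0"
  "pol cartan_point (basis_vec 0) (basis_vec 2) (basis_vec 7) (basis_vec 1) = 0"
  "pol cartan_point (basis_vec 0) (basis_vec 2) (basis_vec 7) (basis_vec 2) = 0"
  "pol cartan_point (basis_vec 0) (basis_vec 1) (basis_vec 0) (basis_vec 7) = 0"
  "pol cartan_point (basis_vec 0) (basis_vec 2) (basis_vec 0) (basis_vec 7) = 0"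
  "pol cartan_point (basis_vec 0) (basis_vec 4) (basis_vec 0) (basis_vec 4) = -3072"
  "pol cartan_point (basis_vec 3) (basis_vec 1) (basis_vec 0) (basis_vec 1) = 0"
  "pol cartan_point (basis_vec 3) (basis_vec 1) (basis_vec 0) (basis_vec 2) = 961"
  "pol cartan_point (basis_vec 3) (basis_vec 1) (basis_vec 3) (basis_vec 0) = 0"
  "pol cartan_point (basis_vec 3) (basis_vec 2) (basis_vec 0) (basis_vec 1) = -61"
  "pol cartan_point (basis_vec 3) (basis_vec 2) (basis_vec 0) (basis_vec 2) = 0"
  "pol cartan_point (basis_vec 3) (basis_vec 2) (basis_vec 3) (basis_vec 0) = 0"
  "pol cartan_point (basis_vec 3) (basis_vec 1) (basis_vec 1) (basis_vec 2) = 0"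
  "pol cartan_point (basis_vec 3) (basis_vec 1) (basis_vec 3) (basis_vec 1) = -768"
  "pol cartan_point (basis_vec 3) (basis_vec 2) (basis_vec 1) (basis_vec 2) = 0"
  "pol cartan_point (basis_vec 3) (basis_vec 2) (basis_vec 3) (basis_vec 1) = 0"
  unfolding pol_def form2_cartan_point
  by (simp_all add: wedge_simps pol_axis neq8, simp_all add: shuffle_sign_insert2 cartan_simps)

section \<open>General forms\<close>

text \<open>
  If this minor is nonzero and the plane spanned by \<open>e\<^sub>0\<close> and \<open>e\<^sub>1 + s e\<^sub>2\<close> is on the hypersurface, then it is a smooth point
  of it and its dual point is a smooth point of the dual hypersurface.
\<close>

definition double_dual_minor :: "8 ext \<times> complex \<Rightarrow> complex" where
  "double_dual_minor p =
    (let a1 = grad1 (fst p) (basis_vec 0) (basis_vec 1 + snd p *s basis_vec 2);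
         a2 = grad2 (fst p) (basis_vec 0) (basis_vec 1 + snd p *s basis_vec 2)
     in grad1 (vol_dual 1 (fst p)) a1 a2 $ 0 * grad2 (vol_dual 1 (fst p)) a1 a2 $ 1 -
        grad1 (vol_dual 1 (fst p)) a1 a2 $ 1 * grad2 (vol_dual 1 (fst p)) a1 a2 $ 0)"

lemma cartan_point_power: "cartan_point \<in> ext_power 4"
  using cartan_point_in cartan_space_power by blast

text \<open>On this line the Pfaffian is \<open>48 - 768 * s ^ 2\<close>, whence 1/16. The constants
  are 1800 = 2 * (961 - 61), 96 = 2 * 48 and 1536 = 2 * 768.\<close>

lemma grad_cartan_point:
  assumes s: "s ^ 2 = 1 / 16"
  shows "grad1 cartan_point (basis_vec 0) (basis_vec 1 + s *s basis_vec 2) = (1800 * s) *s basis_vec 3"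
    and "grad2 cartan_point (basis_vec 0) (basis_vec 1 + s *s basis_vec 2) = 96 *s basis_vec 1 + (- 1536 * s) *s basis_vec 2"
proof -
  let ?w = "basis_vec 1 + s *s basis_vec 2"
  have s': "s * (s * z) = z / 16" for z using s by (simp add: power2_eq_square mult.assoc[symmetric])
  have "\<forall>i\<in>{0, 1, 2, 3, 4, 5, 6, 7}. grad1 cartan_point (basis_vec 0) ?w $ i = ((1800 * s) *s basis_vec 3) $ i"
    by (simp add: grad1_def pol_linear pol_cartan_point axis_nth_if neq8 s' algebra_simps)
  then show "grad1 cartan_point (basis_vec 0) ?w = (1800 * s) *s basis_vec 3"
    unfolding UNIV8[symmetric] vec_eq_iff by blast
  have "\<forall>i\<in>{0, 1, 2, 3, 4, 5, 6, 7}. grad2 cartan_point (basis_vec 0) ?w $ i = (96 *s basis_vec 1 + (- 1536 * s) *s basis_vec 2) $ i"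
    by (simp add: grad2_def pol_linear pol_cartan_point axis_nth_if neq8 s' algebra_simps)
  then show "grad2 cartan_point (basis_vec 0) ?w = 96 *s basis_vec 1 + (- 1536 * s) *s basis_vec 2"
    unfolding UNIV8[symmetric] vec_eq_iff by blast
qed

text \<open>\<open>cartan_point\<close> is its own dual, so the second gradients come from the same
  table; the two that vanish make the minor a single product.\<close>

lemma double_dual_minor_cartan_point:
  assumes s: "s ^ 2 = 1 / 16"
  shows "double_dual_minor (cartan_point, s) \<noteq> 0"
proof -
  have "s \<noteq> 0" using s by auto
  define k :: complex where "k = 1800 * s"
  define d1 :: complex where "d1 = 96"
  define d2 :: complex where "d2 = - 1536 * s"
  have nz: "k \<noteq> 0" "d1 \<noteq> 0" "d2 \<noteq> 0" using \<open>s \<noteq> 0\<close> by (simp_all add: k_def d1_def d2_def)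
  note g = grad_cartan_point[OF s, folded k_def d1_def d2_def]
  let ?a1 = "k *s basis_vec 3" and ?a2 = "d1 *s basis_vec 1 + d2 *s basis_vec 2"
  have "grad1 cartan_point ?a1 ?a2 $ 0 = 1800 * (k * d1 * d2)"
    "grad1 cartan_point ?a1 ?a2 $ 1 = 0"
    "grad2 cartan_point ?a1 ?a2 $ 1 = - 1536 * (k * k * d1)"
    "grad2 cartan_point ?a1 ?a2 $ 0 = 0"
    by (simp_all add: grad1_def grad2_def pol_linear pol_cartan_point)
  then show ?thesis using nz
    by (simp add: double_dual_minor_def g cartan_space_self_dual[OF cartan_point_in])
qed

lemma poly_alg_double_dual_minor: "double_dual_minor \<in> poly_alg ((\<lambda>g (x, s). g x) ` coords \<union> {snd})"
proof -
  let ?G = "(\<lambda>g (x, s). g x) ` coords \<union> {snd} :: (8 ext \<times> complex \<Rightarrow> complex) set"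
  have f: "poly_map ?G fst"
  proof -
    have "(\<lambda>p. fst p $ i) = (\<lambda>(x, s :: complex). x $ i)" for i :: "8 set" by auto
    then have "(\<lambda>p. fst p $ i) \<in> ?G" for i :: "8 set" by (auto simp: coords_def image_iff)
    then show ?thesis unfolding poly_map_def by (blast intro: poly_alg.gen)
  qed
  have s: "snd \<in> poly_alg ?G" by (rule poly_alg.gen) simp
  have w: "poly_map ?G (\<lambda>p. basis_vec 1 + snd p *s basis_vec 2)"
    by (intro poly_map_add poly_map_const poly_map_scale s)
  note a = poly_map_grad[OF f poly_map_const w]
  note b = poly_map_grad[OF poly_map_vol_dual[OF f] a]
  show ?thesis
    unfolding double_dual_minor_def Let_def by (intro poly_alg_diff poly_alg.mult poly_map_nth b)
qed

text \<open>
  The norm of \<open>double_dual_minor\<close> from the double cover of the space of forms given by the two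
  points of the hypersurface on a fixed line; it is nonzero where no root is a zero of the minor.
\<close>

lemma exists_norm:
  "\<exists>N\<in>poly_alg coords. N cartan_point \<noteq> 0 \<and>
    (\<forall>v\<in>ext_power 4. N v \<noteq> 0 \<longrightarrow> (\<exists>s. pfaff v (basis_vec 0) (basis_vec 1 + s *s basis_vec 2) = 0 \<and> double_dual_minor (v, s) \<noteq> 0))"
proof -
  define a b c where "a v = pfaff v (basis_vec 0) (basis_vec 2)"
    and "b v = 2 * pol v (basis_vec 0) (basis_vec 1) (basis_vec 0) (basis_vec 2)"
    and "c v = pfaff v (basis_vec 0) (basis_vec 1)" for v :: "8 ext"
  have abc: "a \<in> poly_alg coords" "b \<in> poly_alg coords" "c \<in> poly_alg coords"
    unfolding a_def b_def c_def
    by (intro poly_alg_pfaff poly_alg_pol poly_alg.mult poly_alg.const poly_map_id poly_map_const)+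
  obtain k \<alpha> \<beta> where \<alpha>: "\<alpha> \<in> poly_alg coords" and \<beta>: "\<beta> \<in> poly_alg coords"
    and red: "\<And>v s. a v * s ^ 2 + b v * s + c v = 0 \<Longrightarrow> a v ^ k * double_dual_minor (v, s) = \<alpha> v * s + \<beta> v"
    using poly_alg_reduce_quadratic[OF poly_alg_double_dual_minor abc] by blast
  \<comment> \<open>The bracket is the norm of the reduced minor; the last factor keeps the equation
    in \<open>s\<close> properly quadratic, so that a root exists.\<close>
  define N where "N v = (\<beta> v ^ 2 * a v - \<alpha> v * \<beta> v * b v + \<alpha> v ^ 2 * c v) * a v" for v
  have "N \<in> poly_alg coords"
    unfolding N_def by (intro poly_alg_intros \<alpha> \<beta> abc)
  moreover have "N cartan_point \<noteq> 0"
  proof -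
    \<comment> \<open>These values make the roots 1/4 and -1/4.\<close>
    have e: "a cartan_point = - 768" "b cartan_point = 0" "c cartan_point = 48"
      by (simp_all add: a_def b_def c_def pfaff_def pol_cartan_point)
    have "\<alpha> cartan_point * s + \<beta> cartan_point \<noteq> 0" if s: "s ^ 2 = 1 / 16" for s
    proof -
      have "(- 768) ^ k * double_dual_minor (cartan_point, s) = \<alpha> cartan_point * s + \<beta> cartan_point"
        using red[of cartan_point s] by (simp add: e s)
      then show ?thesis
        using double_dual_minor_cartan_point[OF s] by (metis mult_eq_0_iff neg_equal_0_iff_equal power_not_zero zero_neq_numeral)
    qed
    from this[of "1 / 4"] this[of "- 1 / 4"]
    have "(\<alpha> cartan_point * (1 / 4) + \<beta> cartan_point) * (\<alpha> cartan_point * (- 1 / 4) + \<beta> cartan_point) \<noteq> 0"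
      unfolding mult_eq_0_iff by (simp add: power_divide)
    moreover have "N cartan_point = 768 ^ 2 *
        ((\<alpha> cartan_point * (1 / 4) + \<beta> cartan_point) * (\<alpha> cartan_point * (- 1 / 4) + \<beta> cartan_point))"
      by (simp add: N_def e power2_eq_square algebra_simps)
    ultimately show ?thesis by simp
  qed
  moreover have "\<exists>s. pfaff v (basis_vec 0) (basis_vec 1 + s *s basis_vec 2) = 0 \<and> double_dual_minor (v, s) \<noteq> 0"
    if v: "v \<in> ext_power 4" and n: "N v \<noteq> 0" for v
  proof -
    have "a v \<noteq> 0" using n by (auto simp: N_def)
    then obtain s where s: "a v * s ^ 2 + b v * s + c v = 0" using quadratic_root by blast
    have "double_dual_minor (v, s) \<noteq> 0"
    proof
      assume "double_dual_minor (v, s) = 0"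
      then have \<beta>s: "\<beta> v = - (\<alpha> v * s)" using red[OF s] by (simp add: eq_neg_iff_add_eq_0 add.commute)
      have "N v = \<alpha> v ^ 2 * (a v * s ^ 2 + b v * s + c v) * a v"
        unfolding N_def \<beta>s by (simp add: power2_eq_square algebra_simps)
      then show False using n s by simp
    qed
    moreover have "pfaff v (basis_vec 0) (basis_vec 1 + s *s basis_vec 2) = 0"
      using s by (simp add: pfaff_add_right[OF v] a_def b_def c_def algebra_simps)
    ultimately show ?thesis by blast
  qed
  ultimately show ?thesis by blast
qed

lemma lin_indep2_minor:
  assumes "i < j" "x $ i * y $ j - x $ j * y $ i \<noteq> 0"
  shows "lin_indep2 x y"
  using wedge_pair_nth[OF assms(1), of x y] assms(2) by (metis zero_index)

lemma double_disc_cartan_point: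
  "double_disc cartan_point (basis_vec 0) (basis_vec 1) (basis_vec 2) (basis_vec 4) \<noteq> 0"
  by (simp add: double_disc_def pfaff_def pol_cartan_point)

theorem theorem5p15:
  shows "\<exists>W :: 8 ext set.
    openin (zariski_affine (ext_power 4)) W \<and> W \<noteq> {} \<and>
    (\<forall>v\<in>W. \<forall>c. c \<noteq> 0 \<longrightarrow>
       has_gr_dual (D_Z1 v) \<and>
       gr_dual (D_Z1 v) = orth ` D_Z1 (vol_dual c v) \<and>
       isomorphic_varieties 2 (D_Z1 v) 2 (D_Z1 (vol_dual c v)))"
proof -
  obtain N where N: "N \<in> poly_alg coords" "N cartan_point \<noteq> 0"
    and root: "\<And>v. v \<in> ext_power 4 \<Longrightarrow> N v \<noteq> 0 \<Longrightarrow>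
      \<exists>s. pfaff v (basis_vec 0) (basis_vec 1 + s *s basis_vec 2) = 0 \<and> double_dual_minor (v, s) \<noteq> 0"
    using exists_norm by blast
  define d where "d v = double_disc v (basis_vec 0) (basis_vec 1) (basis_vec 2) (basis_vec 4)" for v :: "8 ext"
  \<comment> \<open>The factors serve in turn conjugacy to the Cartan subspace, irreducibility of
    the hypersurface, irreducibility of its dual, and the existence of a point that is smooth with
    smooth dual.\<close>
  define Q where "Q v = det (gram v) * (d (vol_dual 1 v) * (d v * N v))" for v
  define W where "W = {v \<in> ext_power 4. Q v \<noteq> 0}"
  have "Q \<in> poly_alg coords"
    unfolding Q_def d_def
    by (intro poly_alg.mult poly_alg_det_gram poly_alg_double_disc poly_map_vol_dual poly_map_id poly_map_const N)
  then have "openin (zariski_affine (ext_power 4)) W"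
    unfolding zariski_affine_def W_def by (intro topology_generated_by_Basis) (auto simp: polynomial_fun_iff)
  moreover have "cartan_point \<in> W"
    using gram_cartan_point double_disc_cartan_point N(2) cartan_point_power
    by (simp add: W_def Q_def d_def cartan_space_self_dual[OF cartan_point_in])
  moreover have "has_gr_dual (D_Z1 v) \<and> gr_dual (D_Z1 v) = orth ` D_Z1 (vol_dual c v) \<and>
      isomorphic_varieties 2 (D_Z1 v) 2 (D_Z1 (vol_dual c v))" if "v \<in> W" and c: "c \<noteq> 0" for v c
  proof -
    have v: "v \<in> ext_power 4" and nz: "det (gram v) \<noteq> 0" "d (vol_dual 1 v) \<noteq> 0" "d v \<noteq> 0" "N v \<noteq> 0"
      using \<open>v \<in> W\<close> by (auto simp: W_def Q_def)
    obtain s where s: "pfaff v (basis_vec 0) (basis_vec 1 + s *s basis_vec 2) = 0" "double_dual_minor (v, s) \<noteq> 0"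
      using root[OF v nz(4)] by blast
    note g = lin_indep2_minor[OF less8_numeral(5) s(2)[unfolded double_dual_minor_def Let_def fst_conv snd_conv]]
    show ?thesis
      using gr_dual_D_Z1[OF v refl c nz(2)[unfolded d_def] nz(3)[unfolded d_def] s(1) g] isomorphic_D_Z1[OF v nz(1) c]
      by simp
  qed
  ultimately show ?thesis by blast
qed

end
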